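(* Let $T$ be a finite set, let $\mathbb P$ be an ergodic shift-invariant Markov probability on $\Omega=T^{\mathbb N}$ with transition probability $Q(t,A)$ whose unique stationary probability measure is the initial distribution $p$ of $\mathbb P$, and let $(X,d)$ be a compact metric space. If $f:T\times X\to X$ is a $\mathbb P$-mostly contracting random map, then its associated skew-product $F:\Omega\times X\to\Omega\times X$ satisfies (fpm) with respect to $\bar m=\mathbb P\times m$, where $m$ is any reference probability measure on $X$. Moreover, there is $\alpha_0>0$ such that for any $0<\alpha\le\alpha_0$ the operator $\hat P:C^\alpha(T\times X)\to C^\alpha(T\times X)$, $$\hat P\varphi(t,x)=\int\varphi(\hat u)\,\hat P((t,x),d\hat u),\qquad \varphi\in C^\alpha(T\times X),$$ associated with the transition probability $\hat P((t,x),B)=\int 1_B(u,f_u(x))\,Q(t,du)$, is quasi-compact.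
   Context: Markov measure: for a transition probability $Q$ on $T$ and a $Q$-stationary probability $p$ ($p=\int Q(t,\cdot)\,dp(t)$), $\mathbb P$ is the unique shift-invariant probability on $\Omega=T^{\mathbb N}$ with $\mathbb P(A_0\times\dots\times A_{m-1}\times\Omega)=\int_{A_0}\cdots\int_{A_{m-1}}Q(t_{m-2},dt_{m-1})\cdots Q(t_0,dt_1)\,dp(t_0)$; $p$ is its initial distribution. A random map is a measurable $f:T\times X\to X$; $f_t=f(t,\cdot)$, $f^n_\omega=f_{\omega_{n-1}}\circ\dots\circ f_{\omega_0}$, $F(\omega,x)=(\sigma(\omega),f_{\omega_0}(x))$ with $\sigma$ the shift. $\mathbb P$-Markovian measure: an $F$-invariant probability measure $\bar\mu$ on $\Omega\times X$ with first marginal $\mathbb P$ and a disintegration $d\bar\mu=\bar\mu_{\omega_0}\,d\mathbb P(\omega)$ (fiber measures depending only on $\omega_0$). Mostly contracting: for $g:X\to X$, $\mathrm{Lip}(g)$ is the infimum of $C\ge0$ with $d(g(x),g(y))\le C\,d(x,y)$ for all $x,y$, and $Lg(z)=\lim_{r\to0^+}\mathrm{Lip}(g|_{B(z,r)})$ with $B(z,r)$ the open ball. Assume the integrability condition $\int\log^+\mathrm{Lip}(f_{\omega_0})\,d\mathbb P(\omega)<\infty$. For an $F$-invariant probability $\bar\mu$ with first marginal $\mathbb P$, the maximal Lyapunov exponent is $\lambda(\bar\mu)=\inf_{n\ge1}\frac1n\int\log Lf^n_\omega(x)\,d\bar\mu=\lim_{n\to\infty}\frac1n\int\log Lf^n_\omega(x)\,d\bar\mu\in[-\infty,\infty)$.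 The random map $f$ is $\mathbb P$-mostly contracting if the integrability condition holds and $\lambda(f)=\sup\{\lambda(\bar\mu):\bar\mu\text{ is a }\mathbb P\text{-Markovian measure}\}<0$. (fpm) for $F$ with respect to $\bar m=\mathbb P\times m$: there are finitely many ergodic $F$-invariant probability measures $\bar\mu_1,\dots,\bar\mu_r$ on $\Omega\times X$ such that 1) each $\bar\mu_i$ is $\mathbb P$-Markovian; 2) $\bar m(B(\bar\mu_i))>0$ for each $i$; 3) $\bar m(B(\bar\mu_1)\cup\dots\cup B(\bar\mu_r))=1$. Here $B(\bar\mu_i)=\{(\omega,x):\frac1n\sum_{j=0}^{n-1}\delta_{F^j(\omega,x)}\to\bar\mu_i\text{ in the weak* topology}\}$, with $T$ discrete and $\Omega\times X$ carrying the product topology. $T\times X$ carries the metric $\hat d((t,x),(t',x'))=\delta(t,t')+d(x,x')$ with $\delta$ the discrete metric; $C^\alpha(Y)$ is the Banach space of real-valued $\alpha$-H\"older functions on $Y$, $0<\alpha\le1$. An operator $P$ on a Banach space $E$ is quasi-compact if there are a compact linear operator $R:E\to E$ and $n\in\mathbb N$ with $\|P^n-R\|_{\rm op}<1$.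
   Formalization: Quasi-compactness is stated under the added assumption that f_u is Lipschitz for every symbol u with p({u})=0 that some Q(t,·) charges; without it the operator need not map C^α(T×X) into itself, and the assumption is equivalent to its doing so. *)

theory Defs
  imports "HOL-Probability.Probability"
begin

subsection \<open>Invariant and ergodic measures\<close>

definition invariant_prob :: "'a measure \<Rightarrow> ('a \<Rightarrow> 'a) \<Rightarrow> 'a measure \<Rightarrow> bool" where
  "invariant_prob N S \<mu> \<longleftrightarrow>
     S \<in> measurable N N \<and> \<mu> \<in> space (prob_algebra N) \<and> distr \<mu> N S = \<mu>"

definition ergodic_prob :: "'a measure \<Rightarrow> ('a \<Rightarrow> 'a) \<Rightarrow> 'a measure \<Rightarrow> bool" where
  "ergodic_prob N S \<mu> \<longleftrightarrow> invariant_prob N S \<mu> \<and>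
     (\<forall>A\<in>sets N. S -` A \<inter> space N = A \<longrightarrow> emeasure \<mu> A = 0 \<or> emeasure \<mu> A = 1)"


subsection \<open>Markov measures on the path space\<close>

text \<open>The finite alphabet is the type \<open>'t\<close> with the discrete sigma-algebra; a point of
  the path space is a function \<open>nat \<Rightarrow> 't\<close>.\<close>

definition transition_prob :: "('t \<Rightarrow> 't measure) \<Rightarrow> bool" where
  "transition_prob Q \<longleftrightarrow> Q \<in> measurable (count_space UNIV) (prob_algebra (count_space UNIV))"

definition stationary_prob :: "('t \<Rightarrow> 't measure) \<Rightarrow> 't measure \<Rightarrow> bool" where
  "stationary_prob Q p \<longleftrightarrow> p \<in> space (prob_algebra (count_space UNIV)) \<and>
     (\<forall>A. emeasure p A = (\<integral>\<^sup>+ t. emeasure (Q t) A \<partial>p))"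

definition path_algebra :: "(nat \<Rightarrow> 't) measure" where
  "path_algebra = (\<Pi>\<^sub>M n\<in>UNIV. count_space UNIV)"

definition shift :: "(nat \<Rightarrow> 't) \<Rightarrow> nat \<Rightarrow> 't" where
  "shift \<omega> = (\<lambda>n. \<omega> (Suc n))"

text \<open>\<open>cylinder_mass Q p [A\<^sub>0, \<dots>, A\<^sub>k]\<close> is the iterated integral
  over \<open>A\<^sub>0\<close> of \<open>dp(t\<^sub>0)\<close>, over \<open>A\<^sub>1\<close> of \<open>Q(t\<^sub>0, dt\<^sub>1)\<close>, and so on, with innermost
  integrator \<open>Q(t\<^bsub>k-1\<^esub>, dt\<^sub>k)\<close> over \<open>A\<^sub>k\<close>.\<close>

fun cylinder_mass :: "('t \<Rightarrow> 't measure) \<Rightarrow> 't measure \<Rightarrow> 't set list \<Rightarrow> ennreal" where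
  "cylinder_mass Q \<mu> [] = 1"
| "cylinder_mass Q \<mu> (A # As) = (\<integral>\<^sup>+ t. indicator A t * cylinder_mass Q (Q t) As \<partial>\<mu>)"

definition markov_measure ::
    "('t \<Rightarrow> 't measure) \<Rightarrow> 't measure \<Rightarrow> (nat \<Rightarrow> 't) measure \<Rightarrow> bool" where
  "markov_measure Q p P \<longleftrightarrow> invariant_prob path_algebra shift P \<and>
     (\<forall>As. emeasure P {\<omega>. \<forall>i<length As. \<omega> i \<in> As ! i} = cylinder_mass Q p As)"


subsection \<open>Random maps and skew products\<close>

definition skew_algebra :: "((nat \<Rightarrow> 't) \<times> 'x::metric_space) measure" where
  "skew_algebra = path_algebra \<Otimes>\<^sub>M borel"

definition skew_topology :: "((nat \<Rightarrow> 't) \<times> 'x::metric_space) topology" where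
  "skew_topology =
     prod_topology (product_topology (\<lambda>n. discrete_topology UNIV) UNIV) euclidean"

definition random_map :: "('t \<Rightarrow> 'x::metric_space \<Rightarrow> 'x) \<Rightarrow> bool" where
  "random_map f \<longleftrightarrow> (\<lambda>(t, x). f t x) \<in> measurable (count_space UNIV \<Otimes>\<^sub>M borel) borel"

primrec fiber_iter :: "('t \<Rightarrow> 'x \<Rightarrow> 'x) \<Rightarrow> nat \<Rightarrow> (nat \<Rightarrow> 't) \<Rightarrow> 'x \<Rightarrow> 'x" where
  "fiber_iter f 0 \<omega> = id"
| "fiber_iter f (Suc n) \<omega> = f (\<omega> n) \<circ> fiber_iter f n \<omega>"

definition skew_product :: "('t \<Rightarrow> 'x \<Rightarrow> 'x) \<Rightarrow> (nat \<Rightarrow> 't) \<times> 'x \<Rightarrow> (nat \<Rightarrow> 't) \<times> 'x" where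
  "skew_product f = (\<lambda>(\<omega>, x). (shift \<omega>, f (\<omega> 0) x))"

lemma skew_product_funpow:
  "(skew_product f ^^ n) (\<omega>, x) = ((shift ^^ n) \<omega>, fiber_iter f n \<omega> x)"
proof -
  have "(shift ^^ k) w 0 = w k" for k and w :: "nat \<Rightarrow> 'a"
    by (induction k arbitrary: w) (simp_all add: shift_def del: funpow.simps(2) add: funpow_Suc_right)
  then show ?thesis
    by (induction n) (simp_all add: skew_product_def)
qed

definition markovian ::
    "(nat \<Rightarrow> 't) measure \<Rightarrow> ('t \<Rightarrow> 'x::metric_space \<Rightarrow> 'x) \<Rightarrow> ((nat \<Rightarrow> 't) \<times> 'x) measure \<Rightarrow> bool" where
  "markovian P f \<mu> \<longleftrightarrow>
     invariant_prob skew_algebra (skew_product f) \<mu> \<and>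
     distr \<mu> path_algebra fst = P \<and>
     (\<exists>\<nu>\<in>measurable (count_space UNIV) (prob_algebra borel).
        \<forall>A\<in>sets path_algebra. \<forall>B\<in>sets borel.
          emeasure \<mu> (A \<times> B) = (\<integral>\<^sup>+ \<omega>. indicator A \<omega> * emeasure (\<nu> (\<omega> 0)) B \<partial>P))"


subsection \<open>Lyapunov exponents and mostly contracting random maps\<close>

text \<open>The value is \<open>\<infinity>\<close> if the function is not Lipschitz on the set.\<close>

definition lip_const :: "'x::metric_space set \<Rightarrow> ('x \<Rightarrow> 'x) \<Rightarrow> ereal" where
  "lip_const U g = (INF C\<in>{C. C-lipschitz_on U g}. ereal C)"

definition local_lip :: "('x::metric_space \<Rightarrow> 'x) \<Rightarrow> 'x \<Rightarrow> ereal" where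
  "local_lip g z = Lim (at_right 0) (\<lambda>r. lip_const (ball z r) g)"

text \<open>Extended logarithm, meant for arguments in \<open>[0, \<infinity>]\<close>.\<close>

definition log_ext :: "ereal \<Rightarrow> ereal" where
  "log_ext a = (if a \<le> 0 then - \<infinity> else if a = \<infinity> then \<infinity> else ereal (ln (real_of_ereal a)))"

text \<open>Integral of an extended-real function whose positive part has a finite integral; the
  value \<open>-\<infinity>\<close> is possible. (\<^const>\<open>e2ennreal\<close> sends negative values to 0.)\<close>

definition integral_ext :: "'a measure \<Rightarrow> ('a \<Rightarrow> ereal) \<Rightarrow> ereal" where
  "integral_ext M h =
     enn2ereal (\<integral>\<^sup>+ z. e2ennreal (h z) \<partial>M) - enn2ereal (\<integral>\<^sup>+ z. e2ennreal (- h z) \<partial>M)"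

definition lyapunov_exponent ::
    "('t \<Rightarrow> 'x::metric_space \<Rightarrow> 'x) \<Rightarrow> ((nat \<Rightarrow> 't) \<times> 'x) measure \<Rightarrow> ereal" where
  "lyapunov_exponent f \<mu> =
     (INF n\<in>{1..}. integral_ext \<mu> (\<lambda>(\<omega>, x). log_ext (local_lip (fiber_iter f n \<omega>) x))
                     / ereal (real n))"

definition log_lip_integrable ::
    "(nat \<Rightarrow> 't) measure \<Rightarrow> ('t \<Rightarrow> 'x::metric_space \<Rightarrow> 'x) \<Rightarrow> bool" where
  "log_lip_integrable P f \<longleftrightarrow>
     (\<integral>\<^sup>+ \<omega>. e2ennreal (max 0 (log_ext (lip_const UNIV (f (\<omega> 0))))) \<partial>P) < \<infinity>"

definition mostly_contracting ::
    "(nat \<Rightarrow> 't) measure \<Rightarrow> ('t \<Rightarrow> 'x::metric_space \<Rightarrow> 'x) \<Rightarrow> bool" where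
  "mostly_contracting P f \<longleftrightarrow> log_lip_integrable P f \<and>
     (SUP \<mu>\<in>{\<mu>. markovian P f \<mu>}. lyapunov_exponent f \<mu>) < 0"


subsection \<open>Statistical basins and property (fpm)\<close>

text \<open>Image of the uniform distribution on \<open>{0, \<dots>, n - 1}\<close> under \<open>j \<mapsto> F\<^sup>j z\<close>, that is,
  the average of the Dirac masses at \<open>z, F z, \<dots>, F\<^sup>n\<^sup>-\<^sup>1 z\<close>.\<close>

definition empirical_measure :: "'a measure \<Rightarrow> ('a \<Rightarrow> 'a) \<Rightarrow> nat \<Rightarrow> 'a \<Rightarrow> 'a measure" where
  "empirical_measure N F n z = distr (uniform_count_measure {..<n}) N (\<lambda>j. (F ^^ j) z)"

lemma integral_empirical_measure:
  fixes \<phi> :: "'a \<Rightarrow> real"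
  assumes "\<And>j. (F ^^ j) z \<in> space N" and "\<phi> \<in> borel_measurable N"
  shows "(\<integral>w. \<phi> w \<partial>empirical_measure N F n z) = (\<Sum>j<n. \<phi> ((F ^^ j) z)) / real n"
proof -
  have "(\<lambda>j. (F ^^ j) z) \<in> measurable (uniform_count_measure {..<n}) N"
    using assms(1) by (simp add: measurable_def sets_uniform_count_measure space_uniform_count_measure)
  then have "(\<integral>w. \<phi> w \<partial>empirical_measure N F n z)
      = (\<integral>j. \<phi> ((F ^^ j) z) \<partial>uniform_count_measure {..<n})"
    unfolding empirical_measure_def using assms(2) by (rule integral_distr)
  also have "\<dots> = (\<Sum>j<n. \<phi> ((F ^^ j) z)) / real n"
    by (simp add: uniform_count_measure_def lebesgue_integral_point_measure_finite sum_divide_distrib)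
  finally show ?thesis .
qed

text \<open>Meant for measures on a compact space, where continuous functions are bounded.\<close>

definition weak_star_conv :: "'a topology \<Rightarrow> (nat \<Rightarrow> 'a measure) \<Rightarrow> 'a measure \<Rightarrow> bool" where
  "weak_star_conv X \<nu> \<mu> \<longleftrightarrow>
     (\<forall>\<phi>. continuous_map X euclideanreal \<phi> \<longrightarrow>
        (\<lambda>n. \<integral>z. \<phi> z \<partial>\<nu> n) \<longlonglongrightarrow> (\<integral>z. \<phi> z \<partial>\<mu>))"

definition basin ::
    "('t \<Rightarrow> 'x::metric_space \<Rightarrow> 'x) \<Rightarrow> ((nat \<Rightarrow> 't) \<times> 'x) measure \<Rightarrow> ((nat \<Rightarrow> 't) \<times> 'x) set" where
  "basin f \<mu> =
     {z. weak_star_conv skew_topology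
           (\<lambda>n. empirical_measure skew_algebra (skew_product f) n z) \<mu>}"

definition fpm ::
    "(nat \<Rightarrow> 't) measure \<Rightarrow> ('t \<Rightarrow> 'x::metric_space \<Rightarrow> 'x) \<Rightarrow> 'x measure \<Rightarrow> bool" where
  "fpm P f m \<longleftrightarrow>
     (\<exists>S. finite S \<and>
        (\<forall>\<mu>\<in>S. ergodic_prob skew_algebra (skew_product f) \<mu> \<and> markovian P f \<mu> \<and>
               emeasure (P \<Otimes>\<^sub>M m) (basin f \<mu>) > 0) \<and>
        emeasure (P \<Otimes>\<^sub>M m) (\<Union>\<mu>\<in>S. basin f \<mu>) = 1)"


subsection \<open>Hoelder spaces\<close>

definition prod_dist1 :: "'t \<times> 'x::metric_space \<Rightarrow> 't \<times> 'x \<Rightarrow> real" where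
  "prod_dist1 u v = (if fst u = fst v then 0 else 1) + dist (snd u) (snd v)"

definition holder_const :: "('y \<Rightarrow> 'y \<Rightarrow> real) \<Rightarrow> real \<Rightarrow> ('y \<Rightarrow> real) \<Rightarrow> real \<Rightarrow> bool" where
  "holder_const D \<alpha> \<phi> C \<longleftrightarrow> 0 \<le> C \<and> (\<forall>u v. \<bar>\<phi> u - \<phi> v\<bar> \<le> C * D u v powr \<alpha>)"

definition holder_space :: "('y \<Rightarrow> 'y \<Rightarrow> real) \<Rightarrow> real \<Rightarrow> ('y \<Rightarrow> real) set" where
  "holder_space D \<alpha> = {\<phi>. \<exists>C. holder_const D \<alpha> \<phi> C}"

text \<open>The supremum is finite because the metric is assumed to be bounded.\<close>

definition holder_norm :: "('y \<Rightarrow> 'y \<Rightarrow> real) \<Rightarrow> real \<Rightarrow> ('y \<Rightarrow> real) \<Rightarrow> real" where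
  "holder_norm D \<alpha> \<phi> = (SUP u. \<bar>\<phi> u\<bar>) + Inf {C. holder_const D \<alpha> \<phi> C}"


lemma holder_spaceE:
  assumes "\<phi> \<in> holder_space D \<alpha>"
  shows "holder_const D \<alpha> \<phi> (Inf {C. holder_const D \<alpha> \<phi> C})"
proof -
  define K where "K = {C. holder_const D \<alpha> \<phi> C}"
  have ne: "K \<noteq> {}" and bdd: "bdd_below K"
    using assms by (auto simp: K_def holder_space_def holder_const_def intro!: bdd_belowI[of _ 0])
  have "\<bar>\<phi> u - \<phi> v\<bar> \<le> Inf K * D u v powr \<alpha>" for u v
  proof (cases "D u v powr \<alpha> = 0")
    case True
    moreover obtain C where "holder_const D \<alpha> \<phi> C" using ne by (auto simp: K_def)
    then have "\<bar>\<phi> u - \<phi> v\<bar> \<le> C * D u v powr \<alpha>" by (simp add: holder_const_def)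
    ultimately show ?thesis by simp
  next
    case False
    then have pos: "D u v powr \<alpha> > 0" by (simp add: less_le)
    have "\<bar>\<phi> u - \<phi> v\<bar> / D u v powr \<alpha> \<le> Inf K"
      using ne pos by (intro cInf_greatest) (auto simp: K_def holder_const_def divide_le_eq)
    then show ?thesis using pos by (simp add: divide_le_eq)
  qed
  moreover have "0 \<le> Inf K"
    using ne by (intro cInf_greatest) (auto simp: K_def holder_const_def)
  ultimately show ?thesis by (simp add: holder_const_def K_def)
qed

subsection \<open>Quasi-compact operators\<close>

text \<open>A normed space of real functions is given by its set \<open>E\<close> of elements, with the
  pointwise operations, and its norm \<open>N\<close>.\<close>

definition linear_op :: "('y \<Rightarrow> real) set \<Rightarrow> (('y \<Rightarrow> real) \<Rightarrow> 'y \<Rightarrow> real) \<Rightarrow> bool" where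
  "linear_op E A \<longleftrightarrow> A \<in> E \<rightarrow> E \<and>
     (\<forall>\<phi>\<in>E. \<forall>\<psi>\<in>E. A (\<lambda>u. \<phi> u + \<psi> u) = (\<lambda>u. A \<phi> u + A \<psi> u)) \<and>
     (\<forall>\<phi>\<in>E. \<forall>c. A (\<lambda>u. c * \<phi> u) = (\<lambda>u. c * A \<phi> u))"

definition op_norm ::
    "('y \<Rightarrow> real) set \<Rightarrow> (('y \<Rightarrow> real) \<Rightarrow> real) \<Rightarrow> (('y \<Rightarrow> real) \<Rightarrow> 'y \<Rightarrow> real) \<Rightarrow> ereal" where
  "op_norm E N A = (SUP \<phi>\<in>{\<phi>\<in>E. N \<phi> \<le> 1}. ereal (N (A \<phi>)))"

text \<open>The value outside \<open>E\<close> is set to 0 so that the locale \<^locale>\<open>Metric_space\<close>, which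
  requires nonnegativity everywhere, applies.\<close>

definition norm_dist ::
    "('y \<Rightarrow> real) set \<Rightarrow> (('y \<Rightarrow> real) \<Rightarrow> real) \<Rightarrow> ('y \<Rightarrow> real) \<Rightarrow> ('y \<Rightarrow> real) \<Rightarrow> real" where
  "norm_dist E N \<phi> \<psi> = (if \<phi> \<in> E \<and> \<psi> \<in> E then N (\<lambda>u. \<phi> u - \<psi> u) else 0)"

definition norm_topology ::
    "('y \<Rightarrow> real) set \<Rightarrow> (('y \<Rightarrow> real) \<Rightarrow> real) \<Rightarrow> ('y \<Rightarrow> real) topology" where
  "norm_topology E N = Metric_space.mtopology E (norm_dist E N)"

definition compact_op ::
    "('y \<Rightarrow> real) set \<Rightarrow> (('y \<Rightarrow> real) \<Rightarrow> real) \<Rightarrow> (('y \<Rightarrow> real) \<Rightarrow> 'y \<Rightarrow> real) \<Rightarrow> bool" where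
  "compact_op E N R \<longleftrightarrow> linear_op E R \<and>
     compactin (norm_topology E N) (norm_topology E N closure_of (R ` {\<phi>\<in>E. N \<phi> \<le> 1}))"

definition quasi_compact ::
    "('y \<Rightarrow> real) set \<Rightarrow> (('y \<Rightarrow> real) \<Rightarrow> real) \<Rightarrow> (('y \<Rightarrow> real) \<Rightarrow> 'y \<Rightarrow> real) \<Rightarrow> bool" where
  "quasi_compact E N A \<longleftrightarrow> linear_op E A \<and> op_norm E N A < \<infinity> \<and>
     (\<exists>R n. n \<ge> 1 \<and> compact_op E N R \<and> op_norm E N (\<lambda>\<phi> u. (A ^^ n) \<phi> u - R \<phi> u) < 1)"


lemma Metric_space_holder:
  assumes bounded: "\<And>u v. 0 \<le> D u v \<and> D u v \<le> b" and "0 < \<alpha>"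
  shows "Metric_space (holder_space D \<alpha>) (norm_dist (holder_space D \<alpha>) (holder_norm D \<alpha>))"
proof -
  let ?L = "\<lambda>\<phi>. Inf {C. holder_const D \<alpha> \<phi> C}"
  have sub: "(\<lambda>u. \<phi> u - \<psi> u) \<in> holder_space D \<alpha>"
    if "\<phi> \<in> holder_space D \<alpha>" "\<psi> \<in> holder_space D \<alpha>" for \<phi> \<psi>
  proof -
    from that obtain C C' where C: "holder_const D \<alpha> \<phi> C" "holder_const D \<alpha> \<psi> C'"
      by (auto simp: holder_space_def)
    have "\<bar>(\<phi> u - \<psi> u) - (\<phi> v - \<psi> v)\<bar> \<le> (C + C') * D u v powr \<alpha>" for u v
    proof -
      have "\<bar>\<phi> u - \<phi> v\<bar> \<le> C * D u v powr \<alpha>" "\<bar>\<psi> u - \<psi> v\<bar> \<le> C' * D u v powr \<alpha>"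
        using C by (auto simp: holder_const_def)
      then show ?thesis by (simp add: distrib_right)
    qed
    then have "holder_const D \<alpha> (\<lambda>u. \<phi> u - \<psi> u) (C + C')"
      using C by (simp add: holder_const_def)
    then show ?thesis by (auto simp: holder_space_def)
  qed
  have bdd: "bdd_above (range (\<lambda>u. \<bar>\<phi> u\<bar>))" if "\<phi> \<in> holder_space D \<alpha>" for \<phi>
  proof -
    from that obtain C where C: "holder_const D \<alpha> \<phi> C" by (auto simp: holder_space_def)
    have "\<bar>\<phi> u\<bar> \<le> \<bar>\<phi> undefined\<bar> + C * b powr \<alpha>" for u
    proof -
      have "\<bar>\<phi> u - \<phi> undefined\<bar> \<le> C * D u undefined powr \<alpha>" "0 \<le> C"
        using C by (auto simp: holder_const_def)
      moreover have "D u undefined powr \<alpha> \<le> b powr \<alpha>"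
        using bounded[of u undefined] \<open>0 < \<alpha>\<close> by (simp add: powr_mono2)
      ultimately show ?thesis
        using mult_left_mono[of "D u undefined powr \<alpha>" "b powr \<alpha>" C] by linarith
    qed
    then show ?thesis by (auto intro!: bdd_aboveI)
  qed
  have L_le: "?L \<phi> \<le> C" if "holder_const D \<alpha> \<phi> C" for \<phi> C
    using that by (intro cInf_lower) (auto simp: holder_const_def intro!: bdd_belowI[of _ 0])
  have L_nonneg: "0 \<le> ?L \<phi>" if "\<phi> \<in> holder_space D \<alpha>" for \<phi>
    using holder_spaceE[OF that] by (simp add: holder_const_def)
  have S_nonneg: "0 \<le> (SUP u. \<bar>\<phi> u\<bar>)" if "\<phi> \<in> holder_space D \<alpha>" for \<phi>
    using cSUP_upper2[OF bdd[OF that], of undefined 0] by simp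
  have N_nonneg: "0 \<le> holder_norm D \<alpha> \<phi>" if "\<phi> \<in> holder_space D \<alpha>" for \<phi>
    using S_nonneg[OF that] L_nonneg[OF that] by (simp add: holder_norm_def)
  have N_sup: "\<bar>\<phi> u\<bar> \<le> holder_norm D \<alpha> \<phi>" if "\<phi> \<in> holder_space D \<alpha>" for \<phi> u
    using cSUP_upper[OF UNIV_I bdd[OF that], of u] L_nonneg[OF that] by (simp add: holder_norm_def)
  have N_zero: "holder_norm D \<alpha> (\<lambda>u. 0) = 0"
  proof -
    have "{C. holder_const D \<alpha> (\<lambda>u. 0) C} = {0..}"
      by (auto simp: holder_const_def)
    then show ?thesis by (simp add: holder_norm_def)
  qed
  have N_commute: "holder_norm D \<alpha> (\<lambda>u. \<phi> u - \<psi> u) = holder_norm D \<alpha> (\<lambda>u. \<psi> u - \<phi> u)" for \<phi> \<psi>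
  proof -
    have "\<bar>\<phi> u - \<psi> u - (\<phi> v - \<psi> v)\<bar> = \<bar>\<psi> u - \<phi> u - (\<psi> v - \<phi> v)\<bar>" for u v
      by linarith
    then show ?thesis
      by (simp add: holder_norm_def holder_const_def abs_minus_commute)
  qed
  have N_triangle: "holder_norm D \<alpha> (\<lambda>u. \<phi> u - \<eta> u)
      \<le> holder_norm D \<alpha> (\<lambda>u. \<phi> u - \<psi> u) + holder_norm D \<alpha> (\<lambda>u. \<psi> u - \<eta> u)"
    if "\<phi> \<in> holder_space D \<alpha>" "\<psi> \<in> holder_space D \<alpha>" "\<eta> \<in> holder_space D \<alpha>" for \<phi> \<psi> \<eta>
  proof -
    let ?g = "\<lambda>u. \<phi> u - \<psi> u" and ?h = "\<lambda>u. \<psi> u - \<eta> u"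
    have g: "?g \<in> holder_space D \<alpha>" and h: "?h \<in> holder_space D \<alpha>"
      using that by (auto intro: sub)
    have "\<bar>\<phi> u - \<eta> u\<bar> \<le> (SUP u. \<bar>?g u\<bar>) + (SUP u. \<bar>?h u\<bar>)" for u
      using cSUP_upper[OF UNIV_I bdd[OF g], of u] cSUP_upper[OF UNIV_I bdd[OF h], of u] by linarith
    then have sup: "(SUP u. \<bar>\<phi> u - \<eta> u\<bar>) \<le> (SUP u. \<bar>?g u\<bar>) + (SUP u. \<bar>?h u\<bar>)"
      by (intro cSUP_least) auto
    have "\<bar>(\<phi> u - \<eta> u) - (\<phi> v - \<eta> v)\<bar> \<le> (?L ?g + ?L ?h) * D u v powr \<alpha>" for u v
    proof -
      have "\<bar>?g u - ?g v\<bar> \<le> ?L ?g * D u v powr \<alpha>" "\<bar>?h u - ?h v\<bar> \<le> ?L ?h * D u v powr \<alpha>"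
        using holder_spaceE[OF g] holder_spaceE[OF h] unfolding holder_const_def by blast+
      then show ?thesis unfolding distrib_right by linarith
    qed
    then have "holder_const D \<alpha> (\<lambda>u. \<phi> u - \<eta> u) (?L ?g + ?L ?h)"
      using L_nonneg[OF g] L_nonneg[OF h] by (simp add: holder_const_def)
    from L_le[OF this] sup show ?thesis by (simp add: holder_norm_def)
  qed
  show ?thesis
  proof
    fix \<phi> \<psi>
    show "0 \<le> norm_dist (holder_space D \<alpha>) (holder_norm D \<alpha>) \<phi> \<psi>"
      by (simp add: norm_dist_def sub N_nonneg)
    show "norm_dist (holder_space D \<alpha>) (holder_norm D \<alpha>) \<phi> \<psi> =
        norm_dist (holder_space D \<alpha>) (holder_norm D \<alpha>) \<psi> \<phi>"
      by (simp add: norm_dist_def N_commute[of \<phi>])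
  next
    fix \<phi> \<psi> assume *: "\<phi> \<in> holder_space D \<alpha>" "\<psi> \<in> holder_space D \<alpha>"
    have "\<phi> = \<psi>" if "holder_norm D \<alpha> (\<lambda>u. \<phi> u - \<psi> u) = 0"
      using N_sup[OF sub[OF *]] that by (simp add: fun_eq_iff)
    then show "norm_dist (holder_space D \<alpha>) (holder_norm D \<alpha>) \<phi> \<psi> = 0 \<longleftrightarrow> \<phi> = \<psi>"
      using * by (auto simp: norm_dist_def N_zero)
  next
    fix \<phi> \<psi> \<eta>
    assume "\<phi> \<in> holder_space D \<alpha>" "\<psi> \<in> holder_space D \<alpha>" "\<eta> \<in> holder_space D \<alpha>"
    then show "norm_dist (holder_space D \<alpha>) (holder_norm D \<alpha>) \<phi> \<eta>
        \<le> norm_dist (holder_space D \<alpha>) (holder_norm D \<alpha>) \<phi> \<psi>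
          + norm_dist (holder_space D \<alpha>) (holder_norm D \<alpha>) \<psi> \<eta>"
      by (simp add: norm_dist_def N_triangle)
  qed
qed


subsection \<open>The transition operator on the product\<close>

definition hat_kernel ::
    "('t \<Rightarrow> 't measure) \<Rightarrow> ('t \<Rightarrow> 'x::metric_space \<Rightarrow> 'x) \<Rightarrow> 't \<times> 'x \<Rightarrow> ('t \<times> 'x) measure" where
  "hat_kernel Q f = (\<lambda>(t, x). distr (Q t) (count_space UNIV \<Otimes>\<^sub>M borel) (\<lambda>u. (u, f u x)))"

definition hat_op ::
    "('t \<Rightarrow> 't measure) \<Rightarrow> ('t \<Rightarrow> 'x::metric_space \<Rightarrow> 'x) \<Rightarrow> ('t \<times> 'x \<Rightarrow> real) \<Rightarrow> 't \<times> 'x \<Rightarrow> real" where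
  "hat_op Q f \<phi> = (\<lambda>v. \<integral>w. \<phi> w \<partial>hat_kernel Q f v)"

text \<open>If \<open>Q(t, \<cdot>)\<close> charges a symbol \<open>u\<close> of stationary measure zero, log-Lipschitz
  integrability does not constrain \<open>f u\<close>; \<^const>\<open>hat_op\<close> preserves the Hoelder spaces
  only if \<open>f u\<close> is Lipschitz for such \<open>u\<close> as well.\<close>

lemma emeasure_hat_kernel:
  assumes "transition_prob Q" and B: "B \<in> sets (count_space UNIV \<Otimes>\<^sub>M borel)"
  shows "emeasure (hat_kernel Q f (t, x)) B = (\<integral>\<^sup>+ u. indicator B (u, f u x) \<partial>Q t)"
proof -
  have s: "sets (Q t) = sets (count_space UNIV)"
    using assms(1) by (auto simp: transition_prob_def space_prob_algebra dest!: measurable_space[where x = t])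
  have m: "(\<lambda>u. (u, f u x)) \<in> measurable (Q t) (count_space UNIV \<Otimes>\<^sub>M borel)"
    by (simp add: measurable_cong_sets[OF s refl] space_pair_measure)
  have "(\<integral>\<^sup>+ u. indicator B (u, f u x) \<partial>Q t) =
      (\<integral>\<^sup>+ u. indicator ((\<lambda>u. (u, f u x)) -` B \<inter> space (Q t)) u \<partial>Q t)"
    by (intro nn_integral_cong) (simp add: indicator_def)
  also have "\<dots> = emeasure (Q t) ((\<lambda>u. (u, f u x)) -` B \<inter> space (Q t))"
    using measurable_sets[OF m B] by simp
  finally show ?thesis
    by (simp add: hat_kernel_def emeasure_distr[OF m B])
qed

end

theory Submission
  imports Defs
begin

text \<open>
  Replace the maps of symbols that the measure does not charge by the identity, so that all maps
  are Lipschitz. Stationary measures of the Markov chain \<open>(t, x) \<mapsto> (u, f\<^sub>t x)\<close> lift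
  to Markovian measures. As the exponents of these lifts are negative, a compactness argument of
  Krylov--Bogoliubov type gives one \<open>N\<close> for which the mean of
  \<open>ln Lf\<^sup>N\<close> is negative at every point; expanding
  \<open>s\<^sup>\<alpha>\<close> at \<open>\<alpha> = 0\<close> turns this into a contraction, in the mean and at
  small scales, of \<open>d\<^sup>\<alpha>\<close> by a factor \<open>\<theta> < 1\<close>.

  This local contraction gives a Doeblin--Fortet inequality for the transition operator; a partition
  of unity replaces it by finite rank operators up to a small error, hence quasi-compactness. It also
  makes nearby points synchronize with probability at least one half and separates
  the minimal absorbing sets, so these are finite in number. On a minimal set every orbit is almost
  surely generic for the lift of the stationary measure of that set (a law of large numbers with
  equicontinuous averages). From every point the chain comes close to a minimal set and then
  synchronizes with a generic orbit, with probability bounded below, and a zero--one argument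
  upgrades this to probability one.
\<close>


text \<open>Two chains occur. Along the skew product the pair \<open>(\<omega> 0, x)\<close> moves
  by applying the map of the current symbol before the next one is drawn. Uniqueness of
  \<open>p\<close> forces the symbol marginal of its stationary measures to be \<open>p\<close>, so
  that their lifts lie over \<open>P\<close>. The operator of the theorem applies the map of the new
  symbol instead; both reduce to the same expectations over words.

  The local Lipschitz constant is only upper semicontinuous and its logarithm may be -infinity. It
  is truncated at a floor exponential in the length of the word, which preserves subadditivity, and
  then approximated by continuous functions from above, the direction in which nonnegativity of
  averages survives.

  Since \<open>m\<close> is arbitrary, a statement for almost every point of X with respect to some
  invariant measure would not suffice: generic behaviour is needed for every starting point and
  almost every path. Birkhoff's theorem does not give this, so a law of large numbers is proved for
  the chain started at each point of a minimal set.\<close>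

section \<open>Weak limits on compact metric spaces\<close>

text \<open>A copy of the alphabet, since the alphabet type itself carries no metric.\<close>

datatype 'a disc = Disc 'a

instantiation disc :: (type) metric_space
begin

definition dist_disc :: "'a disc \<Rightarrow> 'a disc \<Rightarrow> real" where
  "dist_disc x y = (if x = y then 0 else 1)"

definition uniformity_disc :: "('a disc \<times> 'a disc) filter" where
  "uniformity_disc = (INF e\<in>{0<..}. principal {(x, y). dist x y < e})"

definition open_disc :: "'a disc set \<Rightarrow> bool" where
  "open_disc U \<longleftrightarrow> (\<forall>x\<in>U. \<forall>\<^sub>F (x', y) in uniformity. x' = x \<longrightarrow> y \<in> U)"

instance
  by standard (auto simp: uniformity_disc_def open_disc_def dist_disc_def)

end

lemma compact_disc: "compact (UNIV :: 'a::finite disc set)"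
proof -
  have "(UNIV :: 'a disc set) = Disc ` UNIV"
    by (metis disc.exhaust surj_def)
  then show ?thesis
    by (metis finite finite_imageI finite_imp_compact)
qed

lemma compact_disc_times:
  assumes "compact (UNIV :: 'x::metric_space set)"
  shows "compact (UNIV :: ('a::finite disc \<times> 'x) set)"
  using compact_Times[OF compact_disc assms] by simp

text \<open>Distinct symbols are at distance 1 and the product distance dominates that of each
  factor, so a ball of radius at most 1 stays in a single sheet
  \<open>{Disc t} \<times> UNIV\<close>.\<close>

lemma dist_disc_times_less:
  assumes "dist (Disc t, x) (Disc u, y) < r" "r \<le> 1"
  shows "t = u" "dist x y < r"
proof -
  have "dist (Disc t) (Disc u) < 1" "dist x y < r"
    using assms dist_fst_le[of "(Disc t, x)" "(Disc u, y)"] dist_snd_le[of "(Disc t, x)" "(Disc u, y)"]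
    by simp_all
  then show "t = u" "dist x y < r"
    by (simp_all add: dist_disc_def split: if_splits)
qed

lemma dist_disc_times_same: "dist (Disc t, x) (Disc t, y) = dist x y"
  by (simp add: dist_prod_def)

lemma continuous_on_disc_times:
  fixes \<phi> :: "'t disc \<times> 'x::metric_space \<Rightarrow> 'b::topological_space"
  assumes "\<And>t. continuous_on UNIV (\<lambda>x. \<phi> (Disc t, x))"
  shows "continuous_on UNIV \<phi>"
proof -
  have "open (\<phi> -` B)" if B: "open B" for B
    unfolding open_dist
  proof safe
    fix d x assume *: "\<phi> (d, x) \<in> B"
    obtain t where d: "d = Disc t" by (cases d)
    have "open ((\<lambda>x. \<phi> (Disc t, x)) -` B)"
      using assms[of t] B by (simp add: continuous_on_open_vimage)
    then obtain e where e: "e > 0" "\<And>y. dist y x < e \<Longrightarrow> \<phi> (Disc t, y) \<in> B"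
      using * unfolding open_dist d by auto
    have "y \<in> \<phi> -` B" if "dist y (Disc t, x) < min e 1" for y
    proof -
      obtain u z where y: "y = (Disc u, z)" by (metis disc.exhaust surj_pair)
      with that dist_disc_times_less[of u z t x "min e 1"] have "u = t" "dist z x < e" by auto
      with e(2) y show ?thesis by simp
    qed
    then show "\<exists>e>0. \<forall>y. dist y (d, x) < e \<longrightarrow> y \<in> \<phi> -` B"
      using e(1) d by (intro exI[of _ "min e 1"]) auto
  qed
  then show ?thesis
    by (simp add: continuous_on_open_vimage)
qed

lemma continuous_bounded_compact:
  fixes \<phi> :: "'z::metric_space \<Rightarrow> real"
  assumes "compact (UNIV :: 'z set)" "continuous_on UNIV \<phi>"
  obtains B where "B > 0" "\<And>z. \<bar>\<phi> z\<bar> \<le> B"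
proof -
  have "bounded (\<phi> ` UNIV)"
    using assms compact_continuous_image compact_imp_bounded by blast
  then obtain B where "B > 0" "\<forall>y\<in>\<phi> ` UNIV. norm y \<le> B"
    using bounded_pos by blast
  then show ?thesis using that by auto
qed

section \<open>Coding a compact metric space in the real line\<close>

definition ternary :: "(nat \<Rightarrow> bool) \<Rightarrow> real" where
  "ternary b = (\<Sum>k. of_bool (b k) * (2 / 3 ^ Suc k))"

lemma sums_two_thirds: "(\<lambda>k. 2 / 3 ^ Suc (k + j)) sums (1 / 3 ^ j :: real)"
proof -
  have "(\<lambda>k. (2 / 3 ^ Suc j) * (1 / 3) ^ k) sums ((2 / 3 ^ Suc j) * (1 / (1 - 1 / 3)) :: real)"
    by (intro sums_mult geometric_sums) auto
  then show ?thesis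
    by (simp add: power_add field_simps)
qed

lemma summable_ternary: "summable (\<lambda>k. of_bool (b k) * (2 / 3 ^ Suc k) :: real)"
  by (rule summable_comparison_test'[OF sums_summable[OF sums_two_thirds[of 0]], of 0]) auto

lemma ternary_bounds: "0 \<le> ternary b" "ternary b \<le> 1"
proof -
  show "0 \<le> ternary b"
    unfolding ternary_def by (intro suminf_nonneg summable_ternary) auto
  have "ternary b \<le> (\<Sum>k. 2 / 3 ^ Suc (k + 0))"
    unfolding ternary_def
    by (intro suminf_le summable_ternary sums_summable[OF sums_two_thirds]) auto
  also have "\<dots> = 1" using sums_two_thirds[of 0] by (simp add: sums_iff)
  finally show "ternary b \<le> 1" .
qed

text \<open>At the first index \<open>m\<close> where the digits differ the terms differ by
  \<open>2 / 3 ^ Suc m\<close>, while all later terms together contribute at most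
  \<open>1 / 3 ^ Suc m\<close>. This gap is the reason for base 3; binary expansions have
  none.\<close>

lemma ternary_separates:
  assumes "\<bar>ternary b - ternary b'\<bar> < 1 / 3 ^ Suc K" "j \<le> K"
  shows "b j = b' j"
proof (rule ccontr)
  assume "b j \<noteq> b' j"
  define m where "m = (LEAST i. b i \<noteq> b' i)"
  have m: "b m \<noteq> b' m" "m \<le> j" "\<And>i. i < m \<Longrightarrow> b i = b' i"
    unfolding m_def
    using LeastI[of "\<lambda>i. b i \<noteq> b' i", OF \<open>b j \<noteq> b' j\<close>]
      Least_le[of "\<lambda>i. b i \<noteq> b' i", OF \<open>b j \<noteq> b' j\<close>]
      not_less_Least[of _ "\<lambda>i. b i \<noteq> b' i"] by blast+
  define c where "c k = (of_bool (b k) - of_bool (b' k)) * (2 / 3 ^ Suc k :: real)" for k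
  have c_eq: "c = (\<lambda>k. of_bool (b k) * (2 / 3 ^ Suc k) - of_bool (b' k) * (2 / 3 ^ Suc k))"
    unfolding c_def left_diff_distrib ..
  have sc: "summable c"
    unfolding c_eq by (intro summable_diff summable_ternary)
  have "ternary b - ternary b' = (\<Sum>k. c k)"
    unfolding ternary_def c_eq by (rule suminf_diff[OF summable_ternary summable_ternary])
  also have "\<dots> = (\<Sum>k. c (k + Suc m)) + (\<Sum>k<Suc m. c k)"
    by (rule suminf_split_initial_segment[OF sc])
  also have "(\<Sum>k<Suc m. c k) = c m"
    using m(3) by (simp add: c_def)
  finally have eq: "ternary b - ternary b' = (\<Sum>k. c (k + Suc m)) + c m" .
  have sa: "summable (\<lambda>k. \<bar>c (k + Suc m)\<bar>)"
    by (rule summable_comparison_test'[OF sums_summable[OF sums_two_thirds[of "Suc m"]], of 0])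
      (auto simp: c_def)
  have "\<bar>\<Sum>k. c (k + Suc m)\<bar> \<le> (\<Sum>k. \<bar>c (k + Suc m)\<bar>)"
    by (rule summable_rabs[OF sa])
  also have "\<dots> \<le> (\<Sum>k. 2 / 3 ^ Suc (k + Suc m))"
    by (intro suminf_le sa sums_summable[OF sums_two_thirds]) (auto simp: c_def)
  also have "\<dots> = 1 / 3 ^ Suc m" using sums_two_thirds[of "Suc m"] by (simp add: sums_iff)
  finally have "\<bar>\<Sum>k. c (k + Suc m)\<bar> \<le> 1 / 3 ^ Suc m" .
  moreover have "\<bar>c m\<bar> = 2 / 3 ^ Suc m" using m(1) by (auto simp: c_def)
  ultimately have "1 / 3 ^ Suc m \<le> \<bar>ternary b - ternary b'\<bar>" unfolding eq by linarith
  moreover have "(1 / 3 ^ Suc K :: real) \<le> 1 / 3 ^ Suc m"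
    using m(2) assms(2) by (intro divide_left_mono power_increasing) auto
  ultimately show False using assms(1) by linarith
qed

text \<open>The code of a point lists the members of a countable base of balls that contain it;
  reading it as a Cantor-type expansion makes decoding uniformly continuous.\<close>

lemma compact_metric_code:
  assumes K: "compact (UNIV :: 'z::metric_space set)"
  obtains e :: "'z::metric_space \<Rightarrow> real" where "e \<in> borel_measurable borel" "\<And>z. 0 \<le> e z" "\<And>z. e z \<le> 1"
    "\<And>\<epsilon>. \<epsilon> > 0 \<Longrightarrow> \<exists>\<delta>>0. \<forall>x y. \<bar>e x - e y\<bar> < \<delta> \<longrightarrow> dist x y < \<epsilon>"
proof -
  \<comment> \<open>Finite nets at all scales \<open>1 / Suc n\<close>; the balls around their
    points, listed in one sequence, supply the digits of the code.\<close>
  have "\<exists>A. finite A \<and> (UNIV :: 'z set) \<subseteq> (\<Union>a\<in>A. ball a (1 / Suc n))" for n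
    using K unfolding compact_eq_totally_bounded by simp
  then obtain A :: "nat \<Rightarrow> 'z set" where A: "\<And>n. finite (A n)" "\<And>n. UNIV \<subseteq> (\<Union>a\<in>A n. ball a (1 / Suc n))"
    by metis
  define I where "I = (SIGMA n:UNIV. A n)"
  have I: "countable I" "I \<noteq> {}"
    using A(1) A(2)[of 0] unfolding I_def by (auto intro!: countable_SIGMA intro: countable_finite)
  define U where "U k = (case from_nat_into I k of (n, a) \<Rightarrow> ball a (1 / real (Suc n)))" for k
  have openU: "open (U k)" for k by (auto simp: U_def split: prod.split)
  define e where "e z = ternary (\<lambda>k. z \<in> U k)" for z
  have "e \<in> borel_measurable borel"
    unfolding e_def ternary_def using openU
    by (intro borel_measurable_suminf borel_measurable_times borel_measurable_const)
       (auto simp: of_bool_def intro!: measurable_If borel_open)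
  moreover have "\<exists>\<delta>>0. \<forall>x y. \<bar>e x - e y\<bar> < \<delta> \<longrightarrow> dist x y < \<epsilon>" if "\<epsilon> > 0" for \<epsilon>
  proof -
    obtain n where n: "1 / real (Suc n) < \<epsilon> / 2" using \<open>\<epsilon> > 0\<close> nat_approx_posE[of "\<epsilon>/2"] by (metis half_gt_zero)
    define idx where "idx a = to_nat_on I (n, a)" for a
    \<comment> \<open>The last position of a ball of the \<open>n\<close>-th net: codes that agree
      up to \<open>K\<close> put \<open>x\<close> and \<open>y\<close> in the same balls of radius
      \<open>1 / Suc n\<close>, hence at distance below \<open>2 / Suc n\<close>.\<close>
    define K where "K = Max (idx ` A n)"
    have idx: "U (idx a) = ball a (1 / Suc n)" "idx a \<le> K" if "a \<in> A n" for a
    proof -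
      have "(n, a) \<in> I" using that by (simp add: I_def)
      then show "U (idx a) = ball a (1 / Suc n)"
        unfolding U_def idx_def using I(1) by (simp add: from_nat_into_to_nat_on)
      show "idx a \<le> K" unfolding K_def using A(1) that by auto
    qed
    have "dist x y < \<epsilon>" if "\<bar>e x - e y\<bar> < 1 / 3 ^ Suc K" for x y
    proof -
      obtain a where a: "a \<in> A n" "x \<in> ball a (1 / Suc n)" using A(2)[of n] by blast
      have "x \<in> U (idx a) \<longleftrightarrow> y \<in> U (idx a)"
        using ternary_separates[OF that[unfolded e_def] idx(2)[OF a(1)]] .
      then have "dist a x < 1 / Suc n" "dist a y < 1 / Suc n" using a idx by auto
      then show ?thesis using n dist_triangle2[of x y a] by (simp add: dist_commute)
    qed
    then show ?thesis by (intro exI[of _ "1 / 3 ^ Suc K"]) auto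
  qed
  ultimately show ?thesis
    using that ternary_bounds unfolding e_def by blast
qed

text \<open>The inverse of \<open>e\<close> is uniformly continuous on the range of
  \<open>e\<close>, so it extends to the closure. The value at \<open>s\<close> is a cluster point
  of preimages of codes tending to \<open>s\<close>, which compactness provides.\<close>

lemma compact_metric_decode:
  fixes e :: "'z::metric_space \<Rightarrow> real"
  assumes K: "compact (UNIV :: 'z set)"
    and e: "\<And>\<epsilon>. \<epsilon> > 0 \<Longrightarrow> \<exists>\<delta>>0. \<forall>x y. \<bar>e x - e y\<bar> < \<delta> \<longrightarrow> dist x y < \<epsilon>"
  obtains c where "continuous_on (closure (range e)) c" "\<And>z. c (e z) = z"
proof -
  have ex: "\<exists>x. \<forall>\<rho>>0. \<exists>y. \<bar>e y - s\<bar> < \<rho> \<and> dist y x < \<rho>" if "s \<in> closure (range e)" for s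
  proof -
    obtain w where "\<And>n. w n \<in> range e" "w \<longlonglongrightarrow> s" using \<open>s \<in> _\<close> closure_sequential by blast
    then have "\<forall>n. \<exists>y. w n = e y" by auto
    then obtain y where "\<forall>n. w n = e (y n)" by metis
    then have "w = (\<lambda>n. e (y n))" by auto
    with \<open>w \<longlonglongrightarrow> s\<close> have y: "(\<lambda>n. e (y n)) \<longlonglongrightarrow> s" by simp
    obtain x r where x: "strict_mono r" "(y \<circ> r) \<longlonglongrightarrow> x"
      using K unfolding compact_eq_seq_compact_metric seq_compact_def by blast
    have "\<exists>z. \<bar>e z - s\<bar> < \<rho> \<and> dist z x < \<rho>" if "\<rho> > 0" for \<rho>
    proof -
      have "((\<lambda>n. e (y n)) \<circ> r) \<longlonglongrightarrow> s" using LIMSEQ_subseq_LIMSEQ[OF y x(1)] .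
      then have "\<forall>\<^sub>F n in sequentially. dist (e (y (r n))) s < \<rho>"
        using that by (auto simp: tendsto_iff)
      moreover have "\<forall>\<^sub>F n in sequentially. dist (y (r n)) x < \<rho>"
        using x(2) that by (auto simp: tendsto_iff)
      ultimately have "\<forall>\<^sub>F n in sequentially. dist (e (y (r n))) s < \<rho> \<and> dist (y (r n)) x < \<rho>"
        by eventually_elim simp
      then show ?thesis by (auto simp: eventually_sequentially dist_real_def)
    qed
    then show ?thesis by blast
  qed
  define c where "c s = (SOME x. \<forall>\<rho>>0. \<exists>y. \<bar>e y - s\<bar> < \<rho> \<and> dist y x < \<rho>)" for s
  have c: "\<exists>y. \<bar>e y - s\<bar> < \<rho> \<and> dist y (c s) < \<rho>" if "s \<in> closure (range e)" "\<rho> > 0" for s \<rho>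
    using someI_ex[OF ex[OF that(1)]] that(2) unfolding c_def by blast
  have cont: "\<exists>\<delta>>0. \<forall>s\<in>closure (range e). \<forall>s'\<in>closure (range e). \<bar>s - s'\<bar> < \<delta> \<longrightarrow> dist (c s) (c s') < \<epsilon>"
    if eps: "\<epsilon> > 0" for \<epsilon>
  proof -
    have "\<epsilon> / 3 > 0" using eps by simp
    from e[OF this] obtain \<delta> where \<delta>: "\<delta> > 0" "\<And>x y. \<bar>e x - e y\<bar> < \<delta> \<Longrightarrow> dist x y < \<epsilon> / 3"
      by blast
    have "dist (c s) (c s') < \<epsilon>" if s: "s \<in> closure (range e)" "s' \<in> closure (range e)" "\<bar>s - s'\<bar> < \<delta> / 3" for s s'
    proof -
      obtain y y' where y: "\<bar>e y - s\<bar> < min (\<delta> / 3) (\<epsilon> / 3)" "dist y (c s) < min (\<delta> / 3) (\<epsilon> / 3)"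
        "\<bar>e y' - s'\<bar> < min (\<delta> / 3) (\<epsilon> / 3)" "dist y' (c s') < min (\<delta> / 3) (\<epsilon> / 3)"
        using c[OF s(1), of "min (\<delta> / 3) (\<epsilon> / 3)"] c[OF s(2), of "min (\<delta> / 3) (\<epsilon> / 3)"] \<delta>(1) \<open>\<epsilon> > 0\<close> by auto
      have "\<bar>e y - e y'\<bar> < \<delta>" using y s(3) by linarith
      then have "dist y y' < \<epsilon> / 3" by (rule \<delta>(2))
      moreover have "dist (c s) (c s') \<le> dist y (c s) + dist y y' + dist y' (c s')"
        using dist_triangle[of "c s" "c s'" y] dist_triangle[of y "c s'" "y'"] by (simp add: dist_commute)
      ultimately show ?thesis using y by linarith
    qed
    then show ?thesis using \<delta>(1) by (intro exI[of _ "\<delta> / 3"]) auto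
  qed
  have "c (e z) = z" for z
  proof -
    have "dist (c (e z)) z < \<epsilon>" if eps: "\<epsilon> > 0" for \<epsilon>
    proof -
      have "\<epsilon> / 2 > 0" using eps by simp
      from e[OF this] obtain \<delta> where \<delta>: "\<delta> > 0" "\<And>x y. \<bar>e x - e y\<bar> < \<delta> \<Longrightarrow> dist x y < \<epsilon> / 2"
        by blast
      obtain y where "\<bar>e y - e z\<bar> < min \<delta> (\<epsilon> / 2)" "dist y (c (e z)) < min \<delta> (\<epsilon> / 2)"
        using c[of "e z" "min \<delta> (\<epsilon> / 2)"] \<delta>(1) eps closure_subset[of "range e"] by auto
      then show ?thesis using \<delta>(2)[of y z] dist_triangle[of "c (e z)" z y]
        by (simp add: dist_commute)
    qed
    from this[of "dist (c (e z)) z"] show ?thesis by auto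
  qed
  moreover have "continuous_on (closure (range e)) c"
    unfolding continuous_on_iff
  proof safe
    fix s and \<epsilon> :: real assume "s \<in> (closure (range e))" "\<epsilon> > 0"
    with cont[of \<epsilon>] show "\<exists>d>0. \<forall>x'\<in>(closure (range e)). dist x' s < d \<longrightarrow> dist (c x') (c s) < \<epsilon>"
      unfolding dist_real_def by blast
  qed
  ultimately show ?thesis using that by blast
qed

text \<open>On the real line tight sequences have weakly convergent subsequences. The measures are
  carried to \<open>[0, 1]\<close> by the code of the space, a limit is extracted there, and the
  continuous decoding map brings it back.\<close>

lemma prokhorov_compact:
  fixes M :: "nat \<Rightarrow> 'z::metric_space measure"
  assumes K: "compact (UNIV :: 'z set)"
    and M: "\<And>n. prob_space (M n)" "\<And>n. sets (M n) = sets borel"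
  obtains r :: "nat \<Rightarrow> nat" and N :: "'z::metric_space measure" where "strict_mono r" "prob_space N" "sets N = sets borel"
    "\<And>\<phi> :: 'z::metric_space \<Rightarrow> real. continuous_on UNIV \<phi> \<Longrightarrow> (\<lambda>n. \<integral>z. \<phi> z \<partial>M (r n)) \<longlonglongrightarrow> (\<integral>z. \<phi> z \<partial>N)"
proof -
  obtain e :: "'z \<Rightarrow> real" where e: "e \<in> borel_measurable borel" "\<And>z. 0 \<le> e z" "\<And>z. e z \<le> 1"
    and dec: "\<And>\<epsilon>. \<epsilon> > 0 \<Longrightarrow> \<exists>\<delta>>0. \<forall>x y. \<bar>e x - e y\<bar> < \<delta> \<longrightarrow> dist x y < \<epsilon>"
    using compact_metric_code[OF K] by blast
  obtain c where c: "continuous_on (closure (range e)) c" "\<And>z. c (e z) = z"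
    using compact_metric_decode[OF K dec] by blast
  let ?C = "closure (range e)"
  have em[measurable]: "e \<in> borel_measurable (M n)" for n
    using e(1) by (simp add: measurable_cong_sets[OF M(2) refl])
  define \<mu> where "\<mu> n = distr (M n) borel e" for n
  have rd: "real_distribution (\<mu> n)" for n
    unfolding \<mu>_def using M(1) by (auto intro!: prob_space.real_distribution_distr)
  have "tight \<mu>"
    unfolding tight_def
  proof (intro conjI allI impI rd)
    fix \<epsilon> :: real assume "\<epsilon> > 0"
    \<comment> \<open>Tightness is stated with half-open intervals; this one contains
      \<open>[0, 1]\<close>, where all codes lie.\<close>
    have "measure (\<mu> n) {-1<..1} = 1" for n
    proof -
      have "measure (\<mu> n) {-1<..1} = measure (M n) (e -` {-1<..1} \<inter> space (M n))"
        unfolding \<mu>_def by (intro measure_distr) auto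
      also have "e -` {-1<..1} \<inter> space (M n) = space (M n)"
      proof -
        have "e x \<in> {-1<..1}" for x using e(2)[of x] e(3)[of x] by simp
        then show ?thesis by auto
      qed
      finally show ?thesis using M(1) by (simp add: prob_space.prob_space)
    qed
    with \<open>\<epsilon> > 0\<close> show "\<exists>a b. a < b \<and> (\<forall>n. 1 - \<epsilon> < measure (\<mu> n) {a<..b})"
      by (intro exI[of _ "-1"] exI[of _ 1]) auto
  qed
  from tight_imp_convergent_subsubsequence[OF this strict_mono_id]
  obtain r L where r: "strict_mono r" and L: "real_distribution L" and wc: "weak_conv_m (\<mu> \<circ> r) L"
    by (auto simp: o_def id_def)
  interpret L: real_distribution L by (rule L)
  have int_\<mu>: "(\<integral>s. g s \<partial>\<mu> n) = (\<integral>z. g (e z) \<partial>M n)" if "continuous_on UNIV g" for g :: "real \<Rightarrow> real" and n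
    unfolding \<mu>_def using that by (intro integral_distr) (auto intro: borel_measurable_continuous_onI)
  have conv: "(\<lambda>n. \<integral>z. g (e z) \<partial>M (r n)) \<longlonglongrightarrow> (\<integral>s. g s \<partial>L)"
    if g: "continuous_on UNIV g" "\<And>s. \<bar>g s\<bar> \<le> B" for g :: "real \<Rightarrow> real" and B
  proof -
    have "(\<lambda>n. integral\<^sup>L ((\<mu> \<circ> r) n) g) \<longlonglongrightarrow> integral\<^sup>L L g"
      using weak_conv_imp_integral_bdd_continuous_conv[OF _ L wc, of g B] rd g
      by (auto simp: continuous_on_eq_continuous_at)
    then show ?thesis using int_\<mu>[OF g(1)] by simp
  qed
  have ne: "?C \<noteq> {}" by simp
  \<comment> \<open>The truncated distance to the closed set of codes has integral 0 for every
    \<open>\<mu> n\<close>, hence also for the limit.\<close>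
  have AEC: "AE s in L. s \<in> ?C"
  proof -
    let ?g = "\<lambda>s. min 1 (infdist s ?C)"
    have gc: "continuous_on UNIV ?g" by (intro continuous_intros)
    have gb: "\<bar>?g s\<bar> \<le> 1" for s by (simp add: infdist_nonneg)
    have "?g (e z) = 0" for z
      by (simp add: infdist_zero closure_subset[THEN subsetD])
    then have "(\<lambda>n. 0) \<longlonglongrightarrow> (\<integral>s. ?g s \<partial>L)" using conv[OF gc gb] by simp
    then have z: "(\<integral>s. ?g s \<partial>L) = 0" using LIMSEQ_unique tendsto_const by blast
    have gi: "integrable L ?g"
      by (rule L.integrable_const_bound[of _ 1])
         (use gb borel_measurable_continuous_onI[OF gc] in \<open>auto simp: measurable_cong_sets[OF L.events_eq_borel refl]\<close>)
    have "AE s in L. ?g s = 0"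
      using integral_nonneg_eq_0_iff_AE[OF gi] z by (auto simp: infdist_nonneg)
    then show ?thesis
    proof eventually_elim
      case (elim s)
      then have "infdist s ?C = 0" by (auto simp: min_def split: if_splits)
      then show ?case using in_closed_iff_infdist_zero[OF closed_closure ne] by blast
    qed
  qed
  \<comment> \<open>\<open>c\<close> is controlled only on \<open>?C\<close>. A constant value
    elsewhere makes it Borel on the whole line, and \<open>L\<close> does not see the
    change.\<close>
  define c' where "c' s = (if s \<in> ?C then c s else undefined)" for s
  have c'm: "c' \<in> measurable borel borel"
  proof -
    have "c \<in> measurable (restrict_space borel ?C) borel"
      using c(1) by (rule borel_measurable_continuous_on_restrict)
    then show ?thesis unfolding c'_def
      by (subst measurable_If_restrict_space_iff) (auto simp: restrict_space_def)
  qed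
  have c'mL: "c' \<in> measurable L borel" using c'm by (simp add: measurable_cong_sets[OF L.events_eq_borel refl])
  define N where "N = distr L borel c'"
  show ?thesis
  proof (rule that[OF r])
    show "prob_space N" unfolding N_def by (rule L.prob_space_distr[OF c'mL])
    show "sets N = sets borel" by (simp add: N_def)
    fix \<phi> :: "'z \<Rightarrow> real" assume \<phi>: "continuous_on UNIV \<phi>"
    obtain B where B: "B > 0" "\<And>z. \<bar>\<phi> z\<bar> \<le> B" using continuous_bounded_compact[OF K \<phi>] by blast
    have "continuous_on ?C (\<lambda>s. \<phi> (c s))"
      using continuous_on_compose2[OF \<phi> c(1)] by simp
    \<comment> \<open>Convergence in the line is tested with functions on the whole line, so
      \<open>\<phi> \<circ> c\<close> is extended with the same bound.\<close>
    from Tietze[OF this, of UNIV B] obtain g where g: "continuous_on UNIV g"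
      "\<And>s. s \<in> ?C \<Longrightarrow> g s = \<phi> (c s)" "\<And>s. \<bar>g s\<bar> \<le> B"
      using B by auto
    have "(\<lambda>n. \<integral>z. g (e z) \<partial>M (r n)) \<longlonglongrightarrow> (\<integral>s. g s \<partial>L)"
      by (rule conv[OF g(1,3)])
    moreover have "g (e z) = \<phi> z" for z
      using g(2)[of "e z"] c(2)[of z] subsetD[OF closure_subset, of "e z" "range e"] by simp
    moreover have "(\<integral>s. g s \<partial>L) = (\<integral>s. \<phi> (c' s) \<partial>L)"
    proof (rule integral_cong_AE)
      show "AE s in L. g s = \<phi> (c' s)" using AEC by eventually_elim (simp add: g(2) c'_def)
      show "g \<in> borel_measurable L"
        using borel_measurable_continuous_onI[OF g(1)] by (simp add: measurable_cong_sets[OF L.events_eq_borel refl])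
      show "(\<lambda>s. \<phi> (c' s)) \<in> borel_measurable L"
        by (rule measurable_compose[OF c'mL borel_measurable_continuous_onI[OF \<phi>]])
    qed
    moreover have "\<dots> = (\<integral>z. \<phi> z \<partial>N)"
      unfolding N_def by (rule integral_distr[OF c'mL borel_measurable_continuous_onI[OF \<phi>], symmetric])
    ultimately show "(\<lambda>n. \<integral>z. \<phi> z \<partial>M (r n)) \<longlonglongrightarrow> (\<integral>z. \<phi> z \<partial>N)" by simp
  qed
qed

text \<open>Tent functions around a finite net, divided by their sum. Compactness bounds the sum
  away from 0, which is what keeps the quotients Lipschitz.\<close>

lemma lipschitz_partition_of_unity:
  assumes K: "compact (UNIV :: 'x::metric_space set)" and "\<epsilon> > 0"
  obtains I :: "'x::metric_space set" and \<xi> :: "'x \<Rightarrow> 'x \<Rightarrow> real" where "finite I"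
    "\<And>a. a \<in> I \<Longrightarrow> \<exists>L. L-lipschitz_on UNIV (\<xi> a)" "\<And>a x. a \<in> I \<Longrightarrow> 0 \<le> \<xi> a x"
    "\<And>x. (\<Sum>a\<in>I. \<xi> a x) = 1" "\<And>a x. \<xi> a x \<noteq> 0 \<Longrightarrow> dist x a < \<epsilon>"
proof -
  obtain I :: "'x set" where I: "finite I" "UNIV \<subseteq> (\<Union>a\<in>I. ball a \<epsilon>)"
    using K \<open>\<epsilon> > 0\<close> unfolding compact_eq_totally_bounded by blast
  define \<zeta> where "\<zeta> a x = max 0 (\<epsilon> - dist x a)" for a x :: 'x
  define s where "s x = (\<Sum>a\<in>I. \<zeta> a x)" for x
  have \<zeta>_nonneg: "0 \<le> \<zeta> a x" for a x by (simp add: \<zeta>_def)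
  have \<zeta>_lip: "\<bar>\<zeta> a x - \<zeta> a y\<bar> \<le> dist x y" for a x y
    using dist_triangle[of x a y] dist_triangle[of y a x] by (auto simp: \<zeta>_def max_def dist_commute)
  have \<zeta>_cont: "continuous_on UNIV (\<zeta> a)" for a
    unfolding \<zeta>_def by (intro continuous_intros)
  have s_pos: "s x > 0" for x
  proof -
    have "x \<in> (\<Union>a\<in>I. ball a \<epsilon>)" using I(2) by blast
    then obtain a where "a \<in> I" "dist a x < \<epsilon>" by auto
    then show ?thesis
      unfolding s_def using I(1) \<zeta>_nonneg by (intro sum_pos2[of I a]) (auto simp: \<zeta>_def dist_commute)
  qed
  have s_cont: "continuous_on UNIV s"
    unfolding s_def by (intro continuous_intros \<zeta>_cont)
  obtain x0 where x0: "\<And>x. s x0 \<le> s x"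
    using continuous_attains_inf[OF K _ s_cont] by auto
  define c where "c = s x0"
  have c: "c > 0" "\<And>x. c \<le> s x" using s_pos x0 by (auto simp: c_def)
  have s_lip: "\<bar>s x - s y\<bar> \<le> card I * dist x y" for x y
  proof -
    have "\<bar>s x - s y\<bar> \<le> (\<Sum>a\<in>I. \<bar>\<zeta> a x - \<zeta> a y\<bar>)"
      unfolding s_def sum_subtractf[symmetric] by (rule sum_abs)
    also have "\<dots> \<le> (\<Sum>a\<in>I. dist x y)" by (intro sum_mono \<zeta>_lip)
    finally show ?thesis by simp
  qed
  have "((1 + card I) / c)-lipschitz_on UNIV (\<lambda>x. \<zeta> a x / s x)" if "a \<in> I" for a
  proof (rule lipschitz_onI)
    show "0 \<le> (1 + card I) / c" using c by simp
    fix x y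
    have "\<zeta> a y \<le> s y"
      unfolding s_def using that I(1) \<zeta>_nonneg by (intro member_le_sum) auto
    then have q: "0 \<le> \<zeta> a y / s y" "\<zeta> a y / s y \<le> 1" using s_pos[of y] \<zeta>_nonneg by auto
    have "\<zeta> a x / s x - \<zeta> a y / s y = (\<zeta> a x - \<zeta> a y) / s x + (\<zeta> a y / s y) * ((s y - s x) / s x)"
      using s_pos[of x] s_pos[of y] by (simp add: field_simps)
    also have "\<bar>\<dots>\<bar> \<le> \<bar>\<zeta> a x - \<zeta> a y\<bar> / s x + (\<zeta> a y / s y) * (\<bar>s y - s x\<bar> / s x)"
      using s_pos[of x] s_pos[of y] \<zeta>_nonneg[of a y] by (intro order_trans[OF abs_triangle_ineq]) (simp add: abs_mult)
    also have "\<dots> \<le> dist x y / c + 1 * (card I * dist x y / c)"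
      using \<zeta>_lip[of a x y] s_lip[of y x] c q s_pos less_imp_le[OF s_pos[of x]]
      by (intro add_mono frac_le mult_mono) (auto simp: dist_commute)
    finally show "dist (\<zeta> a x / s x) (\<zeta> a y / s y) \<le> (1 + card I) / c * dist x y"
      by (simp add: dist_real_def add_divide_distrib distrib_right)
  qed
  moreover have "(\<Sum>a\<in>I. \<zeta> a x / s x) = 1" for x
    using s_pos[of x] unfolding sum_divide_distrib[symmetric] s_def by simp
  moreover have "dist x a < \<epsilon>" if "\<zeta> a x / s x \<noteq> 0" for a x
    using that by (auto simp: \<zeta>_def)
  ultimately show ?thesis
    using I(1) \<zeta>_nonneg s_pos
    by (intro that[of I "\<lambda>a x. \<zeta> a x / s x"]) (blast | simp add: less_imp_le)+
qed

text \<open>The closed sets form an intersection-stable generator, and the indicator of a nonempty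
  closed set is the limit of the tents \<open>max 0 (1 - real k * infdist x S)\<close>.\<close>

lemma finite_measure_eqI_continuous:
  fixes M N :: "'x::metric_space measure"
  assumes M: "finite_measure M" "sets M = sets borel" and N: "finite_measure N" "sets N = sets borel"
    and eq: "\<And>\<phi> :: 'x \<Rightarrow> real. continuous_on UNIV \<phi> \<Longrightarrow> (\<And>x. 0 \<le> \<phi> x \<and> \<phi> x \<le> 1) \<Longrightarrow> (\<integral>x. \<phi> x \<partial>M) = (\<integral>x. \<phi> x \<partial>N)"
  shows "M = N"
proof -
  have lim: "(\<lambda>k. \<integral>x. max 0 (1 - real k * infdist x S) \<partial>\<mu>) \<longlonglongrightarrow> measure \<mu> S"
    if S: "closed S" "S \<noteq> {}" and \<mu>: "finite_measure \<mu>" "sets \<mu> = sets borel" for S and \<mu> :: "'x measure"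
  proof -
    interpret finite_measure \<mu> by (rule \<mu>)
    have "(\<lambda>k. \<integral>x. max 0 (1 - real k * infdist x S) \<partial>\<mu>) \<longlonglongrightarrow> (\<integral>x. indicator S x \<partial>\<mu>)"
    proof (rule integral_dominated_convergence[where w = "\<lambda>_. 1"])
      show "AE x in \<mu>. (\<lambda>k. max 0 (1 - real k * infdist x S)) \<longlonglongrightarrow> indicator S x"
      proof (rule AE_I2)
        fix x
        show "(\<lambda>k. max 0 (1 - real k * infdist x S)) \<longlonglongrightarrow> indicator S x"
        proof (cases "x \<in> S")
          case True then show ?thesis by simp
        next
          case False
          then have pos: "infdist x S > 0"
            using in_closed_iff_infdist_zero[OF S] infdist_nonneg[of x S] by (metis less_eq_real_def)
          obtain k0 where "1 / infdist x S \<le> real k0" using real_arch_simple by blast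
          then have "max 0 (1 - real k * infdist x S) = 0" if "k \<ge> k0" for k
            using pos that by (simp add: max_def divide_le_eq)
              (smt (verit) mult_right_mono of_nat_mono)
          then have "\<forall>\<^sub>F k in sequentially. max 0 (1 - real k * infdist x S) = 0"
            unfolding eventually_sequentially by blast
          with False show ?thesis
            by (auto intro: tendsto_eventually)
        qed
      qed
      show "(\<lambda>x. max 0 (1 - real k * infdist x S)) \<in> borel_measurable \<mu>" for k
        unfolding measurable_cong_sets[OF \<mu>(2) refl]
        by (intro borel_measurable_continuous_onI continuous_intros)
      show "indicat_real S \<in> borel_measurable \<mu>"
        using S \<mu>(2) by (intro borel_measurable_indicator) auto
    qed (auto simp: infdist_nonneg)
    then show ?thesis using S \<mu>(2) by (simp add: sets_eq_imp_space_eq[OF \<mu>(2)])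
  qed
  interpret M: finite_measure M by (rule M)
  interpret N: finite_measure N by (rule N)
  have closed_eq: "emeasure M S = emeasure N S" if S: "closed S" for S
  \<comment> \<open>\<open>infdist x {}\<close> is 0 by convention, so for the empty set the tents
    would be 1 rather than tend to the indicator.\<close>
  proof (cases "S = {}")
    case False
    have "(\<integral>x. max 0 (1 - real k * infdist x S) \<partial>M) = (\<integral>x. max 0 (1 - real k * infdist x S) \<partial>N)" for k
      by (intro eq continuous_intros) (auto simp: infdist_nonneg)
    then have "measure M S = measure N S"
      using lim[OF S False M] lim[OF S False N] LIMSEQ_unique by simp
    then show ?thesis by (simp add: M.emeasure_eq_measure N.emeasure_eq_measure)
  qed simp
  have b: "sets borel = sigma_sets UNIV {S :: 'x set. closed S}"
    unfolding borel_eq_closed by (subst sets_measure_of) auto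
  show ?thesis
    by (rule measure_eqI_generator_eq[where E = "{S. closed S}" and \<Omega> = UNIV and A = "\<lambda>_. UNIV"])
      (auto simp: Int_stable_def closed_eq M(2) N(2) b)
qed

text \<open>The approximable sets form a sigma-algebra containing \<open>G\<close>: a countable
  union is cut at a finite stage at cost \<open>\<epsilon> / 2\<close>, and the remaining
  \<open>Suc n\<close> sets are approximated within equal shares of the other half.\<close>

lemma (in finite_measure) algebra_approx:
  assumes G: "sets M = sigma_sets (space M) G" "G \<subseteq> Pow (space M)"
    "{} \<in> G" "\<And>C. C \<in> G \<Longrightarrow> space M - C \<in> G" "\<And>C D. C \<in> G \<Longrightarrow> D \<in> G \<Longrightarrow> C \<union> D \<in> G"
    and A: "A \<in> sets M" and e: "\<epsilon> > 0"
  shows "\<exists>C\<in>G. measure M (sym_diff A C) < \<epsilon>"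
proof -
  have GM: "C \<in> sets M" if "C \<in> G" for C using G(1) that by auto
  have "A \<in> sigma_sets (space M) G" using A G(1) by simp
  then show ?thesis using e
  proof (induction arbitrary: \<epsilon>)
    case (Basic a) then show ?case by (intro bexI[of _ a]) auto
  next
    case Empty then show ?case using G(3) by (intro bexI[of _ "{}"]) auto
  next
    case (Compl a)
    then obtain C where C: "C \<in> G" "measure M (sym_diff a C) < \<epsilon>" by blast
    have "a \<subseteq> space M" using Compl(1) G(2) sigma_sets_into_sp by blast
    then have "sym_diff (space M - a) (space M - C) = sym_diff a C" using C(1) G(2) by auto
    with C G(4) show ?case by metis
  next
    case (Union a)
    have aM: "a i \<in> sets M" for i using Union(1) G(1) by simp
    have "(\<lambda>n. measure M (\<Union>i\<le>n. a i)) \<longlonglongrightarrow> measure M (\<Union>n. \<Union>i\<le>n. a i)"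
      using aM by (intro finite_Lim_measure_incseq) (auto simp: incseq_def, meson atMost_iff order_trans)
    moreover have "(\<Union>n. \<Union>i\<le>n. a i) = (\<Union>i. a i)" by auto
    ultimately have "\<forall>\<^sub>F n in sequentially. dist (measure M (\<Union>i\<le>n. a i)) (measure M (\<Union>i. a i)) < \<epsilon> / 2"
      using \<open>\<epsilon> > 0\<close> half_gt_zero[of \<epsilon>] unfolding tendsto_iff by metis
    then obtain n where n: "\<bar>measure M (\<Union>i\<le>n. a i) - measure M (\<Union>i. a i)\<bar> < \<epsilon> / 2"
      by (auto simp: eventually_sequentially dist_real_def)
    have "\<forall>i. \<exists>C\<in>G. measure M (sym_diff (a i) C) < \<epsilon> / (2 * real (Suc n))"
      using Union(2) \<open>\<epsilon> > 0\<close> by (auto intro!: divide_pos_pos)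
    then obtain C where C: "\<And>i. C i \<in> G" "\<And>i. measure M (sym_diff (a i) (C i)) < \<epsilon> / (2 * real (Suc n))"
      by metis
    define D where "D = (\<Union>i\<le>n. C i)"
    have DG: "(\<Union>i\<le>m. C i) \<in> G" for m
      by (induction m) (auto simp: C(1) atMost_Suc G(5) sup_commute intro!: G(5))
    have "sym_diff (\<Union>i. a i) D \<subseteq> ((\<Union>i. a i) - (\<Union>i\<le>n. a i)) \<union> (\<Union>i\<le>n. sym_diff (a i) (C i))"
      unfolding D_def by auto
    then have "measure M (sym_diff (\<Union>i. a i) D)
        \<le> measure M (((\<Union>i. a i) - (\<Union>i\<le>n. a i)) \<union> (\<Union>i\<le>n. sym_diff (a i) (C i)))"
      using aM GM[OF C(1)] by (intro finite_measure_mono) (auto intro!: sets.Un sets.Diff sets.countable_UN)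
    also have "\<dots> \<le> measure M ((\<Union>i. a i) - (\<Union>i\<le>n. a i)) + measure M (\<Union>i\<le>n. sym_diff (a i) (C i))"
      using aM GM[OF C(1)] by (intro measure_Un_le) auto
    also have "measure M ((\<Union>i. a i) - (\<Union>i\<le>n. a i)) = measure M (\<Union>i. a i) - measure M (\<Union>i\<le>n. a i)"
      using aM by (intro finite_measure_Diff) auto
    also have "measure M (\<Union>i\<le>n. sym_diff (a i) (C i)) \<le> (\<Sum>i\<le>n. measure M (sym_diff (a i) (C i)))"
      using aM GM[OF C(1)] by (intro finite_measure_subadditive_finite) auto
    also have "\<dots> \<le> (\<Sum>i\<le>n. \<epsilon> / (2 * real (Suc n)))"
      using C(2) by (intro sum_mono less_imp_le)
    also have "\<dots> = \<epsilon> / 2" by (simp add: field_simps)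
    finally have "measure M (sym_diff (\<Union>i. a i) D) < \<epsilon>" using n by linarith
    then show ?case using DG[of n] unfolding D_def by blast
  qed
qed

text \<open>An elementary zero-one law in the spirit of Levy: for \<open>C\<close> in
  \<open>G\<close> close to \<open>A\<close>, the two sides of \<open>le\<close> are close to
  \<open>measure M A\<close> and \<open>\<kappa> * measure M A\<close>, which forces the measure to
  vanish because \<open>\<kappa> < 1\<close>.\<close>

lemma (in finite_measure) zero_if_contracted_on_algebra:
  assumes G: "sets M = sigma_sets (space M) G" "G \<subseteq> Pow (space M)"
    "{} \<in> G" "\<And>C. C \<in> G \<Longrightarrow> space M - C \<in> G" "\<And>C D. C \<in> G \<Longrightarrow> D \<in> G \<Longrightarrow> C \<union> D \<in> G"
    and A: "A \<in> sets M" and \<kappa>: "0 \<le> \<kappa>" "\<kappa> < 1"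
    and le: "\<And>C. C \<in> G \<Longrightarrow> measure M (A \<inter> C) \<le> \<kappa> * measure M C"
  shows "measure M A = 0"
proof -
  have "measure M A * (1 - \<kappa>) \<le> 0 + \<epsilon>" if "\<epsilon> > 0" for \<epsilon>
  proof -
    obtain C where C: "C \<in> G" "measure M (sym_diff A C) < \<epsilon> / 2"
      using algebra_approx[OF G A, of "\<epsilon> / 2"] \<open>\<epsilon> > 0\<close> by auto
    have CM: "C \<in> sets M" using C(1) G(1) by auto
    have "measure M A \<le> measure M ((A \<inter> C) \<union> sym_diff A C)"
      using A CM by (intro finite_measure_mono) auto
    also have "\<dots> \<le> measure M (A \<inter> C) + measure M (sym_diff A C)"
      using A CM by (intro measure_Un_le) auto
    finally have 1: "measure M A \<le> \<kappa> * measure M C + \<epsilon> / 2" using le[OF C(1)] C(2) by linarith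
    have "measure M C \<le> measure M (A \<union> sym_diff A C)"
      using A CM by (intro finite_measure_mono) auto
    also have "\<dots> \<le> measure M A + measure M (sym_diff A C)"
      using A CM by (intro measure_Un_le) auto
    finally have 2: "measure M C \<le> measure M A + \<epsilon> / 2" using C(2) by linarith
    have "\<kappa> * measure M C \<le> \<kappa> * measure M A + \<epsilon> / 2"
    proof -
      have "\<kappa> * (\<epsilon> / 2) \<le> 1 * (\<epsilon> / 2)" using \<kappa> \<open>\<epsilon> > 0\<close> by (intro mult_right_mono) auto
      with mult_left_mono[OF 2 \<kappa>(1)] show ?thesis unfolding distrib_left by linarith
    qed
    with 1 show ?thesis by (simp add: algebra_simps)
  qed
  then have "measure M A * (1 - \<kappa>) \<le> 0" by (rule field_le_epsilon)
  then show ?thesis using \<kappa> measure_nonneg[of M A]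
    by (smt (verit) mult_pos_pos)
qed

text \<open>Between consecutive squares there are at most \<open>2 * k\<close> further terms, and
  for bounded terms these change the average by at most \<open>2 * A / k\<close>.\<close>

lemma averages_tendsto_zero_squares:
  fixes d :: "nat \<Rightarrow> real"
  assumes A: "\<And>j. \<bar>d j\<bar> \<le> A" and sq: "(\<lambda>k. (\<Sum>j<k\<^sup>2. d j) / real (k\<^sup>2)) \<longlonglongrightarrow> 0"
  shows "(\<lambda>n. (\<Sum>j<n. d j) / real n) \<longlonglongrightarrow> 0"
proof -
  define k where "k n = nat \<lfloor>sqrt (real n)\<rfloor>" for n
  have k: "real (k n) \<le> sqrt n" "sqrt n < real (k n) + 1" for n
    unfolding k_def by (auto simp: of_nat_nat)
  have A0: "A \<ge> 0" using A[of 0] by linarith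
  have k_top: "filterlim k at_top sequentially"
    unfolding k_def
    by (intro filterlim_compose[OF filterlim_nat_sequentially] filterlim_compose[OF filterlim_floor_sequentially]
        filterlim_compose[OF sqrt_at_top] filterlim_real_sequentially)
  have lim: "(\<lambda>n. \<bar>(\<Sum>j<(k n)\<^sup>2. d j) / real ((k n)\<^sup>2)\<bar> + 2 * A / real (k n)) \<longlonglongrightarrow> \<bar>0\<bar> + 0"
  proof (intro tendsto_add tendsto_rabs)
    show "(\<lambda>n. (\<Sum>j<(k n)\<^sup>2. d j) / real ((k n)\<^sup>2)) \<longlonglongrightarrow> 0"
      by (rule filterlim_compose[OF sq k_top])
    show "(\<lambda>n. 2 * A / real (k n)) \<longlonglongrightarrow> 0"
      by (intro tendsto_divide_0[OF tendsto_const] filterlim_at_top_imp_at_infinity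
          filterlim_compose[OF filterlim_real_sequentially k_top])
  qed
  have "\<bar>(\<Sum>j<n. d j) / real n\<bar> \<le> \<bar>(\<Sum>j<(k n)\<^sup>2. d j) / real ((k n)\<^sup>2)\<bar> + 2 * A / real (k n)" if "n \<ge> 1" for n
  proof -
    have "1 \<le> sqrt (real n)" using that by simp
    then have "real (k n) > 0" using k(2)[of n] by linarith
    then have kp: "k n \<ge> 1" by simp
    have "(real (k n))\<^sup>2 \<le> (sqrt n)\<^sup>2" using k(1) by (intro power_mono) auto
    then have "real ((k n)\<^sup>2) \<le> real n" by simp
    then have k2: "(k n)\<^sup>2 \<le> n" using of_nat_le_iff by blast
    have "(sqrt n)\<^sup>2 \<le> (real (k n) + 1)\<^sup>2" using k(2)[of n] by (intro power_mono) auto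
    then have "real n \<le> (real (k n) + 1)\<^sup>2" by simp
    moreover have "real n \<noteq> (real (k n) + 1)\<^sup>2"
    proof
      assume "real n = (real (k n) + 1)\<^sup>2"
      then have "sqrt (real n) = real (k n) + 1" by simp
      with k(2)[of n] show False by simp
    qed
    ultimately have "real n < real ((k n + 1)\<^sup>2)" by (simp add: add.commute)
    then have "n < (k n + 1)\<^sup>2" using of_nat_less_iff by blast
    then have gap: "n - (k n)\<^sup>2 \<le> 2 * k n" by (simp add: power2_eq_square algebra_simps)
    have "(\<Sum>j<n. d j) = (\<Sum>j<(k n)\<^sup>2. d j) + (\<Sum>j=(k n)\<^sup>2..<n. d j)"
      using k2 by (metis lessThan_atLeast0 sum.atLeastLessThan_concat zero_le)
    moreover have "\<bar>\<Sum>j=(k n)\<^sup>2..<n. d j\<bar> \<le> (\<Sum>j=(k n)\<^sup>2..<n. A)"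
      using A by (intro order_trans[OF sum_abs sum_mono])
    moreover have "\<dots> \<le> (2 * k n) * A" using gap A0 by (simp add: mult_right_mono)
    ultimately have "\<bar>\<Sum>j<n. d j\<bar> \<le> \<bar>\<Sum>j<(k n)\<^sup>2. d j\<bar> + 2 * k n * A" by linarith
    then have "\<bar>(\<Sum>j<n. d j) / real n\<bar> \<le> (\<bar>\<Sum>j<(k n)\<^sup>2. d j\<bar> + 2 * k n * A) / real n"
      using that by (simp add: divide_right_mono)
    also have "\<dots> \<le> (\<bar>\<Sum>j<(k n)\<^sup>2. d j\<bar> + 2 * k n * A) / real ((k n)\<^sup>2)"
      using kp k2 A0 \<open>real ((k n)\<^sup>2) \<le> real n\<close> that by (intro divide_left_mono mult_pos_pos) auto
    also have "\<dots> = \<bar>(\<Sum>j<(k n)\<^sup>2. d j) / real ((k n)\<^sup>2)\<bar> + 2 * A / real (k n)"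
      using kp by (simp add: add_divide_distrib power2_eq_square)
    finally show ?thesis .
  qed
  then have "\<forall>\<^sub>F n in sequentially. norm ((\<Sum>j<n. d j) / real n)
      \<le> \<bar>(\<Sum>j<(k n)\<^sup>2. d j) / real ((k n)\<^sup>2)\<bar> + 2 * A / real (k n)"
    by (auto simp: eventually_sequentially intro!: exI[of _ 1])
  moreover have "(\<lambda>n. \<bar>(\<Sum>j<(k n)\<^sup>2. d j) / real ((k n)\<^sup>2)\<bar> + 2 * A / real (k n)) \<longlonglongrightarrow> 0"
    using lim unfolding abs_zero add_0_left .
  ultimately show ?thesis by (rule Lim_null_comparison)
qed

text \<open>At time \<open>k\<^sup>2\<close> the second moment of the average is at most
  \<open>C / k\<^sup>2\<close>, which is summable. Hence the squares of these averages are almost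
  surely summable and tend to 0; the times in between are filled in by boundedness.\<close>

lemma (in prob_space) averages_tendsto_zero_AE:
  assumes [measurable]: "\<And>j. D j \<in> borel_measurable M" and A: "\<And>j \<omega>. \<bar>D j \<omega>\<bar> \<le> A"
    and C: "\<And>n. expectation (\<lambda>\<omega>. (\<Sum>j<n. D j \<omega>)\<^sup>2) \<le> C * real n"
  shows "AE \<omega> in M. (\<lambda>n. (\<Sum>j<n. D j \<omega>) / real n) \<longlonglongrightarrow> 0"
proof -
  define T where "T k \<omega> = ((\<Sum>j<(Suc k)\<^sup>2. D j \<omega>) / real ((Suc k)\<^sup>2))\<^sup>2" for k \<omega>
  have Tm[measurable]: "T k \<in> borel_measurable M" for k unfolding T_def by measurable
  have sumle: "\<bar>\<Sum>j<n. D j \<omega>\<bar> \<le> real n * A" for n \<omega>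
    using order_trans[OF sum_abs sum_mono[of "{..<n}" "\<lambda>j. \<bar>D j \<omega>\<bar>" "\<lambda>_. A"]] A by simp
  have "(\<integral>\<^sup>+\<omega>. ennreal (T k \<omega>) \<partial>M) \<le> ennreal (C / real ((Suc k)\<^sup>2))" for k
  proof -
    have int: "integrable M (\<lambda>\<omega>. (\<Sum>j<n. D j \<omega>)\<^sup>2)" for n
      using sumle by (intro integrable_const_bound[of _ "(real n * A)\<^sup>2"])
        (auto simp: power_mono intro!: AE_I2, metis abs_ge_zero power2_abs power_mono)
    have Teq: "T k \<omega> = (\<Sum>j<(Suc k)\<^sup>2. D j \<omega>)\<^sup>2 / (real ((Suc k)\<^sup>2))\<^sup>2" for \<omega>
      by (simp only: T_def power_divide)
    have Ti: "integrable M (T k)" unfolding Teq using int by simp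
    have "(\<integral>\<^sup>+\<omega>. ennreal (T k \<omega>) \<partial>M) = ennreal (expectation (T k))"
      by (rule nn_integral_eq_integral[OF Ti]) (simp add: T_def)
    also have "expectation (T k) = expectation (\<lambda>\<omega>. (\<Sum>j<(Suc k)\<^sup>2. D j \<omega>)\<^sup>2) / (real ((Suc k)\<^sup>2))\<^sup>2"
      unfolding Teq by simp
    also have "\<dots> \<le> (C * real ((Suc k)\<^sup>2)) / (real ((Suc k)\<^sup>2))\<^sup>2"
      by (intro divide_right_mono C) auto
    also have "\<dots> = C / real ((Suc k)\<^sup>2)" by (simp add: power2_eq_square)
    finally show ?thesis by (simp add: ennreal_leI)
  qed
  then have "(\<Sum>k. \<integral>\<^sup>+\<omega>. ennreal (T k \<omega>) \<partial>M) \<le> (\<Sum>k. ennreal (C / real ((Suc k)\<^sup>2)))"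
    by (intro suminf_le) auto
  also have "\<dots> < \<top>"
  proof -
    have C0: "C \<ge> 0" using C[of 1] by (smt (verit) integral_nonneg_AE AE_I2 zero_le_power2 of_nat_1 mult_cancel_left2)
    have "summable (\<lambda>k. 1 / real ((Suc k)\<^sup>2))"
      using inverse_power_summable[of 2, where 'a=real] summable_Suc_iff[of "\<lambda>k. inverse (real k ^ 2)"]
      by (simp add: inverse_eq_divide)
    then have "summable (\<lambda>k. C / real ((Suc k)\<^sup>2))"
      using summable_mult[of "\<lambda>k. 1 / real ((Suc k)\<^sup>2)" C] by simp
    then have "(\<Sum>k. ennreal (C / real ((Suc k)\<^sup>2))) = ennreal (\<Sum>k. C / real ((Suc k)\<^sup>2))"
      using C0 by (intro suminf_ennreal2) auto
    then show ?thesis by simp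
  qed
  finally have "(\<integral>\<^sup>+\<omega>. (\<Sum>k. ennreal (T k \<omega>)) \<partial>M) < \<top>"
    by (subst nn_integral_suminf) auto
  then have "AE \<omega> in M. (\<Sum>k. ennreal (T k \<omega>)) \<noteq> \<infinity>"
    by (intro nn_integral_PInf_AE) auto
  then show ?thesis
  proof eventually_elim
    case (elim \<omega>)
    have "summable (\<lambda>k. T k \<omega>)"
      using elim by (intro summable_suminf_not_top) (auto simp: T_def)
    then have "(\<lambda>k. T k \<omega>) \<longlonglongrightarrow> 0" by (rule summable_LIMSEQ_zero)
    then have "(\<lambda>k. sqrt (T k \<omega>)) \<longlonglongrightarrow> sqrt 0" by (intro tendsto_real_sqrt)
    then have "(\<lambda>k. \<bar>(\<Sum>j<(Suc k)\<^sup>2. D j \<omega>) / real ((Suc k)\<^sup>2)\<bar>) \<longlonglongrightarrow> 0"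
      unfolding T_def real_sqrt_abs by simp
    then have "(\<lambda>k. (\<Sum>j<(Suc k)\<^sup>2. D j \<omega>) / real ((Suc k)\<^sup>2)) \<longlonglongrightarrow> 0"
      by (rule tendsto_rabs_zero_cancel)
    then have "(\<lambda>k. (\<Sum>j<k\<^sup>2. D j \<omega>) / real (k\<^sup>2)) \<longlonglongrightarrow> 0"
      using filterlim_sequentially_Suc[of "\<lambda>k. (\<Sum>j<k\<^sup>2. D j \<omega>) / real (k\<^sup>2)"] by simp
    then show ?case using A by (intro averages_tendsto_zero_squares)
  qed
qed

section \<open>Finite-state random walks\<close>

text \<open>\<open>path_exp q n t F\<close> is the expectation of \<open>F [t\<^sub>0, \<dots>, t\<^bsub>n-1\<^esub>] t\<^sub>n\<close> over the Markov chain started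
  at \<open>t\<^sub>0 = t\<close>; the last state is kept apart because its map has not been applied yet.\<close>

primrec path_exp :: "('t::finite \<Rightarrow> 't \<Rightarrow> real) \<Rightarrow> nat \<Rightarrow> 't \<Rightarrow> ('t list \<Rightarrow> 't \<Rightarrow> real) \<Rightarrow> real" where
  "path_exp q 0 t F = F [] t"
| "path_exp q (Suc n) t F = (\<Sum>u\<in>UNIV. q t u * path_exp q n u (\<lambda>w v. F (t # w) v))"

primrec word_map :: "('t \<Rightarrow> 'x \<Rightarrow> 'x) \<Rightarrow> 't list \<Rightarrow> 'x \<Rightarrow> 'x" where
  "word_map f [] = id"
| "word_map f (t # w) = word_map f w \<circ> f t"

lemma word_map_append: "word_map f (v @ w) x = word_map f w (word_map f v x)"
  by (induction v arbitrary: x) auto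

lemma word_map_pair:
  "word_map (\<lambda>t. map_prod (f t) (f t)) w (x, y) = (word_map f w x, word_map f w y)"
  by (induction w arbitrary: x y) auto

text \<open>The map of the current symbol is applied before the next symbol is drawn, so that this
  is the chain of \<open>(\<omega> 0, x)\<close> along the skew product; \<open>step_op\<close>
  below applies the map of the new symbol.\<close>

fun markov_op :: "('t::finite \<Rightarrow> 't \<Rightarrow> real) \<Rightarrow> ('t \<Rightarrow> 'x \<Rightarrow> 'x) \<Rightarrow> ('t disc \<times> 'x \<Rightarrow> real) \<Rightarrow> 't disc \<times> 'x \<Rightarrow> real" where
  "markov_op q f \<phi> (Disc t, x) = (\<Sum>u\<in>UNIV. q t u * \<phi> (Disc u, f t x))"

lemma markov_op_power:
  "(markov_op q f ^^ n) \<phi> (Disc t, x) = path_exp q n t (\<lambda>w u. \<phi> (Disc u, word_map f w x))"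
  by (induction n arbitrary: t x) auto

locale stochastic =
  fixes q :: "'t::finite \<Rightarrow> 't \<Rightarrow> real"
  assumes q_nonneg: "0 \<le> q t u" and q_sum: "(\<Sum>u\<in>UNIV. q t u) = 1"
begin

text \<open>The integrands need to be compared only along paths of positive probability. The
  relation \<open>R\<close> between symbol and position is preserved by such transitions; it is used
  for charged symbols, for absorbing sets and for pairs of orbits.\<close>

lemma path_exp_mono_invariant:
  assumes step: "\<And>t s u. R t s \<Longrightarrow> q t u > 0 \<Longrightarrow> R u (g t s)" and "R t s"
    and le: "\<And>w u. length w = n \<Longrightarrow> R u (word_map g w s) \<Longrightarrow> F w u \<le> G w u"
  shows "path_exp q n t F \<le> path_exp q n t G"
  using \<open>R t s\<close> le
proof (induction n arbitrary: t s F G)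
  case 0
  then show ?case by simp
next
  case (Suc n)
  have "q t u * path_exp q n u (\<lambda>w. F (t # w)) \<le> q t u * path_exp q n u (\<lambda>w. G (t # w))" for u
  proof (cases "q t u = 0")
    case False
    then have "R u (g t s)" using step[OF Suc.prems(1)] q_nonneg[of t u] by simp
    then have "path_exp q n u (\<lambda>w. F (t # w)) \<le> path_exp q n u (\<lambda>w. G (t # w))"
      by (rule Suc.IH) (use Suc.prems(2) in simp)
    then show ?thesis using q_nonneg by (intro mult_left_mono)
  qed simp
  then show ?case by (simp add: sum_mono)
qed

lemma path_exp_mono:
  assumes "\<And>w u. length w = n \<Longrightarrow> F w u \<le> G w u"
  shows "path_exp q n t F \<le> path_exp q n t G"
  using path_exp_mono_invariant[where R = "\<lambda>_ _. True" and g = "\<lambda>_. id"] assms by blast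

lemma path_exp_cong:
  assumes "\<And>w u. length w = n \<Longrightarrow> F w u = G w u"
  shows "path_exp q n t F = path_exp q n t G"
  using assms by (intro antisym path_exp_mono) auto

lemma path_exp_const: "path_exp q n t (\<lambda>_ _. c) = c"
  by (induction n arbitrary: t) (simp_all add: sum_distrib_right[symmetric] q_sum)

lemma path_exp_add: "path_exp q n t (\<lambda>w u. F w u + G w u) = path_exp q n t F + path_exp q n t G"
  by (induction n arbitrary: t F G) (simp_all add: distrib_left sum.distrib)

lemma path_exp_cmult: "path_exp q n t (\<lambda>w u. c * F w u) = c * path_exp q n t F"
  by (induction n arbitrary: t F) (simp_all add: sum_distrib_left mult.left_commute)

lemma path_exp_diff: "path_exp q n t (\<lambda>w u. F w u - G w u) = path_exp q n t F - path_exp q n t G"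
  using path_exp_add[of n t F "\<lambda>w u. (-1) * G w u"] path_exp_cmult[of n t "-1" G] by simp

lemma path_exp_abs_diff_le:
  assumes "\<And>w u. length w = n \<Longrightarrow> \<bar>F w u - G w u\<bar> \<le> H w u"
  shows "\<bar>path_exp q n t F - path_exp q n t G\<bar> \<le> path_exp q n t H"
proof -
  have "path_exp q n t (\<lambda>w u. F w u - G w u) \<le> path_exp q n t H"
    using assms by (intro path_exp_mono) (use abs_le_D1 in blast)
  moreover have "path_exp q n t (\<lambda>w u. G w u - F w u) \<le> path_exp q n t H"
    using assms by (intro path_exp_mono) (fastforce dest: abs_le_D2)
  ultimately show ?thesis by (simp add: path_exp_diff)
qed

lemma path_exp_chain:
  "path_exp q (n + m) t F = path_exp q n t (\<lambda>w u. path_exp q m u (\<lambda>w' v. F (w @ w') v))"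
  by (induction n arbitrary: t F) simp_all

text \<open>With finitely many symbols the \<open>n\<close>-step law is finitely supported, so
  expectations are finite sums for every \<open>\<phi>\<close>. This provides the measures for
  \<open>krylov_bogoliubov\<close>.\<close>

lemma finite_support_expectation:
  "\<exists>D :: ('t disc \<times> 'x) pmf. finite (set_pmf D) \<and>
    (\<forall>\<phi>. measure_pmf.expectation D \<phi> = (markov_op q f ^^ n) \<phi> z)"
proof (induction n arbitrary: z)
  case 0
  show ?case by (intro exI[of _ "return_pmf z"]) auto
next
  case (Suc n)
  then obtain D :: "'t disc \<times> 'x \<Rightarrow> ('t disc \<times> 'x) pmf" where
    D: "\<And>z. finite (set_pmf (D z))" "\<And>z \<phi>. measure_pmf.expectation (D z) \<phi> = (markov_op q f ^^ n) \<phi> z"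
    by metis
  obtain t x where z: "z = (Disc t, x)" by (metis disc.exhaust surj_pair)
  define r where "r = embed_pmf (q t)"
  have "pmf r u = q t u" for u
    unfolding r_def
  proof (rule pmf_embed_pmf)
    show "(\<integral>\<^sup>+u. ennreal (q t u) \<partial>count_space UNIV) = 1"
      using q_sum[of t] q_nonneg by (simp add: nn_integral_count_space_finite sum_ennreal)
  qed (rule q_nonneg)
  then have "measure_pmf.expectation (bind_pmf r (\<lambda>u. D (Disc u, f t x))) \<phi> = (markov_op q f ^^ Suc n) \<phi> z" for \<phi>
    by (subst pmf_expectation_bind[where A = UNIV]) (auto simp: D z)
  moreover have "finite (set_pmf (bind_pmf r (\<lambda>u. D (Disc u, f t x))))" using D(1) by auto
  ultimately show ?case by blast
qed

end

section \<open>Stationary measures of the chain\<close>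

locale continuous_walk = stochastic q for q :: "'t::finite \<Rightarrow> 't \<Rightarrow> real" +
  fixes f :: "'t \<Rightarrow> 'x::metric_space \<Rightarrow> 'x"
  assumes K: "compact (UNIV :: 'x set)" and f_cont: "continuous_on UNIV (f t)"
begin

abbreviation "\<K> \<equiv> markov_op q f"

lemma KZ: "compact (UNIV :: ('t disc \<times> 'x) set)"
  by (rule compact_disc_times[OF K])

lemma op_cont:
  assumes "continuous_on UNIV \<phi>"
  shows "continuous_on UNIV (\<K> \<phi>)"
proof (rule continuous_on_disc_times)
  fix t
  have "continuous_on UNIV (\<lambda>x. \<phi> (Disc u, f t x))" for u
    by (rule continuous_on_compose2[OF assms]) (auto intro!: continuous_intros f_cont)
  then show "continuous_on UNIV (\<lambda>x. \<K> \<phi> (Disc t, x))"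
    by (auto intro!: continuous_intros)
qed

lemma op_power_cont: "continuous_on UNIV \<phi> \<Longrightarrow> continuous_on UNIV ((\<K> ^^ n) \<phi>)"
  by (induction n) (auto intro: op_cont)

lemma op_power_add: "(\<K> ^^ n) (\<lambda>z. \<phi> z + \<psi> z) = (\<lambda>z. (\<K> ^^ n) \<phi> z + (\<K> ^^ n) \<psi> z)"
proof
  fix z :: "'t disc \<times> 'x"
  obtain t x where z: "z = (Disc t, x)" by (metis disc.exhaust surj_pair)
  show "(\<K> ^^ n) (\<lambda>z. \<phi> z + \<psi> z) z = (\<K> ^^ n) \<phi> z + (\<K> ^^ n) \<psi> z"
    by (simp add: z markov_op_power path_exp_add)
qed

lemma op_power_cmult: "(\<K> ^^ n) (\<lambda>z. c * \<phi> z) = (\<lambda>z. c * (\<K> ^^ n) \<phi> z)"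
proof
  fix z :: "'t disc \<times> 'x"
  obtain t x where z: "z = (Disc t, x)" by (metis disc.exhaust surj_pair)
  show "(\<K> ^^ n) (\<lambda>z. c * \<phi> z) z = c * (\<K> ^^ n) \<phi> z"
    by (simp add: z markov_op_power path_exp_cmult)
qed

lemma op_power_const: "(\<K> ^^ n) (\<lambda>z. c) = (\<lambda>z. c)"
proof
  fix z :: "'t disc \<times> 'x"
  obtain t x where z: "z = (Disc t, x)" by (metis disc.exhaust surj_pair)
  show "(\<K> ^^ n) (\<lambda>z. c) z = c"
    by (simp add: z markov_op_power path_exp_const)
qed

lemma op_power_mono:
  assumes "\<And>z. \<phi> z \<le> \<psi> z"
  shows "(\<K> ^^ n) \<phi> z \<le> (\<K> ^^ n) \<psi> z"
proof -
  obtain t x where z: "z = (Disc t, x)" by (metis disc.exhaust surj_pair)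
  show ?thesis using assms by (auto simp: z markov_op_power intro: path_exp_mono)
qed

lemma op_power_bound:
  assumes "\<And>z. \<bar>\<phi> z\<bar> \<le> B"
  shows "\<bar>(\<K> ^^ n) \<phi> z\<bar> \<le> B"
proof -
  have "(\<K> ^^ n) \<phi> z \<le> (\<K> ^^ n) (\<lambda>_. B) z" "(\<K> ^^ n) (\<lambda>_. - B) z \<le> (\<K> ^^ n) \<phi> z"
    using assms by (intro op_power_mono; smt (verit))+
  then show ?thesis by (simp add: op_power_const)
qed

text \<open>Invariance is demanded against continuous functions, the class that weak limits
  control.\<close>

definition stationary :: "('t disc \<times> 'x) measure \<Rightarrow> bool" where
  "stationary \<eta> \<longleftrightarrow> prob_space \<eta> \<and> sets \<eta> = sets borel \<and>
    (\<forall>\<phi>. continuous_on UNIV \<phi> \<longrightarrow> (\<integral>z. \<K> \<phi> z \<partial>\<eta>) = (\<integral>z. \<phi> z \<partial>\<eta>))"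

lemma stationary_integrable:
  assumes "stationary \<eta>" "continuous_on UNIV (\<phi> :: _ \<Rightarrow> real)"
  shows "integrable \<eta> \<phi>"
proof -
  interpret prob_space \<eta> using assms(1) by (simp add: stationary_def)
  obtain B where B: "\<And>z. \<bar>\<phi> z\<bar> \<le> B" using continuous_bounded_compact[OF KZ assms(2)] by blast
  have "sets \<eta> = sets borel" using assms(1) by (simp add: stationary_def)
  then have "\<phi> \<in> borel_measurable \<eta>"
    using borel_measurable_continuous_onI[OF assms(2)] measurable_cong_sets by blast
  then show ?thesis using B by (intro integrable_const_bound[of _ B]) auto
qed

lemma stationary_power:
  assumes "stationary \<eta>" "continuous_on UNIV \<phi>"
  shows "(\<integral>z. (\<K> ^^ n) \<phi> z \<partial>\<eta>) = (\<integral>z. \<phi> z \<partial>\<eta>)"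
  using assms op_power_cont[OF assms(2)] by (induction n) (auto simp: stationary_def)

text \<open>The starting point may depend on the number of steps;
  \<open>mean_log_lip_negative\<close> needs this, as it follows a sequence of bad starting
  points.\<close>

lemma krylov_bogoliubov:
  fixes z :: "nat \<Rightarrow> 't disc \<times> 'x"
  obtains r :: "nat \<Rightarrow> nat" and \<eta> where "strict_mono r" "stationary \<eta>"
    "\<And>\<phi>. continuous_on UNIV \<phi> \<Longrightarrow>
       (\<lambda>k. (\<Sum>l<r k. (\<K> ^^ l) \<phi> (z (r k))) / real (r k)) \<longlonglongrightarrow> (\<integral>z. \<phi> z \<partial>\<eta>)"
proof -
  have "\<exists>D :: ('t disc \<times> 'x) pmf. \<forall>\<phi>. measure_pmf.expectation D \<phi> = (\<Sum>l<Suc k. (\<K> ^^ l) \<phi> (z (Suc k))) / real (Suc k)" for k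
  proof -
    obtain D :: "nat \<Rightarrow> ('t disc \<times> 'x) pmf" where
      D: "\<And>l. finite (set_pmf (D l))" "\<And>l \<phi>. measure_pmf.expectation (D l) \<phi> = (\<K> ^^ l) \<phi> (z (Suc k))"
      using finite_support_expectation[where f = f and z = "z (Suc k)"] by metis
    have "measure_pmf.expectation (bind_pmf (pmf_of_set {..<Suc k}) D) \<phi> = (\<Sum>l<Suc k. (\<K> ^^ l) \<phi> (z (Suc k))) / real (Suc k)" for \<phi>
      by (subst pmf_expectation_bind[where A = "{..<Suc k}"])
        (auto simp: D sum_divide_distrib set_pmf_of_set lessThan_empty_iff simp del: sum.lessThan_Suc)
    then show ?thesis by blast
  qed
  then obtain D :: "nat \<Rightarrow> ('t disc \<times> 'x) pmf" where
    D: "\<And>k \<phi>. measure_pmf.expectation (D k) \<phi> = (\<Sum>l<Suc k. (\<K> ^^ l) \<phi> (z (Suc k))) / real (Suc k)"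
    by metis
  \<comment> \<open>The push-forward along \<open>id\<close> replaces the discrete sigma-algebra of
    a \<open>pmf\<close> by the Borel one.\<close>
  define M where "M k = distr (measure_pmf (D k)) borel id" for k
  have M: "prob_space (M k)" "sets (M k) = sets borel" for k
    unfolding M_def by (auto intro!: measure_pmf.prob_space_distr)
  have intM: "(\<integral>z. \<phi> z \<partial>M k) = (\<Sum>l<Suc k. (\<K> ^^ l) \<phi> (z (Suc k))) / real (Suc k)"
    if "continuous_on UNIV \<phi>" for \<phi> k
    unfolding M_def D[symmetric] using borel_measurable_continuous_onI[OF that]
    by (subst integral_distr) (auto simp: id_def)
  obtain r \<eta> where r: "strict_mono r" and \<eta>: "prob_space \<eta>" "sets \<eta> = sets borel"
    "\<And>\<phi> :: _ \<Rightarrow> real. continuous_on UNIV \<phi> \<Longrightarrow> (\<lambda>n. \<integral>z. \<phi> z \<partial>M (r n)) \<longlonglongrightarrow> (\<integral>z. \<phi> z \<partial>\<eta>)"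
    using prokhorov_compact[OF KZ, of M] M by blast
  \<comment> \<open>The averages were indexed by \<open>Suc k\<close> to avoid the empty one, so the
    subsequence is shifted accordingly.\<close>
  define s where "s k = Suc (r k)" for k
  have s: "strict_mono s" using r by (simp add: s_def strict_mono_def)
  have lim: "(\<lambda>k. (\<Sum>l<s k. (\<K> ^^ l) \<phi> (z (s k))) / real (s k)) \<longlonglongrightarrow> (\<integral>z. \<phi> z \<partial>\<eta>)" if "continuous_on UNIV \<phi>" for \<phi>
    using \<eta>(3)[OF that] by (simp add: intM[OF that] s_def)
  have "(\<integral>z. \<K> \<phi> z \<partial>\<eta>) = (\<integral>z. \<phi> z \<partial>\<eta>)" if \<phi>: "continuous_on UNIV \<phi>" for \<phi>
  proof -
    obtain B where B: "\<And>z. \<bar>\<phi> z\<bar> \<le> B" using continuous_bounded_compact[OF KZ \<phi>] by blast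
    \<comment> \<open>The sums telescope, so after averaging the defect of invariance is at most
      \<open>(2 * B) / real (s k)\<close>.\<close>
    have eq: "(\<Sum>l<n. (\<K> ^^ l) (\<K> \<phi>) y) - (\<Sum>l<n. (\<K> ^^ l) \<phi> y) = (\<K> ^^ n) \<phi> y - \<phi> y" for n y
      using sum_lessThan_telescope[of "\<lambda>l. (\<K> ^^ l) \<phi> y" n]
      by (simp add: sum_subtractf funpow_swap1)
    have "(\<lambda>k. (\<Sum>l<s k. (\<K> ^^ l) (\<K> \<phi>) (z (s k))) / real (s k) - (\<Sum>l<s k. (\<K> ^^ l) \<phi> (z (s k))) / real (s k)) \<longlonglongrightarrow> 0"
    proof (rule Lim_null_comparison)
      have "\<bar>(\<K> ^^ n) \<phi> y - \<phi> y\<bar> \<le> 2 * B" for n y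
        using op_power_bound[of \<phi> B n y, OF B] B[of y] by linarith
      then show "\<forall>\<^sub>F k in sequentially. norm ((\<Sum>l<s k. (\<K> ^^ l) (\<K> \<phi>) (z (s k))) / real (s k) - (\<Sum>l<s k. (\<K> ^^ l) \<phi> (z (s k))) / real (s k)) \<le> (2 * B) / real (s k)"
        by (simp add: diff_divide_distrib[symmetric] eq divide_right_mono)
      show "(\<lambda>k. (2 * B) / real (s k)) \<longlonglongrightarrow> 0"
        using s by (intro tendsto_divide_0[OF tendsto_const] filterlim_at_top_imp_at_infinity
          filterlim_compose[OF filterlim_real_sequentially] filterlim_subseq)
    qed
    then have "(\<integral>z. \<K> \<phi> z \<partial>\<eta>) - (\<integral>z. \<phi> z \<partial>\<eta>) = 0"
      using LIMSEQ_unique[OF tendsto_diff[OF lim[OF op_cont[OF \<phi>]] lim[OF \<phi>]]] by blast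
    then show ?thesis by simp
  qed
  with \<eta> have "stationary \<eta>" by (simp add: stationary_def)
  with s lim show ?thesis using that by blast
qed

end

section \<open>From negative Lyapunov exponents to contraction on average\<close>

lemma lip_const_mono: "U \<subseteq> V \<Longrightarrow> lip_const U g \<le> lip_const V g"
  unfolding lip_const_def by (intro INF_superset_mono) (auto intro: lipschitz_on_subset)

text \<open>By monotonicity in the radius the limit exists. As an infimum it turns a strict upper
  bound into a ball with a Lipschitz constant, see \<open>local_lip_less_iff\<close>.\<close>

lemma local_lip_eq_INF: "local_lip g z = (INF r\<in>{0<..}. lip_const (ball z r) g)"
proof -
  have "((\<lambda>r. lip_const (ball z r) g) \<longlongrightarrow> (INF r\<in>{0<..}. lip_const (ball z r) g)) (at_right 0)"
  proof (rule order_tendstoI)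
    fix a assume a: "a < (INF r\<in>{0<..}. lip_const (ball z r) g)"
    have "a < lip_const (ball z r) g" if "r > 0" for r
      using less_le_trans[OF a INF_lower] that by simp
    then show "\<forall>\<^sub>F r in at_right 0. a < lip_const (ball z r) g"
      using eventually_at_right_less[of "0::real"] by (auto elim: eventually_mono)
  next
    fix a assume "(INF r\<in>{0<..}. lip_const (ball z r) g) < a"
    then obtain r0 where r0: "r0 > 0" "lip_const (ball z r0) g < a"
      by (auto simp: INF_less_iff)
    have "lip_const (ball z r) g < a" if "r < r0" for r
      using le_less_trans[OF lip_const_mono r0(2)] that by (simp add: subset_ball)
    then show "\<forall>\<^sub>F r in at_right 0. lip_const (ball z r) g < a"
      using r0(1) unfolding eventually_at_right_field by blast
  qed
  then show ?thesis
    unfolding local_lip_def by (intro tendsto_Lim) auto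
qed

lemma local_lip_less_iff:
  "local_lip g z < ereal c \<longleftrightarrow> (\<exists>r>0. \<exists>C<c. C-lipschitz_on (ball z r) g)"
  by (auto simp: local_lip_eq_INF lip_const_def INF_less_iff)

lemma local_lip_nonneg: "0 \<le> local_lip g z"
  unfolding local_lip_eq_INF lip_const_def
  by (intro INF_greatest) (auto dest: lipschitz_on_nonneg)

lemma local_lip_le: "C-lipschitz_on UNIV g \<Longrightarrow> local_lip g z \<le> ereal C"
  unfolding local_lip_eq_INF lip_const_def
  by (rule INF_lower2[of 1]) (auto intro!: INF_lower intro: lipschitz_on_subset)

definition loc_lip :: "('x::metric_space \<Rightarrow> 'x) \<Rightarrow> 'x \<Rightarrow> real" where
  "loc_lip g z = real_of_ereal (local_lip g z)"

lemma ereal_loc_lip: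
  assumes "C-lipschitz_on UNIV g"
  shows "local_lip g z = ereal (loc_lip g z)"
  using local_lip_le[OF assms, of z] local_lip_nonneg[of g z]
  unfolding loc_lip_def by (cases "local_lip g z") auto

lemma loc_lip_nonneg: "0 \<le> loc_lip g z"
  by (simp add: loc_lip_def local_lip_nonneg real_of_ereal_pos)

lemma loc_lip_le: "C-lipschitz_on UNIV g \<Longrightarrow> loc_lip g z \<le> C"
  using local_lip_le[of C g z] ereal_loc_lip[of C g z] by simp

lemma loc_lip_less_iff:
  assumes "C-lipschitz_on UNIV g"
  shows "loc_lip g z < c \<longleftrightarrow> (\<exists>r>0. \<exists>D<c. D-lipschitz_on (ball z r) g)"
  using local_lip_less_iff[of g z c] by (simp add: ereal_loc_lip[OF assms])

lemma loc_lip_compose: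
  assumes g: "C-lipschitz_on UNIV g" and h: "D-lipschitz_on UNIV h"
  shows "loc_lip (h \<circ> g) z \<le> loc_lip h (g z) * loc_lip g z"
proof -
  have hg: "(D * C)-lipschitz_on UNIV (h \<circ> g)"
    using lipschitz_on_compose[OF g lipschitz_on_subset[OF h]] by simp
  have le: "loc_lip (h \<circ> g) z \<le> (loc_lip h (g z) + \<epsilon>) * (loc_lip g z + \<epsilon>)" if eps: "\<epsilon> > 0" for \<epsilon>
  proof -
    obtain r1 A where A: "r1 > 0" "A < loc_lip h (g z) + \<epsilon>" "A-lipschitz_on (ball (g z) r1) h"
      using loc_lip_less_iff[OF h, of "g z" "loc_lip h (g z) + \<epsilon>"] eps by auto
    obtain r2 B where B: "r2 > 0" "B < loc_lip g z + \<epsilon>" "B-lipschitz_on (ball z r2) g"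
      using loc_lip_less_iff[OF g, of z "loc_lip g z + \<epsilon>"] eps by auto
    have nn: "A \<ge> 0" "B \<ge> 0" using A(3) B(3) lipschitz_on_nonneg by auto
    \<comment> \<open>Small enough for \<open>g\<close> to map the ball into the ball where
      \<open>h\<close> is \<open>A\<close>-Lipschitz; the summand 1 covers
      \<open>B = 0\<close>.\<close>
    define r where "r = min r2 (r1 / (B + 1))"
    have r: "r > 0" using A(1) B(1) nn by (simp add: r_def)
    have sub: "g ` ball z r \<subseteq> ball (g z) r1"
    proof safe
      fix y assume y: "y \<in> ball z r"
      then have "dist (g z) (g y) \<le> B * dist z y"
        using B(1) by (intro lipschitz_onD[OF B(3)]) (auto simp: r_def)
      also have "\<dots> \<le> B * (r1 / (B + 1))"
        using y nn by (intro mult_left_mono) (auto simp: r_def)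
      also have "\<dots> < r1" using nn A(1) by (simp add: field_simps)
      finally show "g y \<in> ball (g z) r1" by simp
    qed
    have "(A * B)-lipschitz_on (ball z r) (h \<circ> g)"
    proof -
      have "ball z r \<subseteq> ball z r2" by (auto simp: r_def)
      then show ?thesis
        using lipschitz_on_compose[OF lipschitz_on_subset[OF B(3)] lipschitz_on_subset[OF A(3) sub]] by simp
    qed
    then have "loc_lip (h \<circ> g) z < c" if "A * B < c" for c
      using loc_lip_less_iff[OF hg] r that by blast
    then have "loc_lip (h \<circ> g) z \<le> A * B" by (meson not_le order_less_irrefl)
    also have "\<dots> \<le> (loc_lip h (g z) + \<epsilon>) * (loc_lip g z + \<epsilon>)"
      using A B nn by (intro mult_mono) auto
    finally show ?thesis .
  qed
  have "((\<lambda>\<epsilon>. (loc_lip h (g z) + \<epsilon>) * (loc_lip g z + \<epsilon>)) \<longlongrightarrow> (loc_lip h (g z) + 0) * (loc_lip g z + 0)) (at_right 0)"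
    by (intro tendsto_intros)
  then show ?thesis
    using le by (intro tendsto_lowerbound[of _ _ "at_right 0"])
      (auto simp: eventually_at_right_field intro!: exI[of _ 1])
qed

section \<open>Upper semicontinuous functions\<close>

definition usc :: "('z::metric_space \<Rightarrow> real) \<Rightarrow> bool" where
  "usc b \<longleftrightarrow> (\<forall>z c. b z < c \<longrightarrow> (\<forall>\<^sub>F y in nhds z. b y < c))"

lemma usc_const: "usc (\<lambda>_. c)"
  by (simp add: usc_def)

lemma usc_add:
  assumes "usc a" "usc b"
  shows "usc (\<lambda>z. a z + b z)"
  unfolding usc_def
proof (intro allI impI)
  fix z c assume c: "a z + b z < c"
  define e where "e = (c - (a z + b z)) / 2"
  have "a z < a z + e" "b z < b z + e" using c by (simp_all add: e_def)
  then have "\<forall>\<^sub>F y in nhds z. a y < a z + e" "\<forall>\<^sub>F y in nhds z. b y < b z + e"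
    using assms unfolding usc_def by blast+
  then show "\<forall>\<^sub>F y in nhds z. a y + b y < c"
    by eventually_elim (simp add: e_def field_simps)
qed

lemma usc_cmult:
  assumes "usc a" "c \<ge> 0"
  shows "usc (\<lambda>z. c * a z)"
proof (cases "c = 0")
  case False
  with assms(2) have "c > 0" by simp
  then have "c * x < d \<longleftrightarrow> x < d / c" for x d by (simp add: field_simps)
  then show ?thesis using assms(1) unfolding usc_def by simp
qed (simp add: usc_def)

lemma usc_sum: "(\<And>i. i \<in> I \<Longrightarrow> usc (a i)) \<Longrightarrow> usc (\<lambda>z. \<Sum>i\<in>I. a i z)"
  by (induction I rule: infinite_finite_induct) (auto intro: usc_const usc_add)

text \<open>A Lipschitz constant valid on \<open>ball z r\<close> is valid on
  \<open>ball y (r / 2)\<close> for every \<open>y\<close> within \<open>r / 2\<close> of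
  \<open>z\<close>, so a strict upper bound persists nearby.\<close>

lemma usc_loc_lip:
  assumes g: "C-lipschitz_on UNIV g"
  shows "usc (loc_lip g)"
  unfolding usc_def
proof (intro allI impI)
  fix z c assume "loc_lip g z < c"
  then obtain r D where r: "r > 0" "D < c" "D-lipschitz_on (ball z r) g"
    using loc_lip_less_iff[OF g] by blast
  have "loc_lip g y < c" if "dist y z < r / 2" for y
  proof -
    have "ball y (r / 2) \<subseteq> ball z r"
      using that by (auto simp: dist_commute) (smt (verit) dist_triangle dist_commute field_sum_of_halves)
    then have "D-lipschitz_on (ball y (r / 2)) g" using r(3) lipschitz_on_subset by blast
    then show ?thesis using loc_lip_less_iff[OF g, of y c] r by (meson half_gt_zero)
  qed
  then show "\<forall>\<^sub>F y in nhds z. loc_lip g y < c"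
    using r(1) unfolding eventually_nhds_metric by (meson half_gt_zero)
qed

lemma usc_ln_max:
  assumes "usc a" "e > 0"
  shows "usc (\<lambda>z. ln (max (a z) e))"
proof -
  have "ln (max x e) < c \<longleftrightarrow> x < exp c \<and> e < exp c" for x c
    using assms(2) by (metis exp_less_cancel_iff exp_ln less_max_iff_disj max_less_iff_conj)
  then show ?thesis using assms(1) unfolding usc_def
    by (auto simp: eventually_conj_iff)
qed

lemma usc_disc_times:
  assumes "\<And>t. usc (\<lambda>x. b (Disc t, x))"
  shows "usc b"
  unfolding usc_def
proof (intro allI impI)
  fix z c assume c: "b z < c"
  obtain t x where z: "z = (Disc t, x)" by (metis disc.exhaust surj_pair)
  have "\<forall>\<^sub>F y in nhds x. b (Disc t, y) < c"
    using assms[of t] c unfolding usc_def z by blast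
  then obtain d where d: "d > 0" "\<And>y. dist y x < d \<Longrightarrow> b (Disc t, y) < c"
    unfolding eventually_nhds_metric by blast
  have "b y < c" if "dist y z < min d 1" for y
  proof -
    obtain u v where y: "y = (Disc u, v)" by (metis disc.exhaust surj_pair)
    show ?thesis
      using dist_disc_times_less[of u v t x "min d 1"] that d(2) by (simp add: y z)
  qed
  then show "\<forall>\<^sub>F y in nhds z. b y < c"
    using d(1) unfolding eventually_nhds_metric by (intro exI[of _ "min d 1"]) auto
qed

text \<open>The approximants are the sup-convolutions \<open>z \<mapsto> sup\<^sub>y (b y - j d(z, y))\<close>.\<close>

lemma usc_approx:
  fixes b :: "'z::metric_space \<Rightarrow> real"
  assumes b: "usc b" "\<And>z. \<bar>b z\<bar> \<le> A"
  obtains \<phi> :: "nat \<Rightarrow> 'z::metric_space \<Rightarrow> real" where "\<And>j. continuous_on UNIV (\<phi> j)" "\<And>j z. b z \<le> \<phi> j z"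
    "\<And>j z. \<bar>\<phi> j z\<bar> \<le> A" "\<And>z. (\<lambda>j. \<phi> j z) \<longlonglongrightarrow> b z"
proof -
  define \<phi> where "\<phi> j z = (SUP y. b y - real j * dist z y)" for j z
  have up: "b y - real j * dist z y \<le> A" for j y z
  proof -
    have "0 \<le> real j * dist z y" by simp
    with b(2)[of y] show ?thesis by linarith
  qed
  then have bdd: "bdd_above (range (\<lambda>y. b y - real j * dist z y))" for j z
    by (auto intro!: bdd_aboveI[of _ A])
  have ge: "b z \<le> \<phi> j z" for j z
    unfolding \<phi>_def by (rule cSUP_upper2[OF bdd, of z]) auto
  have le: "\<phi> j z \<le> A" for j z
    unfolding \<phi>_def by (rule cSUP_least) (auto simp: up)
  have lip: "\<phi> j z \<le> \<phi> j w + real j * dist z w" for j z w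
    unfolding \<phi>_def
  proof (rule cSUP_least)
    fix y
    have "real j * dist w y \<le> real j * (dist z y + dist z w)"
      by (intro mult_left_mono) (metis add.commute dist_commute dist_triangle, simp)
    then have "b y - real j * dist z y \<le> (b y - real j * dist w y) + real j * dist z w"
      by (simp add: distrib_left)
    also have "b y - real j * dist w y \<le> (SUP y. b y - real j * dist w y)"
      by (rule cSUP_upper[OF _ bdd]) simp
    finally show "b y - real j * dist z y \<le> (SUP y. b y - real j * dist w y) + real j * dist z w" by simp
  qed simp
  have "(real j)-lipschitz_on UNIV (\<phi> j)" for j
    using lip[of j] by (intro lipschitz_onI) (auto simp: dist_real_def abs_le_iff dist_commute algebra_simps, metis add.commute dist_commute)
  then have "continuous_on UNIV (\<phi> j)" for j
    by (rule lipschitz_on_continuous_on)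
  moreover have "\<bar>\<phi> j z\<bar> \<le> A" for j z
    using ge[of z j] le[of j z] b(2)[of z] by (simp add: abs_le_iff)
  moreover have "(\<lambda>j. \<phi> j z) \<longlonglongrightarrow> b z" for z
  proof (rule order_tendstoI)
    fix a assume "a < b z" then show "\<forall>\<^sub>F j in sequentially. a < \<phi> j z"
      using ge less_le_trans by (intro always_eventually) blast
  next
    fix a assume a: "b z < a"
    then obtain c where c: "b z < c" "c < a" using dense by blast
    then obtain d where d: "d > 0" "\<And>y. dist y z < d \<Longrightarrow> b y < c"
      using b(1) unfolding usc_def eventually_nhds_metric by metis
    \<comment> \<open>From this slope on, points at distance at least \<open>d\<close> from
      \<open>z\<close> lose at least \<open>2 * A\<close> and cannot compete with
      \<open>z\<close>.\<close>
    obtain j0 where j0: "2 * A / d \<le> real j0" using real_arch_simple by blast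
    have "\<phi> j z < a" if "j \<ge> j0" for j
    proof -
      have "b y - real j * dist z y \<le> c" for y
      proof (cases "dist y z < d")
        case True
        have "0 \<le> real j * dist z y" by simp
        with d(2)[OF True] show ?thesis by linarith
      next
        case False
        have "2 * A \<le> real j0 * d" using j0 d(1) by (simp add: divide_le_eq)
        also have "\<dots> \<le> real j * dist z y" using that False d(1) by (intro mult_mono) (auto simp: dist_commute)
        finally show ?thesis using b(2)[of y] b(2)[of z] c(1) by (simp add: abs_le_iff)
      qed
      then have "\<phi> j z \<le> c" unfolding \<phi>_def by (intro cSUP_least) auto
      then show ?thesis using c by simp
    qed
    then show "\<forall>\<^sub>F j in sequentially. \<phi> j z < a" unfolding eventually_sequentially by blast
  qed
  ultimately show ?thesis using ge that by blast
qed

section \<open>Mean logarithmic Lipschitz constants of random words\<close>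

locale lipschitz_walk = stochastic q for q :: "'t::finite \<Rightarrow> 't \<Rightarrow> real" +
  fixes f :: "'t \<Rightarrow> 'x::metric_space \<Rightarrow> 'x" and L :: real
  assumes K': "compact (UNIV :: 'x set)" and L: "L \<ge> 1" and f_lip: "L-lipschitz_on UNIV (f t)"

sublocale lipschitz_walk \<subseteq> continuous_walk
  by unfold_locales (use K' lipschitz_on_continuous_on[OF f_lip] in auto)

context lipschitz_walk
begin

lemma word_map_lip: "(L ^ length w)-lipschitz_on UNIV (word_map f w)"
proof (induction w)
  case (Cons t w)
  show ?case
    using lipschitz_on_compose[OF f_lip[of t] lipschitz_on_subset[OF Cons.IH subset_UNIV]]
    by (simp add: o_def mult.commute)
qed (auto intro!: lipschitz_onI)

text \<open>The floor keeps the logarithm bounded where the local Lipschitz constant vanishes. It is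
  exponential in the length of the word so that floors multiply under concatenation, which gives
  \<open>log_lip_append\<close>.\<close>

definition log_lip :: "real \<Rightarrow> 't list \<Rightarrow> 'x \<Rightarrow> real" where
  "log_lip M w x = ln (max (loc_lip (word_map f w) x) (exp (- M * length w)))"

definition mean_log_lip :: "nat \<Rightarrow> real \<Rightarrow> 't disc \<times> 'x \<Rightarrow> real" where
  "mean_log_lip n M z = (case z of (Disc t, x) \<Rightarrow> path_exp q n t (\<lambda>w u. log_lip M w x))"

lemma log_lip_bound:
  assumes "M \<ge> 0"
  shows "\<bar>log_lip M w x\<bar> \<le> length w * (M + ln L)"
proof -
  have "loc_lip (word_map f w) x \<le> exp (ln L * length w)"
    using loc_lip_le[OF word_map_lip] L by (simp add: exp_of_nat2_mult mult.commute[of "ln L"] exp_of_nat_mult)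
  moreover have "exp (- M * length w) \<le> exp (ln L * length w)"
  proof -
    have "- M \<le> ln L" using assms ln_ge_zero[OF L] by linarith
    then show ?thesis by (simp only: exp_le_cancel_iff mult_right_mono of_nat_0_le_iff)
  qed
  ultimately have "log_lip M w x \<le> ln (exp (ln L * length w))"
    unfolding log_lip_def by (subst ln_le_cancel_iff) (auto simp: less_max_iff_disj)
  moreover have "ln (exp (- M * length w)) \<le> log_lip M w x"
    unfolding log_lip_def by (subst ln_le_cancel_iff) (auto simp: less_max_iff_disj)
  moreover have "0 \<le> M * length w" "0 \<le> ln L * length w" using assms L by auto
  ultimately show ?thesis by (simp add: abs_le_iff algebra_simps)
qed

lemma log_lip_antimono: "M \<le> M' \<Longrightarrow> log_lip M' w x \<le> log_lip M w x"
proof -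
  assume "M \<le> M'"
  then have "exp (- M' * length w) \<le> exp (- M * length w)" by (simp add: mult_right_mono)
  then have "max (loc_lip (word_map f w) x) (exp (- M' * length w)) \<le> max (loc_lip (word_map f w) x) (exp (- M * length w))"
    by (intro max.mono order_refl)
  then show ?thesis
    unfolding log_lip_def by (rule iffD2[OF ln_le_cancel_iff, rotated 2]) (auto simp: less_max_iff_disj)
qed

lemma log_lip_append: "log_lip M (v @ w) x \<le> log_lip M v x + log_lip M w (word_map f v x)"
proof -
  let ?a = "loc_lip (word_map f v) x" and ?b = "loc_lip (word_map f w) (word_map f v x)"
  have eq: "word_map f (v @ w) = word_map f w \<circ> word_map f v" by (auto simp: word_map_append)
  have "loc_lip (word_map f (v @ w)) x \<le> ?b * ?a"
    unfolding eq by (rule loc_lip_compose[OF word_map_lip word_map_lip])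
  also have "\<dots> \<le> max ?b (exp (- M * length w)) * max ?a (exp (- M * length v))"
    by (intro mult_mono) (auto simp: loc_lip_nonneg max.coboundedI1)
  finally have 1: "loc_lip (word_map f (v @ w)) x \<le> max ?b (exp (- M * length w)) * max ?a (exp (- M * length v))" .
  have "exp (- M * length (v @ w)) = exp (- M * length w) * exp (- M * length v)"
    by (simp add: exp_add[symmetric] algebra_simps)
  also have "\<dots> \<le> max ?b (exp (- M * length w)) * max ?a (exp (- M * length v))"
    by (intro mult_mono) (auto simp: max.coboundedI2)
  finally have "max (loc_lip (word_map f (v @ w)) x) (exp (- M * length (v @ w))) \<le>
    max ?b (exp (- M * length w)) * max ?a (exp (- M * length v))" using 1 by simp
  then have "log_lip M (v @ w) x \<le> ln (max ?b (exp (- M * length w)) * max ?a (exp (- M * length v)))"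
    unfolding log_lip_def by (subst ln_le_cancel_iff) (auto simp: less_max_iff_disj)
  also have "\<dots> = ln (max ?b (exp (- M * length w))) + ln (max ?a (exp (- M * length v)))"
    by (intro ln_mult_pos) (auto simp: less_max_iff_disj)
  finally show ?thesis unfolding log_lip_def by simp
qed

lemma mean_log_lip_bound:
  assumes "M \<ge> 0"
  shows "\<bar>mean_log_lip n M z\<bar> \<le> n * (M + ln L)"
proof -
  obtain t x where z: "z = (Disc t, x)" by (metis disc.exhaust surj_pair)
  have "\<bar>path_exp q n t (\<lambda>w u. log_lip M w x) - path_exp q n t (\<lambda>_ _. 0)\<bar> \<le> path_exp q n t (\<lambda>_ _. n * (M + ln L))"
    using log_lip_bound[OF assms] by (intro path_exp_abs_diff_le) auto
  then show ?thesis by (simp add: z mean_log_lip_def path_exp_const)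
qed

lemma mean_log_lip_subadditive:
  "mean_log_lip (n + m) M z \<le> mean_log_lip n M z + (\<K> ^^ n) (mean_log_lip m M) z"
proof -
  obtain t x where z: "z = (Disc t, x)" by (metis disc.exhaust surj_pair)
  have "path_exp q (n + m) t (\<lambda>w u. log_lip M w x)
      \<le> path_exp q n t (\<lambda>v u. path_exp q m u (\<lambda>w _. log_lip M v x + log_lip M w (word_map f v x)))"
    unfolding path_exp_chain by (intro path_exp_mono log_lip_append)
  then show ?thesis
    by (simp add: z mean_log_lip_def markov_op_power path_exp_add path_exp_const)
qed

lemma mean_log_lip_usc: "usc (mean_log_lip n M)"
proof (rule usc_disc_times)
  fix t
  have *: "usc (\<lambda>x. path_exp q n t (\<lambda>w u. F w x))" if "\<And>w. usc (F w)" for F :: "'t list \<Rightarrow> 'x \<Rightarrow> real"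
    using that by (induction n arbitrary: t F) (auto intro!: usc_sum usc_cmult q_nonneg)
  have "usc (log_lip M w)" for w
    unfolding log_lip_def by (intro usc_ln_max usc_loc_lip[OF word_map_lip]) simp
  from *[OF this] show "usc (\<lambda>x. mean_log_lip n M (Disc t, x))"
    by (simp add: mean_log_lip_def)
qed

text \<open>Each offset \<open>i < n\<close> cuts the word into blocks of length \<open>n\<close> to
  which subadditivity applies; summing over the offsets makes each time below \<open>p * n\<close>
  the start of exactly one block. The constant 5 counts boundary terms: 3 from the incomplete pieces
  at the two ends, 2 from completing the sum over \<open>l\<close> up to \<open>N\<close>.\<close>

lemma mean_log_lip_average:
  assumes M: "M \<ge> 0" and n: "n \<ge> 1" "n \<le> N"
  shows "real n * mean_log_lip N M z \<le> 5 * (real n)\<^sup>2 * (M + ln L) + (\<Sum>l<N. (\<K> ^^ l) (mean_log_lip n M) z)"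
proof -
  define C where "C = M + ln L"
  define b where "b = mean_log_lip n M"
  have C: "C \<ge> 0" using M L by (simp add: C_def)
  have bd: "\<bar>mean_log_lip k M y\<bar> \<le> k * C" for k y
    using mean_log_lip_bound[OF M] by (simp add: C_def)
  have bdK: "\<bar>(\<K> ^^ l) (mean_log_lip k M) y\<bar> \<le> k * C" for l k y
    by (rule op_power_bound[OF bd])
  \<comment> \<open>A number of full blocks that fits after every offset \<open>i < n\<close>,
    leaving at most \<open>2 * n\<close> steps at the end.\<close>
  define p where "p = N div n - 1"
  have "n * 1 \<le> n * (N div n)" using n by (intro mult_left_mono) (auto simp: Suc_leI div_greater_zero_iff)
  then have pn: "p * n + n \<le> N" "N < p * n + 2 * n"
    using n div_times_less_eq_dividend[of N n] dividend_less_div_times[of n N]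
    by (auto simp: p_def algebra_simps)
  have blocks: "mean_log_lip (k * n + m) M y \<le> (\<Sum>j<k. (\<K> ^^ (j * n)) b y) + m * C" for k m y
  proof (induction k arbitrary: m)
    case 0 then show ?case using bd[of m y] by simp
  next
    case (Suc k)
    have "mean_log_lip (Suc k * n + m) M y = mean_log_lip (k * n + (n + m)) M y" by (simp add: algebra_simps)
    also have "\<dots> \<le> mean_log_lip (k * n) M y + (\<K> ^^ (k * n)) (mean_log_lip (n + m) M) y"
      by (rule mean_log_lip_subadditive)
    also have "(\<K> ^^ (k * n)) (mean_log_lip (n + m) M) y \<le> (\<K> ^^ (k * n)) (\<lambda>z. b z + m * C) y"
    proof (rule op_power_mono)
      fix z
      have "(\<K> ^^ n) (mean_log_lip m M) z \<le> m * C" using bdK[of n m z] by (simp add: abs_le_iff)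
      then show "mean_log_lip (n + m) M z \<le> b z + m * C"
        using mean_log_lip_subadditive[of n m M z] by (simp add: b_def)
    qed
    also have "\<dots> = (\<K> ^^ (k * n)) b y + m * C"
      by (simp add: op_power_add op_power_const)
    finally show ?case using Suc.IH[of 0] by simp
  qed
  \<comment> \<open>The first \<open>i\<close> steps cost at most \<open>n * C\<close> and the final
    piece at most \<open>2 * n * C\<close>.\<close>
  have single: "mean_log_lip N M z \<le> 3 * n * C + (\<Sum>j<p. (\<K> ^^ (j * n + i)) b z)" if i: "i < n" for i
  proof -
    define m where "m = N - (i + p * n)"
    have "i + p * n \<le> N" "N \<le> i + p * n + 2 * n" using pn i by linarith+
    then have Neq: "N = i + (p * n + m)" and "m \<le> 2 * n" by (auto simp: m_def)
    then have m: "real m \<le> 2 * n" by linarith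
    have "mean_log_lip N M z \<le> mean_log_lip i M z + (\<K> ^^ i) (mean_log_lip (p * n + m) M) z"
      unfolding Neq by (rule mean_log_lip_subadditive)
    also have "(\<K> ^^ i) (mean_log_lip (p * n + m) M) z \<le> (\<K> ^^ i) (\<lambda>y. (\<Sum>j<p. (\<K> ^^ (j * n)) b y) + m * C) z"
      by (intro op_power_mono blocks)
    also have "\<dots> = (\<K> ^^ i) (\<lambda>y. \<Sum>j<p. (\<K> ^^ (j * n)) b y) z + m * C"
      by (simp add: op_power_add op_power_const)
    also have "(\<K> ^^ i) (\<lambda>y. \<Sum>j<k. (\<K> ^^ (j * n)) b y) z = (\<Sum>j<k. (\<K> ^^ (j * n + i)) b z)" for k
      by (induction k) (simp_all add: op_power_const op_power_add funpow_add add.commute)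
    also have "mean_log_lip i M z \<le> n * C"
      using bd[of i z] i C by (smt (verit) mult_right_mono of_nat_less_iff)
    also have "real m * C \<le> 2 * n * C" using m C by (intro mult_right_mono)
    finally show ?thesis by (simp add: algebra_simps)
  qed
  have "real n * mean_log_lip N M z = (\<Sum>i<n. mean_log_lip N M z)" by simp
  also have "\<dots> \<le> (\<Sum>i<n. 3 * n * C + (\<Sum>j<p. (\<K> ^^ (j * n + i)) b z))"
    by (intro sum_mono single) simp
  also have "\<dots> = 3 * (real n)\<^sup>2 * C + (\<Sum>j<p. \<Sum>i<n. (\<K> ^^ (j * n + i)) b z)"
    by (simp add: sum.distrib power2_eq_square sum.swap[of _ "{..<p}"])
  also have "(\<Sum>j<p. \<Sum>i<n. (\<K> ^^ (j * n + i)) b z) = (\<Sum>l<p * n. (\<K> ^^ l) b z)"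
  proof -
    have "(\<Sum>l=m * n..<m * n + n. (\<K> ^^ l) b z) = (\<Sum>i<n. (\<K> ^^ (m * n + i)) b z)" for m
      using sum.shift_bounds_nat_ivl[of "\<lambda>l. (\<K> ^^ l) b z" 0 "m * n" n]
      by (simp add: add.commute lessThan_atLeast0)
    then show ?thesis unfolding sum.nat_group[symmetric] by simp
  qed
  also have "(\<Sum>l<p * n. (\<K> ^^ l) b z) = (\<Sum>l<N. (\<K> ^^ l) b z) - (\<Sum>l=p * n..<N. (\<K> ^^ l) b z)"
    using pn(1) sum.atLeastLessThan_concat[of 0 "p * n" N "\<lambda>l. (\<K> ^^ l) b z"] by (simp add: atLeast0LessThan)
  finally have main: "real n * mean_log_lip N M z \<le> 3 * (real n)\<^sup>2 * C + ((\<Sum>l<N. (\<K> ^^ l) b z) - (\<Sum>l=p * n..<N. (\<K> ^^ l) b z))" .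
  have "- (\<Sum>l=p * n..<N. (\<K> ^^ l) b z) \<le> (\<Sum>l=p * n..<N. n * C)"
    unfolding sum_negf[symmetric] using bdK[of _ n z] by (intro sum_mono) (simp add: b_def abs_le_iff)
  also have "(\<Sum>l=p * n..<N. n * C) = real (N - p * n) * (n * C)" by simp
  also have "\<dots> \<le> (2 * n) * (n * C)"
    using pn(2) C by (intro mult_right_mono of_nat_mono) auto
  finally show ?thesis using main by (simp add: C_def b_def power2_eq_square algebra_simps)
qed


text \<open>Otherwise every length has a point with nonnegative mean, and time averages of the chain
  started at such points produce a stationary measure against which every truncated mean has
  nonnegative integral.\<close>

lemma mean_log_lip_negative:
  assumes neg: "\<And>\<eta>. stationary \<eta> \<Longrightarrow> \<exists>n\<ge>1. \<exists>M\<ge>0. (\<integral>z. mean_log_lip n M z \<partial>\<eta>) < 0"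
  obtains N M where "N \<ge> 1" "M \<ge> 0" "\<And>z. mean_log_lip N M z < 0"
proof -
  have "\<exists>N\<ge>1. \<exists>M\<ge>0. \<forall>z. mean_log_lip N M z < 0"
  proof (rule ccontr)
    assume contra: "\<not> ?thesis"
    \<comment> \<open>The truncation level grows with the length, so that any fixed \<open>M\<close>
      is eventually below it; by \<open>log_lip_antimono\<close> the mean at level \<open>M\<close>
      is then nonnegative as well.\<close>
    have "\<exists>z. 0 \<le> mean_log_lip k (real k) z" if "k \<ge> 1" for k
      using contra that by (meson not_less of_nat_0_le_iff)
    then obtain z where z: "\<And>k. k \<ge> 1 \<Longrightarrow> 0 \<le> mean_log_lip k (real k) (z k)" by metis
    obtain r \<eta> where r: "strict_mono r" and \<eta>: "stationary \<eta>"
      and lim: "\<And>\<phi>. continuous_on UNIV \<phi> \<Longrightarrow>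
       (\<lambda>k. (\<Sum>l<r k. (\<K> ^^ l) \<phi> (z (r k))) / real (r k)) \<longlonglongrightarrow> (\<integral>z. \<phi> z \<partial>\<eta>)"
      using krylov_bogoliubov[of z] by blast
    obtain n M where n: "n \<ge> 1" and M: "M \<ge> 0" and less: "(\<integral>z. mean_log_lip n M z \<partial>\<eta>) < 0"
      using neg[OF \<eta>] by blast
    define b where "b = mean_log_lip n M"
    have bd: "\<bar>b z\<bar> \<le> n * (M + ln L)" for z
      unfolding b_def by (rule mean_log_lip_bound[OF M])
    \<comment> \<open>Weak convergence is available for continuous functions. Majorants preserve the
      lower bound on the averages, and dominated convergence returns to \<open>b\<close>.\<close>
    obtain \<phi> where \<phi>: "\<And>j. continuous_on UNIV (\<phi> j)" "\<And>j z. b z \<le> \<phi> j z"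
      "\<And>j z. \<bar>\<phi> j z\<bar> \<le> n * (M + ln L)" "\<And>z. (\<lambda>j. \<phi> j z) \<longlonglongrightarrow> b z"
      using usc_approx[of b, OF _ bd] mean_log_lip_usc unfolding b_def by metis
    have r_top: "filterlim r at_top sequentially" by (rule filterlim_subseq[OF r])
    have "0 \<le> (\<integral>z. \<phi> j z \<partial>\<eta>)" for j
    proof -
      define c where "c = 5 * (real n)\<^sup>2 * (M + ln L)"
      have "\<forall>\<^sub>F k in sequentially. max n (nat \<lceil>M\<rceil>) \<le> r k"
        using r_top unfolding filterlim_at_top by blast
      then have "\<forall>\<^sub>F k in sequentially. 0 \<le> (\<Sum>l<r k. (\<K> ^^ l) (\<phi> j) (z (r k))) / real (r k) + c / real (r k)"
      proof eventually_elim
        case (elim k)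
        then have k: "n \<le> r k" "M \<le> real (r k)" "1 \<le> r k"
          using n of_nat_ceiling[of M] by (auto intro: order_trans)
        have "0 \<le> mean_log_lip (r k) (real (r k)) (z (r k))" using z[OF k(3)] .
        also have "\<dots> \<le> mean_log_lip (r k) M (z (r k))"
          using log_lip_antimono[OF k(2)]
          by (auto simp: mean_log_lip_def split: prod.split disc.split intro!: path_exp_mono)
        finally have "0 \<le> real n * mean_log_lip (r k) M (z (r k))" by simp
        also have "\<dots> \<le> c + (\<Sum>l<r k. (\<K> ^^ l) b (z (r k)))"
          unfolding c_def b_def by (rule mean_log_lip_average[OF M n k(1)])
        also have "\<dots> \<le> c + (\<Sum>l<r k. (\<K> ^^ l) (\<phi> j) (z (r k)))"
          by (intro add_left_mono sum_mono op_power_mono \<phi>(2))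
        finally show ?case by (simp add: add_divide_distrib[symmetric] add.commute)
      qed
      moreover have "(\<lambda>k. (\<Sum>l<r k. (\<K> ^^ l) (\<phi> j) (z (r k))) / real (r k) + c / real (r k)) \<longlonglongrightarrow> (\<integral>z. \<phi> j z \<partial>\<eta>) + 0"
        by (intro tendsto_add lim \<phi>(1) tendsto_divide_0[OF tendsto_const] filterlim_at_top_imp_at_infinity
          filterlim_compose[OF filterlim_real_sequentially] r_top)
      ultimately show ?thesis
        using tendsto_lowerbound[where F = sequentially and a = 0] by fastforce
    qed
    moreover have "(\<lambda>j. \<integral>z. \<phi> j z \<partial>\<eta>) \<longlonglongrightarrow> (\<integral>z. b z \<partial>\<eta>)"
    proof (rule integral_dominated_convergence[where w = "\<lambda>_. n * (M + ln L)"])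
      interpret prob_space \<eta> using \<eta> by (simp add: stationary_def)
      show m: "\<phi> j \<in> borel_measurable \<eta>" for j
        using stationary_integrable[OF \<eta> \<phi>(1)] by simp
      show "b \<in> borel_measurable \<eta>"
        by (rule borel_measurable_LIMSEQ_real[where u = \<phi>]) (use \<phi>(4) m in auto)
      show "integrable \<eta> (\<lambda>_. n * (M + ln L))" by simp
    qed (use \<phi> in auto)
    ultimately have "0 \<le> (\<integral>z. b z \<partial>\<eta>)"
      by (intro tendsto_lowerbound[where F = sequentially and f = "\<lambda>j. \<integral>z. \<phi> j z \<partial>\<eta>"]) auto
    with less show False by (simp add: b_def)
  qed
  then show ?thesis by (elim exE conjE) (rule that, auto)
qed

lemma local_mean_contraction:
  assumes N: "N \<ge> 1" and M: "M \<ge> 0" and neg: "mean_log_lip N M (Disc t, x) < 0"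
  obtains \<rho> \<beta> where "\<rho> > 0" "0 < \<beta>" "\<beta> \<le> 1"
    "\<And>\<alpha>. 0 < \<alpha> \<Longrightarrow> \<alpha> \<le> \<beta> \<Longrightarrow> \<exists>\<theta><1. \<forall>y\<in>ball x \<rho>. \<forall>z\<in>ball x \<rho>.
       path_exp q N t (\<lambda>w u. dist (word_map f w y) (word_map f w z) powr \<alpha>) \<le> \<theta> * dist y z powr \<alpha>"
proof -
  \<comment> \<open>Half of the negative mean is given away in \<open>s\<close>, to pass from the
    constant at \<open>x\<close> to a Lipschitz constant on a small ball; the other half drives the
    contraction.\<close>
  define \<kappa> where "\<kappa> = - mean_log_lip N M (Disc t, x) / 2"
  have \<kappa>: "\<kappa> > 0" using neg by (simp add: \<kappa>_def)
  define s where "s w = log_lip M w x + \<kappa>" for w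
  define S where "S = 1 + N * (M + ln L) + \<kappa>"
  have S: "S \<ge> 1" using M L \<kappa> by (simp add: S_def)
  have s_bd: "\<bar>s w\<bar> \<le> S" if "length w = N" for w
    using log_lip_bound[OF M, of w x] \<kappa> that by (simp add: s_def S_def)
  have mean_s: "path_exp q N t (\<lambda>w u. s w) = - \<kappa>"
    unfolding s_def path_exp_add path_exp_const using \<kappa>_def by (simp add: mean_log_lip_def)
  have "\<forall>\<^sub>F \<rho> in at_right 0. (exp (s w))-lipschitz_on (ball x \<rho>) (word_map f w)" for w
  proof -
    have "loc_lip (word_map f w) x < exp (s w)"
    proof -
      have "max (loc_lip (word_map f w) x) (exp (- M * length w)) = exp (log_lip M w x)"
        unfolding log_lip_def by (subst exp_ln) (auto simp: less_max_iff_disj)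
      then have "loc_lip (word_map f w) x \<le> exp (log_lip M w x)" by linarith
      also have "\<dots> < exp (s w)" using \<kappa> by (simp add: s_def)
      finally show ?thesis .
    qed
    then obtain r D where r: "r > 0" "D < exp (s w)" "D-lipschitz_on (ball x r) (word_map f w)"
      using loc_lip_less_iff[OF word_map_lip] by blast
    have "(exp (s w))-lipschitz_on (ball x \<rho>) (word_map f w)" if "\<rho> < r" for \<rho>
      using lipschitz_on_le[OF lipschitz_on_subset[OF r(3)]] r(2) that by (simp add: subset_ball)
    then show ?thesis using r(1) unfolding eventually_at_right_field by blast
  qed
  then have "\<forall>\<^sub>F \<rho> in at_right 0. \<forall>w\<in>{w. length w = N}. (exp (s w))-lipschitz_on (ball x \<rho>) (word_map f w)"
    using finite_lists_length_eq[of "UNIV :: 't set" N] by (subst eventually_ball_finite_distrib) auto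
  then obtain \<rho> where \<rho>: "\<rho> > 0" "\<And>w. length w = N \<Longrightarrow> (exp (s w))-lipschitz_on (ball x \<rho>) (word_map f w)"
    unfolding eventually_at_right_field by (metis (mono_tags, lifting) dense mem_Collect_eq)
  \<comment> \<open>The bound \<open>1 / S\<close> gives
    \<open>\<bar>\<alpha> * s w\<bar> \<le> 1\<close>, the range of the quadratic bound for
    \<open>exp\<close>; the other bound makes the quadratic term at most half of the linear gain
    \<open>\<alpha> * \<kappa>\<close>.\<close>
  define \<beta> where "\<beta> = min (1 / S) (\<kappa> / (2 * S\<^sup>2))"
  have "0 < \<beta>" using S \<kappa> by (simp add: \<beta>_def)
  moreover have "\<beta> \<le> 1 / S" by (simp add: \<beta>_def)
  moreover have "1 / S \<le> 1" using S by simp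
  ultimately have \<beta>: "0 < \<beta>" "\<beta> \<le> 1" by linarith+
  have exp_le: "exp y \<le> 1 + y + y\<^sup>2" if "\<bar>y\<bar> \<le> 1" for y :: real
  proof (cases "y \<ge> 0")
    case True then show ?thesis using exp_bound[of y] that by simp
  next
    case False
    define u where "u = - y"
    have u: "u > 0" using False by (simp add: u_def)
    have "exp y = 1 / exp u" by (simp add: u_def exp_minus inverse_eq_divide)
    also have "\<dots> \<le> 1 / (1 + u)" using u exp_ge_add_one_self[of u] by (intro divide_left_mono) auto
    also have "\<dots> \<le> 1 - u + u\<^sup>2"
    proof -
      have "1 \<le> (1 - u + u\<^sup>2) * (1 + u)" using u by (simp add: power2_eq_square algebra_simps)
      then show ?thesis using u by (simp add: divide_le_eq)
    qed
    finally show ?thesis by (simp add: u_def)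
  qed
  show ?thesis
  proof (rule that[OF \<rho>(1) \<beta>])
    fix \<alpha> :: real assume \<alpha>: "0 < \<alpha>" "\<alpha> \<le> \<beta>"
    define \<theta> where "\<theta> = 1 - \<alpha> * \<kappa> + \<alpha>\<^sup>2 * S\<^sup>2"
    have "\<alpha> * S\<^sup>2 < \<kappa>"
    proof -
      have "\<alpha> \<le> \<kappa> / (2 * S\<^sup>2)" using \<alpha>(2) by (simp add: \<beta>_def)
      then have "\<alpha> * S\<^sup>2 \<le> \<kappa> / 2" using S by (simp add: field_simps)
      then show ?thesis using \<kappa> by simp
    qed
    then have "\<alpha> * (\<alpha> * S\<^sup>2) < \<alpha> * \<kappa>" using \<alpha> by (intro mult_strict_left_mono)
    then have \<theta>: "\<theta> < 1" by (simp add: \<theta>_def power2_eq_square)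
    have aS: "\<alpha> * S \<le> 1"
    proof -
      have "\<alpha> \<le> 1 / S" using \<alpha>(2) by (simp add: \<beta>_def)
      then show ?thesis using S by (simp add: field_simps)
    qed
    have "path_exp q N t (\<lambda>w u. exp (\<alpha> * s w)) \<le> path_exp q N t (\<lambda>w u. (1 + \<alpha> * s w) + \<alpha>\<^sup>2 * S\<^sup>2)"
    proof (rule path_exp_mono)
      fix w :: "'t list" and u assume w: "length w = N"
      have "\<bar>\<alpha> * s w\<bar> \<le> \<alpha> * S" using s_bd[OF w] \<alpha> by (simp add: abs_mult)
      then have "\<bar>\<alpha> * s w\<bar> \<le> 1" and "(\<alpha> * s w)\<^sup>2 \<le> (\<alpha> * S)\<^sup>2"
        using aS abs_le_square_iff[of "\<alpha> * s w" "\<alpha> * S"] by linarith+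
      then show "exp (\<alpha> * s w) \<le> (1 + \<alpha> * s w) + \<alpha>\<^sup>2 * S\<^sup>2"
        using exp_le[of "\<alpha> * s w"] by (simp add: power_mult_distrib)
    qed
    also have "\<dots> = \<theta>"
      by (simp add: path_exp_add path_exp_const path_exp_cmult mean_s \<theta>_def)
    finally have exp_mean: "path_exp q N t (\<lambda>w u. exp (\<alpha> * s w)) \<le> \<theta>" .
    have "path_exp q N t (\<lambda>w u. dist (word_map f w y) (word_map f w z) powr \<alpha>) \<le> \<theta> * dist y z powr \<alpha>"
      if yz: "y \<in> ball x \<rho>" "z \<in> ball x \<rho>" for y z
    proof -
      have "path_exp q N t (\<lambda>w u. dist (word_map f w y) (word_map f w z) powr \<alpha>)
          \<le> path_exp q N t (\<lambda>w u. dist y z powr \<alpha> * exp (\<alpha> * s w))"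
      proof (rule path_exp_mono)
        fix w :: "'t list" and u assume w: "length w = N"
        have "dist (word_map f w y) (word_map f w z) powr \<alpha> \<le> (exp (s w) * dist y z) powr \<alpha>"
          using lipschitz_onD[OF \<rho>(2)[OF w] yz] \<alpha> by (intro powr_mono2) auto
        also have "\<dots> = dist y z powr \<alpha> * exp (\<alpha> * s w)"
        proof -
          have "exp (s w) powr \<alpha> = exp (\<alpha> * s w)" by (simp add: powr_def)
          then show ?thesis by (simp add: powr_mult)
        qed
        finally show "dist (word_map f w y) (word_map f w z) powr \<alpha> \<le> dist y z powr \<alpha> * exp (\<alpha> * s w)" .
      qed
      also have "\<dots> = dist y z powr \<alpha> * path_exp q N t (\<lambda>w u. exp (\<alpha> * s w))"
        by (rule path_exp_cmult)
      also have "\<dots> \<le> dist y z powr \<alpha> * \<theta>" using exp_mean by (intro mult_left_mono) auto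
      finally show ?thesis by (simp add: mult.commute)
    qed
    with \<theta> show "\<exists>\<theta><1. \<forall>y\<in>ball x \<rho>. \<forall>z\<in>ball x \<rho>.
       path_exp q N t (\<lambda>w u. dist (word_map f w y) (word_map f w z) powr \<alpha>) \<le> \<theta> * dist y z powr \<alpha>" by blast
  qed
qed

definition contracts :: "nat \<Rightarrow> real \<Rightarrow> real \<Rightarrow> real \<Rightarrow> bool" where
  "contracts N \<alpha> \<theta> r \<longleftrightarrow> (\<forall>t y z. dist y z < r \<longrightarrow>
     path_exp q N t (\<lambda>w u. dist (word_map f w y) (word_map f w z) powr \<alpha>) \<le> \<theta> * dist y z powr \<alpha>)"

lemma mean_contraction:
  assumes N: "N \<ge> 1" and M: "M \<ge> 0" and neg: "\<And>z. mean_log_lip N M z < 0"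
  obtains \<beta> where "0 < \<beta>" "\<beta> \<le> 1"
    "\<And>\<alpha>. 0 < \<alpha> \<Longrightarrow> \<alpha> \<le> \<beta> \<Longrightarrow> \<exists>\<theta> r. 0 < \<theta> \<and> \<theta> < 1 \<and> 0 < r \<and> contracts N \<alpha> \<theta> r"
proof -
  define R where "R x t \<rho> \<beta> \<longleftrightarrow> \<rho> > 0 \<and> 0 < \<beta> \<and> \<beta> \<le> 1 \<and> (\<forall>\<alpha>. 0 < \<alpha> \<longrightarrow> \<alpha> \<le> \<beta> \<longrightarrow> (\<exists>\<theta><1. \<forall>y\<in>ball x \<rho>. \<forall>z\<in>ball x \<rho>.
       path_exp q N t (\<lambda>w u. dist (word_map f w y) (word_map f w z) powr \<alpha>) \<le> \<theta> * dist y z powr \<alpha>))"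
    for x :: 'x and t \<rho> \<beta>
  have "\<exists>\<rho> \<beta>. R x t \<rho> \<beta>" for x t
    unfolding R_def by (rule local_mean_contraction[OF N M neg[of "(Disc t, x)"]]) blast
  then obtain \<rho> \<beta> where R: "\<And>x t. R x t (\<rho> x t) (\<beta> x t)" by metis
  then have \<rho>\<beta>: "\<And>x t. \<rho> x t > 0" "\<And>x t. 0 < \<beta> x t" "\<And>x t. \<beta> x t \<le> 1"
    and ex: "\<And>x t \<alpha>. 0 < \<alpha> \<Longrightarrow> \<alpha> \<le> \<beta> x t \<Longrightarrow> \<exists>\<theta><1. \<forall>y\<in>ball x (\<rho> x t). \<forall>z\<in>ball x (\<rho> x t).
       path_exp q N t (\<lambda>w u. dist (word_map f w y) (word_map f w z) powr \<alpha>) \<le> \<theta> * dist y z powr \<alpha>"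
    unfolding R_def by blast+
  \<comment> \<open>Half radii act as a Lebesgue number: if one point lies in the half ball and the
    other is within half the radius of it, both lie in the full ball where the local estimate
    holds.\<close>
  have "\<exists>I. finite I \<and> (UNIV :: 'x set) \<subseteq> (\<Union>x\<in>I. ball x (\<rho> x t / 2))" for t
  proof -
    have "x \<in> ball x (\<rho> x t / 2)" for x using \<rho>\<beta>(1) by simp
    then have cover: "(UNIV :: 'x set) \<subseteq> (\<Union>x\<in>UNIV. ball x (\<rho> x t / 2))" by blast
    show ?thesis
      by (rule compactE_image[OF K _ cover, OF open_ball]) (rule exI, rule conjI)
  qed
  then obtain I where I: "\<And>t. finite (I t)" "\<And>t. (UNIV :: 'x set) \<subseteq> (\<Union>x\<in>I t. ball x (\<rho> x t / 2))"
    by metis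
  define J where "J = (SIGMA t:UNIV. I t)"
  have J: "finite J" "J \<noteq> {}" using I(1) I(2)[of undefined] by (auto simp: J_def)
  \<comment> \<open>The range of exponents and the scale \<open>r\<close> are fixed before
    \<open>\<alpha>\<close> is given; the rate found below depends on
    \<open>\<alpha>\<close>.\<close>
  define \<beta>0 where "\<beta>0 = Min ((\<lambda>(t, x). \<beta> x t) ` J)"
  define r where "r = Min ((\<lambda>(t, x). \<rho> x t / 2) ` J)"
  have "0 < \<beta>0" "0 < r"
    using J \<rho>\<beta> by (auto simp: \<beta>0_def r_def Min_gr_iff)
  moreover have "\<beta>0 \<le> 1"
  proof -
    obtain t x where "(t, x) \<in> J" using J(2) by auto
    then have "\<beta>0 \<le> \<beta> x t" using J(1) by (force simp: \<beta>0_def intro: Min_le)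
    then show ?thesis using \<rho>\<beta>(3)[of x t] by simp
  qed
  moreover have "\<exists>\<theta>. 0 < \<theta> \<and> \<theta> < 1 \<and> contracts N \<alpha> \<theta> r" if \<alpha>: "0 < \<alpha>" "\<alpha> \<le> \<beta>0" for \<alpha>
  proof -
    have "\<alpha> \<le> \<beta> x t" if "(t, x) \<in> J" for t x
    proof -
      have "\<beta>0 \<le> \<beta> x t" using J(1) that by (force simp: \<beta>0_def intro: Min_le)
      with \<alpha>(2) show ?thesis by simp
    qed
    note le = this
    define T where "T j \<theta> \<longleftrightarrow> \<theta> < 1 \<and> (\<forall>y\<in>ball (snd j) (\<rho> (snd j) (fst j)). \<forall>z\<in>ball (snd j) (\<rho> (snd j) (fst j)).
       path_exp q N (fst j) (\<lambda>w u. dist (word_map f w y) (word_map f w z) powr \<alpha>) \<le> \<theta> * dist y z powr \<alpha>)" for j \<theta>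
    have "\<exists>\<theta>. T j \<theta>" if "j \<in> J" for j
      unfolding T_def using ex[OF \<alpha>(1) le[of "fst j" "snd j"]] that by auto
    then obtain \<theta> where "\<And>j. j \<in> J \<Longrightarrow> T j (\<theta> j)" by metis
    then have \<theta>: "\<And>j. j \<in> J \<Longrightarrow> \<theta> j < 1"
      "\<And>j y z. j \<in> J \<Longrightarrow> y \<in> ball (snd j) (\<rho> (snd j) (fst j)) \<Longrightarrow> z \<in> ball (snd j) (\<rho> (snd j) (fst j)) \<Longrightarrow>
       path_exp q N (fst j) (\<lambda>w u. dist (word_map f w y) (word_map f w z) powr \<alpha>) \<le> \<theta> j * dist y z powr \<alpha>"
      unfolding T_def by blast+
    \<comment> \<open>The local rates are only known to be below 1; the maximum with
      \<open>1/2\<close> makes the common rate positive.\<close>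
    define \<theta>0 where "\<theta>0 = max (1/2) (Max (\<theta> ` J))"
    have "0 < \<theta>0" "\<theta>0 < 1" using \<theta>(1) J by (auto simp: \<theta>0_def less_max_iff_disj)
    moreover have "contracts N \<alpha> \<theta>0 r"
      unfolding contracts_def
    proof (intro allI impI)
      fix t and y z :: 'x assume d: "dist y z < r"
      obtain x where x: "x \<in> I t" "dist x y < \<rho> x t / 2" using I(2)[of t] by (auto simp: subset_eq)
      then have j: "(t, x) \<in> J" by (simp add: J_def)
      then have "\<rho> x t / 2 \<in> (\<lambda>(t, x). \<rho> x t / 2) ` J" by force
      then have "r \<le> \<rho> x t / 2" unfolding r_def using J(1) by (intro Min_le) auto
      then have "z \<in> ball x (\<rho> x t)" "y \<in> ball x (\<rho> x t)"
        using d x(2) dist_triangle[of x z y] \<rho>\<beta>(1)[of x t] by auto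
      then have "path_exp q N t (\<lambda>w u. dist (word_map f w y) (word_map f w z) powr \<alpha>) \<le> \<theta> (t, x) * dist y z powr \<alpha>"
        using \<theta>(2)[OF j] by simp
      also have "\<theta> (t, x) * dist y z powr \<alpha> \<le> \<theta>0 * dist y z powr \<alpha>"
      proof (rule mult_right_mono)
        have "\<theta> (t, x) \<le> Max (\<theta> ` J)" using j J(1) by (intro Max_ge) auto
        then show "\<theta> (t, x) \<le> \<theta>0" by (simp add: \<theta>0_def)
      qed simp
      finally show "path_exp q N t (\<lambda>w u. dist (word_map f w y) (word_map f w z) powr \<alpha>) \<le> \<theta>0 * dist y z powr \<alpha>" .
    qed
    ultimately show ?thesis by blast
  qed
  ultimately show ?thesis
    by (intro that[of \<beta>0]) (assumption | meson)+
qed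

end

section \<open>Quasi-compactness\<close>

lemma power_less_eventually:
  fixes \<theta> :: real
  assumes "0 < \<theta>" "\<theta> < 1" "\<epsilon> > 0"
  obtains k where "k \<ge> 1" "\<theta> ^ k * C \<le> \<epsilon>"
proof -
  have "(\<lambda>k. \<theta> ^ k * C) \<longlonglongrightarrow> 0 * C"
    using assms by (intro tendsto_mult tendsto_const LIMSEQ_power_zero) auto
  then have "\<forall>\<^sub>F k in sequentially. \<theta> ^ k * C < \<epsilon>"
    using assms(3) by (intro order_tendstoD(2)) auto
  then have "\<forall>\<^sub>F k in sequentially. \<theta> ^ k * C < \<epsilon> \<and> k \<ge> 1"
    using eventually_ge_at_top[of 1] by eventually_elim simp
  then obtain k where "\<theta> ^ k * C < \<epsilon> \<and> k \<ge> 1"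
    using eventually_sequentially by auto
  with that show ?thesis by auto
qed

lemma finite_common_subsequence:
  fixes c :: "nat \<Rightarrow> 'j \<Rightarrow> real"
  assumes "finite J" "\<And>n j. j \<in> J \<Longrightarrow> \<bar>c n j\<bar> \<le> B"
  obtains r :: "nat \<Rightarrow> nat" and l where "strict_mono r" "\<And>j. j \<in> J \<Longrightarrow> (\<lambda>n. c (r n) j) \<longlonglongrightarrow> l j"
    "\<And>j. j \<in> J \<Longrightarrow> \<bar>l j\<bar> \<le> B"
proof -
  have "\<exists>r l. strict_mono (r :: nat \<Rightarrow> nat) \<and> (\<forall>j\<in>J. (\<lambda>n. c (r n) j) \<longlonglongrightarrow> l j \<and> \<bar>l j\<bar> \<le> B)"
    using assms
  proof (induction J)
    case empty
    then show ?case using strict_mono_id by auto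
  next
    case (insert i J)
    then obtain r l where r: "strict_mono (r :: nat \<Rightarrow> nat)" "\<forall>j\<in>J. (\<lambda>n. c (r n) j) \<longlonglongrightarrow> l j \<and> \<bar>l j\<bar> \<le> B"
      by auto
    have "compact {-B..B}" by simp
    moreover have "\<forall>n. c (r n) i \<in> {-B..B}" using insert.prems by (auto simp: abs_le_iff minus_le_iff)
    ultimately obtain a s where a: "a \<in> {-B..B}" "strict_mono s" "((\<lambda>n. c (r n) i) \<circ> s) \<longlonglongrightarrow> a"
      unfolding compact_eq_seq_compact_metric seq_compact_def by metis
    have "(\<lambda>n. c ((r \<circ> s) n) j) \<longlonglongrightarrow> (l(i := a)) j \<and> \<bar>(l(i := a)) j\<bar> \<le> B" if "j \<in> insert i J" for j
    proof (cases "j = i")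
      case True
      then show ?thesis using a by (auto simp: o_def abs_le_iff)
    next
      case False
      then have "(\<lambda>n. c (r n) j) \<longlonglongrightarrow> l j" "\<bar>l j\<bar> \<le> B" using r(2) that by auto
      then show ?thesis using False LIMSEQ_subseq_LIMSEQ[OF _ a(2)] by (auto simp: o_def)
    qed
    moreover have "strict_mono (r \<circ> s)" using r(1) a(2) by (rule strict_mono_o)
    ultimately show ?case by blast
  qed
  then show ?thesis using that by blast
qed

text \<open>\<open>dummy\<close> carries the type \<open>'t\<close>, which \<open>b\<close>,
  \<open>\<alpha>\<close> and the assumptions do not mention.\<close>

locale holder_setting =
  fixes b \<alpha> :: real and dummy :: "'t \<times> 'x::metric_space"
  assumes bound: "\<And>x y :: 'x. dist x y \<le> b" and \<alpha>: "0 < \<alpha>" "\<alpha> \<le> 1"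
begin

abbreviation "E \<equiv> holder_space (prod_dist1 :: 't \<times> 'x \<Rightarrow> _) \<alpha>"
abbreviation "Nm \<equiv> holder_norm (prod_dist1 :: 't \<times> 'x \<Rightarrow> _) \<alpha>"
abbreviation "holder \<equiv> holder_const (prod_dist1 :: 't \<times> 'x \<Rightarrow> _) \<alpha>"

lemma D_bound: "0 \<le> prod_dist1 u v \<and> prod_dist1 u (v :: 't \<times> 'x) \<le> 1 + b"
  using bound[of "snd u" "snd v"] zero_le_dist[of "snd u" "snd v"]
  by (auto simp: prod_dist1_def)

lemma Metric_E: "Metric_space E (norm_dist E Nm)"
  by (rule Metric_space_holder[OF D_bound \<alpha>(1)])

lemma holderD:
  assumes "holder \<phi> C"
  shows "\<bar>\<phi> u - \<phi> v\<bar> \<le> C * prod_dist1 u v powr \<alpha>" "0 \<le> C"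
  using assms unfolding holder_const_def by blast+

lemma holder_Inf_le: "holder \<phi> C \<Longrightarrow> Inf {C. holder \<phi> C} \<le> C"
  by (intro cInf_lower) (auto simp: holder_const_def intro!: bdd_belowI[of _ 0])

lemma norm_leI:
  assumes "\<And>u. \<bar>\<phi> u\<bar> \<le> A" "holder \<phi> C"
  shows "\<phi> \<in> E" "Nm \<phi> \<le> A + C"
proof -
  show "\<phi> \<in> E" using assms(2) by (auto simp: holder_space_def)
  have "(SUP u. \<bar>\<phi> u\<bar>) \<le> A" by (rule cSUP_least) (use assms(1) in auto)
  with holder_Inf_le[OF assms(2)] show "Nm \<phi> \<le> A + C" by (simp add: holder_norm_def)
qed

lemma holder_bdd:
  assumes "\<phi> \<in> E"
  shows "bdd_above (range (\<lambda>u. \<bar>\<phi> u\<bar>))"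
proof -
  from assms obtain C where C: "holder \<phi> C" by (auto simp: holder_space_def)
  have "\<bar>\<phi> u\<bar> \<le> \<bar>\<phi> undefined\<bar> + C * (1 + b) powr \<alpha>" for u
  proof -
    have "\<bar>\<phi> u - \<phi> undefined\<bar> \<le> C * prod_dist1 u undefined powr \<alpha>" "0 \<le> C"
      by (rule holderD[OF C])+
    moreover have "prod_dist1 u undefined powr \<alpha> \<le> (1 + b) powr \<alpha>"
      using D_bound[of u undefined] \<alpha> by (intro powr_mono2) auto
    ultimately show ?thesis
      using mult_left_mono[of "prod_dist1 u undefined powr \<alpha>" "(1 + b) powr \<alpha>" C] by linarith
  qed
  then show ?thesis by (auto intro!: bdd_aboveI)
qed

lemma norm_ge:
  assumes "\<phi> \<in> E"
  shows "\<bar>\<phi> u\<bar> \<le> Nm \<phi>" "holder \<phi> (Nm \<phi>)"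
proof -
  let ?C = "Inf {C. holder \<phi> C}"
  have C: "holder \<phi> ?C" using holder_spaceE[OF assms] .
  then have C0: "0 \<le> ?C" by (simp add: holder_const_def)
  have sup: "\<bar>\<phi> u\<bar> \<le> (SUP u. \<bar>\<phi> u\<bar>)" for u
    by (rule cSUP_upper[OF UNIV_I holder_bdd[OF assms]])
  then show "\<bar>\<phi> u\<bar> \<le> Nm \<phi>" using C0 by (simp add: holder_norm_def add_increasing2)
  have le: "?C \<le> Nm \<phi>" using sup[of undefined] by (simp add: holder_norm_def)
  have "\<bar>\<phi> u - \<phi> v\<bar> \<le> Nm \<phi> * prod_dist1 u v powr \<alpha>" for u v
  proof -
    have "\<bar>\<phi> u - \<phi> v\<bar> \<le> ?C * prod_dist1 u v powr \<alpha>" by (rule holderD(1)[OF C])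
    also have "\<dots> \<le> Nm \<phi> * prod_dist1 u v powr \<alpha>" using le by (intro mult_right_mono) auto
    finally show ?thesis .
  qed
  then show "holder \<phi> (Nm \<phi>)" using C0 le by (simp add: holder_const_def)
qed

lemma norm_nonneg: "\<phi> \<in> E \<Longrightarrow> 0 \<le> Nm \<phi>"
  using norm_ge(2) by (auto simp: holder_const_def)

lemma holder_same: "holder \<phi> C \<Longrightarrow> \<bar>\<phi> (t, x) - \<phi> (t, y)\<bar> \<le> C * dist x y powr \<alpha>"
  using holderD(1)[of \<phi> C "(t, x)" "(t, y)"] by (simp add: prod_dist1_def)

text \<open>Points with different symbols or at distance at least \<open>r\<close> are at
  \<open>prod_dist1\<close> distance at least \<open>r\<close>, and there the oscillation
  \<open>2 * A\<close> is paid for by \<open>2 * A / r powr \<alpha>\<close>.\<close>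

lemma holder_localI:
  assumes r: "0 < r" "r \<le> 1" and A: "\<And>u. \<bar>\<phi> u\<bar> \<le> A" and H: "0 \<le> H"
    and loc: "\<And>t x y. dist x y < r \<Longrightarrow> \<bar>\<phi> (t, x) - \<phi> (t, y)\<bar> \<le> H * dist x y powr \<alpha>"
  shows "holder \<phi> (H + 2 * A / r powr \<alpha>)"
  unfolding holder_const_def
proof (intro conjI allI)
  have A0: "0 \<le> A" using A[of undefined] by simp
  then show "0 \<le> H + 2 * A / r powr \<alpha>" using H by simp
  fix u v :: "'t \<times> 'x"
  obtain t x where u: "u = (t, x)" by (cases u)
  obtain s y where v: "v = (s, y)" by (cases v)
  show "\<bar>\<phi> u - \<phi> v\<bar> \<le> (H + 2 * A / r powr \<alpha>) * prod_dist1 u v powr \<alpha>"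
  proof (cases "t = s \<and> dist x y < r")
    case True
    then have "\<bar>\<phi> u - \<phi> v\<bar> \<le> H * dist x y powr \<alpha>" using loc[of x y t] by (simp add: u v)
    also have "\<dots> \<le> (H + 2 * A / r powr \<alpha>) * dist x y powr \<alpha>"
      using A0 by (intro mult_right_mono) auto
    finally show ?thesis using True by (simp add: u v prod_dist1_def)
  next
    case False
    then have "r \<le> prod_dist1 u v" using r by (auto simp: u v prod_dist1_def intro: add_increasing2)
    then have "r powr \<alpha> \<le> prod_dist1 u v powr \<alpha>" using r \<alpha> by (intro powr_mono2) auto
    then have "2 * A \<le> (2 * A / r powr \<alpha>) * prod_dist1 u v powr \<alpha>"
      using A0 r by (simp add: field_simps mult_left_mono)
    also have "\<dots> \<le> (H + 2 * A / r powr \<alpha>) * prod_dist1 u v powr \<alpha>"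
      using H by (intro mult_right_mono) auto
    finally show ?thesis using A[of u] A[of v] by linarith
  qed
qed

text \<open>A span of finitely many elements meets bounded coefficient sets in compact sets.\<close>

lemma finite_rank_compact:
  assumes J: "finite J" and e: "\<And>j. j \<in> J \<Longrightarrow> e j \<in> E"
    and R: "linear_op E R" and rep: "\<And>\<phi>. \<phi> \<in> E \<Longrightarrow> R \<phi> = (\<lambda>u. \<Sum>j\<in>J. cf j \<phi> * e j u)"
    and cf: "\<And>j \<phi>. j \<in> J \<Longrightarrow> \<phi> \<in> E \<Longrightarrow> Nm \<phi> \<le> 1 \<Longrightarrow> \<bar>cf j \<phi>\<bar> \<le> 1"
  shows "compact_op E Nm R"
proof -
  interpret M: Metric_space E "norm_dist E Nm" by (rule Metric_E)
  define comb where "comb c = (\<lambda>u. \<Sum>j\<in>J. c j * e j u)" for c :: "_ \<Rightarrow> real"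
  \<comment> \<open>The factor 2 arises because the supremum and the Hoelder constant of
    \<open>e j\<close> are each bounded by \<open>Nm (e j)\<close>.\<close>
  have comb: "comb c \<in> E \<and> Nm (comb c) \<le> (\<Sum>j\<in>J. \<bar>c j\<bar> * (2 * Nm (e j)))" for c
  proof -
    have "\<bar>comb c u\<bar> \<le> (\<Sum>j\<in>J. \<bar>c j\<bar> * Nm (e j))" for u
      unfolding comb_def using norm_ge(1)[OF e]
      by (intro order_trans[OF sum_abs] sum_mono) (simp add: abs_mult mult_left_mono)
    moreover have "holder (comb c) (\<Sum>j\<in>J. \<bar>c j\<bar> * Nm (e j))"
      unfolding holder_const_def
    proof (intro conjI allI)
      show "0 \<le> (\<Sum>j\<in>J. \<bar>c j\<bar> * Nm (e j))" using norm_nonneg[OF e] by (intro sum_nonneg) auto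
      fix u v
      have "\<bar>comb c u - comb c v\<bar> = \<bar>\<Sum>j\<in>J. c j * (e j u - e j v)\<bar>"
        by (simp add: comb_def sum_subtractf right_diff_distrib)
      also have "\<dots> \<le> (\<Sum>j\<in>J. \<bar>c j\<bar> * (Nm (e j) * prod_dist1 u v powr \<alpha>))"
        using holderD(1)[OF norm_ge(2)[OF e]]
        by (intro order_trans[OF sum_abs] sum_mono) (simp add: abs_mult mult_left_mono)
      finally show "\<bar>comb c u - comb c v\<bar> \<le> (\<Sum>j\<in>J. \<bar>c j\<bar> * Nm (e j)) * prod_dist1 u v powr \<alpha>"
        by (simp add: sum_distrib_right mult.assoc)
    qed
    ultimately have "comb c \<in> E" "Nm (comb c) \<le> (\<Sum>j\<in>J. \<bar>c j\<bar> * Nm (e j)) + (\<Sum>j\<in>J. \<bar>c j\<bar> * Nm (e j))"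
      by (rule norm_leI)+
    moreover have "(\<Sum>j\<in>J. \<bar>c j\<bar> * (2 * Nm (e j))) = 2 * (\<Sum>j\<in>J. \<bar>c j\<bar> * Nm (e j))"
      unfolding sum_distrib_left by (intro sum.cong) auto
    ultimately show ?thesis by simp
  qed
  define S where "S = comb ` {c. \<forall>j\<in>J. \<bar>c j\<bar> \<le> 1}"
  have "compactin M.mtopology S"
    unfolding M.compactin_sequentially
  proof (intro conjI allI impI)
    show "S \<subseteq> E" using comb by (auto simp: S_def)
    fix \<sigma> :: "nat \<Rightarrow> 't \<times> 'x \<Rightarrow> real" assume "range \<sigma> \<subseteq> S"
    then have "\<forall>n. \<exists>c. \<sigma> n = comb c \<and> (\<forall>j\<in>J. \<bar>c j\<bar> \<le> 1)" by (auto simp: S_def)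
    from choice[OF this] obtain c where "\<forall>n. \<sigma> n = comb (c n) \<and> (\<forall>j\<in>J. \<bar>c n j\<bar> \<le> 1)" by blast
    then have c: "\<And>n. \<sigma> n = comb (c n)" "\<And>n j. j \<in> J \<Longrightarrow> \<bar>c n j\<bar> \<le> 1" by auto
    obtain r :: "nat \<Rightarrow> nat" and l where r: "strict_mono r" "\<And>j. j \<in> J \<Longrightarrow> (\<lambda>n. c (r n) j) \<longlonglongrightarrow> l j" "\<And>j. j \<in> J \<Longrightarrow> \<bar>l j\<bar> \<le> 1"
      using finite_common_subsequence[of J c 1] J c(2) by blast
    have diff: "(\<lambda>u. comb a u - comb a' u) = comb (\<lambda>j. a j - a' j)" for a a'
      by (simp add: comb_def sum_subtractf left_diff_distrib)
    have "(\<lambda>n. \<Sum>j\<in>J. \<bar>c (r n) j - l j\<bar> * (2 * Nm (e j))) \<longlonglongrightarrow> (\<Sum>j\<in>J. \<bar>l j - l j\<bar> * (2 * Nm (e j)))"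
      by (intro tendsto_intros r(2))
    then have lim0: "(\<lambda>n. \<Sum>j\<in>J. \<bar>c (r n) j - l j\<bar> * (2 * Nm (e j))) \<longlonglongrightarrow> 0" by simp
    have "limitin M.mtopology (\<sigma> \<circ> r) (comb l) sequentially"
      unfolding M.limit_metric_sequentially
    proof (intro conjI allI impI)
      show "comb l \<in> E" using comb by blast
      fix \<epsilon> :: real assume "\<epsilon> > 0"
      then have "\<forall>\<^sub>F n in sequentially. (\<Sum>j\<in>J. \<bar>c (r n) j - l j\<bar> * (2 * Nm (e j))) < \<epsilon>"
        using lim0 by (intro order_tendstoD(2)) auto
      then obtain n0 where n0: "\<And>n. n \<ge> n0 \<Longrightarrow> (\<Sum>j\<in>J. \<bar>c (r n) j - l j\<bar> * (2 * Nm (e j))) < \<epsilon>"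
        unfolding eventually_sequentially by blast
      have "norm_dist E Nm ((\<sigma> \<circ> r) n) (comb l) < \<epsilon>" if "n \<ge> n0" for n
        using le_less_trans[OF conjunct2[OF comb] n0[OF that]] comb by (simp add: norm_dist_def c(1) diff)
      then show "\<exists>n0. \<forall>n\<ge>n0. (\<sigma> \<circ> r) n \<in> E \<and> norm_dist E Nm ((\<sigma> \<circ> r) n) (comb l) < \<epsilon>"
        using comb c(1) by (intro exI[of _ n0]) auto
    qed
    moreover have "comb l \<in> S" using r(3) by (auto simp: S_def)
    ultimately show "\<exists>l r. l \<in> S \<and> strict_mono r \<and> limitin M.mtopology (\<sigma> \<circ> r) l sequentially"
      using r(1) by blast
  qed
  moreover have "M.mtopology closure_of (R ` {\<phi> \<in> E. Nm \<phi> \<le> 1}) \<subseteq> S"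
  proof (rule closure_of_minimal)
    have "R \<phi> \<in> S" if "\<phi> \<in> E" "Nm \<phi> \<le> 1" for \<phi>
      unfolding rep[OF that(1)] S_def comb_def using cf[OF _ that] by (intro imageI) auto
    then show "R ` {\<phi> \<in> E. Nm \<phi> \<le> 1} \<subseteq> S" by auto
    show "closedin M.mtopology S"
      using calculation by (simp add: compactin_imp_closedin M.Hausdorff_space_mtopology)
  qed
  ultimately have "compactin M.mtopology (M.mtopology closure_of (R ` {\<phi> \<in> E. Nm \<phi> \<le> 1}))"
    by (rule closed_compactin) simp
  with R show ?thesis by (simp add: compact_op_def norm_topology_def)
qed

end

text \<open>The integral operator \<open>hat_op\<close> and the finite sum \<open>step_op\<close>
  are compared on Hoelder functions, whose measurability enters. As \<open>B\<close> maps
  \<open>E\<close> to itself, agreement on \<open>E\<close> propagates to all powers.\<close>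

lemma quasi_compact_cong:
  assumes eq: "\<And>\<phi>. \<phi> \<in> E \<Longrightarrow> A \<phi> = B \<phi>" and B: "quasi_compact E N B"
    and E: "\<And>\<phi> \<psi>. \<phi> \<in> E \<Longrightarrow> \<psi> \<in> E \<Longrightarrow> (\<lambda>u. \<phi> u + \<psi> u) \<in> E" "\<And>\<phi> c. \<phi> \<in> E \<Longrightarrow> (\<lambda>u. c * \<phi> u) \<in> E"
  shows "quasi_compact E N A"
proof -
  have lin: "linear_op E B" using B by (simp add: quasi_compact_def)
  then have BE: "\<phi> \<in> E \<Longrightarrow> B \<phi> \<in> E" for \<phi> by (auto simp: linear_op_def)
  have pow: "(A ^^ n) \<phi> = (B ^^ n) \<phi> \<and> (B ^^ n) \<phi> \<in> E" if "\<phi> \<in> E" for n \<phi>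
    using that by (induction n) (auto simp: eq BE)
  have "linear_op E A"
    using lin eq E BE unfolding linear_op_def by simp
  moreover have "op_norm E N A = op_norm E N B"
    unfolding op_norm_def by (intro SUP_cong) (auto simp: eq)
  moreover have "op_norm E N (\<lambda>\<phi> u. (A ^^ n) \<phi> u - R \<phi> u) = op_norm E N (\<lambda>\<phi> u. (B ^^ n) \<phi> u - R \<phi> u)" for n R
    unfolding op_norm_def by (intro SUP_cong) (auto simp: pow)
  ultimately show ?thesis
    using B unfolding quasi_compact_def by simp
qed

section \<open>Powers of the transition operator\<close>

fun step_op :: "('t::finite \<Rightarrow> 't \<Rightarrow> real) \<Rightarrow> ('t \<Rightarrow> 'x \<Rightarrow> 'x) \<Rightarrow> ('t \<times> 'x \<Rightarrow> real) \<Rightarrow> 't \<times> 'x \<Rightarrow> real" where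
  "step_op q f \<phi> (t, x) = (\<Sum>u\<in>UNIV. q t u * \<phi> (u, f u x))"

context stochastic
begin

lemma step_op_power_Suc:
  "(step_op q f ^^ Suc n) \<phi> (t, x) = (\<Sum>u\<in>UNIV. q t u * path_exp q n u (\<lambda>w v. \<phi> (v, f v (word_map f w x))))"
proof (induction n arbitrary: t x)
  case (Suc n)
  have "(step_op q f ^^ Suc (Suc n)) \<phi> (t, x) = (\<Sum>u\<in>UNIV. q t u * (step_op q f ^^ Suc n) \<phi> (u, f u x))"
    by simp
  then show ?case unfolding Suc.IH by simp
qed simp

lemma path_exp_Suc_last:
  "path_exp q (Suc n) t (\<lambda>w v. G w) = path_exp q n t (\<lambda>w u. G (w @ [u]))"
  using path_exp_chain[of n 1 t "\<lambda>w v. G w"] by (simp add: sum_distrib_right[symmetric] q_sum)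

text \<open>The starting symbol contributes no map, so the word begins with the first drawn symbol,
  and its last letter is the current symbol of the chain. This brings powers of
  \<open>step_op\<close> to the expectations that occur in \<open>contracts\<close>.\<close>

lemma step_op_power:
  assumes "n \<ge> 1"
  shows "(step_op q f ^^ n) \<phi> (t, x) = (\<Sum>u\<in>UNIV. q t u * path_exp q n u (\<lambda>w v. \<phi> (last w, word_map f w x)))"
proof -
  obtain k where n: "n = Suc k" using assms by (cases n) auto
  show ?thesis
    unfolding n step_op_power_Suc path_exp_Suc_last by (simp add: word_map_append)
qed

lemma step_op_power_bound:
  assumes "\<And>u. \<bar>\<phi> u\<bar> \<le> A"
  shows "\<bar>(step_op q f ^^ n) \<phi> u\<bar> \<le> A"
proof (induction n arbitrary: u)
  case (Suc n)
  obtain t x where u: "u = (t, x)" by (cases u)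
  have "\<bar>\<Sum>s\<in>UNIV. q t s * (step_op q f ^^ n) \<phi> (s, f s x)\<bar> \<le> (\<Sum>s\<in>UNIV. q t s * A)"
    using Suc.IH q_nonneg by (intro order_trans[OF sum_abs] sum_mono) (simp add: abs_mult mult_left_mono)
  then show ?case by (simp add: u sum_distrib_right[symmetric] q_sum)
qed (simp add: assms)

lemma step_op_power_linear:
  "(step_op q f ^^ n) (\<lambda>u. \<phi> u + \<psi> u) = (\<lambda>u. (step_op q f ^^ n) \<phi> u + (step_op q f ^^ n) \<psi> u)"
  "(step_op q f ^^ n) (\<lambda>u. c * \<phi> u) = (\<lambda>u. c * (step_op q f ^^ n) \<phi> u)"
  by (induction n) (auto simp: fun_eq_iff distrib_left sum.distrib sum_distrib_left mult.left_commute)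

lemma step_op_power_sum:
  "(step_op q f ^^ n) (\<lambda>u. \<Sum>j\<in>J. c j * e j u) = (\<lambda>u. \<Sum>j\<in>J. c j * (step_op q f ^^ n) (e j) u)"
proof (induction J rule: infinite_finite_induct)
  case (infinite J)
  then show ?case using step_op_power_linear(2)[of n f 0 "\<lambda>_. 0"] by simp
next
  case empty
  then show ?case using step_op_power_linear(2)[of n f 0 "\<lambda>_. 0"] by simp
next
  case (insert j J)
  then show ?case by (simp add: step_op_power_linear)
qed

end

context lipschitz_walk
begin

lemma local_holder_spread:
  assumes r: "0 < r" and A: "\<And>u. \<bar>\<phi> u\<bar> \<le> A" and H: "0 \<le> H" and \<alpha>: "0 < \<alpha>"
    and loc: "\<And>x y. dist x y < r \<Longrightarrow> \<bar>\<phi> x - \<phi> y\<bar> \<le> H * dist x y powr \<alpha>"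
  shows "\<bar>\<phi> x - \<phi> (y :: 'x)\<bar> \<le> (H + 2 * A / r powr \<alpha>) * dist x y powr \<alpha>"
proof (cases "dist x y < r")
  case True
  have "0 \<le> A" using A[of x] by simp
  then have "H * dist x y powr \<alpha> \<le> (H + 2 * A / r powr \<alpha>) * dist x y powr \<alpha>"
    by (intro mult_right_mono) auto
  then show ?thesis using loc[OF True] by simp
next
  case False
  have A0: "0 \<le> A" using A[of x] by simp
  have "r powr \<alpha> \<le> dist x y powr \<alpha>" using r \<alpha> False by (intro powr_mono2) auto
  then have "2 * A \<le> (2 * A / r powr \<alpha>) * dist x y powr \<alpha>"
    using A0 r by (simp add: field_simps mult_left_mono)
  also have "\<dots> \<le> (H + 2 * A / r powr \<alpha>) * dist x y powr \<alpha>"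
    using H by (intro mult_right_mono) auto
  finally show ?thesis using A[of x] A[of y] by linarith
qed

text \<open>A local Hoelder bound becomes global at the price of
  \<open>2 * A / r powr \<alpha>\<close> before the mean contraction is applied, since images of
  close points may separate. The symbol \<open>g w u\<close> at which \<open>\<phi>\<close> is read
  is \<open>last w\<close> for \<open>step_op\<close> and \<open>u\<close> for
  \<open>\<K>\<close>.\<close>

lemma contraction_step:
  assumes N: "contracts N \<alpha> \<theta> r" and r: "0 < r" and \<alpha>: "0 < \<alpha>" and H: "0 \<le> H"
    and A: "\<And>u y. \<bar>\<phi> u y\<bar> \<le> A"
    and loc: "\<And>u x y. dist x y < r \<Longrightarrow> \<bar>\<phi> u x - \<phi> u y\<bar> \<le> H * dist x y powr \<alpha>"
    and d: "dist x y < r"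
  shows "\<bar>path_exp q N t (\<lambda>w u. \<phi> (g w u) (word_map f w x)) - path_exp q N t (\<lambda>w u. \<phi> (g w u) (word_map f w y))\<bar>
    \<le> \<theta> * (H + 2 * A / r powr \<alpha>) * dist x y powr \<alpha>"
proof -
  let ?B = "H + 2 * A / r powr \<alpha>"
  have "0 \<le> A" using A[of undefined undefined] by linarith
  then have B: "0 \<le> ?B" using H by simp
  have "\<bar>path_exp q N t (\<lambda>w u. \<phi> (g w u) (word_map f w x)) - path_exp q N t (\<lambda>w u. \<phi> (g w u) (word_map f w y))\<bar>
      \<le> path_exp q N t (\<lambda>w u. ?B * dist (word_map f w x) (word_map f w y) powr \<alpha>)"
    by (intro path_exp_abs_diff_le local_holder_spread[OF r A H \<alpha> loc])
  also have "\<dots> = ?B * path_exp q N t (\<lambda>w u. dist (word_map f w x) (word_map f w y) powr \<alpha>)"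
    by (rule path_exp_cmult)
  also have "\<dots> \<le> ?B * (\<theta> * dist x y powr \<alpha>)"
    using N d B unfolding contracts_def by (intro mult_left_mono) auto
  finally show ?thesis by (simp add: algebra_simps)
qed

lemma step_op_contraction:
  assumes N: "contracts N \<alpha> \<theta> r" "N \<ge> 1" and r: "0 < r" and \<alpha>: "0 < \<alpha>" and H: "0 \<le> H"
    and A: "\<And>u. \<bar>\<phi> u\<bar> \<le> A"
    and loc: "\<And>t x y. dist x y < r \<Longrightarrow> \<bar>\<phi> (t, x) - \<phi> (t, y)\<bar> \<le> H * dist x y powr \<alpha>"
    and d: "dist x y < r"
  shows "\<bar>(step_op q f ^^ N) \<phi> (t, x) - (step_op q f ^^ N) \<phi> (t, y)\<bar> \<le> \<theta> * (H + 2 * A / r powr \<alpha>) * dist x y powr \<alpha>"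
proof -
  let ?F = "\<lambda>u x. path_exp q N u (\<lambda>w v. \<phi> (last w, word_map f w x))"
  let ?C = "\<theta> * (H + 2 * A / r powr \<alpha>) * dist x y powr \<alpha>"
  have "\<bar>?F u x - ?F u y\<bar> \<le> ?C" for u
    using contraction_step[OF N(1) r \<alpha> H, of "\<lambda>u y. \<phi> (u, y)" A x y u "\<lambda>w v. last w"] A loc d by simp
  then have "\<bar>\<Sum>u\<in>UNIV. q t u * (?F u x - ?F u y)\<bar> \<le> (\<Sum>u\<in>UNIV. q t u * ?C)"
    using q_nonneg by (intro order_trans[OF sum_abs] sum_mono) (simp add: abs_mult mult_left_mono)
  then show ?thesis
    unfolding step_op_power[OF N(2)]
    by (simp only: sum_distrib_right[symmetric] q_sum sum_subtractf right_diff_distrib mult_1)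
qed

text \<open>The Doeblin-Fortet inequality. The coefficient of the sup bound sums a geometric series:
  \<open>\<theta> / (1 - \<theta>)\<close> is the fixed point of
  \<open>x \<mapsto> \<theta> * (x + 1)\<close>.\<close>

lemma step_op_iterate:
  assumes N: "contracts N \<alpha> \<theta> r" "N \<ge> 1" and \<theta>: "0 < \<theta>" "\<theta> < 1" and r: "0 < r" and \<alpha>: "0 < \<alpha>" and H: "0 \<le> H"
    and A: "\<And>u. \<bar>\<phi> u\<bar> \<le> A"
    and loc: "\<And>t x y. dist x y < r \<Longrightarrow> \<bar>\<phi> (t, x) - \<phi> (t, y)\<bar> \<le> H * dist x y powr \<alpha>"
    and d: "dist x y < r"
  shows "\<bar>(step_op q f ^^ (k * N)) \<phi> (t, x) - (step_op q f ^^ (k * N)) \<phi> (t, y)\<bar>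
    \<le> (\<theta> ^ k * H + \<theta> / (1 - \<theta>) * (2 * A / r powr \<alpha>)) * dist x y powr \<alpha>"
  using d
proof (induction k arbitrary: t x y)
  case 0
  have "0 \<le> A" using A[of undefined] by linarith
  then have "H \<le> H + \<theta> / (1 - \<theta>) * (2 * A / r powr \<alpha>)" using \<theta> by simp
  then have "H * dist x y powr \<alpha> \<le> (H + \<theta> / (1 - \<theta>) * (2 * A / r powr \<alpha>)) * dist x y powr \<alpha>"
    by (intro mult_right_mono) auto
  then show ?case using loc[OF 0, of t] by simp
next
  case (Suc k)
  let ?\<psi> = "(step_op q f ^^ (k * N)) \<phi>" and ?B = "2 * A / r powr \<alpha>"
  let ?H = "\<theta> ^ k * H + \<theta> / (1 - \<theta>) * ?B"
  have A0: "0 \<le> A" using A[of undefined] by linarith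
  then have H0: "0 \<le> ?H" using \<theta> H by simp
  have "(step_op q f ^^ (Suc k * N)) \<phi> = (step_op q f ^^ N) ?\<psi>" by (simp add: funpow_add)
  then have "\<bar>(step_op q f ^^ (Suc k * N)) \<phi> (t, x) - (step_op q f ^^ (Suc k * N)) \<phi> (t, y)\<bar>
      \<le> \<theta> * (?H + ?B) * dist x y powr \<alpha>"
    using step_op_contraction[OF N r \<alpha> H0 step_op_power_bound[OF A] Suc.IH Suc.prems] by simp
  also have "\<theta> * (?H + ?B) = \<theta> ^ Suc k * H + \<theta> / (1 - \<theta>) * ?B"
  proof -
    have "\<theta> * (\<theta> / (1 - \<theta>) * B + B) = \<theta> / (1 - \<theta>) * B" for B
      using \<theta> by (simp add: field_simps)
    from this[of ?B] show ?thesis by (simp only: distrib_left power_Suc mult.assoc add.assoc)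
  qed
  finally show ?case .
qed

lemma contracts_antimono: "contracts N \<alpha> \<theta> r \<Longrightarrow> r' \<le> r \<Longrightarrow> contracts N \<alpha> \<theta> r'"
  unfolding contracts_def by (meson less_le_trans)

lemma step_op_quasi_compact:
  assumes N: "contracts N \<alpha> \<theta> r0" "N \<ge> 1" and \<theta>: "0 < \<theta>" "\<theta> < 1" and r0: "0 < r0" and \<alpha>: "0 < \<alpha>" "\<alpha> \<le> 1"
  shows "quasi_compact (holder_space prod_dist1 \<alpha>) (holder_norm prod_dist1 \<alpha>) (step_op q f)"
proof -
  obtain b where b: "\<And>x y :: 'x. dist x y \<le> b"
    using compact_imp_bounded[OF K] unfolding bounded_two_points by auto
  interpret holder_setting b \<alpha> "undefined :: 't \<times> 'x" by unfold_locales (use b \<alpha> in auto)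
  \<comment> \<open>At scales below 1 one has \<open>dist x y \<le> dist x y powr \<alpha>\<close>,
    and points with different symbols count as far apart.\<close>
  define r where "r = min r0 1"
  have r: "0 < r" "r \<le> 1" using r0 by (auto simp: r_def)
  have Nr: "contracts N \<alpha> \<theta> r" using contracts_antimono[OF N(1)] by (simp add: r_def)
  let ?P = "step_op q f"
  have PE: "?P \<phi> \<in> E \<and> Nm (?P \<phi>) \<le> Nm \<phi> + (Nm \<phi> * L powr \<alpha> + 2 * Nm \<phi>)" if \<phi>: "\<phi> \<in> E" for \<phi>
  proof -
    have A: "\<bar>?P \<phi> u\<bar> \<le> Nm \<phi>" for u
      using step_op_power_bound[of \<phi> "Nm \<phi>" 1 f u] norm_ge(1)[OF \<phi>] by simp
    have "\<bar>?P \<phi> (t, x) - ?P \<phi> (t, y)\<bar> \<le> Nm \<phi> * L powr \<alpha> * dist x y powr \<alpha>" for t x y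
    proof -
      have "\<bar>\<phi> (u, f u x) - \<phi> (u, f u y)\<bar> \<le> Nm \<phi> * L powr \<alpha> * dist x y powr \<alpha>" for u
      proof -
        have "\<bar>\<phi> (u, f u x) - \<phi> (u, f u y)\<bar> \<le> Nm \<phi> * dist (f u x) (f u y) powr \<alpha>"
          by (rule holder_same[OF norm_ge(2)[OF \<phi>]])
        also have "\<dots> \<le> Nm \<phi> * (L * dist x y) powr \<alpha>"
          using lipschitz_onD[OF f_lip] \<alpha> norm_nonneg[OF \<phi>] by (intro mult_left_mono powr_mono2) auto
        finally show ?thesis using L by (simp add: powr_mult)
      qed
      then have "\<bar>\<Sum>u\<in>UNIV. q t u * (\<phi> (u, f u x) - \<phi> (u, f u y))\<bar> \<le> (\<Sum>u\<in>UNIV. q t u * (Nm \<phi> * L powr \<alpha> * dist x y powr \<alpha>))"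
        using q_nonneg by (intro order_trans[OF sum_abs] sum_mono) (simp add: abs_mult mult_left_mono)
      then show ?thesis
        by (simp add: sum_distrib_right[symmetric] q_sum sum_subtractf right_diff_distrib)
    qed
    then have "holder (?P \<phi>) (Nm \<phi> * L powr \<alpha> + 2 * Nm \<phi> / 1 powr \<alpha>)"
      using norm_nonneg[OF \<phi>] A by (intro holder_localI) auto
    from norm_leI[of "?P \<phi>", OF A this] show ?thesis by simp
  qed
  have powE: "(?P ^^ n) \<phi> \<in> E" if "\<phi> \<in> E" for n \<phi>
    using that PE by (induction n) auto
  have lin: "linear_op E (?P ^^ n)" for n
    unfolding linear_op_def using powE by (auto simp: step_op_power_linear)
  \<comment> \<open>The total coefficient of the sup bound \<open>A\<close> in the final norm
    estimate: once for the supremum, once from \<open>step_op_iterate\<close>, once from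
    \<open>holder_localI\<close>. The choice of \<open>\<epsilon>\<close> makes \<open>A * c\<close>
    equal to \<open>1 / 4\<close>.\<close>
  define c where "c = 1 + \<theta> / (1 - \<theta>) * (2 / r powr \<alpha>) + 2 / r powr \<alpha>"
  have c: "c \<ge> 1" using \<theta> r by (simp add: c_def)
  define \<epsilon> where "\<epsilon> = (1 / (4 * c)) powr (1 / \<alpha>)"
  have \<epsilon>: "\<epsilon> > 0" "\<epsilon> powr \<alpha> = 1 / (4 * c)"
    using c \<alpha> by (simp_all add: \<epsilon>_def powr_powr)
  have "\<exists>(I :: 'x set) \<xi>. finite I \<and> (\<forall>a\<in>I. \<exists>L. L-lipschitz_on UNIV (\<xi> a)) \<and> (\<forall>a\<in>I. \<forall>x. 0 \<le> \<xi> a x) \<and>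
      (\<forall>x. (\<Sum>a\<in>I. \<xi> a x) = (1 :: real)) \<and> (\<forall>a x. \<xi> a x \<noteq> 0 \<longrightarrow> dist x a < \<epsilon>)"
    by (rule lipschitz_partition_of_unity[OF K \<epsilon>(1)]) blast
  then obtain I :: "'x set" and \<xi> :: "'x \<Rightarrow> 'x \<Rightarrow> real" where I: "finite I" and \<xi>_lip: "\<forall>a\<in>I. \<exists>L. L-lipschitz_on UNIV (\<xi> a)"
    and \<xi>_nonneg: "\<And>a x. a \<in> I \<Longrightarrow> 0 \<le> \<xi> a x" and \<xi>_sum: "\<And>x. (\<Sum>a\<in>I. \<xi> a x) = 1"
    and \<xi>_near: "\<And>a x. \<xi> a x \<noteq> 0 \<Longrightarrow> dist x a < \<epsilon>"
    by auto
  from bchoice[OF \<xi>_lip] obtain l where l: "\<And>a. a \<in> I \<Longrightarrow> (l a)-lipschitz_on UNIV (\<xi> a)" by blast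
  define \<Lambda> where "\<Lambda> = (\<Sum>a\<in>I. l a)"
  have l0: "0 \<le> l a" if "a \<in> I" for a using l[OF that] by (rule lipschitz_on_nonneg)
  then have \<Lambda>0: "0 \<le> \<Lambda>" by (simp add: \<Lambda>_def sum_nonneg)
  define J where "J = (UNIV :: 't set) \<times> I"
  define \<zeta> where "\<zeta> j u = of_bool (fst u = fst j) * \<xi> (snd j) (snd u)" for j and u :: "'t \<times> 'x"
  \<comment> \<open>Interpolation of \<open>\<phi>\<close> from its values at the finitely many
    points of \<open>J\<close>. For \<open>\<phi>\<close> in the unit ball it is within
    \<open>\<epsilon> powr \<alpha>\<close> of \<open>\<phi>\<close>, but its Hoelder constant may
    be large.\<close>
  define W where "W \<phi> = (\<lambda>u. \<Sum>j\<in>J. \<phi> j * \<zeta> j u)" for \<phi> :: "'t \<times> 'x \<Rightarrow> real"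
  have W: "W \<phi> (t, x) = (\<Sum>a\<in>I. \<phi> (t, a) * \<xi> a x)" for \<phi> t x
  proof -
    have "W \<phi> (t, x) = (\<Sum>s\<in>UNIV. \<Sum>a\<in>I. \<phi> (s, a) * \<zeta> (s, a) (t, x))"
      unfolding W_def J_def by (simp add: sum.cartesian_product)
    also have "\<dots> = (\<Sum>s\<in>UNIV. if s = t then \<Sum>a\<in>I. \<phi> (t, a) * \<xi> a x else 0)"
      by (intro sum.cong) (auto simp: \<zeta>_def)
    finally show ?thesis by simp
  qed
  have \<xi>_loc: "\<bar>\<xi> a x - \<xi> a y\<bar> \<le> l a * dist x y powr \<alpha>" if "a \<in> I" "dist x y < r" for a x y
  proof -
    have "\<bar>\<xi> a x - \<xi> a y\<bar> \<le> l a * dist x y"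
      using lipschitz_onD[OF l[OF that(1)], of x y] by (simp add: dist_real_def)
    also have "dist x y \<le> dist x y powr \<alpha>"
      using powr_mono'[of \<alpha> 1 "dist x y"] \<alpha> that(2) r by (cases "x = y") auto
    finally show ?thesis using l0[OF that(1)] by (simp add: mult_left_mono)
  qed
  have \<xi>_le: "\<bar>\<xi> a x\<bar> \<le> 1" if "a \<in> I" for a x
    using member_le_sum[of a I "\<lambda>a. \<xi> a x"] that I \<xi>_nonneg \<xi>_sum[of x] by simp
  have \<zeta>E: "\<zeta> j \<in> E" if "j \<in> J" for j
  proof (rule norm_leI(1))
    have a: "snd j \<in> I" using that by (auto simp: J_def)
    show A: "\<bar>\<zeta> j u\<bar> \<le> 1" for u using \<xi>_le[OF a] by (simp add: \<zeta>_def)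
    show "holder (\<zeta> j) (l (snd j) + 2 * 1 / r powr \<alpha>)"
      using \<xi>_loc[OF a] l0[OF a] by (intro holder_localI r A) (auto simp: \<zeta>_def)
  qed
  \<comment> \<open>Chosen after the partition of unity: enough iterations to absorb its Lipschitz
    constant \<open>\<Lambda>\<close>, whatever its size.\<close>
  obtain k where k: "k \<ge> 1" "\<theta> ^ k * (1 + \<Lambda>) \<le> 1 / 4"
    using power_less_eventually[OF \<theta>, of "1/4" "1 + \<Lambda>"] by auto
  define R where "R \<phi> = (?P ^^ (k * N)) (W \<phi>)" for \<phi>
  have R_rep: "R \<phi> = (\<lambda>u. \<Sum>j\<in>J. \<phi> j * (?P ^^ (k * N)) (\<zeta> j) u)" for \<phi>
    unfolding R_def W_def by (rule step_op_power_sum)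
  have J: "finite J" using I by (simp add: J_def)
  have WE: "W \<phi> \<in> E" if "\<phi> \<in> E" for \<phi>
  proof -
    have "\<bar>W \<phi> u\<bar> \<le> (\<Sum>j\<in>J. \<bar>\<phi> j\<bar> * Nm (\<zeta> j))" for u
      unfolding W_def using norm_ge(1)[OF \<zeta>E]
      by (intro order_trans[OF sum_abs] sum_mono) (simp add: abs_mult mult_left_mono)
    moreover have "holder (W \<phi>) (\<Sum>j\<in>J. \<bar>\<phi> j\<bar> * Nm (\<zeta> j))"
      unfolding holder_const_def
    proof (intro conjI allI)
      show "0 \<le> (\<Sum>j\<in>J. \<bar>\<phi> j\<bar> * Nm (\<zeta> j))" using norm_nonneg[OF \<zeta>E] by (intro sum_nonneg) auto
      fix u v
      have "\<bar>W \<phi> u - W \<phi> v\<bar> = \<bar>\<Sum>j\<in>J. \<phi> j * (\<zeta> j u - \<zeta> j v)\<bar>"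
        by (simp add: W_def sum_subtractf right_diff_distrib)
      also have "\<dots> \<le> (\<Sum>j\<in>J. \<bar>\<phi> j\<bar> * (Nm (\<zeta> j) * prod_dist1 u v powr \<alpha>))"
        using holderD(1)[OF norm_ge(2)[OF \<zeta>E]]
        by (intro order_trans[OF sum_abs] sum_mono) (simp add: abs_mult mult_left_mono)
      finally show "\<bar>W \<phi> u - W \<phi> v\<bar> \<le> (\<Sum>j\<in>J. \<bar>\<phi> j\<bar> * Nm (\<zeta> j)) * prod_dist1 u v powr \<alpha>"
        by (simp add: sum_distrib_right mult.assoc)
    qed
    ultimately show ?thesis by (rule norm_leI(1))
  qed
  have linR: "linear_op E R"
    unfolding linear_op_def
  proof (intro conjI ballI allI funcsetI)
    show "R \<phi> \<in> E" if "\<phi> \<in> E" for \<phi> unfolding R_def by (intro powE WE that)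
    show "R (\<lambda>u. \<phi> u + \<psi> u) = (\<lambda>u. R \<phi> u + R \<psi> u)" for \<phi> \<psi>
      unfolding R_rep by (simp add: distrib_right sum.distrib)
    show "R (\<lambda>u. a * \<phi> u) = (\<lambda>u. a * R \<phi> u)" for \<phi> a
      unfolding R_rep by (simp add: sum_distrib_left mult.assoc)
  qed
  have "compact_op E Nm R"
  proof (rule finite_rank_compact[OF J _ linR R_rep])
    show "(?P ^^ (k * N)) (\<zeta> j) \<in> E" if "j \<in> J" for j using powE[OF \<zeta>E[OF that]] .
    show "\<bar>\<phi> j\<bar> \<le> 1" if "\<phi> \<in> E" "Nm \<phi> \<le> 1" for \<phi> j using norm_ge(1)[OF that(1), of j] that(2) by simp
  qed
  moreover have "op_norm E Nm (\<lambda>\<phi> u. (?P ^^ (k * N)) \<phi> u - R \<phi> u) \<le> ereal (1 / 2)"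
    unfolding op_norm_def
  proof (rule SUP_least)
    fix \<phi> assume "\<phi> \<in> {\<phi> \<in> E. Nm \<phi> \<le> 1}"
    then have \<phi>: "\<phi> \<in> E" "Nm \<phi> \<le> 1" by auto
    have sup: "\<bar>\<phi> u\<bar> \<le> 1" for u using norm_ge(1)[OF \<phi>(1), of u] \<phi>(2) by simp
    have hol: "\<bar>\<phi> (t, x) - \<phi> (t, y)\<bar> \<le> dist x y powr \<alpha>" for t x y
    proof -
      have "\<bar>\<phi> (t, x) - \<phi> (t, y)\<bar> \<le> Nm \<phi> * dist x y powr \<alpha>" by (rule holder_same[OF norm_ge(2)[OF \<phi>(1)]])
      also have "\<dots> \<le> 1 * dist x y powr \<alpha>" using \<phi>(2) by (intro mult_right_mono) auto
      finally show ?thesis by simp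
    qed
    define \<psi> where "\<psi> u = \<phi> u - W \<phi> u" for u
    define A where "A = \<epsilon> powr \<alpha>"
    have \<psi>_sup: "\<bar>\<psi> u\<bar> \<le> A" for u
    proof -
      obtain t x where u: "u = (t, x)" by (cases u)
      have "\<psi> u = (\<Sum>a\<in>I. (\<phi> (t, x) - \<phi> (t, a)) * \<xi> a x)"
        by (simp add: \<psi>_def u W left_diff_distrib sum_subtractf sum_distrib_left[symmetric] \<xi>_sum)
      also have "\<bar>\<dots>\<bar> \<le> (\<Sum>a\<in>I. A * \<xi> a x)"
      proof (intro order_trans[OF sum_abs] sum_mono)
        fix a assume a: "a \<in> I"
        have "\<bar>\<phi> (t, x) - \<phi> (t, a)\<bar> \<le> A" if "\<xi> a x \<noteq> 0"
        proof -
          have "dist x a powr \<alpha> \<le> \<epsilon> powr \<alpha>" using \<xi>_near[OF that] \<alpha> by (intro powr_mono2) auto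
          then show ?thesis using hol[of t x a] by (simp add: A_def)
        qed
        then show "\<bar>(\<phi> (t, x) - \<phi> (t, a)) * \<xi> a x\<bar> \<le> A * \<xi> a x"
          using \<xi>_nonneg[OF a, of x] by (cases "\<xi> a x = 0") (auto simp: abs_mult mult_right_mono)
      qed
      also have "\<dots> = A" by (simp add: sum_distrib_left[symmetric] \<xi>_sum)
      finally show ?thesis .
    qed
    have \<psi>_loc: "\<bar>\<psi> (t, x) - \<psi> (t, y)\<bar> \<le> (1 + \<Lambda>) * dist x y powr \<alpha>" if "dist x y < r" for t x y
    proof -
      have "W \<phi> (t, x) - W \<phi> (t, y) = (\<Sum>a\<in>I. \<phi> (t, a) * (\<xi> a x - \<xi> a y))"
        by (simp add: W right_diff_distrib sum_subtractf)
      also have "\<bar>\<dots>\<bar> \<le> (\<Sum>a\<in>I. 1 * (l a * dist x y powr \<alpha>))"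
      proof (intro order_trans[OF sum_abs] sum_mono)
        fix a assume "a \<in> I"
        then show "\<bar>\<phi> (t, a) * (\<xi> a x - \<xi> a y)\<bar> \<le> 1 * (l a * dist x y powr \<alpha>)"
          unfolding abs_mult using sup[of "(t, a)"] \<xi>_loc[OF _ that] by (intro mult_mono) auto
      qed
      also have "\<dots> = \<Lambda> * dist x y powr \<alpha>" by (simp add: \<Lambda>_def sum_distrib_right)
      finally show ?thesis using hol[of t x y] by (simp add: \<psi>_def distrib_right)
    qed
    define H where "H = \<theta> ^ k * (1 + \<Lambda>) + \<theta> / (1 - \<theta>) * (2 * A / r powr \<alpha>)"
    have eq: "(\<lambda>u. (?P ^^ (k * N)) \<phi> u - R \<phi> u) = (?P ^^ (k * N)) \<psi>"
    proof -
      have "(?P ^^ (k * N)) (\<lambda>u. \<psi> u + W \<phi> u) = (\<lambda>u. (?P ^^ (k * N)) \<psi> u + R \<phi> u)"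
        unfolding R_def by (rule step_op_power_linear)
      moreover have "(\<lambda>u. \<psi> u + W \<phi> u) = \<phi>" by (auto simp: \<psi>_def)
      ultimately show ?thesis by simp
    qed
    have A0: "0 \<le> A" by (simp add: A_def)
    then have H0: "0 \<le> H" using \<theta> \<Lambda>0 by (simp add: H_def)
    have sup': "\<bar>(?P ^^ (k * N)) \<psi> u\<bar> \<le> A" for u by (rule step_op_power_bound[OF \<psi>_sup])
    have "holder ((?P ^^ (k * N)) \<psi>) (H + 2 * A / r powr \<alpha>)"
      using step_op_iterate[OF Nr N(2) \<theta> r(1) \<alpha>(1) _ \<psi>_sup \<psi>_loc] \<Lambda>0 H0
      by (intro holder_localI r sup') (auto simp: H_def)
    then have "Nm ((?P ^^ (k * N)) \<psi>) \<le> A + (H + 2 * A / r powr \<alpha>)" by (rule norm_leI(2)[OF sup'])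
    also have "\<dots> = \<theta> ^ k * (1 + \<Lambda>) + A * c" by (simp add: H_def c_def algebra_simps)
    also have "A * c = 1 / 4" using c by (simp add: A_def \<epsilon>)
    finally have "Nm ((?P ^^ (k * N)) \<psi>) \<le> 1 / 2" using k(2) by simp
    then show "ereal (Nm (\<lambda>u. (?P ^^ (k * N)) \<phi> u - R \<phi> u)) \<le> ereal (1 / 2)" by (simp add: eq)
  qed
  then have "op_norm E Nm (\<lambda>\<phi> u. (?P ^^ (k * N)) \<phi> u - R \<phi> u) < 1"
    by (rule le_less_trans) simp
  moreover have "op_norm E Nm ?P < \<infinity>"
  proof -
    have "op_norm E Nm ?P \<le> ereal (1 + (L powr \<alpha> + 2))"
      unfolding op_norm_def
    proof (rule SUP_least)
      fix \<phi> assume "\<phi> \<in> {\<phi> \<in> E. Nm \<phi> \<le> 1}"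
      then have \<phi>: "\<phi> \<in> E" "Nm \<phi> \<le> 1" by auto
      have "Nm (?P \<phi>) \<le> Nm \<phi> * (1 + (L powr \<alpha> + 2))"
        using PE[OF \<phi>(1)] by (simp add: algebra_simps)
      also have "\<dots> \<le> 1 * (1 + (L powr \<alpha> + 2))" using \<phi>(2) by (intro mult_right_mono) auto
      finally show "ereal (Nm (?P \<phi>)) \<le> ereal (1 + (L powr \<alpha> + 2))" by simp
    qed
    then show ?thesis by (rule le_less_trans) simp
  qed
  moreover have "k * N \<ge> 1" using k(1) N(2) by simp
  moreover have "linear_op E ?P" using lin[of 1] by simp
  ultimately show ?thesis unfolding quasi_compact_def by blast
qed

end

section \<open>The Markov measure on the path space\<close>

definition cylinder :: "'t set list \<Rightarrow> (nat \<Rightarrow> 't) set" where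
  "cylinder As = {\<omega>. \<forall>i<length As. \<omega> i \<in> As ! i}"

lemma space_path_algebra: "space path_algebra = UNIV"
  by (simp add: path_algebra_def space_PiM)

lemma component_measurable: "(\<lambda>\<omega>. \<omega> i) \<in> measurable path_algebra (count_space UNIV)"
  unfolding path_algebra_def by (rule measurable_component_singleton) simp

lemma shift_measurable: "shift \<in> measurable path_algebra path_algebra"
proof -
  have "(\<lambda>\<omega>. \<lambda>n\<in>UNIV. \<omega> (Suc n)) \<in> measurable path_algebra (\<Pi>\<^sub>M n\<in>UNIV. count_space UNIV)"
    using component_measurable by (intro measurable_restrict)
  then show ?thesis unfolding path_algebra_def shift_def[abs_def] restrict_UNIV .
qed

lemma shift_power_measurable: "(shift ^^ n) \<in> measurable path_algebra path_algebra"
proof (induction n)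
  case (Suc n)
  then show ?case unfolding funpow.simps comp_def by (rule measurable_compose[OF _ shift_measurable])
qed (simp add: id_def)

lemma shift_power_apply: "(shift ^^ n) \<omega> i = \<omega> (n + i)"
  by (induction n arbitrary: \<omega> i) (simp_all add: shift_def)

lemma cylinder_sets: "cylinder As \<in> sets path_algebra"
proof -
  have "cylinder As = (\<Inter>i\<in>{..<length As}. (\<lambda>\<omega>. \<omega> i) -` (As ! i) \<inter> space path_algebra) \<inter> space path_algebra"
    by (auto simp: cylinder_def space_path_algebra)
  also have "\<dots> \<in> sets path_algebra"
  proof (cases "As = []")
    case False
    then show ?thesis
      by (intro sets.Int sets.finite_INT sets.top measurable_sets[OF component_measurable]) auto
  qed simp
  finally show ?thesis .
qed

lemma sets_path_algebra: "sets path_algebra = sigma_sets UNIV (range cylinder)"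
proof
  have cyl: "{f. f i \<in> A} \<in> range cylinder" for i and A :: "'a set"
  proof
    show "{f. f i \<in> A} = cylinder (replicate i UNIV @ [A])"
      by (simp add: cylinder_def All_less_Suc nth_append)
  qed simp
  have "sets (path_algebra :: (nat \<Rightarrow> 'a) measure) = sigma_sets UNIV {{f. f i \<in> A} |i A. True}"
    unfolding path_algebra_def sets_PiM_single by (simp add: PiE_UNIV_domain)
  also have "\<dots> \<subseteq> sigma_sets UNIV (range cylinder)"
    using cyl by (intro sigma_sets_mono) auto
  finally show "sets (path_algebra :: (nat \<Rightarrow> 'a) measure) \<subseteq> sigma_sets UNIV (range cylinder)" .
  show "sigma_sets UNIV (range cylinder) \<subseteq> sets (path_algebra :: (nat \<Rightarrow> 'a) measure)"
    using cylinder_sets by (intro sets.sigma_sets_subset[of _ path_algebra, unfolded space_path_algebra]) auto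
qed

lemma Int_stable_cylinder: "Int_stable (range cylinder)"
proof (rule Int_stableI, safe)
  fix As Bs :: "'a set list"
  define n where "n = max (length As) (length Bs)"
  \<comment> \<open>Pads a list with \<open>UNIV\<close>, so that both cylinders prescribe the same
    number of coordinates.\<close>
  define ext where "ext Cs i = (if i < length Cs then Cs ! i else UNIV)" for Cs :: "'a set list" and i
  have "cylinder As \<inter> cylinder Bs = cylinder (map (\<lambda>i. ext As i \<inter> ext Bs i) [0..<n])"
  proof -
    have "cylinder Cs = {\<omega>. \<forall>i<n. \<omega> i \<in> ext Cs i}" if "length Cs \<le> n" for Cs
      using that unfolding cylinder_def ext_def by (auto dest: less_le_trans)
    from this[of As] this[of Bs] show ?thesis by (auto simp: n_def cylinder_def)
  qed
  then show "cylinder As \<inter> cylinder Bs \<in> range cylinder" by simp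
qed

lemma cylinder_Cons: "cylinder (A # As) = {\<omega>. \<omega> 0 \<in> A} \<inter> shift -` cylinder As"
  by (auto simp: cylinder_def shift_def All_less_Suc2)

lemma prefix_measurable: "(\<lambda>\<omega>. map \<omega> [0..<n]) \<in> measurable path_algebra (count_space (UNIV :: 't::finite list set))"
proof (subst measurable_count_space_eq2_countable, intro conjI ballI)
  fix w :: "'t list"
  have "(\<lambda>\<omega>. map \<omega> [0..<n]) -` {w} = (if length w = n then cylinder (map (\<lambda>a. {a}) w) else {})"
  proof -
    have "map \<omega> [0..<n] = w \<longleftrightarrow> length w = n \<and> (\<forall>i<n. \<omega> i = w ! i)" for \<omega>
      by (subst list_eq_iff_nth_eq) auto
    then show ?thesis by (auto simp: cylinder_def vimage_def)
  qed
  then show "(\<lambda>\<omega>. map \<omega> [0..<n]) -` {w} \<inter> space path_algebra \<in> sets path_algebra"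
    by (simp add: space_path_algebra cylinder_sets)
qed auto

lemma nn_integral_finite_type:
  fixes g :: "'t::finite \<Rightarrow> ennreal"
  assumes "sets \<mu> = UNIV"
  shows "(\<integral>\<^sup>+t. g t \<partial>\<mu>) = (\<Sum>t\<in>UNIV. g t * emeasure \<mu> {t})"
proof -
  have "(\<integral>\<^sup>+t. g t \<partial>\<mu>) = (\<integral>\<^sup>+t. (\<Sum>u\<in>UNIV. g u * indicator {u} t) \<partial>\<mu>)"
    by (intro nn_integral_cong) (simp add: indicator_def if_distrib cong: if_cong)
  also have "\<dots> = (\<Sum>u\<in>UNIV. \<integral>\<^sup>+t. g u * indicator {u} t \<partial>\<mu>)"
    by (intro nn_integral_sum) (simp add: measurable_def assms)
  also have "\<dots> = (\<Sum>t\<in>UNIV. g t * emeasure \<mu> {t})"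
    using assms by (intro sum.cong refl nn_integral_cmult_indicator) simp
  finally show ?thesis .
qed

section \<open>Conditional path laws and the Markov property\<close>

locale markov_path =
  fixes Q :: "'t::finite \<Rightarrow> 't measure" and p :: "'t measure" and P :: "(nat \<Rightarrow> 't) measure"
  assumes Q: "transition_prob Q" and p: "stationary_prob Q p" and P: "markov_measure Q p P"
begin

definition "q t u = measure (Q t) {u}"
definition "pp t = measure p {t}"

lemma Q_prob: "prob_space (Q t)" and Q_sets: "sets (Q t) = UNIV"
  using measurable_space[OF Q[unfolded transition_prob_def], of t] by (auto simp: space_prob_algebra)

lemma p_prob: "prob_space p" and p_sets: "sets p = UNIV"
  using p by (auto simp: stationary_prob_def space_prob_algebra)

lemma P_prob: "prob_space P" and P_sets: "sets P = sets path_algebra"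
  using P by (auto simp: markov_measure_def invariant_prob_def space_prob_algebra)

lemma P_space: "space P = UNIV"
  using sets_eq_imp_space_eq[OF P_sets] by (simp add: space_path_algebra)

lemma P_cylinder: "emeasure P (cylinder As) = cylinder_mass Q p As"
  using P by (simp add: markov_measure_def cylinder_def)

lemma emeasure_Q: "emeasure (Q t) {u} = ennreal (q t u)"
proof -
  interpret prob_space "Q t" by (rule Q_prob)
  show ?thesis by (simp add: q_def emeasure_eq_measure)
qed

lemma emeasure_p: "emeasure p {t} = ennreal (pp t)"
proof -
  interpret prob_space p by (rule p_prob)
  show ?thesis by (simp add: pp_def emeasure_eq_measure)
qed

lemma sum_prob_finite:
  fixes \<mu> :: "'t measure"
  assumes "prob_space \<mu>" "sets \<mu> = UNIV"
  shows "(\<Sum>t\<in>UNIV. measure \<mu> {t}) = 1"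
proof -
  interpret prob_space \<mu> by (rule assms)
  have "space \<mu> = UNIV" using assms(2) sets.top[of \<mu>] sets.sets_into_space[of UNIV \<mu>] by auto
  then have "1 = measure \<mu> UNIV" using prob_space by simp
  also have "\<dots> = measure \<mu> (\<Union>t\<in>UNIV. {t})" by (rule arg_cong[where f = "measure \<mu>"]) auto
  also have "\<dots> = (\<Sum>t\<in>UNIV. measure \<mu> {t})"
    using assms(2) by (intro finite_measure_finite_Union) (auto simp: disjoint_family_on_def)
  finally show ?thesis by simp
qed

lemma pp_nonneg: "0 \<le> pp t" by (simp add: pp_def)

lemma pp_sum: "(\<Sum>t\<in>UNIV. pp t) = 1"
  unfolding pp_def by (rule sum_prob_finite[OF p_prob p_sets])

sublocale stochastic q
proof
  show "0 \<le> q t u" for t u by (simp add: q_def)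
  show "(\<Sum>u\<in>UNIV. q t u) = 1" for t
    unfolding q_def by (rule sum_prob_finite[OF Q_prob Q_sets])
qed

lemma pp_stationary: "(\<Sum>t\<in>UNIV. pp t * q t u) = pp u"
proof -
  have "ennreal (pp u) = (\<integral>\<^sup>+t. emeasure (Q t) {u} \<partial>p)"
    using p by (simp add: stationary_prob_def flip: emeasure_p)
  also have "\<dots> = (\<Sum>t\<in>UNIV. ennreal (q t u) * ennreal (pp t))"
    by (simp add: nn_integral_finite_type[OF p_sets] emeasure_Q emeasure_p)
  also have "\<dots> = ennreal (\<Sum>t\<in>UNIV. pp t * q t u)"
    using pp_nonneg q_nonneg by (subst sum_ennreal[symmetric]) (auto simp: ennreal_mult mult.commute)
  finally show ?thesis using pp_nonneg q_nonneg by (simp add: sum_nonneg)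
qed

lemma pp_closed: "pp t > 0 \<Longrightarrow> q t u > 0 \<Longrightarrow> pp u > 0"
proof -
  assume *: "pp t > 0" "q t u > 0"
  have "0 < (\<Sum>t\<in>UNIV. pp t * q t u)"
    using * pp_nonneg q_nonneg by (intro sum_pos2[of UNIV t]) auto
  then show ?thesis by (simp add: pp_stationary)
qed

lemma start_sets: "{\<omega>. \<omega> 0 = t} \<in> sets P"
  using cylinder_sets[of "[{t}]"] by (simp add: P_sets cylinder_def)

lemma P_start: "measure P {\<omega>. \<omega> 0 = t} = pp t"
proof -
  interpret P: prob_space P by (rule P_prob)
  have "emeasure P (cylinder [{t}]) = emeasure p {t}"
    unfolding P_cylinder by (simp add: p_sets)
  then show ?thesis by (simp add: cylinder_def P.emeasure_eq_measure emeasure_p pp_nonneg)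
qed

text \<open>Conditional law of the path given its first symbol (\<open>P\<close> itself for symbols of mass zero).\<close>

definition "PP t = (if pp t > 0 then uniform_measure P {\<omega>. \<omega> 0 = t} else P)"

lemma PP_sets: "sets (PP t) = sets path_algebra"
  by (simp add: PP_def P_sets)

lemma PP_space: "space (PP t) = UNIV"
  by (simp add: PP_def P_space)

lemma emeasure_P_start: "emeasure P {\<omega>. \<omega> 0 = t} = ennreal (pp t)"
proof -
  interpret P: prob_space P by (rule P_prob)
  show ?thesis by (simp add: P.emeasure_eq_measure P_start)
qed

lemma PP_prob: "prob_space (PP t)"
  using P_prob emeasure_P_start[of t] by (auto simp: PP_def intro!: prob_space_uniform_measure)

lemma emeasure_PP:
  assumes "pp t > 0" "A \<in> sets path_algebra"
  shows "emeasure P ({\<omega>. \<omega> 0 = t} \<inter> A) = ennreal (pp t) * emeasure (PP t) A"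
proof -
  have "emeasure (PP t) A = emeasure P ({\<omega>. \<omega> 0 = t} \<inter> A) / ennreal (pp t)"
    using assms start_sets by (simp add: PP_def emeasure_uniform_measure P_sets emeasure_P_start)
  then show ?thesis using assms(1) ennreal_mult_divide_eq[of "ennreal (pp t)"]
    by (simp add: ennreal_times_divide mult.commute[of "ennreal (pp t)"])
qed

lemma AE_PP_start: "pp t > 0 \<Longrightarrow> AE \<omega> in PP t. \<omega> 0 = t"
proof -
  assume t: "pp t > 0"
  then have PPt: "PP t = uniform_measure P {\<omega>. \<omega> 0 = t}" by (simp add: PP_def)
  show ?thesis unfolding PPt
    using t start_sets[of t] emeasure_P_start[of t] by (subst AE_uniform_measure) auto
qed

lemma PP_measurable_iff: "f \<in> measurable (PP t) M \<longleftrightarrow> f \<in> measurable path_algebra M"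
  using measurable_cong_sets[OF PP_sets refl] by blast

lemma P_measurable_iff: "f \<in> measurable P M \<longleftrightarrow> f \<in> measurable path_algebra M"
  using measurable_cong_sets[OF P_sets refl] by blast

lemma PP_cylinder_Cons:
  assumes "pp t > 0"
  shows "emeasure (PP t) (cylinder (A # As)) = indicator A t * cylinder_mass Q (Q t) As"
proof -
  have "{\<omega>. \<omega> 0 = t} \<inter> cylinder (A # As) = cylinder (({t} \<inter> A) # As)"
    by (auto simp: cylinder_Cons)
  then have "ennreal (pp t) * emeasure (PP t) (cylinder (A # As)) = emeasure P (cylinder (({t} \<inter> A) # As))"
    using emeasure_PP[OF assms cylinder_sets, of "A # As"] by (simp only:)
  also have "\<dots> = (\<Sum>u\<in>UNIV. if u = t then ennreal (pp t) * (indicator A t * cylinder_mass Q (Q t) As) else 0)"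
    unfolding P_cylinder cylinder_mass.simps nn_integral_finite_type[OF p_sets] emeasure_p
    by (intro sum.cong refl) (auto simp: indicator_def mult_ac)
  finally show ?thesis using assms by (simp add: ennreal_mult_cancel_left)
qed

definition "qpmf t = embed_pmf (q t)"

lemma pmf_qpmf: "pmf (qpmf t) u = q t u"
  unfolding qpmf_def
proof (rule pmf_embed_pmf)
  show "(\<integral>\<^sup>+u. ennreal (q t u) \<partial>count_space UNIV) = 1"
    using q_sum[of t] q_nonneg by (simp add: nn_integral_count_space_finite sum_ennreal)
qed (rule q_nonneg)

lemma PP_kernel: "PP \<in> measurable (measure_pmf (qpmf t)) (subprob_algebra path_algebra)"
  using PP_prob PP_sets by (auto simp: measurable_def space_subprob_algebra prob_space_imp_subprob_space)

text \<open>The Markov property, checked on cylinders, where both sides are iterated integrals.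
  Symbols \<open>u\<close> with \<open>q t u = 0\<close> contribute nothing; all others are charged
  by \<open>pp_closed\<close>, so that \<open>PP u\<close> is a genuine conditional law.\<close>

lemma distr_PP_shift:
  assumes t: "pp t > 0"
  shows "distr (PP t) path_algebra shift = measure_pmf (qpmf t) \<bind> PP"
proof (rule measure_eqI_generator_eq[OF Int_stable_cylinder, where \<Omega> = UNIV and A = "\<lambda>_. UNIV"])
  show "sets (measure_pmf (qpmf t) \<bind> PP) = sigma_sets UNIV (range cylinder)"
    unfolding sets_path_algebra[symmetric] by (rule sets_bind[OF sets_kernel[OF PP_kernel]]) auto
  show "sets (distr (PP t) path_algebra shift) = sigma_sets UNIV (range cylinder)"
    by (simp add: sets_path_algebra)
  have "cylinder [] = (UNIV :: (nat \<Rightarrow> 't) set)" by (simp add: cylinder_def)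
  then show "range (\<lambda>_. UNIV :: (nat \<Rightarrow> 't) set) \<subseteq> range cylinder" by (metis image_subsetI rangeI)
  have mass: "emeasure (measure_pmf (qpmf t) \<bind> PP) A = (\<Sum>u\<in>UNIV. ennreal (q t u) * emeasure (PP u) A)"
    if "A \<in> sets path_algebra" for A
    by (subst emeasure_bind[OF _ PP_kernel that])
      (auto simp: nn_integral_measure_pmf_finite nn_integral_finite_type emeasure_pmf_single pmf_qpmf mult.commute)
  have left: "emeasure (distr (PP t) path_algebra shift) (cylinder As) = cylinder_mass Q (Q t) As" for As
  proof -
    have sh: "shift \<in> measurable (PP t) path_algebra" using shift_measurable by (simp add: PP_measurable_iff)
    have "emeasure (distr (PP t) path_algebra shift) (cylinder As) = emeasure (PP t) (shift -` cylinder As)"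
      by (subst emeasure_distr[OF sh cylinder_sets]) (simp add: PP_space)
    also have "\<dots> = emeasure (PP t) (cylinder (UNIV # As))" by (simp add: cylinder_Cons)
    finally show ?thesis by (simp add: PP_cylinder_Cons[OF t])
  qed
  fix X :: "(nat \<Rightarrow> 't) set" assume "X \<in> range cylinder"
  then obtain As :: "'t set list" where X: "X = cylinder As" by auto
  show "emeasure (distr (PP t) path_algebra shift) X = emeasure (measure_pmf (qpmf t) \<bind> PP) X"
    unfolding X left mass[OF cylinder_sets]
  proof (cases As)
    case Nil
    have "(\<Sum>u\<in>UNIV. ennreal (q t u)) = 1" using q_nonneg q_sum[of t] by (simp add: sum_ennreal)
    moreover have "emeasure (PP u) (cylinder []) = 1" for u
      using prob_space.emeasure_space_1[OF PP_prob[of u]] by (simp add: PP_space cylinder_def)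
    ultimately show "cylinder_mass Q (Q t) As = (\<Sum>u\<in>UNIV. ennreal (q t u) * emeasure (PP u) (cylinder As))"
      by (simp add: Nil)
  next
    case (Cons A Bs)
    have "ennreal (q t u) * emeasure (PP u) (cylinder (A # Bs)) = indicator A u * cylinder_mass Q (Q u) Bs * ennreal (q t u)" for u
    proof (cases "q t u = 0")
      case False
      then have "pp u > 0" using pp_closed[OF t] q_nonneg[of t u] by simp
      then show ?thesis by (simp add: PP_cylinder_Cons mult.commute)
    qed simp
    then show "cylinder_mass Q (Q t) As = (\<Sum>u\<in>UNIV. ennreal (q t u) * emeasure (PP u) (cylinder As))"
      by (simp add: Cons nn_integral_finite_type[OF Q_sets] emeasure_Q)
  qed
next
  interpret prob_space "distr (PP t) path_algebra shift"
    using shift_measurable by (intro prob_space.prob_space_distr[OF PP_prob]) (simp add: PP_measurable_iff)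
  show "emeasure (distr (PP t) path_algebra shift) UNIV \<noteq> \<infinity>" by simp
qed auto

lemma integral_PP_shift:
  fixes H :: "(nat \<Rightarrow> 't) \<Rightarrow> real"
  assumes t: "pp t > 0" and H: "H \<in> borel_measurable path_algebra" "\<And>\<omega>. \<bar>H \<omega>\<bar> \<le> B"
  shows "(\<integral>\<omega>. H (shift \<omega>) \<partial>PP t) = (\<Sum>u\<in>UNIV. q t u * (\<integral>\<omega>. H \<omega> \<partial>PP u))"
proof -
  have "(\<integral>\<omega>. H (shift \<omega>) \<partial>PP t) = (\<integral>\<omega>. H \<omega> \<partial>distr (PP t) path_algebra shift)"
    using shift_measurable H by (intro integral_distr[symmetric]) (auto simp: PP_measurable_iff)
  also have "\<dots> = (\<integral>u. \<integral>\<omega>. H \<omega> \<partial>PP u \<partial>measure_pmf (qpmf t))"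
    unfolding distr_PP_shift[OF t]
  proof (rule integral_bind[where K = path_algebra and B = B and B' = 1])
    show "AE u in measure_pmf (qpmf t). emeasure (PP u) (space (PP u)) \<le> ennreal 1"
      using prob_space.emeasure_space_1[OF PP_prob] by simp
  qed (use H PP_kernel measure_pmf.finite_measure_axioms in auto)
  also have "\<dots> = (\<Sum>u\<in>UNIV. q t u * (\<integral>\<omega>. H \<omega> \<partial>PP u))"
    by (subst integral_measure_pmf_real[where A = UNIV]) (auto simp: pmf_qpmf mult.commute)
  finally show ?thesis .
qed

lemma prefix_compose_measurable:
  fixes H :: "'t list \<Rightarrow> (nat \<Rightarrow> 't) \<Rightarrow> 'b"
  assumes "\<And>w. H w \<in> measurable path_algebra M"
  shows "(\<lambda>\<omega>. H (map \<omega> [0..<n]) ((shift ^^ n) \<omega>)) \<in> measurable path_algebra M"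
  by (rule measurable_compose_countable[of "\<lambda>w \<omega>. H w ((shift ^^ n) \<omega>)" path_algebra M "\<lambda>\<omega>. map \<omega> [0..<n]", OF _ prefix_measurable])
    (rule measurable_compose[OF shift_power_measurable assms])

text \<open>The Markov property at time \<open>n\<close>: given the prefix \<open>w\<close>, the
  shifted path has law \<open>PP u\<close>, where \<open>u\<close> is its first symbol. There are
  countably many words, so measurability in \<open>w\<close> is automatic.\<close>

lemma integral_PP_shift_power:
  fixes H :: "'t list \<Rightarrow> (nat \<Rightarrow> 't) \<Rightarrow> real"
  assumes "pp t > 0" and "\<And>w. H w \<in> borel_measurable path_algebra" "\<And>w \<omega>. \<bar>H w \<omega>\<bar> \<le> B"
  shows "(\<integral>\<omega>. H (map \<omega> [0..<n]) ((shift ^^ n) \<omega>) \<partial>PP t) = path_exp q n t (\<lambda>w u. \<integral>\<omega>. H w \<omega> \<partial>PP u)"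
  using assms
proof (induction n arbitrary: t H)
  case 0
  then show ?case by simp
next
  case (Suc n)
  define G where "G \<omega> = H (t # map \<omega> [0..<n]) ((shift ^^ n) \<omega>)" for \<omega>
  have Gm: "G \<in> borel_measurable path_algebra"
    unfolding G_def using Suc.prems(2) by (intro prefix_compose_measurable[where H = "\<lambda>w. H (t # w)"])
  have Hm: "(\<lambda>\<omega>. H (map \<omega> [0..<Suc n]) ((shift ^^ Suc n) \<omega>)) \<in> borel_measurable path_algebra"
    using Suc.prems(2) by (intro prefix_compose_measurable)
  have eq: "H (map \<omega> [0..<Suc n]) ((shift ^^ Suc n) \<omega>) = G (shift \<omega>)" if "\<omega> 0 = t" for \<omega>
  proof -
    have "map \<omega> [0..<Suc n] = \<omega> 0 # map (shift \<omega>) [0..<n]"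
      by (simp add: upt_conv_Cons map_Suc_upt[symmetric] shift_def del: upt_Suc)
    then show ?thesis using that by (simp add: G_def funpow_swap1 del: upt_Suc)
  qed
  have "(\<integral>\<omega>. H (map \<omega> [0..<Suc n]) ((shift ^^ Suc n) \<omega>) \<partial>PP t) = (\<integral>\<omega>. G (shift \<omega>) \<partial>PP t)"
  proof (rule integral_cong_AE)
    show "AE \<omega> in PP t. H (map \<omega> [0..<Suc n]) ((shift ^^ Suc n) \<omega>) = G (shift \<omega>)"
      using AE_PP_start[OF Suc.prems(1)] by eventually_elim (rule eq)
    show "(\<lambda>\<omega>. H (map \<omega> [0..<Suc n]) ((shift ^^ Suc n) \<omega>)) \<in> borel_measurable (PP t)"
      using Hm unfolding PP_measurable_iff .
    show "(\<lambda>\<omega>. G (shift \<omega>)) \<in> borel_measurable (PP t)"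
      unfolding PP_measurable_iff by (rule measurable_compose[OF shift_measurable Gm])
  qed
  also have "\<dots> = (\<Sum>u\<in>UNIV. q t u * (\<integral>\<omega>. G \<omega> \<partial>PP u))"
    using Suc.prems(3) by (intro integral_PP_shift[OF Suc.prems(1) Gm, of B]) (simp add: G_def)
  also have "\<dots> = path_exp q (Suc n) t (\<lambda>w u. \<integral>\<omega>. H w \<omega> \<partial>PP u)"
    unfolding path_exp.simps
  proof (intro sum.cong refl)
    fix u
    show "q t u * (\<integral>\<omega>. G \<omega> \<partial>PP u) = q t u * path_exp q n u (\<lambda>w v. \<integral>\<omega>. H (t # w) \<omega> \<partial>PP v)"
    proof (cases "q t u = 0")
      case False
      then have "pp u > 0" using pp_closed[OF Suc.prems(1)] q_nonneg[of t u] by simp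
      then show ?thesis
        unfolding G_def using Suc.IH[of u "\<lambda>w. H (t # w)"] Suc.prems(2,3) by simp
    qed simp
  qed
  finally show ?case .
qed

lemma integral_P_split:
  fixes H :: "(nat \<Rightarrow> 't) \<Rightarrow> real"
  assumes H: "H \<in> borel_measurable path_algebra" "\<And>\<omega>. \<bar>H \<omega>\<bar> \<le> B"
  shows "(\<integral>\<omega>. H \<omega> \<partial>P) = (\<Sum>t\<in>UNIV. pp t * (\<integral>\<omega>. H \<omega> \<partial>PP t))"
proof -
  interpret P: prob_space P by (rule P_prob)
  have Hi: "integrable P H"
    using H by (intro P.integrable_const_bound[of _ B]) (auto simp: P_measurable_iff)
  have ind: "(\<integral>\<omega>. indicator {\<omega>. \<omega> 0 = t} \<omega> * H \<omega> \<partial>P) = pp t * (\<integral>\<omega>. H \<omega> \<partial>PP t)" for t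
  proof (cases "pp t > 0")
    case True
    have "(\<integral>\<omega>. H \<omega> \<partial>PP t) = (\<integral>\<omega>. indicator {\<omega>. \<omega> 0 = t} \<omega> / pp t * H \<omega> \<partial>P)"
    proof -
      have PPd: "PP t = density P (\<lambda>\<omega>. ennreal (indicator {\<omega>. \<omega> 0 = t} \<omega> / pp t))"
      proof -
        have eq: "(\<lambda>\<omega>. ennreal (indicator {\<omega>. \<omega> 0 = t} \<omega> / pp t)) = (\<lambda>\<omega>. indicator {\<omega>. \<omega> 0 = t} \<omega> / emeasure P {\<omega>. \<omega> 0 = t})"
          using True by (auto simp: fun_eq_iff indicator_def emeasure_P_start divide_ennreal[symmetric])
        show ?thesis unfolding eq using True by (simp add: PP_def uniform_measure_def)
      qed
      have m1: "(\<lambda>\<omega>. indicator {\<omega>. \<omega> 0 = t} \<omega> / pp t) \<in> borel_measurable P"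
        using start_sets by (intro borel_measurable_divide borel_measurable_indicator) auto
      have m2: "H \<in> borel_measurable P" using H(1) unfolding P_measurable_iff .
      show ?thesis
        unfolding PPd by (rule integral_real_density) (use m1 m2 pp_nonneg in auto)
    qed
    also have "\<dots> = (\<integral>\<omega>. indicator {\<omega>. \<omega> 0 = t} \<omega> * H \<omega> \<partial>P) / pp t"
      by (simp flip: integral_divide_zero)
    finally show ?thesis using True by simp
  next
    case False
    then have "pp t = 0" using pp_nonneg[of t] by simp
    then have "AE \<omega> in P. \<omega> \<notin> {\<omega>. \<omega> 0 = t}"
      using emeasure_P_start[of t] start_sets by (intro AE_not_in) (auto simp: null_sets_def)
    then have "(\<integral>\<omega>. indicator {\<omega>. \<omega> 0 = t} \<omega> * H \<omega> \<partial>P) = 0"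
      by (intro integral_eq_zero_AE) auto
    then show ?thesis using \<open>pp t = 0\<close> by simp
  qed
  have "H \<omega> = (\<Sum>t\<in>UNIV. indicator {\<omega>. \<omega> 0 = t} \<omega> * H \<omega>)" for \<omega>
    by (simp add: sum_distrib_right[symmetric] indicator_def)
  then have "(\<integral>\<omega>. H \<omega> \<partial>P) = (\<integral>\<omega>. (\<Sum>t\<in>UNIV. indicator {\<omega>. \<omega> 0 = t} \<omega> * H \<omega>) \<partial>P)" by simp
  also have "\<dots> = (\<Sum>t\<in>UNIV. \<integral>\<omega>. indicator {\<omega>. \<omega> 0 = t} \<omega> * H \<omega> \<partial>P)"
    by (intro Bochner_Integration.integral_sum integrable_mult_indicator[OF start_sets Hi, unfolded real_scaleR_def])
  finally show ?thesis by (simp add: ind)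
qed

lemma AE_P_iff:
  assumes "\<And>t. pp t > 0 \<Longrightarrow> AE \<omega> in PP t. R \<omega>"
  shows "AE \<omega> in P. R \<omega>"
proof -
  have "AE \<omega> in P. \<omega> 0 = t \<longrightarrow> R \<omega>" for t
  proof (cases "pp t > 0")
    case True
    then have PPt: "PP t = uniform_measure P {\<omega>. \<omega> 0 = t}" by (simp add: PP_def)
    show ?thesis using assms[OF True] unfolding PPt
      using True start_sets[of t] emeasure_P_start[of t] by (subst (asm) AE_uniform_measure) auto
  next
    case False
    then have "pp t = 0" using pp_nonneg[of t] by simp
    then have "AE \<omega> in P. \<omega> \<notin> {\<omega>. \<omega> 0 = t}"
      using emeasure_P_start[of t] start_sets by (intro AE_not_in) (auto simp: null_sets_def)
    then show ?thesis by eventually_elim simp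
  qed
  then have "AE \<omega> in P. \<forall>t. \<omega> 0 = t \<longrightarrow> R \<omega>" by (subst AE_all_countable) auto
  then show ?thesis by eventually_elim auto
qed

end

section \<open>Minimal absorbing sets\<close>

context lipschitz_walk
begin

definition absorbing :: "('t disc \<times> 'x) set \<Rightarrow> bool" where
  "absorbing C \<longleftrightarrow> closed C \<and> (\<forall>t x u. (Disc t, x) \<in> C \<longrightarrow> q t u > 0 \<longrightarrow> (Disc u, f t x) \<in> C)"

definition minimal :: "('t disc \<times> 'x) set \<Rightarrow> bool" where
  "minimal M \<longleftrightarrow> absorbing M \<and> M \<noteq> {} \<and> (\<forall>C. absorbing C \<longrightarrow> C \<noteq> {} \<longrightarrow> C \<subseteq> M \<longrightarrow> C = M)"

lemma absorbing_compact: "absorbing C \<Longrightarrow> compact C"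
  using closed_Int_compact[OF _ KZ] by (simp add: absorbing_def)

lemma absorbing_Int: "absorbing C \<Longrightarrow> absorbing D \<Longrightarrow> absorbing (C \<inter> D)"
  by (auto simp: absorbing_def)

lemma op_power_mono_on:
  assumes C: "absorbing C" "z \<in> C" and le: "\<And>y. y \<in> C \<Longrightarrow> \<phi> y \<le> \<psi> y"
  shows "(\<K> ^^ n) \<phi> z \<le> (\<K> ^^ n) \<psi> z"
proof -
  obtain t x where z: "z = (Disc t, x)" by (metis disc.exhaust surj_pair)
  show ?thesis
    unfolding z markov_op_power
    by (rule path_exp_mono_invariant[where R = "\<lambda>t x. (Disc t, x) \<in> C" and g = f])
      (use C le in \<open>auto simp: absorbing_def z\<close>)
qed

lemma op_power_eq_on:
  assumes "absorbing C" "z \<in> C" "\<And>y. y \<in> C \<Longrightarrow> \<phi> y = \<psi> y"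
  shows "(\<K> ^^ n) \<phi> z = (\<K> ^^ n) \<psi> z"
  using assms by (intro antisym op_power_mono_on[of C]) auto

lemma minimal_exists:
  assumes C: "absorbing C" "C \<noteq> {}"
  obtains M where "minimal M" "M \<subseteq> C"
proof -
  \<comment> \<open>Zorn's lemma yields maximal elements, so it is applied to the open
    complements.\<close>
  define \<A> where "\<A> = {- D |D. absorbing D \<and> D \<noteq> {} \<and> D \<subseteq> C}"
  have "\<exists>U\<in>\<A>. \<forall>X\<in>\<A>. U \<subseteq> X \<longrightarrow> X = U"
  proof (rule subset_Zorn_nonempty)
    show "\<A> \<noteq> {}" using C by (auto simp: \<A>_def)
    fix \<C> assume ne: "\<C> \<noteq> {}" and chain: "subset.chain \<A> \<C>"
    have sub: "\<C> \<subseteq> \<A>" using chain by (simp add: subset.chain_def)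
    let ?D = "- \<Union>\<C>"
    have mem: "absorbing (- U)" "- U \<noteq> {}" "- U \<subseteq> C" "open U" if "U \<in> \<C>" for U
    proof -
      have "U \<in> \<A>" using that sub by (rule subsetD[rotated])
      then obtain D where "U = - D" "absorbing D" "D \<noteq> {}" "D \<subseteq> C"
        unfolding \<A>_def by auto
      then show "absorbing (- U)" "- U \<noteq> {}" "- U \<subseteq> C" "open U"
        by (auto simp: absorbing_def)
    qed
    \<comment> \<open>By compactness an open chain covering the space has a finite subcover, hence a
      member equal to the whole space, against \<open>mem(2)\<close>.\<close>
    have "?D \<noteq> {}"
    proof
      assume "?D = {}"
      then have cover: "UNIV \<subseteq> \<Union>\<C>" by auto
      obtain \<D> where \<D>: "\<D> \<subseteq> \<C>" "finite \<D>" "UNIV \<subseteq> \<Union>\<D>"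
        by (rule compactE[OF KZ cover mem(4)])
      have "\<D> \<noteq> {}" using \<D>(3) by auto
      moreover have "subset.chain \<A> \<D>" 
        unfolding subset_chain_def
      proof (intro conjI ballI)
        show "\<D> \<subseteq> \<A>" using \<D>(1) sub by (rule subset_trans)
        show "X \<subseteq> Y \<or> Y \<subseteq> X" if "X \<in> \<D>" "Y \<in> \<D>" for X Y
          using chain[unfolded subset_chain_def] subsetD[OF \<D>(1) that(1)] subsetD[OF \<D>(1) that(2)] by metis
      qed
      ultimately have "\<Union>\<D> \<in> \<D>" using \<D>(2) by (intro Union_in_chain)
      then have "UNIV \<in> \<C>" using \<D> by (metis subsetD top.extremum_uniqueI)
      then show False using mem(2) by fastforce
    qed
    moreover have "absorbing ?D"
    proof -
      have "open (\<Union>\<C>)" using mem(4) by auto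
      moreover have "(Disc u, f t x) \<notin> U" if "U \<in> \<C>" "(Disc t, x) \<notin> U" "q t u > 0" for U t x u
        using mem(1)[OF that(1)] that(2,3) by (auto simp: absorbing_def)
      ultimately show ?thesis unfolding absorbing_def by (auto simp: closed_def)
    qed
    moreover have "?D \<subseteq> C" using ne mem(3) by blast
    ultimately show "\<Union>\<C> \<in> \<A>" unfolding \<A>_def by (auto intro!: exI[of _ ?D])
  qed
  then obtain U where U: "U \<in> \<A>" "\<And>X. X \<in> \<A> \<Longrightarrow> U \<subseteq> X \<Longrightarrow> X = U" by blast
  then obtain M where M: "U = - M" "absorbing M" "M \<noteq> {}" "M \<subseteq> C" by (auto simp: \<A>_def)
  have "D = M" if "absorbing D" "D \<noteq> {}" "D \<subseteq> M" for D
  proof -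
    have "- D \<in> \<A>" using that M(4) unfolding \<A>_def by blast
    then have "- D = U" using U(2) that(3) M(1) by blast
    then show ?thesis using M(1) by blast
  qed
  with M that show ?thesis by (auto simp: minimal_def)
qed

section \<open>Separation and finiteness of minimal sets\<close>

lemma minimal_disjoint:
  assumes "minimal M" "minimal M'" "M \<inter> M' \<noteq> {}"
  shows "M = M'"
  using assms absorbing_Int[of M M'] unfolding minimal_def by (metis inf_le1 inf_le2)

text \<open>Consider a closest pair of points of the two sets. If it were closer than
  \<open>min 1 r\<close>, both points would carry the same symbol, and the mean contraction would
  bring their images strictly closer along some possible word; yet the images stay in the two
  sets.\<close>

lemma minimal_separated:
  assumes con: "contracts N \<alpha> \<theta> r" "\<theta> < 1" "\<alpha> > 0"
    and M: "minimal M" "minimal M'" "M \<noteq> M'" and z: "z \<in> M" "z' \<in> M'"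
  shows "min 1 r \<le> dist z z'"
proof (rule ccontr)
  assume "\<not> ?thesis"
  then have less: "dist z z' < min 1 r" by (simp only: not_le)
  have abs: "absorbing M" "absorbing M'" using M by (auto simp: minimal_def)
  have "compact (M \<times> M')" using abs by (intro compact_Times absorbing_compact)
  moreover have "continuous_on (M \<times> M') (\<lambda>w. dist (fst w) (snd w))" by (intro continuous_intros)
  ultimately obtain w where w: "w \<in> M \<times> M'" "\<And>v. v \<in> M \<times> M' \<Longrightarrow> dist (fst w) (snd w) \<le> dist (fst v) (snd v)"
    using continuous_attains_inf[of "M \<times> M'" "\<lambda>w. dist (fst w) (snd w)"] z by blast
  obtain t x where a: "fst w = (Disc t, x)" by (metis disc.exhaust surj_pair)
  obtain s y where b: "snd w = (Disc s, y)" by (metis disc.exhaust surj_pair)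
  have "dist (Disc t, x) (Disc s, y) < min 1 r" using w(2)[of "(z, z')"] z less a b by simp
  from dist_disc_times_less[OF this] have ts: "t = s" and d: "dist x y < min 1 r" by auto
  have mem: "(Disc t, x) \<in> M" "(Disc t, y) \<in> M'" using w(1) a b ts by (auto simp: mem_Times_iff)
  have "x \<noteq> y" using mem minimal_disjoint[OF M(1,2)] M(3) by auto
  then have pos: "dist x y powr \<alpha> > 0" by simp
  have "dist x y powr \<alpha> = path_exp q N t (\<lambda>_ _. dist x y powr \<alpha>)" by (simp add: path_exp_const)
  also have "\<dots> \<le> path_exp q N t (\<lambda>w u. max (dist (word_map f w x) (word_map f w y) powr \<alpha>) (dist x y powr \<alpha>))"
    by (intro path_exp_mono) auto
  also have "\<dots> \<le> path_exp q N t (\<lambda>w u. dist (word_map f w x) (word_map f w y) powr \<alpha>)"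
  proof (rule path_exp_mono_invariant[where R = "\<lambda>t p. (Disc t, fst p) \<in> M \<and> (Disc t, snd p) \<in> M'"
        and g = "\<lambda>t. map_prod (f t) (f t)" and s = "(x, y)"])
    fix v u assume "(Disc u, fst (word_map (\<lambda>t. map_prod (f t) (f t)) v (x, y))) \<in> M \<and>
      (Disc u, snd (word_map (\<lambda>t. map_prod (f t) (f t)) v (x, y))) \<in> M'"
    then have "(Disc u, word_map f v x) \<in> M" "(Disc u, word_map f v y) \<in> M'" by (simp_all add: word_map_pair)
    then have "dist x y \<le> dist (word_map f v x) (word_map f v y)"
      using w(2)[of "((Disc u, word_map f v x), (Disc u, word_map f v y))"]
      by (simp add: a b ts dist_disc_times_same)
    then show "max (dist (word_map f v x) (word_map f v y) powr \<alpha>) (dist x y powr \<alpha>)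
        \<le> dist (word_map f v x) (word_map f v y) powr \<alpha>"
      using con(3) by (simp add: powr_mono2)
  qed (use mem abs in \<open>auto simp: absorbing_def\<close>)
  also have "\<dots> \<le> \<theta> * dist x y powr \<alpha>" using con(1) d unfolding contracts_def by simp
  also have "\<dots> < 1 * dist x y powr \<alpha>" using con(2) pos by (intro mult_strict_right_mono)
  finally show False by simp
qed

lemma finite_minimal:
  assumes con: "contracts N \<alpha> \<theta> r" "\<theta> < 1" "\<alpha> > 0" "r > 0"
  shows "finite {M. minimal M}"
proof -
  define \<epsilon> where "\<epsilon> = min 1 r"
  have \<epsilon>: "\<epsilon> > 0" using con by (simp add: \<epsilon>_def)
  obtain A :: "('t disc \<times> 'x) set" where A: "finite A" "UNIV \<subseteq> (\<Union>a\<in>A. ball a (\<epsilon> / 2))"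
    using KZ \<epsilon> unfolding compact_eq_totally_bounded by (meson half_gt_zero)
  have "\<exists>a z. a \<in> A \<and> z \<in> M \<and> dist a z < \<epsilon> / 2" if "minimal M" for M
  proof -
    obtain z where z: "z \<in> M" using \<open>minimal M\<close> by (auto simp: minimal_def)
    have "z \<in> (\<Union>a\<in>A. ball a (\<epsilon> / 2))" using A(2) by blast
    then obtain a where "a \<in> A" "dist a z < \<epsilon> / 2" by auto
    with z show ?thesis by blast
  qed
  then obtain a z where az: "\<And>M. minimal M \<Longrightarrow> a M \<in> A \<and> z M \<in> M \<and> dist (a M) (z M) < \<epsilon> / 2"
    by metis
  have "inj_on a {M. minimal M}"
  proof (rule inj_onI, rule ccontr)
    fix M M' assume M: "M \<in> {M. minimal M}" "M' \<in> {M. minimal M}" "a M = a M'" "M \<noteq> M'"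
    then have "\<epsilon> \<le> dist (z M) (z M')"
      unfolding \<epsilon>_def using az by (intro minimal_separated[OF con(1,2,3)]) auto
    moreover have "dist (z M) (z M') < \<epsilon>"
      using az[of M] az[of M'] M dist_triangle3[of "z M" "z M'" "a M"] by simp
    ultimately show False by simp
  qed
  then show ?thesis
    by (rule inj_on_finite[OF _ _ A(1)]) (use az in auto)
qed

text \<open>The points of \<open>C\<close> from which \<open>v\<close> is never seen to be positive
  form an absorbing set, which \<open>meets\<close> shows to be empty. Compactness then bounds both
  the waiting time and the expected amount.\<close>

lemma reach:
  assumes C: "absorbing C" and v: "continuous_on UNIV v" "\<And>z. 0 \<le> v z"
    and meets: "\<And>D. absorbing D \<Longrightarrow> D \<noteq> {} \<Longrightarrow> D \<subseteq> C \<Longrightarrow> \<exists>z\<in>D. v z > 0"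
  obtains n c where "c > 0" "\<And>z. z \<in> C \<Longrightarrow> c \<le> (\<Sum>j<n. (\<K> ^^ j) v z)"
proof -
  have nonneg: "0 \<le> (\<K> ^^ j) v z" for j z
    using op_power_mono[of "\<lambda>_. 0" v j z] v(2) by (simp add: op_power_const)
  have cont: "continuous_on UNIV ((\<K> ^^ j) v)" for j by (rule op_power_cont[OF v(1)])
  define D where "D = C \<inter> (\<Inter>j. {z. (\<K> ^^ j) v z = 0})"
  have "absorbing D"
    unfolding absorbing_def
  proof (intro conjI allI impI)
    have "closed {z. (\<K> ^^ j) v z = 0}" for j
      by (rule closed_Collect_eq[OF cont continuous_on_const])
    then show "closed D" unfolding D_def using C by (auto simp: absorbing_def)
    fix t x u assume z: "(Disc t, x) \<in> D" and q: "q t u > 0"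
    have "(\<K> ^^ j) v (Disc u, f t x) = 0" for j
    proof -
      have "(\<K> ^^ Suc j) v (Disc t, x) = 0" using z unfolding D_def by blast
      then have "(\<Sum>u\<in>UNIV. q t u * (\<K> ^^ j) v (Disc u, f t x)) = 0" by simp
      then have "q t u * (\<K> ^^ j) v (Disc u, f t x) = 0"
        using q_nonneg nonneg by (subst (asm) sum_nonneg_eq_0_iff) auto
      then show ?thesis using q by simp
    qed
    moreover have "(Disc u, f t x) \<in> C" using z q C by (auto simp: D_def absorbing_def)
    ultimately show "(Disc u, f t x) \<in> D" by (simp add: D_def)
  qed
  moreover have "\<not> (\<exists>z\<in>D. v z > 0)"
  proof safe
    fix a b assume "(a, b) \<in> D" "0 < v (a, b)"
    then have "(\<K> ^^ 0) v (a, b) = 0" unfolding D_def by blast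
    with \<open>0 < v (a, b)\<close> show False by simp
  qed
  ultimately have "D = {}" using meets[of D] by (auto simp: D_def)
  then have some: "\<exists>j. (\<K> ^^ j) v z > 0" if "z \<in> C" for z
    using that nonneg unfolding D_def by (auto simp: less_le)
  define U where "U n = {z. (\<Sum>j<n. (\<K> ^^ j) v z) > 0}" for n
  have Uopen: "open (U n)" for n
  proof -
    have "continuous_on UNIV (\<lambda>z. \<Sum>j<n. (\<K> ^^ j) v z)" by (intro continuous_intros cont)
    then show ?thesis
      using open_Collect_less[of "\<lambda>_. 0" "\<lambda>z. \<Sum>j<n. (\<K> ^^ j) v z"] by (simp add: U_def)
  qed
  have Umono: "U n \<subseteq> U m" if "n \<le> m" for n m
  proof
    fix z assume "z \<in> U n"
    moreover have "(\<Sum>j<n. (\<K> ^^ j) v z) \<le> (\<Sum>j<m. (\<K> ^^ j) v z)"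
      using that nonneg by (intro sum_mono2) auto
    ultimately show "z \<in> U m" by (simp add: U_def)
  qed
  have "C \<subseteq> (\<Union>n. U n)"
  proof
    fix z assume "z \<in> C"
    then obtain j where "(\<K> ^^ j) v z > 0" using some by blast
    then have "z \<in> U (Suc j)"
      using sum_nonneg[of "{..<j}" "\<lambda>j. (\<K> ^^ j) v z"] nonneg by (simp add: U_def add_nonneg_pos)
    then show "z \<in> (\<Union>n. U n)" by blast
  qed
  then obtain I where I: "finite I" "C \<subseteq> (\<Union>n\<in>I. U n)"
    by (rule compactE_image[OF absorbing_compact[OF C] Uopen])
  define n where "n = Max (insert 0 I)"
  have CU: "C \<subseteq> U n"
  proof
    fix z assume "z \<in> C"
    then obtain k where k: "k \<in> I" "z \<in> U k" using I(2) by auto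
    then have "k \<le> n" unfolding n_def using I(1) by (intro Max_ge) auto
    then show "z \<in> U n" using Umono k(2) by blast
  qed
  show ?thesis
  proof (cases "C = {}")
    case True then show ?thesis using that[of 1 0] by simp
  next
    case False
    have "continuous_on C (\<lambda>z. \<Sum>j<n. (\<K> ^^ j) v z)"
      by (intro continuous_intros continuous_on_subset[OF cont]) auto
    then obtain w where "w \<in> C" "\<And>z. z \<in> C \<Longrightarrow> (\<Sum>j<n. (\<K> ^^ j) v w) \<le> (\<Sum>j<n. (\<K> ^^ j) v z)"
      using continuous_attains_inf[OF absorbing_compact[OF C] False] by blast
    then show ?thesis using CU by (intro that[of "\<Sum>j<n. (\<K> ^^ j) v w" n]) (auto simp: U_def)
  qed
qed

section \<open>Cesaro averages and equicontinuity\<close>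

definition avg :: "nat \<Rightarrow> ('t disc \<times> 'x \<Rightarrow> real) \<Rightarrow> 't disc \<times> 'x \<Rightarrow> real" where
  "avg m \<phi> z = (\<Sum>l<m. (\<K> ^^ l) \<phi> z) / real m"

definition equicontinuous :: "('t disc \<times> 'x \<Rightarrow> real) \<Rightarrow> bool" where
  "equicontinuous \<phi> \<longleftrightarrow> (\<forall>\<epsilon>>0. \<exists>\<rho>>0. \<forall>n z z'. dist z z' < \<rho> \<longrightarrow> \<bar>(\<K> ^^ n) \<phi> z - (\<K> ^^ n) \<phi> z'\<bar> \<le> \<epsilon>)"

lemma avg_cont: "continuous_on UNIV \<phi> \<Longrightarrow> continuous_on UNIV (avg m \<phi>)"
  unfolding avg_def divide_inverse by (intro continuous_intros op_power_cont)

lemma avg_near: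
  assumes "equicontinuous \<phi>" "\<epsilon> > 0"
  obtains \<rho> where "\<rho> > 0" "\<And>m z z'. m \<ge> 1 \<Longrightarrow> dist z z' < \<rho> \<Longrightarrow> \<bar>avg m \<phi> z - avg m \<phi> z'\<bar> \<le> \<epsilon>"
proof -
  obtain \<rho> where \<rho>: "\<rho> > 0" "\<And>n z z'. dist z z' < \<rho> \<Longrightarrow> \<bar>(\<K> ^^ n) \<phi> z - (\<K> ^^ n) \<phi> z'\<bar> \<le> \<epsilon>"
    using assms unfolding equicontinuous_def by blast
  have "\<bar>avg m \<phi> z - avg m \<phi> z'\<bar> \<le> \<epsilon>" if "m \<ge> 1" "dist z z' < \<rho>" for m z z'
  proof -
    have "\<bar>\<Sum>l<m. (\<K> ^^ l) \<phi> z - (\<K> ^^ l) \<phi> z'\<bar> \<le> (\<Sum>l<m. \<epsilon>)"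
      using \<rho>(2)[OF that(2)] by (intro order_trans[OF sum_abs] sum_mono)
    then show ?thesis
      using that(1) by (simp add: avg_def sum_subtractf diff_divide_distrib[symmetric] divide_le_eq mult.commute)
  qed
  with \<rho>(1) that show ?thesis by blast
qed

text \<open>Averages are almost harmonic: by telescoping, one step changes
  \<open>avg m \<phi>\<close> by \<open>((\<K> ^^ m) \<phi> - \<phi>) / m\<close>.\<close>

lemma op_power_avg_diff:
  assumes B: "\<And>z. \<bar>\<phi> z\<bar> \<le> B" and m: "m \<ge> 1"
  shows "\<bar>(\<K> ^^ j) (avg m \<phi>) z - avg m \<phi> z\<bar> \<le> real j * (2 * B / real m)"
proof (induction j)
  case (Suc j)
  have tel: "(\<K> ^^ 1) (avg m \<phi>) y - avg m \<phi> y = ((\<K> ^^ m) \<phi> y - \<phi> y) / real m" for y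
  proof -
    have "(\<K> ^^ 1) (\<lambda>y. \<Sum>l<k. (\<K> ^^ l) \<phi> y) y = (\<Sum>l<k. (\<K> ^^ Suc l) \<phi> y)" for k
    proof (induction k)
      case 0 then show ?case using op_power_const[of 1 0] by simp
    next
      case (Suc k)
      then show ?case using op_power_add[of 1 "\<lambda>y. \<Sum>l<k. (\<K> ^^ l) \<phi> y" "(\<K> ^^ k) \<phi>"] by simp
    qed
    moreover have "(\<K> ^^ 1) (avg m \<phi>) y = (\<K> ^^ 1) (\<lambda>y. \<Sum>l<m. (\<K> ^^ l) \<phi> y) y / real m"
      using op_power_cmult[of 1 "1 / real m" "\<lambda>y. \<Sum>l<m. (\<K> ^^ l) \<phi> y"] by (simp add: avg_def[abs_def])
    ultimately have "(\<K> ^^ 1) (avg m \<phi>) y - avg m \<phi> y = ((\<Sum>l<m. (\<K> ^^ Suc l) \<phi> y) - (\<Sum>l<m. (\<K> ^^ l) \<phi> y)) / real m"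
      by (simp add: avg_def diff_divide_distrib)
    also have "(\<Sum>l<m. (\<K> ^^ Suc l) \<phi> y) - (\<Sum>l<m. (\<K> ^^ l) \<phi> y) = (\<K> ^^ m) \<phi> y - \<phi> y"
      using sum_lessThan_telescope[of "\<lambda>l. (\<K> ^^ l) \<phi> y" m] by (simp add: sum_subtractf)
    finally show ?thesis .
  qed
  have bd: "\<bar>(\<K> ^^ 1) (avg m \<phi>) y - avg m \<phi> y\<bar> \<le> 2 * B / real m" for y
  proof -
    have "\<bar>(\<K> ^^ m) \<phi> y - \<phi> y\<bar> \<le> 2 * B" using op_power_bound[of \<phi> B m y, OF B] B[of y] by linarith
    then show ?thesis unfolding tel by (simp add: divide_right_mono)
  qed
  have "(\<K> ^^ Suc j) (avg m \<phi>) z - (\<K> ^^ j) (avg m \<phi>) z = (\<K> ^^ j) (\<lambda>y. (\<K> ^^ 1) (avg m \<phi>) y - avg m \<phi> y) z"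
    using op_power_add[of j "(\<K> ^^ 1) (avg m \<phi>)" "\<lambda>y. (-1) * avg m \<phi> y"] op_power_cmult[of j "-1" "avg m \<phi>"]
    by (simp add: funpow_swap1)
  moreover have "\<bar>(\<K> ^^ j) (\<lambda>y. (\<K> ^^ 1) (avg m \<phi>) y - avg m \<phi> y) z\<bar> \<le> 2 * B / real m"
    by (rule op_power_bound[OF bd])
  ultimately show ?case using Suc.IH unfolding of_nat_Suc distrib_right mult_1 by linarith
qed simp

text \<open>A nearly harmonic function with a modulus of continuity is nearly constant on a minimal set,
  because its values near any point are seen from its maximum with a probability bounded below.\<close>

lemma avg_osc:
  assumes M: "minimal M" and \<phi>: "continuous_on UNIV \<phi>" "equicontinuous \<phi>" and \<epsilon>: "\<epsilon> > 0"
  obtains m where "m \<ge> 1" "\<And>z z'. z \<in> M \<Longrightarrow> z' \<in> M \<Longrightarrow> \<bar>avg m \<phi> z - avg m \<phi> z'\<bar> \<le> \<epsilon>"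
proof -
  have abs: "absorbing M" and ne: "M \<noteq> {}" using M by (auto simp: minimal_def)
  have Mc: "compact M" by (rule absorbing_compact[OF abs])
  obtain B where B: "B > 0" "\<And>z. \<bar>\<phi> z\<bar> \<le> B" using continuous_bounded_compact[OF KZ \<phi>(1)] by blast
  have "\<epsilon> / 3 > 0" using \<epsilon> by simp
  from avg_near[OF \<phi>(2) this] obtain \<rho> where \<rho>: "\<rho> > 0"
    "\<And>m z z'. m \<ge> 1 \<Longrightarrow> dist z z' < \<rho> \<Longrightarrow> \<bar>avg m \<phi> z - avg m \<phi> z'\<bar> \<le> \<epsilon> / 3" by blast
  have "M \<subseteq> (\<Union>y\<in>M. ball y \<rho>)" using \<rho>(1) by auto
  then obtain Y where Y: "Y \<subseteq> M" "finite Y" "M \<subseteq> (\<Union>y\<in>Y. ball y \<rho>)"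
    by (rule compactE_image[OF Mc open_ball])
  define v where "v y z = max 0 (\<rho> - dist z y)" for y z :: "'t disc \<times> 'x"
  have v: "continuous_on UNIV (v y)" "0 \<le> v y z" "v y z \<le> \<rho>" for y z
    using \<rho>(1) unfolding v_def by (auto intro!: continuous_intros)
  have "\<exists>n c. c > 0 \<and> (\<forall>z\<in>M. c \<le> (\<Sum>j<n. (\<K> ^^ j) (v y) z))" if "y \<in> Y" for y
  proof (rule reach[OF abs v(1,2)])
    fix D assume "absorbing D" "D \<noteq> {}" "D \<subseteq> M"
    then have "D = M" using M by (simp add: minimal_def)
    then have "y \<in> D" using that Y(1) by auto
    then show "\<exists>z\<in>D. v y z > 0" using \<rho>(1) by (auto simp: v_def intro!: bexI[of _ y])
  qed blast
  then have "\<forall>y\<in>Y. \<exists>nc. snd nc > (0 :: real) \<and> (\<forall>z\<in>M. snd nc \<le> (\<Sum>j<fst nc. (\<K> ^^ j) (v y) z))" by simp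
  from bchoice[OF this] obtain nc where nc: "\<forall>y\<in>Y. snd (nc y) > (0 :: real) \<and> (\<forall>z\<in>M. snd (nc y) \<le> (\<Sum>j<fst (nc y). (\<K> ^^ j) (v y) z))" by blast
  define n where "n y = fst (nc y)" for y
  define c where "c y = snd (nc y)" for y
  have nc: "c y > 0" "\<And>z. z \<in> M \<Longrightarrow> c y \<le> (\<Sum>j<n y. (\<K> ^^ j) (v y) z)" if "y \<in> Y" for y
    using nc that by (auto simp: n_def c_def)
  \<comment> \<open>The estimate in \<open>near_max\<close> shows that the drop \<open>d\<close>
    satisfies \<open>d \<le> g y / m\<close>; the number \<open>m\<close> is then chosen to make
    this at most \<open>\<epsilon> / 3\<close> for all \<open>y\<close> in \<open>Y\<close>.\<close>
  define g where "g y = 2 * B * (real (n y))\<^sup>2 * \<rho> / c y" for y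
  have g0: "0 \<le> g y" if "y \<in> Y" for y using nc(1)[OF that] B \<rho> by (simp add: g_def)
  obtain m0 where m0: "(\<Sum>y\<in>Y. g y) / (\<epsilon> / 3) \<le> real m0" using real_arch_simple by blast
  define m where "m = max 1 m0"
  have m1: "m \<ge> 1" by (simp add: m_def)
  have gm: "g y / real m \<le> \<epsilon> / 3" if "y \<in> Y" for y
  proof -
    have "g y \<le> (\<Sum>y\<in>Y. g y)" using that Y(2) g0 by (intro member_le_sum) auto
    also have "\<dots> \<le> real m * (\<epsilon> / 3)"
    proof -
      have "(\<Sum>y\<in>Y. g y) \<le> real m0 * (\<epsilon> / 3)" using m0 \<epsilon> by (simp add: divide_le_eq)
      also have "\<dots> \<le> real m * (\<epsilon> / 3)" using \<epsilon> by (intro mult_right_mono) (auto simp: m_def)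
      finally show ?thesis .
    qed
    finally show ?thesis using m1 by (simp add: divide_le_eq mult.commute)
  qed
  let ?h = "avg m \<phi>"
  have "continuous_on M ?h" using avg_cont[OF \<phi>(1)] continuous_on_subset by blast
  then obtain w where w: "w \<in> M" "\<And>z. z \<in> M \<Longrightarrow> ?h z \<le> ?h w"
    using continuous_attains_sup[OF Mc ne] by blast
  have near_max: "?h w - ?h y \<le> 2 * (\<epsilon> / 3)" if y: "y \<in> Y" for y
  proof (rule ccontr)
    \<comment> \<open>By the choice of \<open>\<rho>\<close>, the deficit from the maximum is still
      at least \<open>d\<close> on the whole ball around \<open>y\<close>.\<close>
    define d where "d = ?h w - ?h y - \<epsilon> / 3"
    assume "\<not> ?thesis"
    then have d: "d > \<epsilon> / 3" by (simp add: d_def)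
    then have d0: "d > 0" using \<epsilon> by linarith
    have low: "(d / \<rho>) * (\<K> ^^ j) (v y) w \<le> ?h w - (\<K> ^^ j) ?h w" for j
    proof -
      have "(\<K> ^^ j) (\<lambda>z. (d / \<rho>) * v y z) w \<le> (\<K> ^^ j) (\<lambda>z. ?h w + (-1) * ?h z) w"
      proof (rule op_power_mono_on[OF abs w(1)])
        fix z assume z: "z \<in> M"
        show "(d / \<rho>) * v y z \<le> ?h w + (-1) * ?h z"
        proof (cases "dist z y < \<rho>")
          case True
          have "(d / \<rho>) * v y z \<le> (d / \<rho>) * \<rho>" using v(3) d0 \<rho>(1) by (intro mult_left_mono) auto
          also have "\<dots> = d" using \<rho>(1) by simp
          also have "d \<le> ?h w - ?h z" using \<rho>(2)[OF m1 True] unfolding d_def by linarith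
          finally show ?thesis by simp
        next
          case False
          then have "v y z = 0" by (simp add: v_def)
          then show ?thesis using w(2)[OF z] by simp
        qed
      qed
      moreover have "(\<K> ^^ j) (\<lambda>z. ?h w + (-1) * ?h z) w = ?h w - (\<K> ^^ j) ?h w"
        using op_power_add[of j "\<lambda>_. ?h w" "\<lambda>z. (-1) * ?h z"] op_power_cmult[of j "-1" ?h]
        by (simp add: op_power_const)
      ultimately show ?thesis by (simp only: op_power_cmult)
    qed
    have "(d / \<rho>) * c y \<le> (d / \<rho>) * (\<Sum>j<n y. (\<K> ^^ j) (v y) w)"
      using nc(2)[OF y w(1)] d0 \<rho>(1) by (intro mult_left_mono) auto
    also have "\<dots> \<le> (\<Sum>j<n y. ?h w - (\<K> ^^ j) ?h w)"
      unfolding sum_distrib_left by (intro sum_mono low)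
    also have "\<dots> \<le> (\<Sum>j<n y. real (n y) * (2 * B / real m))"
    proof (rule sum_mono)
      fix j assume j: "j \<in> {..<n y}"
      have "?h w - (\<K> ^^ j) ?h w \<le> real j * (2 * B / real m)"
        using op_power_avg_diff[where \<phi> = \<phi> and j = j and z = w, OF B(2) m1] by linarith
      also have "\<dots> \<le> real (n y) * (2 * B / real m)" using j B(1) by (intro mult_right_mono) auto
      finally show "?h w - (\<K> ^^ j) ?h w \<le> real (n y) * (2 * B / real m)" .
    qed
    also have "\<dots> = 2 * B * (real (n y))\<^sup>2 / real m" by (simp add: power2_eq_square)
    finally have "(d / \<rho>) * c y * (\<rho> / c y) \<le> 2 * B * (real (n y))\<^sup>2 / real m * (\<rho> / c y)"
      using nc(1)[OF y] \<rho>(1) by (intro mult_right_mono) auto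
    then have "d \<le> g y / real m" using nc(1)[OF y] \<rho>(1) by (simp add: g_def mult_ac)
    with gm[OF y] d show False by linarith
  qed
  have "?h w - ?h z \<le> \<epsilon>" if z: "z \<in> M" for z
  proof -
    obtain y where y: "y \<in> Y" "dist y z < \<rho>" using Y(3) z by auto
    show ?thesis using near_max[OF y(1)] \<rho>(2)[OF m1 y(2)] by linarith
  qed
  then have "\<bar>?h z - ?h z'\<bar> \<le> \<epsilon>" if "z \<in> M" "z' \<in> M" for z z'
    using that w(2)[of z] w(2)[of z'] by (smt (verit))
  with m1 that show ?thesis by blast
qed

text \<open>Integrating against \<open>\<eta>\<close>, which is invariant and carried by
  \<open>M\<close>, identifies the near-constant value of the average.\<close>

lemma avg_uniform:
  assumes M: "minimal M" and \<phi>: "continuous_on UNIV \<phi>" "equicontinuous \<phi>" and \<epsilon>: "\<epsilon> > 0"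
    and \<eta>: "stationary \<eta>" "AE z in \<eta>. z \<in> M"
  obtains m where "m \<ge> 1" "\<And>z. z \<in> M \<Longrightarrow> \<bar>avg m \<phi> z - (\<integral>y. \<phi> y \<partial>\<eta>)\<bar> \<le> \<epsilon>"
proof -
  obtain m where m: "m \<ge> 1" "\<And>z z'. z \<in> M \<Longrightarrow> z' \<in> M \<Longrightarrow> \<bar>avg m \<phi> z - avg m \<phi> z'\<bar> \<le> \<epsilon>"
    using avg_osc[OF M \<phi> \<epsilon>] by blast
  interpret prob_space \<eta> using \<eta>(1) by (simp add: stationary_def)
  have int: "integrable \<eta> (avg m \<phi>)" by (rule stationary_integrable[OF \<eta>(1) avg_cont[OF \<phi>(1)]])
  have "(\<integral>y. avg m \<phi> y \<partial>\<eta>) = (\<Sum>l<m. \<integral>y. (\<K> ^^ l) \<phi> y \<partial>\<eta>) / real m"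
    unfolding avg_def using stationary_integrable[OF \<eta>(1) op_power_cont[OF \<phi>(1)]]
    by (simp add: Bochner_Integration.integral_sum)
  also have "\<dots> = (\<integral>y. \<phi> y \<partial>\<eta>)" using m(1) by (simp add: stationary_power[OF \<eta>(1) \<phi>(1)])
  finally have eq: "(\<integral>y. avg m \<phi> y \<partial>\<eta>) = (\<integral>y. \<phi> y \<partial>\<eta>)" .
  have "\<bar>avg m \<phi> z - (\<integral>y. \<phi> y \<partial>\<eta>)\<bar> \<le> \<epsilon>" if z: "z \<in> M" for z
  proof -
    have ae: "AE y in \<eta>. avg m \<phi> y \<le> avg m \<phi> z + \<epsilon>" "AE y in \<eta>. avg m \<phi> z - \<epsilon> \<le> avg m \<phi> y"
      using \<eta>(2) by (eventually_elim, use m(2)[OF z] in \<open>smt (verit)\<close>)+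
    have "(\<integral>y. avg m \<phi> y \<partial>\<eta>) \<le> (\<integral>y. avg m \<phi> z + \<epsilon> \<partial>\<eta>)"
      by (rule integral_mono_AE[OF int _ ae(1)]) simp
    moreover have "(\<integral>y. avg m \<phi> z - \<epsilon> \<partial>\<eta>) \<le> (\<integral>y. avg m \<phi> y \<partial>\<eta>)"
      by (rule integral_mono_AE[OF _ int ae(2)]) simp
    ultimately show ?thesis by (simp add: eq prob_space abs_le_iff)
  qed
  with m(1) that show ?thesis by blast
qed

text \<open>A limit of time averages of the chain started in \<open>C\<close>; the distance to
  \<open>C\<close> has mean 0 at all times, hence also under the limit.\<close>

lemma stationary_on_absorbing:
  assumes C: "absorbing C" "C \<noteq> {}"
  obtains \<eta> where "stationary \<eta>" "AE z in \<eta>. z \<in> C"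
proof -
  obtain z0 where z0: "z0 \<in> C" using C by blast
  obtain r :: "nat \<Rightarrow> nat" and \<eta> where \<eta>: "stationary \<eta>" and lim: "\<And>\<phi>. continuous_on UNIV \<phi> \<Longrightarrow>
       (\<lambda>k. (\<Sum>l<r k. (\<K> ^^ l) \<phi> z0) / real (r k)) \<longlonglongrightarrow> (\<integral>z. \<phi> z \<partial>\<eta>)"
    using krylov_bogoliubov[of "\<lambda>_. z0"] by blast
  let ?g = "\<lambda>z. infdist z C"
  have g: "continuous_on UNIV ?g" by (intro continuous_intros)
  have "(\<K> ^^ l) ?g z0 = 0" for l
    using op_power_eq_on[OF C(1) z0, of ?g "\<lambda>_. 0" l] by (simp add: op_power_const)
  then have "(\<lambda>k. 0) \<longlonglongrightarrow> (\<integral>z. ?g z \<partial>\<eta>)" using lim[OF g] by simp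
  then have "(\<integral>z. ?g z \<partial>\<eta>) = 0" using LIMSEQ_unique tendsto_const by blast
  then have "AE z in \<eta>. ?g z = 0"
    using integral_nonneg_eq_0_iff_AE[OF stationary_integrable[OF \<eta> g]] by (simp add: infdist_nonneg)
  then have "AE z in \<eta>. z \<in> C"
    by eventually_elim (use C in \<open>simp add: absorbing_def in_closed_iff_infdist_zero\<close>)
  with \<eta> that show ?thesis by blast
qed

text \<open>The analogue of \<open>step_op_iterate\<close> for the chain of the skew product. A
  bound uniform in \<open>k\<close> is the goal, so the factor \<open>\<theta> ^ k\<close> is
  dropped.\<close>

lemma op_contraction_iterate:
  assumes N: "contracts N \<alpha> \<theta> r" and \<theta>: "0 < \<theta>" "\<theta> < 1" and r: "0 < r" and \<alpha>: "0 < \<alpha>" and H: "0 \<le> H"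
    and A: "\<And>z. \<bar>\<phi> z\<bar> \<le> A"
    and loc: "\<And>t x y. dist x y < r \<Longrightarrow> \<bar>\<phi> (Disc t, x) - \<phi> (Disc t, y)\<bar> \<le> H * dist x y powr \<alpha>"
    and d: "dist x y < r"
  shows "\<bar>(\<K> ^^ (k * N)) \<phi> (Disc t, x) - (\<K> ^^ (k * N)) \<phi> (Disc t, y)\<bar>
    \<le> (H + \<theta> / (1 - \<theta>) * (2 * A / r powr \<alpha>)) * dist x y powr \<alpha>"
  using d
proof (induction k arbitrary: t x y)
  case 0
  have "0 \<le> A" using A[of undefined] by linarith
  then have "H * dist x y powr \<alpha> \<le> (H + \<theta> / (1 - \<theta>) * (2 * A / r powr \<alpha>)) * dist x y powr \<alpha>"
    using \<theta> by (intro mult_right_mono) auto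
  then show ?case using loc[OF 0, of t] by simp
next
  case (Suc k)
  let ?\<psi> = "(\<K> ^^ (k * N)) \<phi>" and ?B = "2 * A / r powr \<alpha>"
  let ?H = "H + \<theta> / (1 - \<theta>) * ?B"
  have A0: "0 \<le> A" using A[of undefined] by linarith
  then have H0: "0 \<le> ?H" using \<theta> H by simp
  have eq: "(\<K> ^^ (Suc k * N)) \<phi> = (\<K> ^^ N) ?\<psi>" by (simp add: funpow_add)
  have "\<bar>(\<K> ^^ (Suc k * N)) \<phi> (Disc t, x) - (\<K> ^^ (Suc k * N)) \<phi> (Disc t, y)\<bar>
      \<le> \<theta> * (?H + ?B) * dist x y powr \<alpha>"
    unfolding eq markov_op_power[of N]
    by (rule contraction_step[OF N r \<alpha> H0, of "\<lambda>u y. ?\<psi> (Disc u, y)" A x y t "\<lambda>w u. u",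
        OF op_power_bound[where \<phi> = \<phi>, OF A] Suc.IH Suc.prems])
  also have "\<theta> * (?H + ?B) = \<theta> * H + \<theta> / (1 - \<theta>) * ?B"
  proof -
    have "\<theta> * (\<theta> / (1 - \<theta>) * B + B) = \<theta> / (1 - \<theta>) * B" for B
      using \<theta> by (simp add: field_simps)
    from this[of ?B] show ?thesis by (simp only: distrib_left add.assoc)
  qed
  also have "(\<theta> * H + \<theta> / (1 - \<theta>) * ?B) * dist x y powr \<alpha> \<le> ?H * dist x y powr \<alpha>"
    using \<theta> H by (intro mult_right_mono add_right_mono) (auto simp: mult_left_le_one_le)
  finally show ?case .
qed

text \<open>With \<open>n = k * N + j\<close> and \<open>j < N\<close>, the \<open>j\<close> single
  steps enlarge the Lipschitz constant by at most \<open>L ^ N\<close>, and the \<open>k\<close>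
  blocks of length \<open>N\<close> are controlled uniformly by
  \<open>op_contraction_iterate\<close>.\<close>

lemma lipschitz_equicontinuous:
  assumes N: "contracts N \<alpha> \<theta> r0" "N \<ge> 1" and \<theta>: "0 < \<theta>" "\<theta> < 1" and r0: "0 < r0" and \<alpha>: "0 < \<alpha>" "\<alpha> \<le> 1"
    and lip: "\<And>t x y. \<bar>\<phi> (Disc t, x) - \<phi> (Disc t, y)\<bar> \<le> l * dist x y" and A: "\<And>z. \<bar>\<phi> z\<bar> \<le> A"
  shows "equicontinuous \<phi>"
  unfolding equicontinuous_def
proof (intro allI impI)
  fix \<epsilon> :: real assume \<epsilon>: "\<epsilon> > 0"
  define r where "r = min r0 1"
  have r: "0 < r" "r \<le> 1" using r0 by (auto simp: r_def)
  have Nr: "contracts N \<alpha> \<theta> r" using contracts_antimono[OF N(1)] by (simp add: r_def)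
  define H where "H = \<bar>l\<bar> * L ^ N"
  define B where "B = H + \<theta> / (1 - \<theta>) * (2 * A / r powr \<alpha>)"
  have A0: "0 \<le> A" using A[of undefined] by linarith
  have H0: "0 \<le> H" using L by (simp add: H_def)
  have B0: "0 \<le> B" using A0 H0 \<theta> by (simp add: B_def)
  have hold: "\<bar>(\<K> ^^ n) \<phi> (Disc t, x) - (\<K> ^^ n) \<phi> (Disc t, y)\<bar> \<le> B * dist x y powr \<alpha>" if d: "dist x y < r" for n t x y
  proof -
    define j where "j = n mod N"
    define k where "k = n div N"
    have jN: "j < N" using N(2) by (simp add: j_def)
    have n: "(\<K> ^^ n) \<phi> = (\<K> ^^ (k * N)) ((\<K> ^^ j) \<phi>)"
      unfolding j_def k_def funpow_add[THEN fun_cong, unfolded comp_def, symmetric] by simp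
    have "\<bar>(\<K> ^^ j) \<phi> (Disc t, x) - (\<K> ^^ j) \<phi> (Disc t, y)\<bar> \<le> H * dist x y powr \<alpha>" if d: "dist x y < r" for t x y
    proof -
      have "\<bar>(\<K> ^^ j) \<phi> (Disc t, x) - (\<K> ^^ j) \<phi> (Disc t, y)\<bar> \<le> path_exp q j t (\<lambda>_ _. H * dist x y)"
        unfolding markov_op_power
      proof (rule path_exp_abs_diff_le)
        fix w :: "'t list" and u assume w: "length w = j"
        have "\<bar>\<phi> (Disc u, word_map f w x) - \<phi> (Disc u, word_map f w y)\<bar> \<le> \<bar>l\<bar> * dist (word_map f w x) (word_map f w y)"
          using lip[of u "word_map f w x" "word_map f w y"] by (intro order_trans[OF lip] mult_right_mono) auto
        also have "\<dots> \<le> \<bar>l\<bar> * (L ^ N * dist x y)"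
        proof (intro mult_left_mono)
          have "dist (word_map f w x) (word_map f w y) \<le> L ^ j * dist x y"
            using lipschitz_onD[OF word_map_lip, of x y w] by (simp add: w)
          also have "\<dots> \<le> L ^ N * dist x y" using jN L by (intro mult_right_mono power_increasing) auto
          finally show "dist (word_map f w x) (word_map f w y) \<le> L ^ N * dist x y" .
        qed simp
        finally show "\<bar>\<phi> (Disc u, word_map f w x) - \<phi> (Disc u, word_map f w y)\<bar> \<le> H * dist x y" by (simp add: H_def)
      qed
      also have "\<dots> = H * dist x y" by (rule path_exp_const)
      also have "dist x y \<le> dist x y powr \<alpha>"
        using powr_mono'[of \<alpha> 1 "dist x y"] \<alpha> d r by (cases "x = y") auto
      finally show ?thesis using H0 by (simp add: mult_left_mono)
    qed
    from op_contraction_iterate[OF Nr \<theta> r(1) \<alpha>(1) H0 op_power_bound[where \<phi> = \<phi>, OF A] this d]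
    show ?thesis unfolding n B_def .
  qed
  define \<rho> where "\<rho> = min r ((\<epsilon> / (B + 1)) powr (1 / \<alpha>))"
  have "\<rho> > 0" using r \<epsilon> B0 by (simp add: \<rho>_def)
  moreover have "\<bar>(\<K> ^^ n) \<phi> z - (\<K> ^^ n) \<phi> z'\<bar> \<le> \<epsilon>" if d: "dist z z' < \<rho>" for n z z'
  proof -
    obtain t x where z: "z = (Disc t, x)" by (metis disc.exhaust surj_pair)
    obtain s y where z': "z' = (Disc s, y)" by (metis disc.exhaust surj_pair)
    have ts: "t = s" and xy: "dist x y < \<rho>"
      using dist_disc_times_less[of t x s y \<rho>] d r by (auto simp: z z' \<rho>_def)
    have "dist x y powr \<alpha> \<le> ((\<epsilon> / (B + 1)) powr (1 / \<alpha>)) powr \<alpha>"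
      using xy \<alpha> by (intro powr_mono2) (auto simp: \<rho>_def)
    also have "\<dots> = \<epsilon> / (B + 1)" using \<alpha> \<epsilon> B0 by (simp add: powr_powr)
    finally have "B * dist x y powr \<alpha> \<le> B * (\<epsilon> / (B + 1))" using B0 by (intro mult_left_mono)
    also have "\<dots> \<le> \<epsilon>" using \<epsilon> B0 by (simp add: field_simps)
    finally show ?thesis using hold[of x y n t] xy by (simp add: z z' ts \<rho>_def)
  qed
  ultimately show "\<exists>\<rho>>0. \<forall>n z z'. dist z z' < \<rho> \<longrightarrow> \<bar>(\<K> ^^ n) \<phi> z - (\<K> ^^ n) \<phi> z'\<bar> \<le> \<epsilon>" by blast
qed

end

section \<open>Orbits of the skew product\<close>

lemma fiber_iter_word: "fiber_iter f n \<omega> x = word_map f (map \<omega> [0..<n]) x"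
  by (induction n) (simp_all add: word_map_append)

lemma fiber_iter_add: "fiber_iter f i ((shift ^^ j) \<omega>) (fiber_iter f j \<omega> x) = fiber_iter f (j + i) \<omega> x"
  by (induction i) (simp_all add: shift_power_apply)

text \<open>Shifting the summation range by \<open>i\<close> exchanges at most \<open>i\<close>
  terms at each end, a change of at most \<open>2 * i * B\<close>.\<close>

lemma averages_of_windows:
  fixes a :: "nat \<Rightarrow> real"
  assumes a: "\<And>j. \<bar>a j\<bar> \<le> B" and m: "m \<ge> 1" and n: "n \<ge> 1"
  shows "\<bar>(\<Sum>j<n. (\<Sum>i<m. a (j + i)) / real m) / real n - (\<Sum>j<n. a j) / real n\<bar> \<le> 2 * real m * B / real n"
proof -
  have B: "0 \<le> B" using a[of 0] by linarith
  have one: "\<bar>(\<Sum>j<n. a (j + i)) - (\<Sum>j<n. a j)\<bar> \<le> 2 * real i * B" for i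
  proof (induction i)
    case (Suc i)
    have "(\<Sum>j<n. a (j + Suc i)) - (\<Sum>j<n. a (j + i)) = a (n + i) - a i"
      using sum_lessThan_telescope[of "\<lambda>j. a (j + i)" n] by (simp add: sum_subtractf)
    then have "\<bar>(\<Sum>j<n. a (j + Suc i)) - (\<Sum>j<n. a (j + i))\<bar> \<le> 2 * B"
      using a[of "n + i"] a[of i] by linarith
    with Suc.IH show ?case by (simp add: algebra_simps)
  qed simp
  have "(\<Sum>j<n. (\<Sum>i<m. a (j + i)) / real m) - (\<Sum>j<n. a j)
      = (\<Sum>i<m. (\<Sum>j<n. a (j + i)) - (\<Sum>j<n. a j)) / real m"
    using m by (simp add: sum_subtractf sum_divide_distrib[symmetric] sum.swap[of _ "{..<m}"] field_simps)
  also have "\<bar>\<dots>\<bar> \<le> (\<Sum>i<m. 2 * real m * B) / real m"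
  proof -
    have "\<bar>\<Sum>i<m. (\<Sum>j<n. a (j + i)) - (\<Sum>j<n. a j)\<bar> \<le> (\<Sum>i<m. 2 * real m * B)"
    proof (intro order_trans[OF sum_abs] sum_mono)
      fix i assume "i \<in> {..<m}"
      then have "2 * real i * B \<le> 2 * real m * B" using B by (intro mult_right_mono) auto
      then show "\<bar>(\<Sum>j<n. a (j + i)) - (\<Sum>j<n. a j)\<bar> \<le> 2 * real m * B" using one[of i] by linarith
    qed
    then show ?thesis unfolding abs_divide abs_of_nat by (intro divide_right_mono) auto
  qed
  also have "\<dots> = 2 * real m * B" using m by simp
  finally show ?thesis
    by (simp add: diff_divide_distrib[symmetric] divide_right_mono)
qed

locale skew_walk = markov_path Q p P + lipschitz_walk "markov_path.q Q" f L
  for Q :: "'t::finite \<Rightarrow> 't measure" and p :: "'t measure" and P :: "(nat \<Rightarrow> 't) measure"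
    and f :: "'t \<Rightarrow> 'x::metric_space \<Rightarrow> 'x" and L :: real
begin

definition support :: "('t disc \<times> 'x) set" where
  "support = {Disc t |t. pp t > 0} \<times> UNIV"

lemma in_support [simp]: "(Disc t, x) \<in> support \<longleftrightarrow> pp t > 0"
  by (simp add: support_def)

lemma absorbing_support: "absorbing support"
  unfolding absorbing_def
proof (intro conjI allI impI)
  have "finite {Disc t |t. pp t > 0}" by (rule finite_subset[OF _ finite_imageI[OF finite[of "UNIV :: 't set"], of Disc]]) auto
  then show "closed support" unfolding support_def by (rule closed_Times[OF finite_imp_closed closed_UNIV])
  show "(Disc u, f t x) \<in> support" if "(Disc t, x) \<in> support" "q t u > 0" for t x u
    using that pp_closed by simp
qed

lemma support_nonempty: "support \<noteq> {}"
proof -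
  have "\<exists>t. pp t > 0"
  proof (rule ccontr)
    assume contra: "\<not> ?thesis"
    have "pp t = 0" for t using pp_nonneg[of t] contra by (meson antisym not_less)
    then show False using pp_sum by simp
  qed
  then show ?thesis by (auto simp: support_def)
qed

text \<open>The conditional expectation given the first symbol and the position. It intertwines the
  skew product with \<open>\<K>\<close>, see \<open>orbit_mean\<close>.\<close>

definition fiber_mean :: "((nat \<Rightarrow> 't) \<Rightarrow> 'x \<Rightarrow> real) \<Rightarrow> 't disc \<times> 'x \<Rightarrow> real" where
  "fiber_mean G z = (case z of (Disc t, x) \<Rightarrow> \<integral>\<omega>. G \<omega> x \<partial>PP t)"

lemma fiber_mean_apply [simp]: "fiber_mean G (Disc t, x) = (\<integral>\<omega>. G \<omega> x \<partial>PP t)"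
  by (simp add: fiber_mean_def)

lemma fiber_mean_bound:
  assumes "\<And>x. (\<lambda>\<omega>. G \<omega> x) \<in> borel_measurable path_algebra" "\<And>\<omega> x. \<bar>G \<omega> x\<bar> \<le> B"
  shows "\<bar>fiber_mean G z\<bar> \<le> B"
proof -
  obtain t x where z: "z = (Disc t, x)" by (metis disc.exhaust surj_pair)
  interpret PP: prob_space "PP t" by (rule PP_prob)
  have int: "integrable (PP t) (\<lambda>\<omega>. G \<omega> x)"
    using assms by (intro PP.integrable_const_bound[of _ B]) (auto simp: PP_measurable_iff)
  have "\<bar>\<integral>\<omega>. G \<omega> x \<partial>PP t\<bar> \<le> (\<integral>\<omega>. \<bar>G \<omega> x\<bar> \<partial>PP t)" by (rule integral_abs_bound)
  also have "\<dots> \<le> (\<integral>\<omega>. B \<partial>PP t)" using int assms(2) by (intro integral_mono) auto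
  finally show ?thesis by (simp add: z PP.prob_space)
qed

lemma orbit_mean:
  assumes t: "pp t > 0" and G: "\<And>x. (\<lambda>\<omega>. G \<omega> x) \<in> borel_measurable path_algebra" "\<And>\<omega> x. \<bar>G \<omega> x\<bar> \<le> B"
  shows "(\<integral>\<omega>. G ((shift ^^ n) \<omega>) (fiber_iter f n \<omega> x) \<partial>PP t) = (\<K> ^^ n) (fiber_mean G) (Disc t, x)"
  unfolding fiber_iter_word markov_op_power fiber_mean_apply
  using G by (intro integral_PP_shift_power[OF t, where H = "\<lambda>w \<omega>. G \<omega> (word_map f w x)" and B = B])

lemma orbit_measurable:
  assumes "\<And>x. (\<lambda>\<omega>. G \<omega> x) \<in> measurable path_algebra N"
  shows "(\<lambda>\<omega>. G ((shift ^^ n) \<omega>) (fiber_iter f n \<omega> x)) \<in> measurable path_algebra N"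
  unfolding fiber_iter_word using assms
  by (intro prefix_compose_measurable[where H = "\<lambda>w \<omega>. G \<omega> (word_map f w x)"])

text \<open>The probability of being outside \<open>C\<close> at time \<open>j\<close> is
  \<open>\<K> ^^ j\<close> applied to a function that vanishes on \<open>C \<inter> support\<close>,
  which is again absorbing.\<close>

lemma orbit_stays:
  assumes C: "absorbing C" "(Disc t, x) \<in> C" and t: "pp t > 0"
  shows "AE \<omega> in PP t. \<forall>j. (Disc (\<omega> j), fiber_iter f j \<omega> x) \<in> C"
proof -
  interpret PP: prob_space "PP t" by (rule PP_prob)
  define G where "G \<omega> y = (of_bool ((Disc (\<omega> 0), y) \<notin> C) :: real)" for \<omega> :: "nat \<Rightarrow> 't" and y
  have Gm: "(\<lambda>\<omega>. G \<omega> y) \<in> borel_measurable path_algebra" for y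
    unfolding G_def by (rule measurable_compose[OF component_measurable]) simp
  have Gb: "\<bar>G \<omega> y\<bar> \<le> 1" for \<omega> y by (simp add: G_def)
  have zero: "fiber_mean G z = 0" if "z \<in> C \<inter> support" for z
  proof -
    obtain u y where z: "z = (Disc u, y)" by (metis disc.exhaust surj_pair)
    have "AE \<omega> in PP u. G \<omega> y = 0"
      using AE_PP_start[of u] that by (auto simp: z G_def)
    then show ?thesis by (simp add: z integral_eq_zero_AE)
  qed
  have "AE \<omega> in PP t. (Disc (\<omega> j), fiber_iter f j \<omega> x) \<in> C" for j
  proof -
    have m: "(\<lambda>\<omega>. G ((shift ^^ j) \<omega>) (fiber_iter f j \<omega> x)) \<in> borel_measurable (PP t)"
      unfolding PP_measurable_iff by (rule orbit_measurable[OF Gm])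
    have "(\<integral>\<omega>. G ((shift ^^ j) \<omega>) (fiber_iter f j \<omega> x) \<partial>PP t) = (\<K> ^^ j) (fiber_mean G) (Disc t, x)"
      by (rule orbit_mean[OF t Gm Gb])
    also have "\<dots> = (\<K> ^^ j) (\<lambda>_. 0) (Disc t, x)"
      using zero C t by (intro op_power_eq_on[OF absorbing_Int[OF C(1) absorbing_support]]) auto
    finally have "(\<integral>\<omega>. G ((shift ^^ j) \<omega>) (fiber_iter f j \<omega> x) \<partial>PP t) = 0" by (simp add: op_power_const)
    moreover have "integrable (PP t) (\<lambda>\<omega>. G ((shift ^^ j) \<omega>) (fiber_iter f j \<omega> x))"
      using m Gb by (intro PP.integrable_const_bound[of _ 1]) auto
    ultimately have "AE \<omega> in PP t. G ((shift ^^ j) \<omega>) (fiber_iter f j \<omega> x) = 0"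
      by (subst (asm) integral_nonneg_eq_0_iff_AE) (auto simp: G_def)
    then show ?thesis by eventually_elim (simp add: G_def shift_power_apply)
  qed
  then show ?thesis by (subst AE_all_countable) auto
qed

text \<open>\<open>\<Gamma>\<close> sees \<open>k\<close> symbols and has conditional mean 0, so by
  the Markov property terms at times at least \<open>k\<close> apart are orthogonal. The second
  moment of the sum is then linear in \<open>n\<close>, as \<open>averages_tendsto_zero_AE\<close>
  requires.\<close>

lemma orbit_lln:
  assumes t: "pp t > 0" and A: "\<And>\<omega> y. \<bar>\<Gamma> \<omega> y\<bar> \<le> A"
    and m: "\<And>y. (\<lambda>\<omega>. \<Gamma> \<omega> y) \<in> borel_measurable path_algebra"
    and dep: "\<And>\<omega> \<omega>' y. (\<And>i. i < k \<Longrightarrow> \<omega> i = \<omega>' i) \<Longrightarrow> \<Gamma> \<omega> y = \<Gamma> \<omega>' y"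
    and zero: "\<And>u y. pp u > 0 \<Longrightarrow> (\<integral>\<omega>. \<Gamma> \<omega> y \<partial>PP u) = 0"
  shows "AE \<omega> in PP t. (\<lambda>n. (\<Sum>j<n. \<Gamma> ((shift ^^ j) \<omega>) (fiber_iter f j \<omega> x)) / real n) \<longlonglongrightarrow> 0"
proof -
  interpret PP: prob_space "PP t" by (rule PP_prob)
  define D where "D j \<omega> = \<Gamma> ((shift ^^ j) \<omega>) (fiber_iter f j \<omega> x)" for j \<omega>
  have A0: "0 \<le> A" using A[of undefined undefined] by linarith
  have Dm: "D j \<in> borel_measurable (PP t)" for j
    unfolding PP_measurable_iff D_def by (rule orbit_measurable[OF m])
  have Db: "\<bar>D j \<omega>\<bar> \<le> A" for j \<omega> by (simp add: D_def A)
  have DDb: "\<bar>D i \<omega> * D j \<omega>\<bar> \<le> A * A" for i j \<omega>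
    unfolding abs_mult using Db A0 by (intro mult_mono) auto
  have DDi: "integrable (PP t) (\<lambda>\<omega>. D i \<omega> * D j \<omega>)" for i j
    using Dm DDb by (intro PP.integrable_const_bound[of _ "A * A"]) auto
  have orth: "(\<integral>\<omega>. D i \<omega> * D j \<omega> \<partial>PP t) = 0" if ij: "i + k \<le> j" for i j
  proof -
    \<comment> \<open>Expresses \<open>D i\<close> through the prefix of length \<open>j\<close>:
      the symbols of index below \<open>i + k \<le> j\<close> are read from \<open>w\<close>, and by
      \<open>dep\<close> the padding beyond them does not change the value.\<close>
    define g where "g w = \<Gamma> (\<lambda>n. if i + n < length w then w ! (i + n) else undefined) (word_map f (take i w) x)" for w
    define H where "H w \<omega> = g w * \<Gamma> \<omega> (word_map f w x)" for w \<omega>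
    have "D i \<omega> = g (map \<omega> [0..<j])" for \<omega>
    proof -
      have "take i (map \<omega> [0..<j]) = map \<omega> [0..<i]" using ij by (simp add: take_map)
      then show ?thesis
        unfolding D_def g_def fiber_iter_word using ij by (auto intro!: dep simp: shift_power_apply)
    qed
    then have "D i \<omega> * D j \<omega> = H (map \<omega> [0..<j]) ((shift ^^ j) \<omega>)" for \<omega>
      by (simp add: H_def D_def fiber_iter_word)
    then have "(\<integral>\<omega>. D i \<omega> * D j \<omega> \<partial>PP t) = (\<integral>\<omega>. H (map \<omega> [0..<j]) ((shift ^^ j) \<omega>) \<partial>PP t)" by simp
    also have "\<dots> = path_exp q j t (\<lambda>w u. \<integral>\<omega>. H w \<omega> \<partial>PP u)"
    proof (rule integral_PP_shift_power[OF t, where B = "A * A"])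
      show "H w \<in> borel_measurable path_algebra" for w
        unfolding H_def by (intro borel_measurable_times borel_measurable_const m)
      show "\<bar>H w \<omega>\<bar> \<le> A * A" for w \<omega>
        unfolding H_def abs_mult g_def using A A0 by (intro mult_mono) auto
    qed
    also have "\<dots> = path_exp q j t (\<lambda>_ _. 0)"
    proof -
      have z: "(\<integral>\<omega>. H w \<omega> \<partial>PP u) = 0" if "pp u > 0" for w u
        unfolding H_def using zero[OF that] by simp
      have "path_exp q j t F \<le> path_exp q j t G" if "\<And>w u. pp u > 0 \<Longrightarrow> F w u \<le> G w u" for F G
        by (rule path_exp_mono_invariant[where R = "\<lambda>t s. pp t > 0" and g = "\<lambda>_ s. s"])
          (use that pp_closed t in auto)
      then show ?thesis using z by (intro antisym) auto
    qed
    finally show ?thesis by (simp add: path_exp_const)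
  qed
  have "PP.expectation (\<lambda>\<omega>. (\<Sum>j<n. D j \<omega>)\<^sup>2) \<le> (2 * real k * (A * A)) * real n" for n
  proof -
    have "(\<Sum>j<n. D j \<omega>)\<^sup>2 = (\<Sum>i<n. \<Sum>j<n. D i \<omega> * D j \<omega>)" for \<omega>
      by (simp add: power2_eq_square sum_product)
    then have "PP.expectation (\<lambda>\<omega>. (\<Sum>j<n. D j \<omega>)\<^sup>2) = (\<Sum>i<n. \<Sum>j<n. \<integral>\<omega>. D i \<omega> * D j \<omega> \<partial>PP t)"
      using DDi by (simp add: Bochner_Integration.integral_sum)
    also have "\<dots> \<le> (\<Sum>i<n. 2 * real k * (A * A))"
    proof (rule sum_mono)
      fix i
      let ?I = "{j. j < n \<and> i < j + k \<and> j < i + k}"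
      have "(\<Sum>j<n. \<integral>\<omega>. D i \<omega> * D j \<omega> \<partial>PP t) \<le> (\<Sum>j<n. if i < j + k \<and> j < i + k then A * A else 0)"
      proof (rule sum_mono)
        fix j
        have "(\<integral>\<omega>. D i \<omega> * D j \<omega> \<partial>PP t) \<le> (\<integral>\<omega>. A * A \<partial>PP t)"
          using DDi DDb by (intro integral_mono) (auto simp: abs_le_iff)
        then have "(\<integral>\<omega>. D i \<omega> * D j \<omega> \<partial>PP t) \<le> A * A" by (simp add: PP.prob_space)
        moreover have "(\<integral>\<omega>. D i \<omega> * D j \<omega> \<partial>PP t) = 0" if "\<not> (i < j + k \<and> j < i + k)"
          using that orth[of i j] orth[of j i] by (auto simp: not_less mult.commute)
        ultimately show "(\<integral>\<omega>. D i \<omega> * D j \<omega> \<partial>PP t) \<le> (if i < j + k \<and> j < i + k then A * A else 0)" by auto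
      qed
      also have "\<dots> = (\<Sum>j\<in>?I. A * A)"
        by (subst sum.inter_filter[symmetric]) (auto intro!: sum.cong)
      also have "\<dots> = real (card ?I) * (A * A)" by simp
      also have "\<dots> \<le> 2 * real k * (A * A)"
      proof (rule mult_right_mono)
        have "card ?I \<le> card {i + 1 - k..<i + k}" by (intro card_mono) auto
        then show "real (card ?I) \<le> 2 * real k" by simp
      qed (simp add: A0)
      finally show "(\<Sum>j<n. \<integral>\<omega>. D i \<omega> * D j \<omega> \<partial>PP t) \<le> 2 * real k * (A * A)" .
    qed
    finally show ?thesis by (simp add: mult.commute)
  qed
  from PP.averages_tendsto_zero_AE[where D = D, OF Dm Db this] show ?thesis unfolding D_def .
qed

definition orbit_avg :: "((nat \<Rightarrow> 't) \<Rightarrow> 'x \<Rightarrow> real) \<Rightarrow> nat \<Rightarrow> (nat \<Rightarrow> 't) \<Rightarrow> 'x \<Rightarrow> real" where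
  "orbit_avg \<Phi> n \<omega> x = (\<Sum>j<n. \<Phi> ((shift ^^ j) \<omega>) (fiber_iter f j \<omega> x)) / real n"

text \<open>\<open>\<Phi>\<close> is replaced by its average \<open>G\<close> over \<open>m\<close>
  steps, whose conditional mean is nearly constant on \<open>M\<close> by
  \<open>avg_uniform\<close>. The centred part obeys \<open>orbit_lln\<close>, and by
  \<open>averages_of_windows\<close> the orbit averages of \<open>G\<close> and of
  \<open>\<Phi>\<close> agree asymptotically.\<close>

lemma orbit_avg_near:
  assumes M: "minimal M" "(Disc t, x) \<in> M" "pp t > 0" and \<eta>: "stationary \<eta>" "AE z in \<eta>. z \<in> M"
    and B: "\<And>\<omega> y. \<bar>\<Phi> \<omega> y\<bar> \<le> B"
    and meas: "\<And>y. (\<lambda>\<omega>. \<Phi> \<omega> y) \<in> borel_measurable path_algebra"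
    and dep: "\<And>\<omega> \<omega>' y. (\<And>i. i < k \<Longrightarrow> \<omega> i = \<omega>' i) \<Longrightarrow> \<Phi> \<omega> y = \<Phi> \<omega>' y"
    and cont: "continuous_on UNIV (fiber_mean \<Phi>)" "equicontinuous (fiber_mean \<Phi>)"
    and \<epsilon>: "\<epsilon> > 0"
  shows "AE \<omega> in PP t. \<forall>\<^sub>F n in sequentially. \<bar>orbit_avg \<Phi> n \<omega> x - (\<integral>z. fiber_mean \<Phi> z \<partial>\<eta>)\<bar> \<le> \<epsilon>"
proof -
  define \<psi> where "\<psi> = fiber_mean \<Phi>"
  define c where "c = (\<integral>z. \<psi> z \<partial>\<eta>)"
  have abs: "absorbing M" using M(1) by (simp add: minimal_def)
  have "\<epsilon> / 3 > 0" using \<epsilon> by simp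
  from avg_uniform[OF M(1) cont this \<eta>] obtain m where m: "m \<ge> 1" "\<And>z. z \<in> M \<Longrightarrow> \<bar>avg m \<psi> z - c\<bar> \<le> \<epsilon> / 3"
    unfolding \<psi>_def c_def by blast
  define G where "G \<omega> y = (\<Sum>i<m. \<Phi> ((shift ^^ i) \<omega>) (fiber_iter f i \<omega> y)) / real m" for \<omega> y
  have B0: "0 \<le> B" using B[of undefined undefined] by linarith
  have Gm: "(\<lambda>\<omega>. G \<omega> y) \<in> borel_measurable path_algebra" for y
    unfolding G_def by (intro borel_measurable_divide borel_measurable_sum orbit_measurable[OF meas] borel_measurable_const)
  have Gb: "\<bar>G \<omega> y\<bar> \<le> B" for \<omega> y
  proof -
    have "\<bar>\<Sum>i<m. \<Phi> ((shift ^^ i) \<omega>) (fiber_iter f i \<omega> y)\<bar> \<le> (\<Sum>i<m. B)"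
      using B by (intro order_trans[OF sum_abs] sum_mono)
    then show ?thesis using m(1) by (simp add: G_def divide_le_eq mult.commute)
  qed
  have G_mean: "(\<integral>\<omega>. G \<omega> y \<partial>PP u) = avg m \<psi> (Disc u, y)" if "pp u > 0" for u y
  proof -
    interpret PPu: prob_space "PP u" by (rule PP_prob)
    have "integrable (PP u) (\<lambda>\<omega>. \<Phi> ((shift ^^ i) \<omega>) (fiber_iter f i \<omega> y))" for i
      using B orbit_measurable[OF meas] by (intro PPu.integrable_const_bound[of _ B]) (auto simp: PP_measurable_iff)
    then show ?thesis
      unfolding G_def avg_def \<psi>_def using orbit_mean[where G = \<Phi>, OF that meas B]
      by (simp add: Bochner_Integration.integral_sum)
  qed
  \<comment> \<open>Centred by the conditional mean given the first symbol; along the orbit this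
    mean is \<open>avg m \<psi>\<close>, which is within \<open>\<epsilon> / 3\<close> of
    \<open>c\<close>.\<close>
  define \<Gamma> where "\<Gamma> \<omega> y = G \<omega> y - (\<integral>\<omega>'. G \<omega>' y \<partial>PP (\<omega> 0))" for \<omega> y
  have mean_b: "\<bar>\<integral>\<omega>'. G \<omega>' y \<partial>PP u\<bar> \<le> B" for u y
    using fiber_mean_bound[where G = G, OF Gm Gb, of "(Disc u, y)"] by simp
  have lln: "AE \<omega> in PP t. (\<lambda>n. (\<Sum>j<n. \<Gamma> ((shift ^^ j) \<omega>) (fiber_iter f j \<omega> x)) / real n) \<longlonglongrightarrow> 0"
  proof (rule orbit_lln[OF M(3), where k = "Suc (m + k)" and A = "2 * B"])
    show "\<bar>\<Gamma> \<omega> y\<bar> \<le> 2 * B" for \<omega> y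
      using Gb[of \<omega> y] mean_b[where u = "\<omega> 0" and y = y] unfolding \<Gamma>_def by linarith
    show "(\<lambda>\<omega>. \<Gamma> \<omega> y) \<in> borel_measurable path_algebra" for y
      unfolding \<Gamma>_def by (intro borel_measurable_diff Gm measurable_compose[OF component_measurable]) simp
    show "\<Gamma> \<omega> y = \<Gamma> \<omega>' y" if "\<And>i. i < Suc (m + k) \<Longrightarrow> \<omega> i = \<omega>' i" for \<omega> \<omega>' y
    proof -
      have "\<Phi> ((shift ^^ i) \<omega>) (fiber_iter f i \<omega> y) = \<Phi> ((shift ^^ i) \<omega>') (fiber_iter f i \<omega>' y)" if i: "i < m" for i
      proof -
        have eq: "map \<omega> [0..<i] = map \<omega>' [0..<i]" using i \<open>\<And>i. i < Suc (m + k) \<Longrightarrow> \<omega> i = \<omega>' i\<close> by simp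
        show ?thesis
          unfolding fiber_iter_word eq
          by (rule dep) (use i \<open>\<And>i. i < Suc (m + k) \<Longrightarrow> \<omega> i = \<omega>' i\<close> in \<open>simp add: shift_power_apply\<close>)
      qed
      then have "G \<omega> y = G \<omega>' y" by (simp add: G_def)
      moreover have "\<omega> 0 = \<omega>' 0" using that by simp
      ultimately show ?thesis by (simp add: \<Gamma>_def)
    qed
    show "(\<integral>\<omega>. \<Gamma> \<omega> y \<partial>PP u) = 0" if u: "pp u > 0" for u y
    proof -
      interpret PPu: prob_space "PP u" by (rule PP_prob)
      have "(\<integral>\<omega>. \<Gamma> \<omega> y \<partial>PP u) = (\<integral>\<omega>. G \<omega> y - (\<integral>\<omega>'. G \<omega>' y \<partial>PP u) \<partial>PP u)"
      proof (rule integral_cong_AE)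
        show "AE \<omega> in PP u. \<Gamma> \<omega> y = G \<omega> y - (\<integral>\<omega>'. G \<omega>' y \<partial>PP u)"
          using AE_PP_start[OF u] by eventually_elim (simp add: \<Gamma>_def)
        show "(\<lambda>\<omega>. \<Gamma> \<omega> y) \<in> borel_measurable (PP u)"
          unfolding \<Gamma>_def PP_measurable_iff
          by (intro borel_measurable_diff Gm measurable_compose[OF component_measurable]) simp
        show "(\<lambda>\<omega>. G \<omega> y - (\<integral>\<omega>'. G \<omega>' y \<partial>PP u)) \<in> borel_measurable (PP u)"
          unfolding PP_measurable_iff by (intro borel_measurable_diff Gm borel_measurable_const)
      qed
      also have "\<dots> = 0"
      proof -
        have "integrable (PP u) (\<lambda>\<omega>. G \<omega> y)"
          using Gm Gb by (intro PPu.integrable_const_bound[of _ B]) (auto simp: PP_measurable_iff)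
        then show ?thesis by (simp add: PPu.prob_space)
      qed
      finally show ?thesis .
    qed
  qed
  have "AE \<omega> in PP t. \<forall>j. (Disc (\<omega> j), fiber_iter f j \<omega> x) \<in> support"
    by (rule orbit_stays[OF absorbing_support _ M(3)]) (simp add: M(3))
  with lln orbit_stays[OF abs M(2,3)] show ?thesis
  proof eventually_elim
    case (elim \<omega>)
    define a where "a j = \<Phi> ((shift ^^ j) \<omega>) (fiber_iter f j \<omega> x)" for j
    have supp: "pp (\<omega> j) > 0" for j using elim(3) M(3) by simp
    have Ga: "G ((shift ^^ j) \<omega>) (fiber_iter f j \<omega> x) = (\<Sum>i<m. a (j + i)) / real m" for j
      unfolding G_def a_def fiber_iter_add funpow_add[of _ j, symmetric, THEN fun_cong, unfolded comp_def] 
      by (simp add: funpow_add add.commute)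
    have \<Gamma>a: "\<bar>(\<Sum>i<m. a (j + i)) / real m - c\<bar> \<le> \<bar>\<Gamma> ((shift ^^ j) \<omega>) (fiber_iter f j \<omega> x)\<bar> + \<epsilon> / 3" for j
    proof -
      have "\<bar>avg m \<psi> (Disc (\<omega> j), fiber_iter f j \<omega> x) - c\<bar> \<le> \<epsilon> / 3" using elim(2) by (intro m(2)) simp
      moreover have "\<Gamma> ((shift ^^ j) \<omega>) (fiber_iter f j \<omega> x) = (\<Sum>i<m. a (j + i)) / real m - avg m \<psi> (Disc (\<omega> j), fiber_iter f j \<omega> x)"
        unfolding \<Gamma>_def Ga using G_mean[OF supp] by (simp add: shift_power_apply)
      ultimately show ?thesis by linarith
    qed
    have "\<forall>\<^sub>F n in sequentially. \<bar>(\<Sum>j<n. \<Gamma> ((shift ^^ j) \<omega>) (fiber_iter f j \<omega> x)) / real n\<bar> < \<epsilon> / 3"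
      using tendstoD[OF elim(1) \<open>\<epsilon> / 3 > 0\<close>] unfolding dist_real_def diff_0_right .
    moreover have "\<forall>\<^sub>F n in sequentially. 2 * real m * B / real n < \<epsilon> / 3"
    proof -
      have "(\<lambda>n. 2 * real m * B / real n) \<longlonglongrightarrow> 0"
        by (intro tendsto_divide_0[OF tendsto_const] filterlim_at_top_imp_at_infinity filterlim_real_sequentially)
      then show ?thesis using \<open>\<epsilon> / 3 > 0\<close> by (rule order_tendstoD(2))
    qed
    ultimately show ?case using eventually_ge_at_top[of 1]
    proof eventually_elim
      case (elim n)
      have "(\<Sum>j<n. (\<Sum>i<m. a (j + i)) / real m) / real n - c
          = (\<Sum>j<n. \<Gamma> ((shift ^^ j) \<omega>) (fiber_iter f j \<omega> x)) / real n
            + (\<Sum>j<n. avg m \<psi> (Disc (\<omega> j), fiber_iter f j \<omega> x) - c) / real n"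
      proof -
        have "(\<Sum>i<m. a (j + i)) / real m = \<Gamma> ((shift ^^ j) \<omega>) (fiber_iter f j \<omega> x) + avg m \<psi> (Disc (\<omega> j), fiber_iter f j \<omega> x)" for j
          unfolding \<Gamma>_def Ga using G_mean[OF supp] by (simp add: shift_power_apply)
        then show ?thesis using elim(3) by (simp add: sum.distrib sum_subtractf add_divide_distrib diff_divide_distrib)
      qed
      moreover have "\<bar>(\<Sum>j<n. avg m \<psi> (Disc (\<omega> j), fiber_iter f j \<omega> x) - c) / real n\<bar> \<le> \<epsilon> / 3"
      proof -
        have "\<bar>\<Sum>j<n. avg m \<psi> (Disc (\<omega> j), fiber_iter f j \<omega> x) - c\<bar> \<le> (\<Sum>j<n. \<epsilon> / 3)"
          using \<open>\<forall>j. (Disc (\<omega> j), fiber_iter f j \<omega> x) \<in> M\<close>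
          by (intro order_trans[OF sum_abs] sum_mono m(2)) simp
        then show ?thesis using elim(3) by (simp add: divide_le_eq mult.commute)
      qed
      moreover have "\<bar>(\<Sum>j<n. (\<Sum>i<m. a (j + i)) / real m) / real n - (\<Sum>j<n. a j) / real n\<bar> \<le> 2 * real m * B / real n"
        using B elim(3) by (intro averages_of_windows m(1)) (auto simp: a_def)
      ultimately have "\<bar>(\<Sum>j<n. a j) / real n - c\<bar> \<le> \<epsilon>" using elim(1,2) by linarith
      then show ?case by (simp add: orbit_avg_def a_def c_def \<psi>_def)
    qed
  qed
qed

lemma orbit_avg_tendsto:
  assumes M: "minimal M" "(Disc t, x) \<in> M" "pp t > 0" and \<eta>: "stationary \<eta>" "AE z in \<eta>. z \<in> M"
    and B: "\<And>\<omega> y. \<bar>\<Phi> \<omega> y\<bar> \<le> B"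
    and meas: "\<And>y. (\<lambda>\<omega>. \<Phi> \<omega> y) \<in> borel_measurable path_algebra"
    and dep: "\<And>\<omega> \<omega>' y. (\<And>i. i < k \<Longrightarrow> \<omega> i = \<omega>' i) \<Longrightarrow> \<Phi> \<omega> y = \<Phi> \<omega>' y"
    and cont: "continuous_on UNIV (fiber_mean \<Phi>)" "equicontinuous (fiber_mean \<Phi>)"
  shows "AE \<omega> in PP t. (\<lambda>n. orbit_avg \<Phi> n \<omega> x) \<longlonglongrightarrow> (\<integral>z. fiber_mean \<Phi> z \<partial>\<eta>)"
proof -
  let ?c = "\<integral>z. fiber_mean \<Phi> z \<partial>\<eta>"
  have "AE \<omega> in PP t. \<forall>e :: nat. \<forall>\<^sub>F n in sequentially. \<bar>orbit_avg \<Phi> n \<omega> x - ?c\<bar> \<le> 1 / real (Suc e)"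
    unfolding AE_all_countable by (intro allI orbit_avg_near[OF assms]) auto
  then show ?thesis
  proof eventually_elim
    case (elim \<omega>)
    show ?case
    proof (rule tendstoI)
      fix \<epsilon> :: real assume "\<epsilon> > 0"
      then obtain e where e: "1 / real (Suc e) < \<epsilon>" using nat_approx_posE by blast
      from elim have "\<forall>\<^sub>F n in sequentially. \<bar>orbit_avg \<Phi> n \<omega> x - ?c\<bar> \<le> 1 / real (Suc e)" by blast
      then show "\<forall>\<^sub>F n in sequentially. dist (orbit_avg \<Phi> n \<omega> x) ?c < \<epsilon>"
        by eventually_elim (use e in \<open>simp add: dist_real_def\<close>)
    qed
  qed
qed

end

section \<open>Test functions and basins\<close>

definition cyl_test :: "'t list \<Rightarrow> ('x \<Rightarrow> real) \<Rightarrow> (nat \<Rightarrow> 't) \<Rightarrow> 'x \<Rightarrow> real" where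
  "cyl_test w \<xi> \<omega> x = of_bool (map \<omega> [0..<length w] = w) * \<xi> x"

lemma cyl_test_bound:
  assumes "\<And>x. \<bar>\<xi> x\<bar> \<le> B"
  shows "\<bar>cyl_test w \<xi> \<omega> x\<bar> \<le> B"
proof -
  have "0 \<le> B" using assms[of x] abs_ge_zero[of "\<xi> x"] by linarith
  then show ?thesis using assms[of x] by (simp add: cyl_test_def)
qed

lemma cyl_test_measurable:
  "(\<lambda>\<omega>. cyl_test w \<xi> \<omega> x) \<in> borel_measurable (path_algebra :: (nat \<Rightarrow> 't::finite) measure)"
  unfolding cyl_test_def
  by (intro borel_measurable_times borel_measurable_const measurable_compose[OF prefix_measurable]) simp

lemma cyl_test_dep:
  assumes "\<And>i. i < length w \<Longrightarrow> \<omega> i = \<omega>' i"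
  shows "cyl_test w \<xi> \<omega> x = cyl_test w \<xi> \<omega>' x"
proof -
  have eq: "map \<omega> [0..<length w] = map \<omega>' [0..<length w]" using assms by simp
  show ?thesis unfolding cyl_test_def eq ..
qed

lemma cyl_test_skew_measurable:
  fixes \<xi> :: "'x::metric_space \<Rightarrow> real"
  assumes "\<xi> \<in> borel_measurable borel"
  shows "(\<lambda>(\<omega>, x). cyl_test w \<xi> \<omega> x) \<in> borel_measurable (skew_algebra :: ((nat \<Rightarrow> 't::finite) \<times> 'x) measure)"
proof -
  have "(\<lambda>z. of_bool (map (fst z) [0..<length w] = w) :: real) \<in> borel_measurable (skew_algebra :: ((nat \<Rightarrow> 't) \<times> 'x) measure)"
    unfolding skew_algebra_def
    by (rule measurable_compose[OF measurable_compose[OF measurable_fst prefix_measurable]]) simp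
  moreover have "(\<lambda>z. \<xi> (snd z)) \<in> borel_measurable (skew_algebra :: ((nat \<Rightarrow> 't) \<times> 'x) measure)"
    unfolding skew_algebra_def by (rule measurable_compose[OF measurable_snd assms])
  ultimately show ?thesis
    unfolding cyl_test_def case_prod_unfold by (rule borel_measurable_times)
qed

lemma cyl_test_continuous:
  fixes \<xi> :: "'x::metric_space \<Rightarrow> real"
  assumes "continuous_on UNIV \<xi>"
  shows "continuous_map (skew_topology :: ((nat \<Rightarrow> 't) \<times> 'x) topology) euclideanreal (\<lambda>(\<omega>, x). cyl_test w \<xi> \<omega> x)"
proof -
  let ?T = "skew_topology :: ((nat \<Rightarrow> 't) \<times> 'x) topology"
  have comp: "continuous_map ?T (discrete_topology UNIV) (\<lambda>z. fst z i)" for i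
  proof -
    have "continuous_map (product_topology (\<lambda>n. discrete_topology (UNIV :: 't set)) UNIV) (discrete_topology UNIV) (\<lambda>\<omega>. \<omega> i)"
      by (rule continuous_map_product_projection) simp
    then show ?thesis
      unfolding skew_topology_def using continuous_map_compose[OF continuous_map_fst, of _ _ "\<lambda>\<omega>. \<omega> i"] by (simp only: comp_def)
  qed
  have "continuous_map ?T euclideanreal (\<lambda>z. of_bool (fst z i = w ! i))" for i
    using continuous_map_compose[OF comp[of i], of euclideanreal "\<lambda>t. of_bool (t = w ! i)"]
    by (simp add: comp_def)
  then have "continuous_map ?T euclideanreal (\<lambda>z. \<Prod>i<length w. of_bool (fst z i = w ! i))"
    by (intro continuous_map_prod) auto
  moreover have "(\<Prod>i<length w. of_bool (\<omega> i = w ! i)) = (of_bool (map \<omega> [0..<length w] = w) :: real)" for \<omega> :: "nat \<Rightarrow> 't"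
  proof -
    have "map \<omega> [0..<length w] = w \<longleftrightarrow> (\<forall>i<length w. \<omega> i = w ! i)"
      by (subst list_eq_iff_nth_eq) auto
    then show ?thesis by (cases "\<forall>i<length w. \<omega> i = w ! i") auto
  qed
  moreover have "continuous_map ?T euclideanreal (\<lambda>z. \<xi> (snd z))"
  proof -
    have "continuous_map euclidean euclideanreal \<xi>" using assms by simp
    then show ?thesis
      unfolding skew_topology_def using continuous_map_compose[OF continuous_map_snd, of _ _ \<xi>] by (simp only: comp_def)
  qed
  ultimately show ?thesis
    unfolding cyl_test_def case_prod_unfold by (simp add: continuous_map_real_mult)
qed

text \<open>Paths over \<open>'t\<close> carry no metric, so \<open>\<phi>\<close> is pulled back to
  paths over \<open>'t disc\<close>, where compactness of the metric product makes continuity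
  uniform.\<close>

lemma skew_uniform_continuity:
  fixes \<phi> :: "(nat \<Rightarrow> 't::finite) \<times> 'x::metric_space \<Rightarrow> real"
  assumes K: "compact (UNIV :: 'x set)" and \<phi>: "continuous_map skew_topology euclideanreal \<phi>" and \<epsilon>: "\<epsilon> > 0"
  shows "\<exists>k. \<exists>\<rho>>0. \<forall>\<omega> \<omega>' x y. (\<forall>i<k. \<omega> i = \<omega>' i) \<longrightarrow> dist x y < \<rho> \<longrightarrow> \<bar>\<phi> (\<omega>, x) - \<phi> (\<omega>', y)\<bar> < \<epsilon>"
proof -
  define un :: "'t disc \<Rightarrow> 't" where "un d = (case d of Disc t \<Rightarrow> t)" for d
  define h :: "(nat \<Rightarrow> 't disc) \<times> 'x \<Rightarrow> (nat \<Rightarrow> 't) \<times> 'x" where "h z = (\<lambda>i. un (fst z i), snd z)" for z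
  have "continuous_map euclidean (skew_topology :: ((nat \<Rightarrow> 't) \<times> 'x) topology) h"
    unfolding skew_topology_def continuous_map_pairwise
  proof
    have opn: "open (A :: 't disc set)" for A
      unfolding open_dist by (auto simp: dist_disc_def intro!: exI[of _ 1])
    have un: "continuous_map euclidean (discrete_topology UNIV) un"
      by (auto simp: continuous_map_def opn)
    have pr: "continuous_map euclidean euclidean (\<lambda>z :: (nat \<Rightarrow> 't disc) \<times> 'x. fst z i)" for i
      using continuous_on_compose2[OF continuous_on_product_coordinates continuous_on_fst[OF continuous_on_id] subset_UNIV]
      by simp
    show "continuous_map euclidean (product_topology (\<lambda>n. discrete_topology (UNIV :: 't set)) UNIV) (fst \<circ> h)"
      unfolding continuous_map_componentwise_UNIV
      using continuous_map_compose[OF pr un] by (auto simp: h_def comp_def)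
    show "continuous_map euclidean euclidean (snd \<circ> h)"
      by (auto simp: h_def comp_def intro!: continuous_intros)
  qed
  then have "continuous_map euclidean euclideanreal (\<phi> \<circ> h)" using \<phi> by (rule continuous_map_compose)
  then have cont: "continuous_on UNIV (\<lambda>z. \<phi> (h z))" by (simp add: comp_def)
  have "compact (UNIV :: (nat \<Rightarrow> 't disc) set)"
  proof -
    have "compact_space (euclidean :: 't disc topology)" by (simp add: compact_space_def compact_disc)
    then have "compact_space (product_topology (\<lambda>n :: nat. (euclidean :: 't disc topology)) UNIV)"
      by (simp add: compact_space_product_topology)
    then show ?thesis by (simp add: euclidean_product_topology compact_space_def)
  qed
  then have "compact (UNIV :: ((nat \<Rightarrow> 't disc) \<times> 'x) set)"
    using compact_Times[OF _ K] by fastforce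
  then have "uniformly_continuous_on UNIV (\<lambda>z. \<phi> (h z))"
    using cont by (intro compact_uniformly_continuous)
  then obtain d where d: "d > 0" "\<And>z z'. dist z z' < d \<Longrightarrow> dist (\<phi> (h z)) (\<phi> (h z')) < \<epsilon>"
    using \<epsilon> unfolding uniformly_continuous_on_def by (metis UNIV_I dist_commute)
  obtain N where N: "(1 / 2 :: real) ^ N < d / 2" using real_arch_pow_inv[of "d/2" "1/2"] d(1) by auto
  \<comment> \<open>The product metric weights the coordinates along the enumeration
    \<open>from_nat\<close>; \<open>k\<close> exceeds every coordinate enumerated up to
    \<open>N\<close>.\<close>
  define k where "k = Suc (Max ((from_nat :: nat \<Rightarrow> nat) ` {..N}))"
  have "\<bar>\<phi> (\<omega>, x) - \<phi> (\<omega>', y)\<bar> < \<epsilon>" if eq: "\<And>i. i < k \<Longrightarrow> \<omega> i = \<omega>' i" and xy: "dist x y < d / 2" for \<omega> \<omega>' x y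
  proof -
    let ?\<delta> = "\<lambda>i. Disc (\<omega> i)" and ?\<delta>' = "\<lambda>i. Disc (\<omega>' i)"
    have "\<omega> (from_nat n) = \<omega>' (from_nat n)" if "n \<le> N" for n
      using that by (intro eq) (auto simp: k_def less_Suc_eq_le)
    then have "{dist (?\<delta> (from_nat n)) (?\<delta>' (from_nat n)) |n. n \<le> N} = {0}"
      by (auto intro: exI[of _ 0])
    then have "dist ?\<delta> ?\<delta>' \<le> (1 / 2) ^ N"
      using dist_fun_le_dist_first_terms[of ?\<delta> ?\<delta>' N] by simp
    then have "dist (?\<delta>, x) (?\<delta>', y) < d"
      using N xy dist_Pair_Pair[of ?\<delta> x ?\<delta>' y] sqrt_sum_squares_le_sum[of "dist ?\<delta> ?\<delta>'" "dist x y"] by simp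
    from d(2)[OF this] show ?thesis by (simp add: h_def un_def dist_real_def)
  qed
  then show ?thesis using d(1) by (intro exI[of _ k] exI[of _ "d / 2"]) auto
qed

lemma empirical_integral:
  fixes \<phi> :: "(nat \<Rightarrow> 't::finite) \<times> 'x::metric_space \<Rightarrow> real"
  assumes "\<phi> \<in> borel_measurable skew_algebra"
  shows "(\<integral>w. \<phi> w \<partial>empirical_measure skew_algebra F n z) = (\<Sum>j<n. \<phi> ((F ^^ j) z)) / real n"
  by (rule integral_empirical_measure) (use assms in \<open>simp_all add: skew_algebra_def space_pair_measure space_path_algebra\<close>)

text \<open>Products of cylinder indicators with countably many partition functions suffice to test
  weak* convergence.\<close>

locale test_family =
  fixes I :: "nat \<Rightarrow> 'x::metric_space set" and \<xi> :: "nat \<Rightarrow> 'x \<Rightarrow> 'x \<Rightarrow> real" and dummy :: "'t::finite itself"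
  assumes K: "compact (UNIV :: 'x set)"
    and I: "\<And>n. finite (I n)" and \<xi>_lip: "\<And>n a. a \<in> I n \<Longrightarrow> \<exists>L. L-lipschitz_on UNIV (\<xi> n a)"
    and \<xi>_nonneg: "\<And>n a x. a \<in> I n \<Longrightarrow> 0 \<le> \<xi> n a x" and \<xi>_sum: "\<And>n x. (\<Sum>a\<in>I n. \<xi> n a x) = 1"
    and \<xi>_near: "\<And>n a x. \<xi> n a x \<noteq> 0 \<Longrightarrow> dist x a < 1 / real (Suc n)"
begin

abbreviation test :: "'t list \<Rightarrow> nat \<Rightarrow> 'x \<Rightarrow> (nat \<Rightarrow> 't) \<times> 'x \<Rightarrow> real" where
  "test w n a \<equiv> (\<lambda>(\<omega>, x). cyl_test w (\<xi> n a) \<omega> x)"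

lemma \<xi>_cont: "a \<in> I n \<Longrightarrow> continuous_on UNIV (\<xi> n a)"
  using \<xi>_lip lipschitz_on_continuous_on by blast

lemma \<xi>_le: "a \<in> I n \<Longrightarrow> \<bar>\<xi> n a x\<bar> \<le> 1"
  using member_le_sum[of a "I n" "\<lambda>a. \<xi> n a x"] I \<xi>_nonneg \<xi>_sum[of n x] by simp

lemma test_measurable: "a \<in> I n \<Longrightarrow> test w n a \<in> borel_measurable skew_algebra"
  by (intro cyl_test_skew_measurable borel_measurable_continuous_onI \<xi>_cont)

lemma test_bound: "a \<in> I n \<Longrightarrow> \<bar>test w n a z\<bar> \<le> 1"
  by (cases z) (auto intro: cyl_test_bound \<xi>_le)

lemma test_approx:
  fixes \<phi> :: "(nat \<Rightarrow> 't) \<times> 'x \<Rightarrow> real"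
  assumes \<phi>: "continuous_map skew_topology euclideanreal \<phi>" and \<epsilon>: "\<epsilon> > 0"
  shows "\<exists>k n c. \<forall>z. \<bar>\<phi> z - (\<Sum>w\<in>{w. length w = k}. \<Sum>a\<in>I n. c w a * test w n a z)\<bar> \<le> \<epsilon>"
proof -
  from skew_uniform_continuity[OF K \<phi> \<epsilon>] obtain k \<rho> where k: "\<rho> > 0"
    "\<forall>\<omega> \<omega>' x y. (\<forall>i<k. \<omega> i = \<omega>' i) \<longrightarrow> dist x y < \<rho> \<longrightarrow> \<bar>\<phi> (\<omega>, x) - \<phi> (\<omega>', y)\<bar> < \<epsilon>"
    by (elim exE conjE)
  obtain n where n: "1 / real (Suc n) < \<rho>" using nat_approx_posE[OF k(1)] by blast
  \<comment> \<open>A sample of \<open>\<phi>\<close> at \<open>a\<close> and at one path with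
    prefix \<open>w\<close>; by the choice of \<open>k\<close> and \<open>n\<close>, wherever the
    test function is nonzero the value of \<open>\<phi>\<close> differs from it by less than
    \<open>\<epsilon>\<close>.\<close>
  define c where "c w a = \<phi> (\<lambda>i. if i < k then w ! i else undefined, a)" for w a
  have "\<bar>\<phi> (\<omega>, x) - (\<Sum>w\<in>{w. length w = k}. \<Sum>a\<in>I n. c w a * test w n a (\<omega>, x))\<bar> \<le> \<epsilon>" for \<omega> x
  proof -
    define w where "w = map \<omega> [0..<k]"
    have fin: "finite {w :: 't list. length w = k}"
      using finite_lists_length_eq[of "UNIV :: 't set" k] by simp
    have "(\<Sum>v\<in>{v. length v = k}. \<Sum>a\<in>I n. c v a * test v n a (\<omega>, x)) = (\<Sum>v\<in>{v. length v = k}. if v = w then \<Sum>a\<in>I n. c w a * \<xi> n a x else 0)"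
      by (intro sum.cong refl) (auto simp: cyl_test_def w_def)
    also have "\<dots> = (\<Sum>a\<in>I n. c w a * \<xi> n a x)" using fin by (simp add: w_def)
    finally have "\<phi> (\<omega>, x) - (\<Sum>v\<in>{v. length v = k}. \<Sum>a\<in>I n. c v a * test v n a (\<omega>, x)) = (\<Sum>a\<in>I n. (\<phi> (\<omega>, x) - c w a) * \<xi> n a x)"
      by (simp add: left_diff_distrib sum_subtractf sum_distrib_left[symmetric] \<xi>_sum)
    also have "\<bar>\<dots>\<bar> \<le> (\<Sum>a\<in>I n. \<epsilon> * \<xi> n a x)"
    proof (intro order_trans[OF sum_abs] sum_mono)
      fix a assume a: "a \<in> I n"
      have "\<bar>\<phi> (\<omega>, x) - c w a\<bar> \<le> \<epsilon>" if "\<xi> n a x \<noteq> 0"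
        unfolding c_def using \<xi>_near[OF that] n by (intro less_imp_le k(2)[rule_format]) (auto simp: w_def)
      then show "\<bar>(\<phi> (\<omega>, x) - c w a) * \<xi> n a x\<bar> \<le> \<epsilon> * \<xi> n a x"
        using \<xi>_nonneg[OF a, of x] by (cases "\<xi> n a x = 0") (auto simp: abs_mult mult_right_mono)
    qed
    also have "\<dots> = \<epsilon>" by (simp add: sum_distrib_left[symmetric] \<xi>_sum)
    finally show ?thesis .
  qed
  then have "\<bar>\<phi> z - (\<Sum>w\<in>{w. length w = k}. \<Sum>a\<in>I n. c w a * test w n a z)\<bar> \<le> \<epsilon>" for z
    by (cases z) simp
  then show ?thesis by (intro exI allI)
qed

text \<open>The test functions are measurable by construction, and continuous functions are uniform
  limits of their linear combinations.\<close>

lemma continuous_skew_measurable: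
  fixes \<phi> :: "(nat \<Rightarrow> 't) \<times> 'x \<Rightarrow> real"
  assumes \<phi>: "continuous_map skew_topology euclideanreal \<phi>"
  shows "\<phi> \<in> borel_measurable skew_algebra"
proof -
  have "\<exists>S. S \<in> borel_measurable skew_algebra \<and> (\<forall>z. \<bar>\<phi> z - S z\<bar> \<le> 1 / real (Suc e))" for e
  proof -
    have "1 / real (Suc e) > 0" by simp
    from test_approx[OF \<phi> this] obtain k n c where
      "\<forall>z. \<bar>\<phi> z - (\<Sum>w\<in>{w. length w = k}. \<Sum>a\<in>I n. c w a * test w n a z)\<bar> \<le> 1 / real (Suc e)"
      by (elim exE)
    moreover have "(\<lambda>z. \<Sum>w\<in>{w. length w = k}. \<Sum>a\<in>I n. c w a * test w n a z) \<in> borel_measurable skew_algebra"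
      by (intro borel_measurable_sum borel_measurable_times borel_measurable_const test_measurable)
    ultimately show ?thesis by blast
  qed
  then obtain S where S: "\<And>e. S e \<in> borel_measurable skew_algebra" "\<And>e z. \<bar>\<phi> z - S e z\<bar> \<le> 1 / real (Suc e)" by metis
  show ?thesis
  proof (rule borel_measurable_LIMSEQ_real[OF _ S(1)])
    fix z
    show "(\<lambda>e. S e z) \<longlonglongrightarrow> \<phi> z"
    proof (rule LIM_zero_cancel, rule Lim_null_comparison)
      show "\<forall>\<^sub>F e in sequentially. norm (S e z - \<phi> z) \<le> 1 / real (Suc e)"
        using S(2) by (simp add: abs_minus_commute)
      show "(\<lambda>e. 1 / real (Suc e)) \<longlonglongrightarrow> 0" using LIMSEQ_inverse_real_of_nat by (simp add: inverse_eq_divide)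
    qed
  qed
qed

text \<open>Countably many conditions remain, which makes the basin measurable and allows almost
  sure statements to be collected. They suffice because linear combinations of tests approximate
  every continuous function uniformly.\<close>

lemma basin_iff:
  fixes f :: "'t \<Rightarrow> 'x \<Rightarrow> 'x" and \<mu> :: "((nat \<Rightarrow> 't) \<times> 'x) measure"
  assumes \<mu>: "prob_space \<mu>" "sets \<mu> = sets skew_algebra"
  shows "z \<in> basin f \<mu> \<longleftrightarrow> (\<forall>w n. \<forall>a\<in>I n.
    (\<lambda>m. (\<Sum>j<m. test w n a ((skew_product f ^^ j) z)) / real m) \<longlonglongrightarrow> (\<integral>y. test w n a y \<partial>\<mu>))"
proof
  assume z: "z \<in> basin f \<mu>"
  show "\<forall>w n. \<forall>a\<in>I n. (\<lambda>m. (\<Sum>j<m. test w n a ((skew_product f ^^ j) z)) / real m) \<longlonglongrightarrow> (\<integral>y. test w n a y \<partial>\<mu>)"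
  proof (intro allI ballI)
    fix w n a assume a: "a \<in> I n"
    have "(\<lambda>m. \<integral>y. test w n a y \<partial>empirical_measure skew_algebra (skew_product f) m z) \<longlonglongrightarrow> (\<integral>y. test w n a y \<partial>\<mu>)"
      using z cyl_test_continuous[OF \<xi>_cont[OF a], of w] unfolding basin_def weak_star_conv_def by simp
    then show "(\<lambda>m. (\<Sum>j<m. test w n a ((skew_product f ^^ j) z)) / real m) \<longlonglongrightarrow> (\<integral>y. test w n a y \<partial>\<mu>)"
      unfolding empirical_integral[OF test_measurable[OF a]] .
  qed
next
  assume lim: "\<forall>w n. \<forall>a\<in>I n. (\<lambda>m. (\<Sum>j<m. test w n a ((skew_product f ^^ j) z)) / real m) \<longlonglongrightarrow> (\<integral>y. test w n a y \<partial>\<mu>)"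
  interpret prob_space \<mu> by (rule \<mu>(1))
  let ?F = "skew_product f"
  have "(\<lambda>m. \<integral>y. \<phi> y \<partial>empirical_measure skew_algebra ?F m z) \<longlonglongrightarrow> (\<integral>y. \<phi> y \<partial>\<mu>)"
    if \<phi>: "continuous_map skew_topology euclideanreal \<phi>" for \<phi>
    unfolding empirical_integral[OF continuous_skew_measurable[OF \<phi>]]
  proof (rule tendstoI)
    fix \<epsilon> :: real assume \<epsilon>: "\<epsilon> > 0"
    then have "\<epsilon> / 4 > 0" by simp
    from test_approx[OF \<phi> this] obtain k n c where
      app: "\<forall>z. \<bar>\<phi> z - (\<Sum>w\<in>{w. length w = k}. \<Sum>a\<in>I n. c w a * test w n a z)\<bar> \<le> \<epsilon> / 4"
      by (elim exE)
    define S where "S z = (\<Sum>w\<in>{w. length w = k}. \<Sum>a\<in>I n. c w a * test w n a z)" for z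
    have app: "\<bar>\<phi> z - S z\<bar> \<le> \<epsilon> / 4" for z using app[rule_format, of z] unfolding S_def .
    have ti: "integrable \<mu> (test w n a)" if "a \<in> I n" for w a
    proof (rule integrable_const_bound[of _ 1])
      show "test w n a \<in> borel_measurable \<mu>"
        using test_measurable[OF that] unfolding measurable_cong_sets[OF \<mu>(2) refl] .
      show "AE z in \<mu>. norm (test w n a z) \<le> 1"
        using test_bound[OF that] by (intro AE_I2) (simp only: real_norm_def)
    qed
    have Si: "integrable \<mu> S" unfolding S_def using ti by (intro Bochner_Integration.integrable_sum integrable_mult_right)
    have "\<phi> \<in> borel_measurable \<mu>" using continuous_skew_measurable[OF \<phi>] measurable_cong_sets[OF \<mu>(2) refl] by blast
    have \<phi>i: "integrable \<mu> \<phi>"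
    proof -
      have "integrable \<mu> (\<lambda>z. \<phi> z - S z)"
        using app \<open>\<phi> \<in> borel_measurable \<mu>\<close> Si by (intro integrable_const_bound[of _ "\<epsilon> / 4"]) auto
      from Bochner_Integration.integrable_add[OF this Si] show ?thesis by simp
    qed
    have near_int: "\<bar>(\<integral>y. \<phi> y \<partial>\<mu>) - (\<integral>y. S y \<partial>\<mu>)\<bar> \<le> \<epsilon> / 4"
    proof -
      have "\<bar>\<integral>y. \<phi> y - S y \<partial>\<mu>\<bar> \<le> (\<integral>y. \<bar>\<phi> y - S y\<bar> \<partial>\<mu>)" by (rule integral_abs_bound)
      also have "\<dots> \<le> (\<integral>y. \<epsilon> / 4 \<partial>\<mu>)" using app \<phi>i Si by (intro integral_mono) auto
      finally show ?thesis using \<phi>i Si by (simp add: prob_space)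
    qed
    have near_avg: "\<bar>(\<Sum>j<m. \<phi> ((?F ^^ j) z)) / real m - (\<Sum>j<m. S ((?F ^^ j) z)) / real m\<bar> \<le> \<epsilon> / 4" for m
    proof (cases "m = 0")
      case False
      have "\<bar>\<Sum>j<m. \<phi> ((?F ^^ j) z) - S ((?F ^^ j) z)\<bar> \<le> (\<Sum>j<m. \<epsilon> / 4)"
        by (intro order_trans[OF sum_abs] sum_mono app)
      then show ?thesis using False
        by (simp add: sum_subtractf diff_divide_distrib[symmetric] divide_le_eq mult.commute)
    qed (use \<epsilon> in simp)
    have "(\<lambda>m. (\<Sum>j<m. S ((?F ^^ j) z)) / real m) \<longlonglongrightarrow> (\<integral>y. S y \<partial>\<mu>)"
    proof -
      have "(\<lambda>m. \<Sum>w\<in>{w. length w = k}. \<Sum>a\<in>I n. c w a * ((\<Sum>j<m. test w n a ((?F ^^ j) z)) / real m))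
          \<longlonglongrightarrow> (\<Sum>w\<in>{w. length w = k}. \<Sum>a\<in>I n. c w a * (\<integral>y. test w n a y \<partial>\<mu>))"
        using lim by (intro tendsto_sum tendsto_mult tendsto_const) auto
      moreover have "(\<Sum>w\<in>{w. length w = k}. \<Sum>a\<in>I n. c w a * ((\<Sum>j<m. test w n a ((?F ^^ j) z)) / real m)) = (\<Sum>j<m. S ((?F ^^ j) z)) / real m" for m
      proof -
        have "(\<Sum>j<m. S ((?F ^^ j) z)) = (\<Sum>w\<in>{w. length w = k}. \<Sum>j<m. \<Sum>a\<in>I n. c w a * test w n a ((?F ^^ j) z))"
          unfolding S_def by (rule sum.swap)
        also have "\<dots> = (\<Sum>w\<in>{w. length w = k}. \<Sum>a\<in>I n. \<Sum>j<m. c w a * test w n a ((?F ^^ j) z))"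
          by (intro sum.cong refl sum.swap)
        finally show ?thesis by (simp only: sum_distrib_left sum_divide_distrib times_divide_eq_right)
      qed
      moreover have "(\<integral>y. S y \<partial>\<mu>) = (\<Sum>w\<in>{w. length w = k}. \<Sum>a\<in>I n. c w a * (\<integral>y. test w n a y \<partial>\<mu>))"
      proof -
        have "(\<integral>y. S y \<partial>\<mu>) = (\<Sum>w\<in>{w. length w = k}. \<integral>y. (\<Sum>a\<in>I n. c w a * test w n a y) \<partial>\<mu>)"
          unfolding S_def using ti
          by (intro Bochner_Integration.integral_sum Bochner_Integration.integrable_sum integrable_mult_right)
        also have "\<dots> = (\<Sum>w\<in>{w. length w = k}. \<Sum>a\<in>I n. \<integral>y. c w a * test w n a y \<partial>\<mu>)"
          using ti by (intro sum.cong refl Bochner_Integration.integral_sum integrable_mult_right)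
        finally show ?thesis by simp
      qed
      ultimately show ?thesis by simp
    qed
    then have "\<forall>\<^sub>F m in sequentially. \<bar>(\<Sum>j<m. S ((?F ^^ j) z)) / real m - (\<integral>y. S y \<partial>\<mu>)\<bar> < \<epsilon> / 4"
      using \<open>\<epsilon> / 4 > 0\<close> unfolding tendsto_iff dist_real_def by blast
    then show "\<forall>\<^sub>F m in sequentially. dist ((\<Sum>j<m. \<phi> ((?F ^^ j) z)) / real m) (\<integral>y. \<phi> y \<partial>\<mu>) < \<epsilon>"
    proof eventually_elim
      case (elim m)
      then show ?case unfolding dist_real_def using near_int near_avg[of m] \<epsilon> by linarith
    qed
  qed
  then show "z \<in> basin f \<mu>" unfolding basin_def weak_star_conv_def by simp
qed

lemma basin_sets:
  fixes f :: "'t \<Rightarrow> 'x \<Rightarrow> 'x" and \<mu> :: "((nat \<Rightarrow> 't) \<times> 'x) measure"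
  assumes \<mu>: "prob_space \<mu>" "sets \<mu> = sets skew_algebra"
    and F: "skew_product f \<in> measurable skew_algebra skew_algebra"
  shows "basin f \<mu> \<in> sets skew_algebra"
proof -
  have sp: "space (skew_algebra :: ((nat \<Rightarrow> 't) \<times> 'x) measure) = UNIV"
    by (simp add: skew_algebra_def space_pair_measure space_path_algebra)
  have Fn: "(skew_product f ^^ j) \<in> measurable skew_algebra skew_algebra" for j
  proof (induction j)
    case (Suc j)
    then show ?case unfolding funpow.simps comp_def by (rule measurable_compose[OF _ F])
  qed (simp add: id_def)
  have *: "{z. (\<lambda>m. (\<Sum>j<m. test w n a ((skew_product f ^^ j) z)) / real m) \<longlonglongrightarrow> (\<integral>y. test w n a y \<partial>\<mu>)} \<in> sets skew_algebra"
    if a: "a \<in> I n" for w n a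
  proof -
    have "(\<lambda>z. (\<Sum>j<m. test w n a ((skew_product f ^^ j) z)) / real m) \<in> borel_measurable skew_algebra" for m
      by (intro borel_measurable_divide borel_measurable_sum borel_measurable_const measurable_compose[OF Fn test_measurable[OF a]])
    then have "Measurable.pred skew_algebra (\<lambda>z. (\<lambda>m. (\<Sum>j<m. test w n a ((skew_product f ^^ j) z)) / real m) \<longlonglongrightarrow> (\<integral>y. test w n a y \<partial>\<mu>))"
      by (intro measurable_limit2) simp_all
    then show ?thesis by (simp add: pred_def sp)
  qed
  have ne: "I n \<noteq> {}" for n using \<xi>_sum[of n] by auto
  have "(\<Inter>w. \<Inter>n. \<Inter>a\<in>I n. {z. (\<lambda>m. (\<Sum>j<m. test w n a ((skew_product f ^^ j) z)) / real m) \<longlonglongrightarrow> (\<integral>y. test w n a y \<partial>\<mu>)}) \<in> sets skew_algebra"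
    (is "?B \<in> _")
    using I ne * sets.top[of "skew_algebra :: ((nat \<Rightarrow> 't) \<times> 'x) measure"]
    by (intro sets.countable_INT'' sets.finite_INT) (auto simp: sp intro: countable_finite)
  moreover have "basin f \<mu> = ?B" using basin_iff[OF \<mu>, of _ f] by auto
  ultimately show ?thesis by simp
qed

end

section \<open>Invariant measures of the skew product\<close>

lemma averages_null:
  fixes a :: "nat \<Rightarrow> real"
  assumes "a \<longlonglongrightarrow> 0"
  shows "(\<lambda>n. (\<Sum>j<n. a j) / real n) \<longlonglongrightarrow> 0"
proof (rule LIMSEQ_I)
  fix \<epsilon> :: real assume "\<epsilon> > 0"
  then obtain N where N: "\<And>n. n \<ge> N \<Longrightarrow> \<bar>a n\<bar> < \<epsilon> / 2"
    using LIMSEQ_D[OF assms, of "\<epsilon> / 2"] by auto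
  define C where "C = (\<Sum>j<N. \<bar>a j\<bar>)"
  obtain N' where N': "2 * C / \<epsilon> < real N'" using reals_Archimedean2 by blast
  have "norm ((\<Sum>j<n. a j) / real n - 0) < \<epsilon>" if n: "n \<ge> max (max N N') 1" for n
  proof -
    have "\<bar>\<Sum>j<n. a j\<bar> \<le> (\<Sum>j<n. \<bar>a j\<bar>)" by (rule sum_abs)
    also have "\<dots> = C + (\<Sum>j=N..<n. \<bar>a j\<bar>)"
      unfolding C_def using n sum.atLeastLessThan_concat[of 0 N n "\<lambda>j. \<bar>a j\<bar>"] by (simp add: lessThan_atLeast0)
    also have "(\<Sum>j=N..<n. \<bar>a j\<bar>) \<le> (\<Sum>j=N..<n. \<epsilon> / 2)" using N by (intro sum_mono) (auto intro: less_imp_le)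
    also have "\<dots> \<le> real n * (\<epsilon> / 2)" using \<open>\<epsilon> > 0\<close> by (simp add: mult_right_mono)
    finally have 1: "\<bar>\<Sum>j<n. a j\<bar> \<le> C + real n * (\<epsilon> / 2)" by simp
    have "2 * C / \<epsilon> < real n" using N' n by linarith
    then have "C < real n * (\<epsilon> / 2)" using \<open>\<epsilon> > 0\<close> by (simp add: field_simps)
    with 1 have "\<bar>\<Sum>j<n. a j\<bar> < real n * \<epsilon>" by linarith
    then show ?thesis using n by (simp add: divide_less_eq mult.commute)
  qed
  then show "\<exists>no. \<forall>n\<ge>no. norm ((\<Sum>j<n. a j) / real n - 0) < \<epsilon>" by blast
qed

lemma space_skew_algebra: "space (skew_algebra :: ((nat \<Rightarrow> 't) \<times> 'x::metric_space) measure) = UNIV"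
  by (simp add: skew_algebra_def space_pair_measure space_path_algebra)

lemma skew_product_measurable:
  fixes f :: "'t::finite \<Rightarrow> 'x::metric_space \<Rightarrow> 'x"
  assumes "\<And>t. f t \<in> borel_measurable borel"
  shows "skew_product f \<in> measurable skew_algebra skew_algebra"
proof -
  have "(\<lambda>z. f (fst z 0) (snd z)) \<in> measurable (path_algebra \<Otimes>\<^sub>M borel) borel"
  proof (rule measurable_compose_countable[where f = "\<lambda>t z. f t (snd z)" and g = "\<lambda>z. fst z 0"])
    show "(\<lambda>z. f t (snd z)) \<in> measurable (path_algebra \<Otimes>\<^sub>M borel) borel" for t
      by (rule measurable_compose[OF measurable_snd assms])
    show "(\<lambda>z. fst z 0) \<in> measurable (path_algebra \<Otimes>\<^sub>M borel) (count_space UNIV)"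
      by (rule measurable_compose[OF measurable_fst component_measurable])
  qed
  moreover have "(\<lambda>z. shift (fst z)) \<in> measurable (path_algebra \<Otimes>\<^sub>M borel) path_algebra"
    by (rule measurable_compose[OF measurable_fst shift_measurable])
  ultimately show ?thesis
    unfolding skew_product_def skew_algebra_def case_prod_unfold by (rule measurable_Pair[rotated])
qed

text \<open>For fixed \<open>A\<close> the functions \<open>\<phi>\<close> determine the projection
  to X of the measure restricted to \<open>A \<times> UNIV\<close>, hence the mass of every
  rectangle over \<open>A\<close>; rectangles over the generator \<open>E\<close> determine the
  measure.\<close>

lemma skew_measure_eqI:
  fixes \<mu> \<nu> :: "((nat \<Rightarrow> 't) \<times> 'x::metric_space) measure"
  assumes E: "Int_stable E" "sets path_algebra = sigma_sets UNIV E" "UNIV \<in> E"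
    and \<mu>: "finite_measure \<mu>" "sets \<mu> = sets skew_algebra" and \<nu>: "finite_measure \<nu>" "sets \<nu> = sets skew_algebra"
    and eq: "\<And>A \<phi> :: 'x \<Rightarrow> real. A \<in> E \<Longrightarrow> continuous_on UNIV \<phi> \<Longrightarrow> (\<And>x. 0 \<le> \<phi> x \<and> \<phi> x \<le> 1) \<Longrightarrow>
      (\<integral>z. indicator A (fst z) * \<phi> (snd z) \<partial>\<mu>) = (\<integral>z. indicator A (fst z) * \<phi> (snd z) \<partial>\<nu>)"
  shows "\<mu> = \<nu>"
proof -
  have Em: "A \<in> sets path_algebra" if "A \<in> E" for A using that E(2) by auto
  have rect: "emeasure \<mu> (A \<times> B) = emeasure \<nu> (A \<times> B)" if A: "A \<in> E" and B: "B \<in> sets borel" for A B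
  proof -
    define R where "R \<kappa> = distr (density \<kappa> (indicator (A \<times> UNIV))) borel snd" for \<kappa> :: "((nat \<Rightarrow> 't) \<times> 'x) measure"
    have AX: "A \<times> UNIV \<in> sets skew_algebra"
      unfolding skew_algebra_def by (intro pair_measureI Em[OF A]) simp
    have sndm: "snd \<in> measurable skew_algebra borel" unfolding skew_algebra_def by simp
    have R: "finite_measure (R \<kappa>)" "sets (R \<kappa>) = sets borel" "\<And>B. B \<in> sets borel \<Longrightarrow> emeasure (R \<kappa>) B = emeasure \<kappa> (A \<times> B)"
      "\<And>\<phi> :: 'x \<Rightarrow> real. continuous_on UNIV \<phi> \<Longrightarrow> (\<integral>x. \<phi> x \<partial>R \<kappa>) = (\<integral>z. indicator A (fst z) * \<phi> (snd z) \<partial>\<kappa>)"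
      if \<kappa>: "finite_measure \<kappa>" "sets \<kappa> = sets skew_algebra" for \<kappa>
    proof -
      have sp: "space \<kappa> = UNIV" using sets_eq_imp_space_eq[OF \<kappa>(2)] space_skew_algebra by simp
      have snd\<kappa>: "snd \<in> measurable (density \<kappa> (indicator (A \<times> UNIV))) borel"
        using sndm unfolding measurable_cong_sets[OF trans[OF sets_density \<kappa>(2)] refl] .
      have AX\<kappa>: "A \<times> UNIV \<in> sets \<kappa>" using AX \<kappa>(2) by simp
      show R3: "emeasure (R \<kappa>) B = emeasure \<kappa> (A \<times> B)" if B: "B \<in> sets borel" for B
      proof -
        have "UNIV \<times> B \<in> sets \<kappa>"
          unfolding \<kappa>(2) skew_algebra_def using B sets.top[of path_algebra] by (intro pair_measureI) (auto simp: space_path_algebra)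
        then have "emeasure (R \<kappa>) B = emeasure \<kappa> ((A \<times> UNIV) \<inter> (UNIV \<times> B))"
          unfolding R_def using B AX\<kappa>
          by (subst emeasure_distr[OF snd\<kappa> B], subst emeasure_density)
            (auto simp: sp vimage_snd nn_integral_indicator[symmetric] simp del: nn_integral_indicator intro!: nn_integral_cong split: split_indicator)
        also have "(A \<times> UNIV) \<inter> (UNIV \<times> B) = A \<times> B" by auto
        finally show ?thesis .
      qed
      show "sets (R \<kappa>) = sets borel" by (simp add: R_def)
      show "finite_measure (R \<kappa>)"
      proof
        have "emeasure (R \<kappa>) UNIV = emeasure \<kappa> (A \<times> UNIV)" by (rule R3) simp
        then show "emeasure (R \<kappa>) (space (R \<kappa>)) \<noteq> \<infinity>"
          using finite_measure.emeasure_finite[OF \<kappa>(1)] by (simp add: R_def)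
      qed
      show "(\<integral>x. \<phi> x \<partial>R \<kappa>) = (\<integral>z. indicator A (fst z) * \<phi> (snd z) \<partial>\<kappa>)" if \<phi>: "continuous_on UNIV \<phi>" for \<phi> :: "'x \<Rightarrow> real"
      proof -
        have \<phi>m: "\<phi> \<in> borel_measurable borel" by (rule borel_measurable_continuous_onI[OF \<phi>])
        have "(\<integral>x. \<phi> x \<partial>R \<kappa>) = (\<integral>z. \<phi> (snd z) \<partial>density \<kappa> (\<lambda>z. ennreal (indicator (A \<times> UNIV) z)))"
          unfolding R_def using snd\<kappa> by (simp add: integral_distr[OF _ \<phi>m] ennreal_indicator)
        also have "\<dots> = (\<integral>z. indicator (A \<times> UNIV) z * \<phi> (snd z) \<partial>\<kappa>)"
        proof (rule integral_real_density)
          have "snd \<in> measurable \<kappa> borel" using sndm unfolding measurable_cong_sets[OF \<kappa>(2) refl] .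
          then show "(\<lambda>z. \<phi> (snd z)) \<in> borel_measurable \<kappa>" using \<phi>m by (rule measurable_compose)
        qed (use AX\<kappa> in auto)
        also have "\<dots> = (\<integral>z. indicator A (fst z) * \<phi> (snd z) \<partial>\<kappa>)"
          by (intro Bochner_Integration.integral_cong) (auto split: split_indicator)
        finally show ?thesis .
      qed
    qed
    have "R \<mu> = R \<nu>"
      using R[OF \<mu>] R[OF \<nu>] eq[OF A] by (intro finite_measure_eqI_continuous) auto
    then show ?thesis using R(3)[OF \<mu> B] R(3)[OF \<nu> B] by simp
  qed
  let ?G = "{A \<times> B |A B. A \<in> E \<and> B \<in> sets (borel :: 'x measure)}"
  \<comment> \<open>For a fixed \<open>B\<close>, the sets \<open>A\<close> whose product with
    \<open>B\<close> is generated by \<open>?G\<close> form a sigma-algebra containing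
    \<open>E\<close>.\<close>
  have G: "sets skew_algebra = sigma_sets UNIV ?G"
  proof
    have "A \<times> B \<in> sigma_sets UNIV ?G" if "A \<in> sigma_sets UNIV E" "B \<in> sets borel" for A B
      using that(1)
    proof induction
      case (Basic A) then show ?case using that(2) by (intro sigma_sets.Basic) blast
    next
      case Empty then show ?case by (simp add: sigma_sets.Empty)
    next
      case (Compl A)
      have "UNIV \<times> B \<in> sigma_sets UNIV ?G" using E(3) that(2) by (intro sigma_sets.Basic) blast
      moreover have "(UNIV - A) \<times> B = UNIV \<times> B - A \<times> B" by auto
      ultimately show ?case using Compl.IH
        by (metis (no_types, lifting) Pow_UNIV UNIV_I sets.Diff sets_measure_of subsetI PowI)
    next
      case (Union A)
      have "(\<Union>i. A i) \<times> B = (\<Union>i. A i \<times> B)" by auto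
      then show ?case using Union.IH by (simp add: sigma_sets.Union)
    qed
    then show "sets (skew_algebra :: ((nat \<Rightarrow> 't) \<times> 'x) measure) \<subseteq> sigma_sets UNIV ?G"
      unfolding skew_algebra_def sets_pair_measure E(2) space_path_algebra
      by (simp only: space_borel UNIV_Times_UNIV) (intro sigma_sets_mono; blast)
    show "sigma_sets UNIV ?G \<subseteq> sets (skew_algebra :: ((nat \<Rightarrow> 't) \<times> 'x) measure)"
    proof (rule sets.sigma_sets_subset[of _ skew_algebra, unfolded space_skew_algebra])
      show "?G \<subseteq> sets (skew_algebra :: ((nat \<Rightarrow> 't) \<times> 'x) measure)"
        unfolding skew_algebra_def using Em by auto
    qed
  qed
  show ?thesis
  proof (rule measure_eqI_generator_eq[where E = ?G and \<Omega> = UNIV and A = "\<lambda>_. UNIV"])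
    show "Int_stable ?G"
    proof (rule Int_stableI, safe)
      fix A A' and B B' :: "'x set" assume "A \<in> E" "A' \<in> E" "B \<in> sets borel" "B' \<in> sets borel"
      then show "\<exists>C D. A \<times> B \<inter> A' \<times> B' = C \<times> D \<and> C \<in> E \<and> D \<in> sets borel"
        using E(1) by (intro exI[of _ "A \<inter> A'"] exI[of _ "B \<inter> B'"]) (auto simp: Int_stable_def)
    qed
    show "emeasure \<mu> X = emeasure \<nu> X" if "X \<in> ?G" for X using that rect by auto
    have "(UNIV :: ((nat \<Rightarrow> 't) \<times> 'x) set) = UNIV \<times> UNIV" by simp
    then show "range (\<lambda>_. UNIV) \<subseteq> ?G" using E(3) by (auto intro!: exI[of _ UNIV])
    show "emeasure \<mu> UNIV \<noteq> \<infinity>" using finite_measure.emeasure_finite[OF \<mu>(1)] by simp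
  qed (auto simp: \<mu>(2) \<nu>(2) G)
qed

text \<open>If almost every point is generic, an invariant set is independent of every continuous
  observable, hence of itself.\<close>

lemma ergodic_if_basin_full:
  fixes f :: "'t::finite \<Rightarrow> 'x::metric_space \<Rightarrow> 'x"
  assumes K: "compact (UNIV :: 'x set)"
    and inv: "invariant_prob skew_algebra (skew_product f) \<mu>" and bas: "AE z in \<mu>. z \<in> basin f \<mu>"
  shows "ergodic_prob skew_algebra (skew_product f) \<mu>"
  unfolding ergodic_prob_def
proof (intro conjI inv ballI impI)
  fix A assume A: "A \<in> sets skew_algebra" "skew_product f -` A \<inter> space skew_algebra = A"
  let ?F = "skew_product f"
  have Fm: "?F \<in> measurable skew_algebra skew_algebra" and \<mu>: "prob_space \<mu>" "sets \<mu> = sets skew_algebra"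
    and dF: "distr \<mu> skew_algebra ?F = \<mu>"
    using inv by (auto simp: invariant_prob_def space_prob_algebra)
  interpret prob_space \<mu> by (rule \<mu>(1))
  have AF: "?F z \<in> A \<longleftrightarrow> z \<in> A" for z using A(2) by (auto simp: space_skew_algebra)
  have Fn: "(?F ^^ j) \<in> measurable \<mu> skew_algebra" for j
  proof (induction j)
    case 0 then show ?case by (simp add: id_def measurable_cong_sets[OF \<mu>(2) refl])
  next
    case (Suc j)
    then show ?case unfolding funpow.simps comp_def by (rule measurable_compose[OF _ Fm])
  qed
  have Am: "A \<in> sets \<mu>" using A(1) \<mu>(2) by simp
  \<comment> \<open>The restriction of \<open>\<mu>\<close> to \<open>A\<close> and the multiple of
    \<open>\<mu>\<close> by the mass of \<open>A\<close>. Their equality, evaluated at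
    \<open>A\<close>, gives \<open>measure \<mu> A = (measure \<mu> A)\<^sup>2\<close>.\<close>
  define \<nu>1 where "\<nu>1 = density \<mu> (\<lambda>z. ennreal (indicator A z))"
  define \<nu>2 where "\<nu>2 = density \<mu> (\<lambda>z. ennreal (measure \<mu> A))"
  have "\<nu>1 = \<nu>2"
  proof (rule skew_measure_eqI[OF Int_stable_cylinder sets_path_algebra])
    have "cylinder [] = (UNIV :: (nat \<Rightarrow> 't) set)" by (simp add: cylinder_def)
    then show "(UNIV :: (nat \<Rightarrow> 't) set) \<in> range cylinder" by (metis rangeI)
    show "finite_measure \<nu>1" unfolding \<nu>1_def
      using Am by (intro finite_measureI) (simp add: emeasure_density ennreal_indicator)
    show "finite_measure \<nu>2" unfolding \<nu>2_def
      by (intro finite_measureI) (simp add: emeasure_density ennreal_mult_eq_top_iff)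
    show "sets \<nu>1 = sets skew_algebra" "sets \<nu>2 = sets skew_algebra" by (simp_all add: \<nu>1_def \<nu>2_def \<mu>(2))
    fix C :: "(nat \<Rightarrow> 't) set" and \<phi> :: "'x \<Rightarrow> real"
    assume "C \<in> range cylinder" and \<phi>: "continuous_on UNIV \<phi>" "\<And>x. 0 \<le> \<phi> x \<and> \<phi> x \<le> 1"
    then obtain As :: "'t set list" where C: "C = cylinder As" by auto
    define \<Phi> where "\<Phi> z = indicator C (fst z) * \<phi> (snd z)" for z :: "(nat \<Rightarrow> 't) \<times> 'x"
    have \<Phi>m: "\<Phi> \<in> borel_measurable skew_algebra"
    proof -
      have "(\<lambda>z. indicator C (fst z) :: real) \<in> borel_measurable (skew_algebra :: ((nat \<Rightarrow> 't) \<times> 'x) measure)"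
        unfolding skew_algebra_def C
        by (rule measurable_compose[OF measurable_fst]) (intro borel_measurable_indicator cylinder_sets)
      moreover have "(\<lambda>z. \<phi> (snd z)) \<in> borel_measurable (skew_algebra :: ((nat \<Rightarrow> 't) \<times> 'x) measure)"
        unfolding skew_algebra_def by (rule measurable_compose[OF measurable_snd borel_measurable_continuous_onI[OF \<phi>(1)]])
      ultimately show ?thesis unfolding \<Phi>_def by (rule borel_measurable_times)
    qed
    have \<Phi>c: "continuous_map skew_topology euclideanreal \<Phi>"
    proof -
      let ?T = "skew_topology :: ((nat \<Rightarrow> 't) \<times> 'x) topology"
      have comp: "continuous_map ?T (discrete_topology UNIV) (\<lambda>z. fst z i)" for i
      proof -
        have "continuous_map (product_topology (\<lambda>n. discrete_topology (UNIV :: 't set)) UNIV) (discrete_topology UNIV) (\<lambda>\<omega>. \<omega> i)"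
          by (rule continuous_map_product_projection) simp
        then show ?thesis
          unfolding skew_topology_def using continuous_map_compose[OF continuous_map_fst, of _ _ "\<lambda>\<omega>. \<omega> i"] by (simp only: comp_def)
      qed
      have "continuous_map ?T euclideanreal (\<lambda>z. of_bool (fst z i \<in> As ! i))" for i
        using continuous_map_compose[OF comp[of i], of euclideanreal "\<lambda>t. of_bool (t \<in> As ! i)"]
        by (simp add: comp_def)
      then have "continuous_map ?T euclideanreal (\<lambda>z. \<Prod>i<length As. of_bool (fst z i \<in> As ! i))"
        by (intro continuous_map_prod) auto
      moreover have "(\<Prod>i<length As. of_bool (\<omega> i \<in> As ! i)) = (indicator C \<omega> :: real)" for \<omega> :: "nat \<Rightarrow> 't"
        by (cases "\<forall>i<length As. \<omega> i \<in> As ! i") (auto simp: C cylinder_def)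
      moreover have "continuous_map ?T euclideanreal (\<lambda>z. \<phi> (snd z))"
      proof -
        have "continuous_map euclidean euclideanreal \<phi>" using \<phi>(1) by simp
        then show ?thesis
          unfolding skew_topology_def using continuous_map_compose[OF continuous_map_snd, of _ _ \<phi>] by (simp only: comp_def)
      qed
      ultimately show ?thesis unfolding \<Phi>_def by (simp add: continuous_map_real_mult)
    qed
    have \<Phi>b: "\<bar>\<Phi> z\<bar> \<le> 1" for z using \<phi>(2)[of "snd z"] by (simp add: \<Phi>_def split: split_indicator)
    have \<Phi>\<mu>: "\<Phi> \<in> borel_measurable \<mu>" using \<Phi>m unfolding measurable_cong_sets[OF \<mu>(2) refl] .
    have \<Phi>j: "(\<lambda>z. \<Phi> ((?F ^^ j) z)) \<in> borel_measurable \<mu>" for j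
      by (rule measurable_compose[OF Fn \<Phi>m])
    have ind\<mu>: "indicat_real A \<in> borel_measurable \<mu>" using Am by simp
    \<comment> \<open>As \<open>A\<close> and \<open>\<mu>\<close> are invariant, the correlation of
      \<open>A\<close> with \<open>\<Phi>\<close> does not change along the orbit, so it equals the
      limit of its averages,
      \<open>measure \<mu> A * (\<integral>y. \<Phi> y \<partial>\<mu>)\<close>.\<close>
    have step: "(\<integral>z. indicator A z * \<Phi> ((?F ^^ j) z) \<partial>\<mu>) = (\<integral>z. indicator A z * \<Phi> z \<partial>\<mu>)" for j
    proof (induction j)
      case (Suc j)
      have m: "(\<lambda>z. indicator A z * \<Phi> ((?F ^^ j) z)) \<in> borel_measurable skew_algebra"
        using borel_measurable_times[OF ind\<mu> \<Phi>j[of j]] unfolding measurable_cong_sets[OF \<mu>(2) refl] .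
      have "(\<integral>z. indicator A z * \<Phi> ((?F ^^ j) z) \<partial>\<mu>) = (\<integral>z. indicator A z * \<Phi> ((?F ^^ j) z) \<partial>distr \<mu> skew_algebra ?F)"
        by (simp add: dF)
      also have "\<dots> = (\<integral>z. indicator A (?F z) * \<Phi> ((?F ^^ j) (?F z)) \<partial>\<mu>)"
        using Fm m by (intro integral_distr) (simp add: measurable_cong_sets[OF \<mu>(2) refl])
      also have "\<dots> = (\<integral>z. indicator A z * \<Phi> ((?F ^^ Suc j) z) \<partial>\<mu>)"
        by (simp add: AF indicator_def funpow_swap1)
      finally show ?case using Suc.IH by simp
    qed simp
    have "(\<lambda>m. \<integral>z. indicator A z * ((\<Sum>j<m. \<Phi> ((?F ^^ j) z)) / real m) \<partial>\<mu>) \<longlonglongrightarrow> (\<integral>z. indicator A z * (\<integral>y. \<Phi> y \<partial>\<mu>) \<partial>\<mu>)"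
    proof (rule integral_dominated_convergence[where w = "\<lambda>_. 1"])
      show "AE z in \<mu>. (\<lambda>m. indicator A z * ((\<Sum>j<m. \<Phi> ((?F ^^ j) z)) / real m)) \<longlonglongrightarrow> indicator A z * (\<integral>y. \<Phi> y \<partial>\<mu>)"
        using bas
      proof eventually_elim
        case (elim z)
        then have "(\<lambda>m. \<integral>y. \<Phi> y \<partial>empirical_measure skew_algebra ?F m z) \<longlonglongrightarrow> (\<integral>y. \<Phi> y \<partial>\<mu>)"
          using \<Phi>c unfolding basin_def weak_star_conv_def by simp
        then show ?case unfolding empirical_integral[OF \<Phi>m] by (intro tendsto_mult tendsto_const)
      qed
      show "AE z in \<mu>. norm (indicator A z * ((\<Sum>j<m. \<Phi> ((?F ^^ j) z)) / real m)) \<le> 1" for m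
      proof (rule AE_I2)
        fix z
        have "\<bar>\<Sum>j<m. \<Phi> ((?F ^^ j) z)\<bar> \<le> (\<Sum>j<m. 1)" by (intro order_trans[OF sum_abs] sum_mono \<Phi>b)
        then have "\<bar>(\<Sum>j<m. \<Phi> ((?F ^^ j) z)) / real m\<bar> \<le> 1" by (cases "m = 0") (auto simp: divide_le_eq)
        then show "norm (indicator A z * ((\<Sum>j<m. \<Phi> ((?F ^^ j) z)) / real m)) \<le> 1"
          by (simp split: split_indicator)
      qed
    qed (use ind\<mu> \<Phi>j in auto)
    moreover have "(\<integral>z. indicator A z * ((\<Sum>j<m. \<Phi> ((?F ^^ j) z)) / real m) \<partial>\<mu>) = (\<integral>z. indicator A z * \<Phi> z \<partial>\<mu>)" if "m \<ge> 1" for m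
    proof -
      have int: "integrable \<mu> (\<lambda>z. indicator A z * \<Phi> ((?F ^^ j) z))" for j
        using ind\<mu> \<Phi>j \<Phi>b by (intro integrable_const_bound[of _ 1]) (auto split: split_indicator)
      have "(\<integral>z. indicator A z * ((\<Sum>j<m. \<Phi> ((?F ^^ j) z)) / real m) \<partial>\<mu>) = (\<integral>z. (\<Sum>j<m. indicator A z * \<Phi> ((?F ^^ j) z)) / real m \<partial>\<mu>)"
        by (simp add: sum_distrib_left)
      also have "\<dots> = (\<Sum>j<m. \<integral>z. indicator A z * \<Phi> ((?F ^^ j) z) \<partial>\<mu>) / real m"
        by (simp only: integral_divide_zero Bochner_Integration.integral_sum[OF int])
      finally show ?thesis using that by (simp add: step)
    qed
    then have "\<forall>\<^sub>F m in sequentially. (\<integral>z. indicator A z * ((\<Sum>j<m. \<Phi> ((?F ^^ j) z)) / real m) \<partial>\<mu>) = (\<integral>z. indicator A z * \<Phi> z \<partial>\<mu>)"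
      unfolding eventually_sequentially by blast
    then have "(\<lambda>m. \<integral>z. indicator A z * ((\<Sum>j<m. \<Phi> ((?F ^^ j) z)) / real m) \<partial>\<mu>) \<longlonglongrightarrow> (\<integral>z. indicator A z * \<Phi> z \<partial>\<mu>)"
      by (rule tendsto_eventually)
    ultimately have "(\<integral>z. indicator A z * \<Phi> z \<partial>\<mu>) = (\<integral>z. indicator A z * (\<integral>y. \<Phi> y \<partial>\<mu>) \<partial>\<mu>)"
      using LIMSEQ_unique by blast
    also have "\<dots> = measure \<mu> A * (\<integral>y. \<Phi> y \<partial>\<mu>)"
      using sets.sets_into_space[OF Am] by (simp add: Int_absorb2)
    finally have main: "(\<integral>z. indicator A z * \<Phi> z \<partial>\<mu>) = measure \<mu> A * (\<integral>y. \<Phi> y \<partial>\<mu>)" .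
    have "(\<integral>z. \<Phi> z \<partial>\<nu>1) = (\<integral>z. indicator A z * \<Phi> z \<partial>\<mu>)"
      unfolding \<nu>1_def using ind\<mu> \<Phi>\<mu> by (intro integral_real_density) auto
    moreover have "(\<integral>z. \<Phi> z \<partial>\<nu>2) = (\<integral>z. measure \<mu> A * \<Phi> z \<partial>\<mu>)"
      unfolding \<nu>2_def using \<Phi>\<mu> by (intro integral_real_density) auto
    ultimately show "(\<integral>z. indicator C (fst z) * \<phi> (snd z) \<partial>\<nu>1) = (\<integral>z. indicator C (fst z) * \<phi> (snd z) \<partial>\<nu>2)"
      using main by (simp add: \<Phi>_def)
  qed
  moreover have "emeasure \<nu>1 A = ennreal (measure \<mu> A)"
    unfolding \<nu>1_def using Am by (simp add: emeasure_density ennreal_indicator emeasure_eq_measure flip: indicator_inter_arith)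
  moreover have "emeasure \<nu>2 A = ennreal (measure \<mu> A * measure \<mu> A)"
    unfolding \<nu>2_def using Am by (simp add: emeasure_density nn_integral_cmult emeasure_eq_measure ennreal_mult)
  ultimately have "measure \<mu> A = measure \<mu> A * measure \<mu> A" by simp
  then have "measure \<mu> A = 0 \<or> measure \<mu> A = 1" by (metis mult_cancel_left2)
  then show "emeasure \<mu> A = 0 \<or> emeasure \<mu> A = 1" by (auto simp: emeasure_eq_measure)
qed

section \<open>Lifting stationary measures to the skew product\<close>

fun sym_of :: "'t disc \<times> 'x \<Rightarrow> 't" where
  "sym_of (Disc t, x) = t"

lemma sym_of_vimage: "{z. sym_of z = t} = {Disc t} \<times> UNIV"
proof (intro set_eqI)
  show "z \<in> {z. sym_of z = t} \<longleftrightarrow> z \<in> {Disc t} \<times> UNIV" for z :: "'a disc \<times> 'b"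
    by (cases z rule: sym_of.cases) auto
qed

lemma sym_of_vimage_sets: "{z :: 't disc \<times> 'x::metric_space. sym_of z = t} \<in> sets borel"
  unfolding sym_of_vimage by (intro borel_closed closed_Times closed_singleton closed_UNIV)

lemma sym_of_measurable: "(sym_of :: 't::finite disc \<times> 'x::metric_space \<Rightarrow> 't) \<in> measurable borel (count_space UNIV)"
  using sym_of_vimage_sets
  by (subst measurable_count_space_eq2_countable) (auto simp: vimage_def countable_finite)

lemma snd_borel_measurable: "(snd :: 't disc \<times> 'x::metric_space \<Rightarrow> 'x) \<in> borel_measurable borel"
  by (intro borel_measurable_continuous_onI continuous_on_snd continuous_on_id)

locale unique_walk = skew_walk Q p P f L
  for Q :: "'t::finite \<Rightarrow> 't measure" and p :: "'t measure" and P :: "(nat \<Rightarrow> 't) measure"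
    and f :: "'t \<Rightarrow> 'x::metric_space \<Rightarrow> 'x" and L :: real +
  assumes unique: "\<And>v. (\<And>t. 0 \<le> v t) \<Longrightarrow> (\<Sum>t\<in>UNIV. v t) = 1 \<Longrightarrow> (\<And>u. (\<Sum>t\<in>UNIV. v t * markov_path.q Q t u) = v u) \<Longrightarrow> v = markov_path.pp p"
begin

text \<open>On functions of the symbol alone \<open>\<K>\<close> acts as the matrix
  \<open>q\<close>, so the symbol marginal of \<open>\<eta>\<close> is a stationary vector, and
  there is only one.\<close>

lemma stationary_marginal:
  assumes \<eta>: "stationary \<eta>"
  shows "measure \<eta> {z. sym_of z = t} = pp t"
proof -
  interpret \<eta>: prob_space \<eta> using \<eta> by (simp add: stationary_def)
  have s: "sets \<eta> = sets borel" using \<eta> by (simp add: stationary_def)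
  define a where "a t = measure \<eta> {z. sym_of z = t}" for t
  define \<iota> where "\<iota> t z = (of_bool (sym_of z = t) :: real)" for t and z :: "'t disc \<times> 'x"
  have cont: "continuous_on UNIV (\<iota> t)" for t
    by (rule continuous_on_disc_times) (simp add: \<iota>_def)
  have int: "(\<integral>z. \<iota> t z \<partial>\<eta>) = a t" for t
  proof -
    have "(\<integral>z. \<iota> t z \<partial>\<eta>) = (\<integral>z. indicator {z. sym_of z = t} z \<partial>\<eta>)"
      by (intro Bochner_Integration.integral_cong) (auto simp: \<iota>_def)
    then show ?thesis using sets_eq_imp_space_eq[OF s] by (simp add: a_def)
  qed
  have "a = pp"
  proof (rule unique)
    show "0 \<le> a t" for t by (simp add: a_def)
    have "(\<Sum>t\<in>UNIV. a t) = (\<integral>z. (\<Sum>t\<in>UNIV. \<iota> t z) \<partial>\<eta>)"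
      unfolding int[symmetric] using stationary_integrable[OF \<eta> cont] by simp
    also have "\<dots> = 1" by (simp add: \<iota>_def \<eta>.prob_space)
    finally show "(\<Sum>t\<in>UNIV. a t) = 1" .
    fix u
    have K: "\<K> (\<iota> u) z = (\<Sum>t\<in>UNIV. q t u * \<iota> t z)" for z
      by (cases z rule: sym_of.cases) (simp add: \<iota>_def)
    have "a u = (\<integral>z. \<K> (\<iota> u) z \<partial>\<eta>)" using \<eta> cont by (simp add: stationary_def int)
    also have "\<dots> = (\<Sum>t\<in>UNIV. q t u * a t)"
      unfolding K int[symmetric] using stationary_integrable[OF \<eta> cont] by simp
    finally show "(\<Sum>t\<in>UNIV. a t * q t u) = a u" by (simp add: mult.commute)
  qed
  then show ?thesis by (simp add: a_def fun_eq_iff)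
qed

lemma stationary_support:
  assumes \<eta>: "stationary \<eta>"
  shows "AE z in \<eta>. z \<in> support"
proof -
  interpret \<eta>: prob_space \<eta> using \<eta> by (simp add: stationary_def)
  have s: "sets \<eta> = sets borel" using \<eta> by (simp add: stationary_def)
  have "AE z in \<eta>. sym_of z = t \<longrightarrow> pp t > 0" for t
  proof (cases "pp t > 0")
    case False
    then have "measure \<eta> {z. sym_of z = t} = 0" using stationary_marginal[OF \<eta>, of t] pp_nonneg[of t] by simp
    then have "{z. sym_of z = t} \<in> null_sets \<eta>"
      using sym_of_vimage_sets[of t] s by (auto simp: null_sets_def \<eta>.emeasure_eq_measure)
    from AE_not_in[OF this] show ?thesis by eventually_elim simp
  qed simp
  then have "AE z in \<eta>. \<forall>t\<in>UNIV. sym_of z = t \<longrightarrow> pp t > 0" by (intro AE_finite_allI) auto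
  then show ?thesis
  proof eventually_elim
    case (elim z)
    then show ?case by (cases z rule: sym_of.cases) simp
  qed
qed

definition kernel :: "'t disc \<times> 'x \<Rightarrow> ((nat \<Rightarrow> 't) \<times> 'x) measure" where
  "kernel z = distr (PP (sym_of z)) skew_algebra (\<lambda>\<omega>. (\<omega>, snd z))"

text \<open>A state \<open>(t, x)\<close> is drawn from \<open>\<eta>\<close> and the path from the
  law \<open>PP t\<close>, independently of \<open>x\<close> given \<open>t\<close>; this is why the
  fiber measures depend on the first symbol alone.\<close>

definition lift :: "('t disc \<times> 'x) measure \<Rightarrow> ((nat \<Rightarrow> 't) \<times> 'x) measure" where
  "lift \<eta> = \<eta> \<bind> kernel"

lemma attach_measurable:
  fixes x :: 'x
  shows "(\<lambda>\<omega>. (\<omega>, x)) \<in> measurable (PP t) skew_algebra"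
  unfolding skew_algebra_def PP_measurable_iff by simp

lemma section_measurable:
  fixes G :: "(nat \<Rightarrow> 't) \<times> 'x \<Rightarrow> 'b"
  assumes "G \<in> measurable skew_algebra N"
  shows "(\<lambda>\<omega>. G (\<omega>, x)) \<in> measurable path_algebra N"
  using measurable_compose[OF attach_measurable assms] unfolding PP_measurable_iff .

lemma kernel_measurable: "kernel \<in> measurable borel (subprob_algebra skew_algebra)"
proof -
  have "(\<lambda>z :: 't disc \<times> 'x. distr (PP (sym_of z)) skew_algebra (\<lambda>\<omega>. (\<omega>, snd z))) \<in> measurable borel (subprob_algebra skew_algebra)"
  proof (rule measurable_distr2)
    have "(\<lambda>y. (snd y, snd (fst y))) \<in> measurable ((borel :: ('t disc \<times> 'x) measure) \<Otimes>\<^sub>M path_algebra) (path_algebra \<Otimes>\<^sub>M borel)"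
      by (intro measurable_Pair measurable_snd measurable_compose[OF measurable_fst snd_borel_measurable])
    then show "(\<lambda>(z, \<omega>). (\<omega>, snd z)) \<in> measurable ((borel :: ('t disc \<times> 'x) measure) \<Otimes>\<^sub>M path_algebra) skew_algebra"
      by (simp add: skew_algebra_def case_prod_unfold)
    have "PP \<in> measurable (count_space UNIV) (subprob_algebra path_algebra)"
      using PP_prob PP_sets by (auto simp: measurable_def space_subprob_algebra prob_space_imp_subprob_space)
    then show "(\<lambda>z. PP (sym_of z)) \<in> measurable (borel :: ('t disc \<times> 'x) measure) (subprob_algebra path_algebra)"
      by (rule measurable_compose[OF sym_of_measurable])
  qed
  then show ?thesis by (simp add: kernel_def[abs_def])
qed

lemma kernel_prob: "prob_space (kernel z)"
  unfolding kernel_def by (intro prob_space.prob_space_distr PP_prob attach_measurable)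

lemma integral_kernel:
  assumes "G \<in> borel_measurable skew_algebra"
  shows "(\<integral>y. G y \<partial>kernel z) = fiber_mean (\<lambda>\<omega> x. G (\<omega>, x)) z"
  by (cases z rule: sym_of.cases) (simp add: kernel_def integral_distr[OF attach_measurable assms])

lemma fiber_mean_measurable:
  assumes "(G :: _ \<Rightarrow> real) \<in> borel_measurable skew_algebra"
  shows "fiber_mean (\<lambda>\<omega> x. G (\<omega>, x)) \<in> borel_measurable borel"
  using measurable_compose[OF kernel_measurable integral_measurable_subprob_algebra[OF assms]]
  unfolding integral_kernel[OF assms] .

lemma kernel_measurable': "sets \<eta> = sets borel \<Longrightarrow> kernel \<in> measurable \<eta> (subprob_algebra skew_algebra)"
  using kernel_measurable by (subst measurable_cong_sets[OF _ refl])

lemma lift_sets: "prob_space \<eta> \<Longrightarrow> sets \<eta> = sets borel \<Longrightarrow> sets (lift \<eta>) = sets skew_algebra"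
  unfolding lift_def by (rule sets_bind) (auto simp: kernel_def prob_space.not_empty)

lemma lift_prob: "prob_space \<eta> \<Longrightarrow> sets \<eta> = sets borel \<Longrightarrow> prob_space (lift \<eta>)"
  unfolding lift_def by (rule prob_space.prob_space_bind[OF _ _ kernel_measurable']) (auto simp: kernel_prob)

lemma integral_lift:
  fixes G :: "(nat \<Rightarrow> 't) \<times> 'x \<Rightarrow> real"
  assumes \<eta>: "prob_space \<eta>" "sets \<eta> = sets borel" and G: "G \<in> borel_measurable skew_algebra" "\<And>y. \<bar>G y\<bar> \<le> B"
  shows "(\<integral>y. G y \<partial>lift \<eta>) = (\<integral>z. fiber_mean (\<lambda>\<omega> x. G (\<omega>, x)) z \<partial>\<eta>)"
proof -
  have "(\<integral>y. G y \<partial>lift \<eta>) = (\<integral>z. \<integral>y. G y \<partial>kernel z \<partial>\<eta>)"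
    unfolding lift_def
  proof (rule integral_bind[where K = skew_algebra and B = B and B' = 1])
    show "AE z in \<eta>. emeasure (kernel z) (space (kernel z)) \<le> ennreal 1"
      using prob_space.emeasure_space_1[OF kernel_prob] by simp
  qed (use \<eta> G kernel_measurable'[OF \<eta>(2)] prob_space.finite_measure[OF \<eta>(1)] prob_space.not_empty[OF \<eta>(1)] in auto)
  then show ?thesis unfolding integral_kernel[OF G(1)] .
qed

lemma AE_lift:
  assumes \<eta>: "prob_space \<eta>" "sets \<eta> = sets borel" and A: "A \<in> sets skew_algebra"
    and ae: "AE z in \<eta>. AE \<omega> in PP (sym_of z). (\<omega>, snd z) \<in> A"
  shows "AE y in lift \<eta>. y \<in> A"
proof -
  have "Measurable.pred skew_algebra (\<lambda>y. y \<in> A)" using A by simp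
  moreover have "AE z in \<eta>. AE y in kernel z. y \<in> A"
    using ae
  proof eventually_elim
    case (elim z)
    have "{y \<in> space skew_algebra. y \<in> A} \<in> sets skew_algebra" using A by simp
    from elim show ?case unfolding kernel_def by (subst AE_distr_iff[OF attach_measurable \<open>{y \<in> space skew_algebra. y \<in> A} \<in> sets skew_algebra\<close>])
  qed
  ultimately show ?thesis
    unfolding lift_def by (subst AE_bind[OF kernel_measurable'[OF \<eta>(2)]])
qed

lemma rectangle_measurable:
  assumes "A \<in> sets path_algebra" "\<phi> \<in> borel_measurable borel"
  shows "(\<lambda>y. indicator A (fst y) * \<phi> (snd y) :: real) \<in> borel_measurable (skew_algebra :: ((nat \<Rightarrow> 't) \<times> 'x) measure)"
  unfolding skew_algebra_def
  by (intro borel_measurable_times measurable_compose[OF measurable_fst] measurable_compose[OF measurable_snd]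
      borel_measurable_indicator assms)

lemma fiber_mean_rectangle:
  assumes "A \<in> sets path_algebra"
  shows "fiber_mean (\<lambda>\<omega> x. indicator A \<omega> * \<phi> x) z = measure (PP (sym_of z)) A * \<phi> (snd z)"
proof -
  have "A \<in> sets (PP t)" for t using assms by (simp add: PP_sets)
  then show ?thesis
    using PP_space by (cases z rule: sym_of.cases) (simp add: Int_absorb2)
qed

text \<open>Tested on rectangles, invariance of the lift is stationarity of \<open>\<eta>\<close>:
  by \<open>orbit_mean\<close> for one step, composition with the skew product becomes
  \<open>\<K>\<close> on conditional means. That identity holds over charged symbols, which carry
  \<open>\<eta>\<close>.\<close>

lemma lift_invariant:
  assumes \<eta>: "stationary \<eta>"
  shows "invariant_prob skew_algebra (skew_product f) (lift \<eta>)"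
proof -
  let ?F = "skew_product f"
  have \<eta>': "prob_space \<eta>" "sets \<eta> = sets borel" using \<eta> by (auto simp: stationary_def)
  interpret \<eta>: prob_space \<eta> by (rule \<eta>')
  have Fm: "?F \<in> measurable skew_algebra skew_algebra"
    using f_cont by (intro skew_product_measurable borel_measurable_continuous_onI)
  have Fl: "?F \<in> measurable (lift \<eta>) skew_algebra"
    using Fm unfolding measurable_cong_sets[OF lift_sets[OF \<eta>'] refl] .
  have "distr (lift \<eta>) skew_algebra ?F = lift \<eta>"
  proof (rule skew_measure_eqI[OF Int_stable_cylinder sets_path_algebra])
    have "cylinder [] = (UNIV :: (nat \<Rightarrow> 't) set)" by (simp add: cylinder_def)
    then show "(UNIV :: (nat \<Rightarrow> 't) set) \<in> range cylinder" by (metis rangeI)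
    show "finite_measure (lift \<eta>)" "sets (lift \<eta>) = sets skew_algebra"
      using prob_space.finite_measure[OF lift_prob[OF \<eta>']] lift_sets[OF \<eta>'] by simp_all
    show "finite_measure (distr (lift \<eta>) skew_algebra ?F)" "sets (distr (lift \<eta>) skew_algebra ?F) = sets skew_algebra"
      using prob_space.finite_measure[OF prob_space.prob_space_distr[OF lift_prob[OF \<eta>'] Fl]] by simp_all
    fix A :: "(nat \<Rightarrow> 't) set" and \<phi> :: "'x \<Rightarrow> real"
    assume "A \<in> range cylinder" and \<phi>: "continuous_on UNIV \<phi>" "\<And>x. 0 \<le> \<phi> x \<and> \<phi> x \<le> 1"
    then have A: "A \<in> sets path_algebra" using cylinder_sets by auto
    define G where "G \<omega> x = indicator A \<omega> * \<phi> x" for \<omega> x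
    have Gm: "(\<lambda>y. G (fst y) (snd y)) \<in> borel_measurable skew_algebra"
      unfolding G_def by (intro rectangle_measurable A borel_measurable_continuous_onI \<phi>)
    have Gx: "(\<lambda>\<omega>. G \<omega> x) \<in> borel_measurable path_algebra" for x
      using section_measurable[OF Gm, of x] by simp
    have Gb: "\<bar>G \<omega> x\<bar> \<le> 1" for \<omega> x using \<phi>(2)[of x] by (simp add: G_def split: split_indicator)
    have FG: "(\<lambda>y. G (fst (?F y)) (snd (?F y))) \<in> borel_measurable skew_algebra"
      by (rule measurable_compose[OF Fm Gm])
    have cont: "continuous_on UNIV (fiber_mean G)"
      unfolding G_def fiber_mean_rectangle[OF A]
      by (rule continuous_on_disc_times) (simp add: continuous_on_mult_left \<phi>(1))
    have "(\<integral>y. G (fst y) (snd y) \<partial>distr (lift \<eta>) skew_algebra ?F) = (\<integral>y. G (fst (?F y)) (snd (?F y)) \<partial>lift \<eta>)"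
      by (rule integral_distr[OF Fl Gm])
    also have "\<dots> = (\<integral>z. fiber_mean (\<lambda>\<omega> x. G (fst (?F (\<omega>, x))) (snd (?F (\<omega>, x)))) z \<partial>\<eta>)"
      by (rule integral_lift[OF \<eta>' FG Gb])
    also have "\<dots> = (\<integral>z. \<K> (fiber_mean G) z \<partial>\<eta>)"
    proof (rule integral_cong_AE)
      show "fiber_mean (\<lambda>\<omega> x. G (fst (?F (\<omega>, x))) (snd (?F (\<omega>, x)))) \<in> borel_measurable \<eta>"
        using fiber_mean_measurable[OF FG] unfolding measurable_cong_sets[OF \<eta>'(2) refl] .
      show "\<K> (fiber_mean G) \<in> borel_measurable \<eta>"
        using borel_measurable_continuous_onI[OF op_cont[OF cont]] unfolding measurable_cong_sets[OF \<eta>'(2) refl] .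
      show "AE z in \<eta>. fiber_mean (\<lambda>\<omega> x. G (fst (?F (\<omega>, x))) (snd (?F (\<omega>, x)))) z = \<K> (fiber_mean G) z"
        using stationary_support[OF \<eta>]
      proof eventually_elim
        case (elim z)
        obtain t x where z: "z = (Disc t, x)" by (cases z rule: sym_of.cases)
        then have "pp t > 0" using elim by simp
        from orbit_mean[OF this Gx Gb, where n = 1 and x = x] show ?case by (simp add: z skew_product_def)
      qed
    qed
    also have "\<dots> = (\<integral>z. fiber_mean G z \<partial>\<eta>)" using \<eta> cont by (simp add: stationary_def)
    also have "\<dots> = (\<integral>y. G (fst y) (snd y) \<partial>lift \<eta>)" using integral_lift[OF \<eta>' Gm Gb] by simp
    finally show "(\<integral>y. indicator A (fst y) * \<phi> (snd y) \<partial>distr (lift \<eta>) skew_algebra ?F) = (\<integral>y. indicator A (fst y) * \<phi> (snd y) \<partial>lift \<eta>)"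
      by (simp only: G_def)
  qed
  then show ?thesis
    using Fm lift_prob[OF \<eta>'] lift_sets[OF \<eta>'] by (simp add: invariant_prob_def space_prob_algebra)
qed

lemma measure_lift_rectangle:
  assumes \<eta>: "prob_space \<eta>" "sets \<eta> = sets borel" and A: "A \<in> sets path_algebra" and B: "B \<in> sets borel"
  shows "measure (lift \<eta>) (A \<times> B) = (\<Sum>t\<in>UNIV. measure (PP t) A * measure \<eta> ({Disc t} \<times> B))"
proof -
  interpret \<eta>: prob_space \<eta> by (rule \<eta>(1))
  have AB: "A \<times> B \<in> sets (lift \<eta>)" unfolding lift_sets[OF \<eta>] skew_algebra_def using A B by simp
  have tB: "{Disc t} \<times> B \<in> sets \<eta>" for t
  proof -
    have "{Disc t} \<times> B = {z. sym_of z = t} \<inter> snd -` B"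
      unfolding sym_of_vimage by auto
    also have "\<dots> \<in> sets \<eta>"
      unfolding \<eta>(2) using sym_of_vimage_sets[of t] measurable_sets[OF snd_borel_measurable B] by (intro sets.Int) auto
    finally show ?thesis .
  qed
  have "measure (lift \<eta>) (A \<times> B) = (\<integral>y. indicator A (fst y) * indicator B (snd y) \<partial>lift \<eta>)"
  proof -
    have "(\<integral>y. indicat_real A (fst y) * indicator B (snd y) \<partial>lift \<eta>) = (\<integral>y. indicator (A \<times> B) y \<partial>lift \<eta>)"
      by (intro Bochner_Integration.integral_cong) (auto split: split_indicator)
    then show ?thesis using sets.sets_into_space[OF AB] by (simp add: Int_absorb2)
  qed
  also have "\<dots> = (\<integral>z. fiber_mean (\<lambda>\<omega> x. indicator A \<omega> * indicator B x) z \<partial>\<eta>)"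
    using integral_lift[OF \<eta> rectangle_measurable[OF A, of "indicator B"], of 1] B by (simp split: split_indicator)
  also have "\<dots> = (\<integral>z. (\<Sum>t\<in>UNIV. measure (PP t) A * indicator ({Disc t} \<times> B) z) \<partial>\<eta>)"
  proof (rule Bochner_Integration.integral_cong[OF refl])
    fix z :: "'t disc \<times> 'x"
    obtain s x where z: "z = (Disc s, x)" by (cases z rule: sym_of.cases)
    have "(\<Sum>t\<in>UNIV. measure (PP t) A * indicator ({Disc t} \<times> B) z) = (\<Sum>t\<in>UNIV. if t = s then measure (PP s) A * indicator B x else 0)"
      by (intro sum.cong refl) (auto simp: z split: split_indicator)
    then show "fiber_mean (\<lambda>\<omega> x. indicator A \<omega> * indicator B x) z = (\<Sum>t\<in>UNIV. measure (PP t) A * indicator ({Disc t} \<times> B) z)"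
      unfolding fiber_mean_rectangle[OF A] by (simp add: z)
  qed
  also have "\<dots> = (\<Sum>t\<in>UNIV. measure (PP t) A * measure \<eta> ({Disc t} \<times> B))"
  proof -
    have i: "integrable \<eta> (indicator ({Disc t} \<times> B) :: _ \<Rightarrow> real)" for t
      using tB by (intro integrable_real_indicator) (simp_all add: \<eta>.emeasure_eq_measure)
    have "space \<eta> = UNIV" using sets_eq_imp_space_eq[OF \<eta>(2)] by simp
    then show ?thesis using i by (subst Bochner_Integration.integral_sum) auto
  qed
  finally show ?thesis .
qed

lemma markovian_lift:
  assumes \<eta>: "stationary \<eta>"
  shows "markovian P f (lift \<eta>)"
proof -
  have \<eta>': "prob_space \<eta>" "sets \<eta> = sets borel" using \<eta> by (auto simp: stationary_def)
  interpret \<eta>: prob_space \<eta> by (rule \<eta>'(1))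
  interpret l: prob_space "lift \<eta>" by (rule lift_prob[OF \<eta>'])
  have sp: "space \<eta> = UNIV" using sets_eq_imp_space_eq[OF \<eta>'(2)] by simp
  have snd\<eta>: "snd \<in> measurable (uniform_measure \<eta> {z. sym_of z = t}) borel" for t
    using snd_borel_measurable unfolding measurable_cong_sets[OF trans[OF sets_uniform_measure \<eta>'(2)] refl] .
  \<comment> \<open>The law of the position given the symbol; for symbols of mass zero any
    probability measure will do.\<close>
  define \<nu> where "\<nu> t = (if pp t > 0 then distr (uniform_measure \<eta> {z. sym_of z = t}) borel snd else return borel undefined)" for t
  have em: "emeasure \<eta> {z. sym_of z = t} = ennreal (pp t)" for t
    using stationary_marginal[OF \<eta>] by (simp add: \<eta>.emeasure_eq_measure)
  have \<nu>p: "prob_space (\<nu> t)" for t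
    unfolding \<nu>_def using em[of t] snd\<eta>
    by (auto intro!: prob_space.prob_space_distr prob_space_uniform_measure prob_space_return)
  have \<nu>s: "sets (\<nu> t) = sets borel" for t by (simp add: \<nu>_def)
  have \<nu>B: "pp t * measure (\<nu> t) B = measure \<eta> ({Disc t} \<times> B)" if B: "B \<in> sets borel" for t B
  proof -
    have tB: "{Disc t} \<times> B = {z. sym_of z = t} \<inter> snd -` B" unfolding sym_of_vimage by auto
    have S: "snd -` B \<in> sets \<eta>" "{z. sym_of z = t} \<in> sets \<eta>"
      unfolding \<eta>'(2) using measurable_sets[OF snd_borel_measurable B] sym_of_vimage_sets by auto
    show ?thesis
    proof (cases "pp t > 0")
      case True
      have "measure (\<nu> t) B = measure (uniform_measure \<eta> {z. sym_of z = t}) (snd -` B)"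
        using True B by (simp add: \<nu>_def measure_distr[OF snd\<eta> B] sp)
      also have "\<dots> = measure \<eta> ({z. sym_of z = t} \<inter> snd -` B) / measure \<eta> {z. sym_of z = t}"
        using S em[of t] True by (intro measure_uniform_measure) auto
      finally show ?thesis using True stationary_marginal[OF \<eta>, of t] by (simp add: tB)
    next
      case False
      then have "pp t = 0" using pp_nonneg[of t] by simp
      moreover have "measure \<eta> ({z. sym_of z = t} \<inter> snd -` B) \<le> measure \<eta> {z. sym_of z = t}"
        using S by (intro \<eta>.finite_measure_mono) auto
      ultimately show ?thesis using stationary_marginal[OF \<eta>, of t] by (simp add: tB measure_le_0_iff)
    qed
  qed
  have rect: "measure (lift \<eta>) (A \<times> B) = (\<integral>\<omega>. indicator A \<omega> * measure (\<nu> (\<omega> 0)) B \<partial>P)"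
    and meas: "(\<lambda>\<omega>. indicator A \<omega> * measure (\<nu> (\<omega> 0)) B) \<in> borel_measurable path_algebra"
    if A: "A \<in> sets path_algebra" and B: "B \<in> sets borel" for A B
  proof -
    have "(\<lambda>\<omega>. measure (\<nu> (\<omega> 0)) B) \<in> borel_measurable path_algebra"
      by (rule measurable_compose[OF component_measurable[of 0], of "\<lambda>t. measure (\<nu> t) B"]) simp
    then show m: "(\<lambda>\<omega>. indicator A \<omega> * measure (\<nu> (\<omega> 0)) B) \<in> borel_measurable path_algebra"
      using A by (intro borel_measurable_times borel_measurable_indicator)
    have b: "\<bar>indicator A \<omega> * measure (\<nu> (\<omega> 0)) B\<bar> \<le> 1" for \<omega>
      using prob_space.prob_le_1[OF \<nu>p] by (simp split: split_indicator)
    have "pp t * (\<integral>\<omega>. indicator A \<omega> * measure (\<nu> (\<omega> 0)) B \<partial>PP t) = measure (PP t) A * measure \<eta> ({Disc t} \<times> B)" for t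
    proof (cases "pp t > 0")
      case True
      have At: "A \<in> sets (PP t)" using A by (simp add: PP_sets)
      have "(\<integral>\<omega>. indicator A \<omega> * measure (\<nu> (\<omega> 0)) B \<partial>PP t) = (\<integral>\<omega>. indicator A \<omega> * measure (\<nu> t) B \<partial>PP t)"
      proof (rule integral_cong_AE)
        show "(\<lambda>\<omega>. indicator A \<omega> * measure (\<nu> (\<omega> 0)) B) \<in> borel_measurable (PP t)"
          unfolding PP_measurable_iff by (rule m)
        show "AE \<omega> in PP t. indicator A \<omega> * measure (\<nu> (\<omega> 0)) B = indicator A \<omega> * measure (\<nu> t) B"
          using AE_PP_start[OF True] by eventually_elim simp
      qed (use At in simp)
      also have "\<dots> = measure (PP t) A * measure (\<nu> t) B" by (simp add: PP_space)
      finally show ?thesis using \<nu>B[OF B, of t] by (simp add: mult.left_commute)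
    next
      case False
      then have "pp t = 0" using pp_nonneg[of t] by simp
      then show ?thesis using \<nu>B[OF B, of t] by simp
    qed
    then show "measure (lift \<eta>) (A \<times> B) = (\<integral>\<omega>. indicator A \<omega> * measure (\<nu> (\<omega> 0)) B \<partial>P)"
      unfolding measure_lift_rectangle[OF \<eta>' A B] integral_P_split[OF m b] by simp
  qed
  have P: "prob_space P" "sets P = sets path_algebra" by (rule P_prob P_sets)+
  interpret P: prob_space P by (rule P)
  have "emeasure (lift \<eta>) (A \<times> B) = (\<integral>\<^sup>+ \<omega>. indicator A \<omega> * emeasure (\<nu> (\<omega> 0)) B \<partial>P)"
    if A: "A \<in> sets path_algebra" and B: "B \<in> sets borel" for A B
  proof -
    have m: "(\<lambda>\<omega>. indicator A \<omega> * measure (\<nu> (\<omega> 0)) B) \<in> borel_measurable P"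
      using meas[OF A B] unfolding P_measurable_iff .
    have "(\<integral>\<^sup>+ \<omega>. indicator A \<omega> * emeasure (\<nu> (\<omega> 0)) B \<partial>P) = (\<integral>\<^sup>+ \<omega>. ennreal (indicator A \<omega> * measure (\<nu> (\<omega> 0)) B) \<partial>P)"
      by (intro nn_integral_cong)
        (simp add: finite_measure.emeasure_eq_measure[OF prob_space.finite_measure[OF \<nu>p]] split: split_indicator)
    also have "\<dots> = ennreal (\<integral>\<omega>. indicator A \<omega> * measure (\<nu> (\<omega> 0)) B \<partial>P)"
    proof (rule nn_integral_eq_integral)
      show "integrable P (\<lambda>\<omega>. indicator A \<omega> * measure (\<nu> (\<omega> 0)) B)"
        using m prob_space.prob_le_1[OF \<nu>p] by (intro P.integrable_const_bound[of _ 1]) (auto split: split_indicator)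
    qed simp
    finally show ?thesis unfolding l.emeasure_eq_measure rect[OF A B] by simp
  qed
  moreover have "distr (lift \<eta>) path_algebra fst = P"
  proof (rule measure_eqI)
    show "sets (distr (lift \<eta>) path_algebra fst) = sets P" by (simp add: P_sets)
    fix A assume "A \<in> sets (distr (lift \<eta>) path_algebra fst)"
    then have A: "A \<in> sets path_algebra" by simp
    have fst: "fst \<in> measurable (lift \<eta>) path_algebra"
      unfolding measurable_cong_sets[OF lift_sets[OF \<eta>'] refl] skew_algebra_def by simp
    have "space (lift \<eta>) = UNIV" using sets_eq_imp_space_eq[OF lift_sets[OF \<eta>']] by (simp add: space_skew_algebra)
    then have "emeasure (distr (lift \<eta>) path_algebra fst) A = emeasure (lift \<eta>) (A \<times> UNIV)"
      by (simp add: emeasure_distr[OF fst A] vimage_fst)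
    also have "\<dots> = ennreal (\<integral>\<omega>. indicator A \<omega> * measure (\<nu> (\<omega> 0)) UNIV \<partial>P)"
      unfolding l.emeasure_eq_measure using rect[OF A, of UNIV] by simp
    also have "(\<lambda>\<omega>. indicator A \<omega> * measure (\<nu> (\<omega> 0)) UNIV) = (indicator A :: _ \<Rightarrow> real)"
      using prob_space.prob_space[OF \<nu>p] sets_eq_imp_space_eq[OF \<nu>s] by (simp add: fun_eq_iff)
    finally show "emeasure (distr (lift \<eta>) path_algebra fst) A = emeasure P A"
      by (simp add: P_space P.emeasure_eq_measure)
  qed
  moreover have "\<nu> \<in> measurable (count_space UNIV) (prob_algebra borel)"
    using \<nu>p \<nu>s by (simp add: space_prob_algebra)
  ultimately show ?thesis
    using lift_invariant[OF \<eta>] unfolding markovian_def by blast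
qed

end

section \<open>Basins of attraction\<close>

lemma null_diff_tendsto_iff:
  fixes a b :: "nat \<Rightarrow> real"
  assumes "(\<lambda>n. a n - b n) \<longlonglongrightarrow> 0"
  shows "a \<longlonglongrightarrow> l \<longleftrightarrow> b \<longlonglongrightarrow> l"
proof
  have *: "(\<lambda>n. b n - a n) \<longlonglongrightarrow> 0" using tendsto_minus[OF assms] by simp
  show "a \<longlonglongrightarrow> l \<Longrightarrow> b \<longlonglongrightarrow> l" using tendsto_add[OF * , of a l] by simp
  show "b \<longlonglongrightarrow> l \<Longrightarrow> a \<longlonglongrightarrow> l" using tendsto_add[OF assms, of b l] by simp
qed

lemma averages_shift:
  fixes a :: "nat \<Rightarrow> real"
  assumes a: "\<And>j. \<bar>a j\<bar> \<le> B"
  shows "(\<lambda>m. (\<Sum>j<m. a (Suc j)) / real m) \<longlonglongrightarrow> l \<longleftrightarrow> (\<lambda>m. (\<Sum>j<m. a j) / real m) \<longlonglongrightarrow> l"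
proof (rule null_diff_tendsto_iff)
  have eq: "(\<Sum>j<m. a (Suc j)) / real m - (\<Sum>j<m. a j) / real m = (a m - a 0) / real m" for m
  proof -
    have "(\<Sum>j<m. a (Suc j)) = (\<Sum>j<m. a j) + a m - a 0" by (induction m) auto
    then show ?thesis by (simp add: diff_divide_distrib[symmetric])
  qed
  have "(\<lambda>m. (a m - a 0) / real m) \<longlonglongrightarrow> 0"
  proof (rule Lim_null_comparison)
    show "\<forall>\<^sub>F m in sequentially. norm ((a m - a 0) / real m) \<le> 2 * B / real m"
      using a[of 0] by (intro always_eventually allI) (simp add: divide_right_mono abs_le_iff, smt (verit) a divide_right_mono of_nat_0_le_iff)
    show "(\<lambda>m. 2 * B / real m) \<longlonglongrightarrow> 0" by (rule lim_const_over_n)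
  qed
  then show "(\<lambda>m. (\<Sum>j<m. a (Suc j)) / real m - (\<Sum>j<m. a j) / real m) \<longlonglongrightarrow> 0" unfolding eq .
qed

lemma test_family_exists:
  assumes K: "compact (UNIV :: 'x::metric_space set)"
  shows "\<exists>(I :: nat \<Rightarrow> 'x set) \<xi>. test_family I \<xi>"
proof -
  have "\<forall>n. \<exists>y :: 'x set \<times> ('x \<Rightarrow> 'x \<Rightarrow> real). finite (fst y) \<and> (\<forall>a\<in>fst y. \<exists>L. L-lipschitz_on UNIV (snd y a)) \<and>
      (\<forall>a\<in>fst y. \<forall>x. 0 \<le> snd y a x) \<and> (\<forall>x. (\<Sum>a\<in>fst y. snd y a x) = 1) \<and>
      (\<forall>a x. snd y a x \<noteq> 0 \<longrightarrow> dist x a < 1 / real (Suc n))"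
  proof
    fix n
    have "1 / real (Suc n) > 0" by simp
    have "\<exists>(I :: 'x set) (\<xi> :: 'x \<Rightarrow> 'x \<Rightarrow> real). finite I \<and> (\<forall>a\<in>I. \<exists>L. L-lipschitz_on UNIV (\<xi> a)) \<and>
      (\<forall>a\<in>I. \<forall>x. 0 \<le> \<xi> a x) \<and> (\<forall>x. (\<Sum>a\<in>I. \<xi> a x) = 1) \<and> (\<forall>a x. \<xi> a x \<noteq> 0 \<longrightarrow> dist x a < 1 / real (Suc n))"
    proof (rule lipschitz_partition_of_unity[OF K \<open>1 / real (Suc n) > 0\<close>])
      fix I :: "'x set" and \<xi> :: "'x \<Rightarrow> 'x \<Rightarrow> real"
      assume *: "finite I" "\<And>a. a \<in> I \<Longrightarrow> \<exists>L. L-lipschitz_on UNIV (\<xi> a)" "\<And>a x. a \<in> I \<Longrightarrow> 0 \<le> \<xi> a x"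
        "\<And>x. (\<Sum>a\<in>I. \<xi> a x) = 1" "\<And>a x. \<xi> a x \<noteq> 0 \<Longrightarrow> dist x a < 1 / real (Suc n)"
      show ?thesis by (intro exI[of _ I] exI[of _ \<xi>] conjI ballI allI impI *)
    qed
    then obtain I :: "'x set" and \<xi> :: "'x \<Rightarrow> 'x \<Rightarrow> real" where "finite I \<and> (\<forall>a\<in>I. \<exists>L. L-lipschitz_on UNIV (\<xi> a)) \<and>
      (\<forall>a\<in>I. \<forall>x. 0 \<le> \<xi> a x) \<and> (\<forall>x. (\<Sum>a\<in>I. \<xi> a x) = 1) \<and> (\<forall>a x. \<xi> a x \<noteq> 0 \<longrightarrow> dist x a < 1 / real (Suc n))"
      by (elim exE)
    then show "\<exists>y :: 'x set \<times> ('x \<Rightarrow> 'x \<Rightarrow> real). finite (fst y) \<and> (\<forall>a\<in>fst y. \<exists>L. L-lipschitz_on UNIV (snd y a)) \<and>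
      (\<forall>a\<in>fst y. \<forall>x. 0 \<le> snd y a x) \<and> (\<forall>x. (\<Sum>a\<in>fst y. snd y a x) = 1) \<and>
      (\<forall>a x. snd y a x \<noteq> 0 \<longrightarrow> dist x a < 1 / real (Suc n))" by (intro exI[of _ "(I, \<xi>)"]) simp
  qed
  from choice[OF this] obtain y :: "nat \<Rightarrow> 'x set \<times> ('x \<Rightarrow> 'x \<Rightarrow> real)"
    where y: "\<forall>n. finite (fst (y n)) \<and> (\<forall>a\<in>fst (y n). \<exists>L. L-lipschitz_on UNIV (snd (y n) a)) \<and>
      (\<forall>a\<in>fst (y n). \<forall>x. 0 \<le> snd (y n) a x) \<and> (\<forall>x. (\<Sum>a\<in>fst (y n). snd (y n) a x) = 1) \<and>
      (\<forall>a x. snd (y n) a x \<noteq> 0 \<longrightarrow> dist x a < 1 / real (Suc n))" by (elim exE)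
  have "test_family (\<lambda>n. fst (y n)) (\<lambda>n. snd (y n))"
    by unfold_locales (use K y in simp_all)
  then show ?thesis by (intro exI)
qed

context test_family
begin

lemma basin_shift:
  fixes f :: "'t \<Rightarrow> 'x \<Rightarrow> 'x" and \<mu> :: "((nat \<Rightarrow> 't) \<times> 'x) measure"
  assumes \<mu>: "prob_space \<mu>" "sets \<mu> = sets skew_algebra"
  shows "skew_product f z \<in> basin f \<mu> \<longleftrightarrow> z \<in> basin f \<mu>"
proof -
  have "(\<lambda>m. (\<Sum>j<m. test w n a ((skew_product f ^^ Suc j) z)) / real m) \<longlonglongrightarrow> l
    \<longleftrightarrow> (\<lambda>m. (\<Sum>j<m. test w n a ((skew_product f ^^ j) z)) / real m) \<longlonglongrightarrow> l" if "a \<in> I n" for w n a l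
    by (rule averages_shift[where a = "\<lambda>j. test w n a ((skew_product f ^^ j) z)", OF test_bound[OF that]])
  moreover have "(skew_product f ^^ Suc j) z = (skew_product f ^^ j) (skew_product f z)" for j
    by (simp add: funpow_swap1)
  ultimately show ?thesis unfolding basin_iff[OF \<mu>] by simp
qed

text \<open>Both orbits read the same path, so a test function along them differs only through its
  Lipschitz factor in the position, and these differences vanish in the average.\<close>

lemma basin_sync:
  fixes f :: "'t \<Rightarrow> 'x \<Rightarrow> 'x" and \<mu> :: "((nat \<Rightarrow> 't) \<times> 'x) measure"
  assumes \<mu>: "prob_space \<mu>" "sets \<mu> = sets skew_algebra"
    and sync: "(\<lambda>j. dist (fiber_iter f j \<omega> x) (fiber_iter f j \<omega> y)) \<longlonglongrightarrow> 0" and y: "(\<omega>, y) \<in> basin f \<mu>"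
  shows "(\<omega>, x) \<in> basin f \<mu>"
  unfolding basin_iff[OF \<mu>]
proof (intro allI ballI)
  fix w n a assume a: "a \<in> I n"
  let ?F = "skew_product f"
  obtain L where L: "L-lipschitz_on UNIV (\<xi> n a)" using \<xi>_lip[OF a] by blast
  have "(\<lambda>j. test w n a ((?F ^^ j) (\<omega>, x)) - test w n a ((?F ^^ j) (\<omega>, y))) \<longlonglongrightarrow> 0"
  proof (rule Lim_null_comparison)
    show "(\<lambda>j. L * dist (fiber_iter f j \<omega> x) (fiber_iter f j \<omega> y)) \<longlonglongrightarrow> 0"
      using tendsto_mult[OF tendsto_const sync] by simp
    have "norm (test w n a ((?F ^^ j) (\<omega>, x)) - test w n a ((?F ^^ j) (\<omega>, y))) \<le> L * dist (fiber_iter f j \<omega> x) (fiber_iter f j \<omega> y)" for j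
      using lipschitz_onD[OF L, of "fiber_iter f j \<omega> x" "fiber_iter f j \<omega> y"] lipschitz_on_nonneg[OF L]
      by (auto simp: skew_product_funpow cyl_test_def dist_real_def)
    then show "\<forall>\<^sub>F j in sequentially. norm (test w n a ((?F ^^ j) (\<omega>, x)) - test w n a ((?F ^^ j) (\<omega>, y))) \<le> L * dist (fiber_iter f j \<omega> x) (fiber_iter f j \<omega> y)"
      by (intro always_eventually allI)
  qed
  from averages_null[OF this]
  have "(\<lambda>m. (\<Sum>j<m. test w n a ((?F ^^ j) (\<omega>, x))) / real m - (\<Sum>j<m. test w n a ((?F ^^ j) (\<omega>, y))) / real m) \<longlonglongrightarrow> 0"
    by (simp only: sum_subtractf diff_divide_distrib)
  from null_diff_tendsto_iff[OF this]
  show "(\<lambda>m. (\<Sum>j<m. test w n a ((?F ^^ j) (\<omega>, x))) / real m) \<longlonglongrightarrow> (\<integral>y. test w n a y \<partial>\<mu>)"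
    using y a unfolding basin_iff[OF \<mu>] by simp
qed

end

context unique_walk
begin

context
  fixes N :: nat and \<alpha> \<theta> r :: real
  assumes con: "contracts N \<alpha> \<theta> r" and N: "N \<ge> 1" and \<theta>: "0 < \<theta>" "\<theta> < 1" and r: "0 < r" and \<alpha>: "0 < \<alpha>" "\<alpha> \<le> 1"
begin

subsection \<open>Synchronization of nearby points\<close>

text \<open>Sums the \<open>\<alpha>\<close>-th powers of the distances at multiples of \<open>N\<close>, stopped once the orbits
  are no longer \<open>r\<close>-close. If it stays below \<open>r\<^sup>\<alpha>\<close>, the orbits never separate.\<close>

primrec spread :: "nat \<Rightarrow> (nat \<Rightarrow> 't) \<Rightarrow> 'x \<Rightarrow> 'x \<Rightarrow> real" where
  "spread 0 \<omega> x y = 0"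
| "spread (Suc k) \<omega> x y = dist x y powr \<alpha> +
    (if dist x y < r then spread k ((shift ^^ N) \<omega>) (fiber_iter f N \<omega> x) (fiber_iter f N \<omega> y) else 0)"

lemma spread_measurable: "(\<lambda>\<omega>. spread k \<omega> x y) \<in> borel_measurable path_algebra"
proof (induction k arbitrary: x y)
  case (Suc k)
  have "(\<lambda>\<omega>. spread k ((shift ^^ N) \<omega>) (fiber_iter f N \<omega> x) (fiber_iter f N \<omega> y)) \<in> borel_measurable path_algebra"
    unfolding fiber_iter_word
    by (rule prefix_compose_measurable[where H = "\<lambda>w \<omega>. spread k \<omega> (word_map f w x) (word_map f w y)"]) (rule Suc.IH)
  then show ?case by (cases "dist x y < r") simp_all
qed simp

lemma dist_diameter: "dist x y \<le> diameter (UNIV :: 'x set)" for x y :: 'x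
  by (rule diameter_bounded_bound[OF compact_imp_bounded[OF K]]) auto

lemma spread_bound: "0 \<le> spread k \<omega> x y \<and> spread k \<omega> x y \<le> real k * diameter (UNIV :: 'x set) powr \<alpha>"
proof (induction k arbitrary: \<omega> x y)
  case (Suc k)
  have "dist x y powr \<alpha> \<le> diameter (UNIV :: 'x set) powr \<alpha>"
    using dist_diameter \<alpha> by (intro powr_mono2) auto
  then show ?case using Suc.IH[of "(shift ^^ N) \<omega>" "fiber_iter f N \<omega> x" "fiber_iter f N \<omega> y"]
    by (auto simp: algebra_simps intro: add_increasing)
qed simp

lemma spread_mono: "spread k \<omega> x y \<le> spread (Suc k) \<omega> x y"
proof (induction k arbitrary: \<omega> x y)
  case (Suc k)
  then show ?case by (subst (1 2) spread.simps(2)) auto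
qed (use spread_bound[of 1] in simp)

text \<open>By the Markov property and the contraction the bound reproduces itself:
  \<open>d + \<theta> * d / (1 - \<theta>) = d / (1 - \<theta>)\<close> with
  \<open>d = dist x y powr \<alpha>\<close>. Stopping at \<open>r\<close> keeps the contraction
  applicable.\<close>

lemma spread_mean:
  assumes "pp t > 0"
  shows "(\<integral>\<omega>. spread k \<omega> x y \<partial>PP t) \<le> dist x y powr \<alpha> / (1 - \<theta>)"
  using assms
proof (induction k arbitrary: t x y)
  case (Suc k)
  interpret PP: prob_space "PP t" by (rule PP_prob)
  have grow: "d \<le> d / (1 - \<theta>)" if "0 \<le> d" for d
    using that \<theta> by (simp add: le_divide_eq mult_left_le)
  show ?case
  proof (cases "dist x y < r")
    case True
    let ?S = "\<lambda>\<omega>. spread k ((shift ^^ N) \<omega>) (fiber_iter f N \<omega> x) (fiber_iter f N \<omega> y)"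
    have Sb: "\<bar>spread k \<omega> x y\<bar> \<le> real k * diameter (UNIV :: 'x set) powr \<alpha>" for \<omega> x y
      using spread_bound[of k \<omega> x y] by simp
    have Sm: "?S \<in> borel_measurable (PP t)"
      unfolding fiber_iter_word PP_measurable_iff
      by (rule prefix_compose_measurable[where H = "\<lambda>w \<omega>. spread k \<omega> (word_map f w x) (word_map f w y)"]) (rule spread_measurable)
    have Si: "integrable (PP t) ?S"
      using Sm Sb by (intro PP.integrable_const_bound[of _ "real k * diameter (UNIV :: 'x set) powr \<alpha>"]) auto
    have "(\<integral>\<omega>. ?S \<omega> \<partial>PP t) = path_exp q N t (\<lambda>w u. \<integral>\<omega>. spread k \<omega> (word_map f w x) (word_map f w y) \<partial>PP u)"
      unfolding fiber_iter_word
      by (rule integral_PP_shift_power[OF Suc.prems, where H = "\<lambda>w \<omega>. spread k \<omega> (word_map f w x) (word_map f w y)", OF spread_measurable Sb])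
    also have "\<dots> \<le> path_exp q N t (\<lambda>w u. (1 / (1 - \<theta>)) * dist (word_map f w x) (word_map f w y) powr \<alpha>)"
      by (rule path_exp_mono_invariant[where R = "\<lambda>t s. pp t > 0" and g = f]) (use Suc pp_closed in auto)
    also have "\<dots> = (1 / (1 - \<theta>)) * path_exp q N t (\<lambda>w u. dist (word_map f w x) (word_map f w y) powr \<alpha>)"
      by (rule path_exp_cmult)
    also have "\<dots> \<le> (1 / (1 - \<theta>)) * (\<theta> * dist x y powr \<alpha>)"
      using con True \<theta> unfolding contracts_def by (intro mult_left_mono) auto
    finally have "(\<integral>\<omega>. ?S \<omega> \<partial>PP t) \<le> \<theta> * dist x y powr \<alpha> / (1 - \<theta>)" by simp
    moreover have "(\<integral>\<omega>. spread (Suc k) \<omega> x y \<partial>PP t) = dist x y powr \<alpha> + (\<integral>\<omega>. ?S \<omega> \<partial>PP t)"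
      using True Si by (simp add: PP.prob_space)
    moreover have "dist x y powr \<alpha> + \<theta> * dist x y powr \<alpha> / (1 - \<theta>) = dist x y powr \<alpha> / (1 - \<theta>)"
      using \<theta> by (simp add: field_simps)
    ultimately show ?thesis by linarith
  next
    case False
    then show ?thesis using grow[of "dist x y powr \<alpha>"] by (simp add: PP.prob_space)
  qed
qed (use \<theta> in simp)

lemma spread_sum:
  assumes "\<And>k. spread k \<omega> x y < r powr \<alpha>"
  shows "(\<Sum>j<n. dist (fiber_iter f (j * N) \<omega> x) (fiber_iter f (j * N) \<omega> y) powr \<alpha>) = spread n \<omega> x y"
  using assms
proof (induction n arbitrary: \<omega> x y)
  case (Suc n)
  \<comment> \<open>Otherwise the first summand alone is at least \<open>r powr \<alpha>\<close>,
    against the assumption for \<open>k = 1\<close>.\<close>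
  have d: "dist x y < r"
  proof (rule ccontr)
    assume "\<not> dist x y < r"
    then have "r powr \<alpha> \<le> dist x y powr \<alpha>" using r \<alpha> by (intro powr_mono2) auto
    then show False using Suc.prems[of 1] spread_bound[of 0] by (simp split: if_splits)
  qed
  have "spread k ((shift ^^ N) \<omega>) (fiber_iter f N \<omega> x) (fiber_iter f N \<omega> y) < r powr \<alpha>" for k
  proof -
    have "dist x y powr \<alpha> + spread k ((shift ^^ N) \<omega>) (fiber_iter f N \<omega> x) (fiber_iter f N \<omega> y) < r powr \<alpha>"
      using Suc.prems[of "Suc k"] d by simp
    then show ?thesis by (rule le_less_trans[rotated]) simp
  qed
  from Suc.IH[OF this]
  have "(\<Sum>j<n. dist (fiber_iter f (Suc j * N) \<omega> x) (fiber_iter f (Suc j * N) \<omega> y) powr \<alpha>)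
      = spread n ((shift ^^ N) \<omega>) (fiber_iter f N \<omega> x) (fiber_iter f N \<omega> y)"
    by (simp only: fiber_iter_add mult_Suc)
  then show ?case using d by (simp add: sum.lessThan_Suc_shift del: sum.lessThan_Suc)
qed simp

text \<open>The powers of the distances at multiples of \<open>N\<close> are summable, hence tend to
  0; at the times in between the distance grows by a factor of at most \<open>L ^ N\<close>.\<close>

lemma spread_sync:
  assumes "\<And>k. spread k \<omega> x y < r powr \<alpha>"
  shows "(\<lambda>j. dist (fiber_iter f j \<omega> x) (fiber_iter f j \<omega> y)) \<longlonglongrightarrow> 0"
proof -
  define d where "d j = dist (fiber_iter f j \<omega> x) (fiber_iter f j \<omega> y)" for j
  have "summable (\<lambda>j. d (j * N) powr \<alpha>)"
  proof (rule summableI_nonneg_bounded)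
    show "(\<Sum>j<n. d (j * N) powr \<alpha>) \<le> r powr \<alpha>" for n
      unfolding d_def spread_sum[OF assms] using assms[of n] by simp
  qed simp
  from summable_LIMSEQ_zero[OF this] have lim0: "(\<lambda>j. d (j * N) powr \<alpha>) \<longlonglongrightarrow> 0" .
  have "(\<lambda>j. (d (j * N) powr \<alpha>) powr (1 / \<alpha>)) \<longlonglongrightarrow> 0"
    by (rule tendsto_zero_powrI[OF lim0 tendsto_const[of "1 / \<alpha>"]]) (use \<alpha> in simp_all)
  moreover have "(d (j * N) powr \<alpha>) powr (1 / \<alpha>) = d (j * N)" for j
    using \<alpha> by (simp add: powr_powr d_def)
  ultimately have lim: "(\<lambda>j. d (j * N)) \<longlonglongrightarrow> 0" by simp
  have "filterlim (\<lambda>j. j div N) sequentially sequentially"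
    unfolding filterlim_at_top
  proof
    fix Z
    have "Z \<le> j div N" if "j \<ge> Z * N" for j using div_le_mono[OF that, of N] N by simp
    then show "\<forall>\<^sub>F j in sequentially. Z \<le> j div N" unfolding eventually_sequentially by blast
  qed
  from filterlim_compose[OF lim this] have lim': "(\<lambda>j. d (j div N * N)) \<longlonglongrightarrow> 0" .
  have "d \<longlonglongrightarrow> 0"
  proof (rule Lim_null_comparison)
    show "(\<lambda>j. L ^ N * d (j div N * N)) \<longlonglongrightarrow> 0" using tendsto_mult[OF tendsto_const lim'] by simp
    have "norm (d j) \<le> L ^ N * d (j div N * N)" for j
    proof -
      let ?k = "j div N * N" and ?s = "j mod N"
      have j: "j = ?k + ?s" by simp
      let ?w = "map ((shift ^^ ?k) \<omega>) [0..<?s]"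
      have F: "fiber_iter f j \<omega> z = word_map f ?w (fiber_iter f ?k \<omega> z)" for z
        using fiber_iter_add[of f ?s ?k \<omega> z] j by (simp add: fiber_iter_word)
      have "d j \<le> L ^ length ?w * d ?k"
        unfolding d_def F by (rule lipschitz_onD[OF word_map_lip]) auto
      also have "\<dots> \<le> L ^ N * d ?k"
        using L N by (intro mult_right_mono power_increasing) (auto simp: d_def intro: less_imp_le)
      finally show ?thesis by (simp add: d_def)
    qed
    then show "\<forall>\<^sub>F j in sequentially. norm (d j) \<le> L ^ N * d (j div N * N)" by (intro always_eventually allI)
  qed
  then show ?thesis unfolding d_def[abs_def] .
qed

lemma synchronization:
  "\<exists>\<delta>>0. \<forall>t x y. pp t > 0 \<longrightarrow> dist x y < \<delta> \<longrightarrow> (\<exists>A\<in>sets path_algebra. 1 / 2 \<le> measure (PP t) A \<and>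
     (\<forall>\<omega>\<in>A. (\<lambda>j. dist (fiber_iter f j \<omega> x) (fiber_iter f j \<omega> y)) \<longlonglongrightarrow> 0))"
proof -
  \<comment> \<open>Chosen so that \<open>\<delta> powr \<alpha> / (1 - \<theta>)\<close> is half of
    \<open>r powr \<alpha>\<close>; Markov's inequality then bounds the probability that
    \<open>spread\<close> reaches \<open>r powr \<alpha>\<close> by one half.\<close>
  define \<delta> where "\<delta> = (r powr \<alpha> * (1 - \<theta>) / 2) powr (1 / \<alpha>)"
  have "\<delta> > 0" using r \<theta> by (simp add: \<delta>_def)
  moreover have "\<exists>A\<in>sets path_algebra. 1 / 2 \<le> measure (PP t) A \<and>
     (\<forall>\<omega>\<in>A. (\<lambda>j. dist (fiber_iter f j \<omega> x) (fiber_iter f j \<omega> y)) \<longlonglongrightarrow> 0)"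
    if t: "pp t > 0" and d: "dist x y < \<delta>" for t x y
  proof -
    interpret PP: prob_space "PP t" by (rule PP_prob)
    define B where "B k = {\<omega>. r powr \<alpha> \<le> spread k \<omega> x y}" for k
    have rp: "r powr \<alpha> > 0" using r by simp
    have Bs: "B k \<in> sets (PP t)" for k
    proof -
      have "{\<omega> \<in> space (PP t). r powr \<alpha> \<le> spread k \<omega> x y} \<in> sets (PP t)"
        using spread_measurable[of k x y] by (intro borel_measurable_le) (auto simp: PP_measurable_iff)
      then show ?thesis by (simp add: B_def PP_space)
    qed
    have small: "measure (PP t) (B k) \<le> 1 / 2" for k
    proof -
      have Si: "integrable (PP t) (\<lambda>\<omega>. spread k \<omega> x y)"
        using spread_measurable[of k x y] spread_bound[of k _ x y]
        by (intro PP.integrable_const_bound[of _ "real k * diameter (UNIV :: 'x set) powr \<alpha>"]) (auto simp: PP_measurable_iff)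
      have "r powr \<alpha> * measure (PP t) (B k) = (\<integral>\<omega>. r powr \<alpha> * indicator (B k) \<omega> \<partial>PP t)"
        using Bs[of k] by (simp add: PP_space)
      also have "\<dots> \<le> (\<integral>\<omega>. spread k \<omega> x y \<partial>PP t)"
        using Bs[of k] Si spread_bound[of k _ x y]
        by (intro integral_mono integrable_mult_right integrable_real_indicator) (auto simp: B_def PP.emeasure_eq_measure split: split_indicator)
      also have "\<dots> \<le> dist x y powr \<alpha> / (1 - \<theta>)" by (rule spread_mean[OF t])
      also have "\<dots> \<le> \<delta> powr \<alpha> / (1 - \<theta>)"
        using d \<alpha> \<theta> by (intro divide_right_mono powr_mono2) auto
      also have "\<dots> = r powr \<alpha> * (1 / 2)"
      proof -
        have "\<delta> powr \<alpha> = r powr \<alpha> * (1 - \<theta>) / 2" using r \<theta> \<alpha> by (simp add: \<delta>_def powr_powr)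
        then show ?thesis using \<theta> by (simp add: divide_eq_eq algebra_simps)
      qed
      finally show ?thesis using rp by (simp only: mult_le_cancel_left_pos)
    qed
    have "incseq B"
      by (intro incseq_SucI subsetI) (simp only: B_def mem_Collect_eq, rule order_trans[OF _ spread_mono])
    then have "(\<lambda>k. measure (PP t) (B k)) \<longlonglongrightarrow> measure (PP t) (\<Union>k. B k)"
      using Bs by (intro PP.finite_Lim_measure_incseq) auto
    then have le: "measure (PP t) (\<Union>k. B k) \<le> 1 / 2"
      using small by (intro LIMSEQ_le_const2[of _ _ "1/2"]) auto
    have U: "(\<Union>k. B k) \<in> sets (PP t)" using Bs by (intro sets.countable_UN) auto
    show ?thesis
    proof (intro bexI[of _ "UNIV - (\<Union>k. B k)"] conjI ballI)
      show "UNIV - (\<Union>k. B k) \<in> sets path_algebra"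
        using sets.compl_sets[OF U] by (simp add: PP_sets PP_space)
      show "1 / 2 \<le> measure (PP t) (UNIV - (\<Union>k. B k))"
        using PP.prob_compl[OF U] le by (simp add: PP_space)
      fix \<omega> assume "\<omega> \<in> UNIV - (\<Union>k. B k)"
      then have "spread k \<omega> x y < r powr \<alpha>" for k by (auto simp: B_def not_le)
      then show "(\<lambda>j. dist (fiber_iter f j \<omega> x) (fiber_iter f j \<omega> y)) \<longlonglongrightarrow> 0" by (rule spread_sync)
    qed
  qed
  ultimately show ?thesis by blast
qed

subsection \<open>Generic points\<close>

text \<open>The conditional mean of a test function is a factor depending on the symbol times a
  Lipschitz function of the position, hence equicontinuous. The law of large numbers then holds for
  all tests at once, as they are countably many.\<close>

lemma AE_basin_of_minimal:
  assumes M: "minimal M" "(Disc t, x) \<in> M" "pp t > 0" and \<eta>: "stationary \<eta>" "AE z in \<eta>. z \<in> M"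
  shows "AE \<omega> in PP t. (\<omega>, x) \<in> basin f (lift \<eta>)"
proof -
  from test_family_exists[OF K] obtain I :: "nat \<Rightarrow> 'x set" and \<xi> where "test_family I \<xi>" by (elim exE)
  then interpret T: test_family I \<xi> "TYPE('t)" .
  have \<eta>': "prob_space \<eta>" "sets \<eta> = sets borel" using \<eta> by (auto simp: stationary_def)
  have lim: "AE \<omega> in PP t. (\<lambda>m. orbit_avg (cyl_test w (\<xi> n a)) m \<omega> x) \<longlonglongrightarrow> (\<integral>y. T.test w n a y \<partial>lift \<eta>)"
    if a: "a \<in> I n" for w n a
  proof -
    obtain l where l: "l-lipschitz_on UNIV (\<xi> n a)" using T.\<xi>_lip[OF a] by blast
    have b: "\<bar>cyl_test w (\<xi> n a) \<omega> y\<bar> \<le> 1" for \<omega> y by (rule cyl_test_bound[OF T.\<xi>_le[OF a]])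
    define c :: "'t \<Rightarrow> real" where "c t = (\<integral>\<omega>. of_bool (map \<omega> [0..<length w] = w) \<partial>PP t)" for t
    have fm: "fiber_mean (cyl_test w (\<xi> n a)) (Disc t, y) = c t * \<xi> n a y" for t y
      by (simp add: cyl_test_def c_def)
    have c: "\<bar>c t\<bar> \<le> 1" for t
    proof -
      have "\<bar>fiber_mean (cyl_test w (\<lambda>_ :: 'x. 1)) (Disc t, y)\<bar> \<le> 1" for y
        by (rule fiber_mean_bound[OF cyl_test_measurable cyl_test_bound]) simp
      then show ?thesis by (simp add: cyl_test_def c_def)
    qed
    have "AE \<omega> in PP t. (\<lambda>m. orbit_avg (cyl_test w (\<xi> n a)) m \<omega> x) \<longlonglongrightarrow> (\<integral>z. fiber_mean (cyl_test w (\<xi> n a)) z \<partial>\<eta>)"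
    proof (rule orbit_avg_tendsto[OF M \<eta> b cyl_test_measurable cyl_test_dep])
      show "continuous_on UNIV (fiber_mean (cyl_test w (\<xi> n a)))"
        by (rule continuous_on_disc_times) (simp only: fm, intro continuous_on_mult_left T.\<xi>_cont a)
      show "equicontinuous (fiber_mean (cyl_test w (\<xi> n a)))"
      proof (rule lipschitz_equicontinuous[OF con N \<theta> r \<alpha>])
        show "\<bar>fiber_mean (cyl_test w (\<xi> n a)) (Disc t, x) - fiber_mean (cyl_test w (\<xi> n a)) (Disc t, y)\<bar> \<le> l * dist x y" for t x y
        proof -
          have "\<bar>c t * \<xi> n a x - c t * \<xi> n a y\<bar> = \<bar>c t\<bar> * \<bar>\<xi> n a x - \<xi> n a y\<bar>"
            by (simp add: abs_mult right_diff_distrib[symmetric])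
          also have "\<dots> \<le> 1 * (l * dist x y)"
            using c lipschitz_onD[OF l, of x y] by (intro mult_mono) (auto simp: dist_real_def)
          finally show ?thesis by (simp only: fm mult_1)
        qed
        show "\<bar>fiber_mean (cyl_test w (\<xi> n a)) z\<bar> \<le> 1" for z
          by (rule fiber_mean_bound[OF cyl_test_measurable b])
      qed
    qed
    moreover have "(\<integral>y. T.test w n a y \<partial>lift \<eta>) = (\<integral>z. fiber_mean (cyl_test w (\<xi> n a)) z \<partial>\<eta>)"
      using integral_lift[OF \<eta>' T.test_measurable[OF a] T.test_bound[OF a]] by simp
    ultimately show ?thesis by simp
  qed
  have "AE \<omega> in PP t. \<forall>a\<in>I n. (\<lambda>m. orbit_avg (cyl_test w (\<xi> n a)) m \<omega> x) \<longlonglongrightarrow> (\<integral>y. T.test w n a y \<partial>lift \<eta>)" for w n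
    by (intro AE_finite_allI T.I lim)
  then have "AE \<omega> in PP t. \<forall>w n. \<forall>a\<in>I n. (\<lambda>m. orbit_avg (cyl_test w (\<xi> n a)) m \<omega> x) \<longlonglongrightarrow> (\<integral>y. T.test w n a y \<partial>lift \<eta>)"
    unfolding AE_all_countable by blast
  then show ?thesis
  proof eventually_elim
    case (elim \<omega>)
    then show ?case
      unfolding T.basin_iff[OF lift_prob[OF \<eta>'] lift_sets[OF \<eta>']] orbit_avg_def skew_product_funpow by simp
  qed
qed

subsection \<open>The basins cover almost every point\<close>

text \<open>The events decided by a finite prefix; they are the algebra to which
  \<open>zero_if_contracted_on_algebra\<close> is applied.\<close>

lemma prefix_algebra:
  defines "G \<equiv> {{\<omega> :: nat \<Rightarrow> 't. map \<omega> [0..<n] \<in> W} |n W. True}"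
  shows "sets path_algebra = sigma_sets UNIV G" "{} \<in> G" "C \<in> G \<Longrightarrow> UNIV - C \<in> G"
    "C \<in> G \<Longrightarrow> D \<in> G \<Longrightarrow> C \<union> D \<in> G"
proof -
  show "sets path_algebra = sigma_sets UNIV G"
  proof
    have "cylinder As \<in> G" for As :: "'t set list"
    proof -
      have "cylinder As = {\<omega>. map \<omega> [0..<length As] \<in> {w. \<forall>i<length As. w ! i \<in> As ! i}}"
        by (auto simp: cylinder_def)
      then show ?thesis unfolding G_def by blast
    qed
    then show "sets (path_algebra :: (nat \<Rightarrow> 't) measure) \<subseteq> sigma_sets UNIV G"
      unfolding sets_path_algebra by (intro sigma_sets_mono) auto
    have "{\<omega> \<in> space path_algebra. map \<omega> [0..<n] \<in> W} \<in> sets path_algebra" for n and W :: "'t list set"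
      using measurable_sets[OF prefix_measurable[of n], of W] by (simp add: vimage_def Int_def conj_commute)
    then have "{\<omega>. map \<omega> [0..<n] \<in> W} \<in> sets path_algebra" for n and W :: "'t list set"
      by (simp add: space_path_algebra)
    then show "sigma_sets UNIV G \<subseteq> sets (path_algebra :: (nat \<Rightarrow> 't) measure)"
      using sets.sigma_sets_subset[of G "path_algebra :: (nat \<Rightarrow> 't) measure"] by (auto simp: G_def space_path_algebra)
  qed
  have "{\<omega> :: nat \<Rightarrow> 't. map \<omega> [0..<0] \<in> {}} \<in> G" unfolding G_def by blast
  then show "{} \<in> G" by simp
  show "UNIV - C \<in> G" if "C \<in> G"
  proof -
    from that obtain n W where C: "C = {\<omega>. map \<omega> [0..<n] \<in> W}" unfolding G_def by blast
    then have "UNIV - C = {\<omega>. map \<omega> [0..<n] \<in> - W}" by auto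
    then show ?thesis unfolding G_def by blast
  qed
  show "C \<union> D \<in> G" if "C \<in> G" "D \<in> G"
  proof -
    from that obtain n W m V where CD: "C = {\<omega>. map \<omega> [0..<n] \<in> W}" "D = {\<omega>. map \<omega> [0..<m] \<in> V}" unfolding G_def by blast
    have "map \<omega> [0..<n] = take n (map \<omega> [0..<n + m])" "map \<omega> [0..<m] = take m (map \<omega> [0..<n + m])" for \<omega> :: "nat \<Rightarrow> 't"
      by (simp_all add: take_map take_upt)
    then have "C \<union> D = {\<omega>. map \<omega> [0..<n + m] \<in> {w. take n w \<in> W \<or> take m w \<in> V}}" unfolding CD by auto
    then show ?thesis unfolding G_def by blast
  qed
qed

text \<open>Conditionally on any prefix, the complement has probability at most \<open>1 - \<kappa>\<close>; approximating
  it by events that depend on a prefix shows that it is null.\<close>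

lemma full_if_bounded_below:
  fixes G :: "(nat \<Rightarrow> 't) \<Rightarrow> 'x \<Rightarrow> bool"
  assumes Gm: "\<And>x. {\<omega>. G \<omega> x} \<in> sets path_algebra"
    and inv: "\<And>\<omega> x n. G ((shift ^^ n) \<omega>) (fiber_iter f n \<omega> x) \<longleftrightarrow> G \<omega> x"
    and \<kappa>: "0 < \<kappa>" "\<kappa> \<le> 1" "\<And>t x. pp t > 0 \<Longrightarrow> \<kappa> \<le> measure (PP t) {\<omega>. G \<omega> x}"
    and t: "pp t > 0"
  shows "AE \<omega> in PP t. G \<omega> x"
proof -
  interpret PP: prob_space "PP t" by (rule PP_prob)
  define A where "A = {\<omega>. \<not> G \<omega> x}"
  have As: "{\<omega>. \<not> G \<omega> y} \<in> sets path_algebra" for y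
  proof -
    have "{\<omega>. \<not> G \<omega> y} = space path_algebra - {\<omega>. G \<omega> y}" by (auto simp: space_path_algebra)
    then show ?thesis using sets.compl_sets[OF Gm[of y]] by simp
  qed
  have "measure (PP t) A = 0"
  proof (rule PP.zero_if_contracted_on_algebra[where G = "{{\<omega> :: nat \<Rightarrow> 't. map \<omega> [0..<n] \<in> W} |n W. True}" and \<kappa> = "1 - \<kappa>"])
    show "A \<in> sets (PP t)" using As[of x] by (simp add: A_def PP_sets)
    fix C :: "(nat \<Rightarrow> 't) set" assume "C \<in> {{\<omega>. map \<omega> [0..<n] \<in> W} |n W. True}"
    then obtain n W where C: "C = {\<omega>. map \<omega> [0..<n] \<in> W}" by blast
    \<comment> \<open>By invariance the event \<open>A\<close> can be read off from the orbit after
      time \<open>n\<close>, so on \<open>C\<close> its indicator is a function of the prefix and of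
      the shifted path, and the Markov property applies.\<close>
    define H where "H w \<omega> = indicat_real W w * indicator {\<omega>. \<not> G \<omega> (word_map f w x)} \<omega>" for w \<omega>
    have Hm: "H w \<in> borel_measurable path_algebra" for w
      unfolding H_def using As by (intro borel_measurable_times borel_measurable_const borel_measurable_indicator)
    have Hb: "\<bar>H w \<omega>\<bar> \<le> 1" for w \<omega> by (simp add: H_def split: split_indicator)
    have CA: "C \<in> sets (PP t)"
      using prefix_algebra(1) unfolding C by (auto simp: PP_sets intro!: sigma_sets.Basic)
    have mC: "measure (PP t) C = path_exp q n t (\<lambda>w u. indicator W w)"
    proof -
      have "(\<integral>\<omega>. indicator W (map \<omega> [0..<n]) \<partial>PP t) = path_exp q n t (\<lambda>w u. \<integral>\<omega>. indicat_real W w \<partial>PP u)"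
        by (rule integral_PP_shift_power[OF t, where H = "\<lambda>w \<omega>. indicat_real W w" and B = 1]) (auto split: split_indicator)
      also have "\<dots> = path_exp q n t (\<lambda>w u. indicator W w)"
        using prob_space.prob_space[OF PP_prob] by simp
      also have "(\<lambda>\<omega>. indicat_real W (map \<omega> [0..<n])) = indicator C" by (auto simp: C indicator_def fun_eq_iff)
      finally show ?thesis by (simp add: PP_space)
    qed
    have "measure (PP t) (A \<inter> C) = (\<integral>\<omega>. indicator (A \<inter> C) \<omega> \<partial>PP t)" by (simp add: PP_space)
    also have "indicat_real (A \<inter> C) = (\<lambda>\<omega>. H (map \<omega> [0..<n]) ((shift ^^ n) \<omega>))"
      using inv by (auto simp: H_def A_def C fun_eq_iff fiber_iter_word[symmetric] split: split_indicator)
    also have "(\<integral>\<omega>. H (map \<omega> [0..<n]) ((shift ^^ n) \<omega>) \<partial>PP t) = path_exp q n t (\<lambda>w u. \<integral>\<omega>. H w \<omega> \<partial>PP u)"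
      by (rule integral_PP_shift_power[OF t Hm Hb])
    also have "\<dots> \<le> path_exp q n t (\<lambda>w u. (1 - \<kappa>) * indicator W w)"
    proof (rule path_exp_mono_invariant[where R = "\<lambda>t s. pp t > 0" and g = f and s = x])
      fix w u assume u: "pp u > 0"
      have sets: "{\<omega>. G \<omega> (word_map f w x)} \<in> sets (PP u)" using Gm by (simp add: PP_sets)
      have "measure (PP u) {\<omega>. \<not> G \<omega> (word_map f w x)} = 1 - measure (PP u) {\<omega>. G \<omega> (word_map f w x)}"
        using prob_space.prob_compl[OF PP_prob sets] by (simp add: PP_space Compl_eq_Diff_UNIV[symmetric] Collect_neg_eq)
      then show "(\<integral>\<omega>. H w \<omega> \<partial>PP u) \<le> (1 - \<kappa>) * indicator W w"
        using \<kappa>(3)[OF u, of "word_map f w x"] by (simp add: H_def PP_space split: split_indicator)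
    qed (use t pp_closed in auto)
    also have "\<dots> = (1 - \<kappa>) * measure (PP t) C" unfolding mC by (rule path_exp_cmult)
    finally show "measure (PP t) (A \<inter> C) \<le> (1 - \<kappa>) * measure (PP t) C" .
  qed (use prefix_algebra \<kappa> in \<open>simp_all only: PP_sets PP_space, auto\<close>)
  then have "A \<in> null_sets (PP t)" using As[of x] by (auto simp: null_sets_def PP_sets A_def PP.emeasure_eq_measure)
  from AE_not_in[OF this] show ?thesis by (simp add: A_def)
qed

lemma physical_measures:
  "\<exists>S. finite S \<and> (\<forall>\<mu>\<in>S. markovian P f \<mu> \<and> (AE y in \<mu>. y \<in> basin f \<mu>)) \<and>
     (\<forall>x. AE \<omega> in P. \<exists>\<mu>\<in>S. (\<omega>, x) \<in> basin f \<mu>)"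
proof -
  from test_family_exists[OF K] obtain I :: "nat \<Rightarrow> 'x set" and \<xi> where "test_family I \<xi>" by (elim exE)
  then interpret T: test_family I \<xi> "TYPE('t)" .
  have Fm: "skew_product f \<in> measurable skew_algebra skew_algebra"
    using f_cont by (intro skew_product_measurable borel_measurable_continuous_onI)
  \<comment> \<open>Minimal sets inside \<open>support\<close>: over charged symbols
    \<open>PP t\<close> is a genuine conditional law, and every nonempty absorbing subset of
    \<open>support\<close> contains such a set.\<close>
  define Ms where "Ms = {M. minimal M \<and> M \<subseteq> support}"
  have fin: "finite Ms" unfolding Ms_def using finite_minimal[OF con \<theta>(2) \<alpha>(1) r] by (rule finite_subset[rotated]) auto
  have "\<exists>\<eta>. stationary \<eta> \<and> (AE z in \<eta>. z \<in> M)" if "M \<in> Ms" for M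
  proof -
    have "absorbing M" "M \<noteq> {}" using that by (auto simp: Ms_def minimal_def)
    then show ?thesis by (rule stationary_on_absorbing) (intro exI conjI)
  qed
  then have "\<forall>M\<in>Ms. \<exists>\<eta>. stationary \<eta> \<and> (AE z in \<eta>. z \<in> M)" by (intro ballI)
  from bchoice[OF this] obtain \<eta> where "\<forall>M\<in>Ms. stationary (\<eta> M) \<and> (AE z in \<eta> M. z \<in> M)" by (elim exE)
  then have \<eta>: "stationary (\<eta> M)" "AE z in \<eta> M. z \<in> M" if "M \<in> Ms" for M using that by simp_all
  have \<eta>': "prob_space (\<eta> M)" "sets (\<eta> M) = sets borel" if "M \<in> Ms" for M
    using \<eta>(1)[OF that] by (auto simp: stationary_def)
  define \<mu> where "\<mu> M = lift (\<eta> M)" for M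
  have \<mu>: "prob_space (\<mu> M)" "sets (\<mu> M) = sets skew_algebra" if "M \<in> Ms" for M
    unfolding \<mu>_def using lift_prob[OF \<eta>'[OF that]] lift_sets[OF \<eta>'[OF that]] .
  have bs: "basin f (\<mu> M) \<in> sets skew_algebra" if "M \<in> Ms" for M
    by (rule T.basin_sets[OF \<mu>[OF that] Fm])
  have gen: "AE \<omega> in PP t. (\<omega>, x) \<in> basin f (\<mu> M)" if M: "M \<in> Ms" "(Disc t, x) \<in> M" for M t x
  proof -
    have "pp t > 0" "minimal M" using M by (auto simp: Ms_def)
    then show ?thesis unfolding \<mu>_def using M \<eta>[OF M(1)] by (intro AE_basin_of_minimal)
  qed
  have ae: "AE y in \<mu> M. y \<in> basin f (\<mu> M)" if M: "M \<in> Ms" for M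
  proof -
    have "AE z in \<eta> M. AE \<omega> in PP (sym_of z). (\<omega>, snd z) \<in> basin f (\<mu> M)"
      using \<eta>(2)[OF M]
    proof eventually_elim
      case (elim z)
      then show ?case using gen[OF M] by (cases z rule: sym_of.cases) simp
    qed
    from AE_lift[OF \<eta>'[OF M] bs[OF M] this] show ?thesis by (simp only: \<mu>_def)
  qed
  define Bas where "Bas = (\<Union>M\<in>Ms. basin f (\<mu> M))"
  have Bs: "Bas \<in> sets skew_algebra" unfolding Bas_def using fin bs by (intro sets.finite_UN) auto
  have Bx: "{\<omega>. (\<omega>, x) \<in> Bas} \<in> sets path_algebra" for x
  proof -
    have "Measurable.pred skew_algebra (\<lambda>y. y \<in> Bas)" using Bs by simp
    from section_measurable[OF this, of x] show ?thesis by (simp add: pred_def space_path_algebra)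
  qed
  have shiftB: "(skew_product f ^^ n) z \<in> Bas \<longleftrightarrow> z \<in> Bas" for n z
  proof (induction n)
    case (Suc n)
    have "skew_product f y \<in> Bas \<longleftrightarrow> y \<in> Bas" for y unfolding Bas_def using T.basin_shift[OF \<mu>] by auto
    then show ?case using Suc.IH by simp
  qed simp
  have inv: "((shift ^^ n) \<omega>, fiber_iter f n \<omega> x) \<in> Bas \<longleftrightarrow> (\<omega>, x) \<in> Bas" for n \<omega> x
    using shiftB[of n "(\<omega>, x)"] by (simp only: skew_product_funpow)
  define G where "G \<omega> x = indicat_real {\<omega>. (\<omega>, x) \<in> Bas} \<omega>" for \<omega> x
  have Gm: "(\<lambda>\<omega>. G \<omega> x) \<in> borel_measurable path_algebra" for x unfolding G_def by (intro borel_measurable_indicator Bx)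
  have Gb: "\<bar>G \<omega> x\<bar> \<le> 1" for \<omega> x by (simp add: G_def split: split_indicator)
  \<comment> \<open>The probability of being generic for one of the measures. Invariance of the
    basins makes it harmonic on \<open>support\<close>, see \<open>hinv\<close>.\<close>
  define h where "h = fiber_mean G"
  have h: "h (Disc t, x) = measure (PP t) {\<omega>. (\<omega>, x) \<in> Bas}" for t x by (simp add: h_def G_def PP_space)
  have h0: "0 \<le> h z" for z by (cases z rule: sym_of.cases) (simp add: h)
  have hinv: "(\<K> ^^ j) h z = h z" if "z \<in> support" for z j
  proof -
    obtain t x where z: "z = (Disc t, x)" by (cases z rule: sym_of.cases)
    have "G ((shift ^^ j) \<omega>) (fiber_iter f j \<omega> x) = G \<omega> x" for \<omega> using inv by (simp add: G_def indicator_def)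
    then show ?thesis using orbit_mean[of t G, OF _ Gm Gb, of j x] that by (simp add: z h_def)
  qed
  from synchronization obtain \<delta>0 where \<delta>0: "\<delta>0 > 0" "\<forall>t x y. pp t > 0 \<longrightarrow> dist x y < \<delta>0 \<longrightarrow> (\<exists>A\<in>sets path_algebra. 1 / 2 \<le> measure (PP t) A \<and>
     (\<forall>\<omega>\<in>A. (\<lambda>j. dist (fiber_iter f j \<omega> x) (fiber_iter f j \<omega> y)) \<longlonglongrightarrow> 0))" by (elim exE conjE)
  define \<delta> where "\<delta> = min \<delta>0 1"
  have \<delta>: "\<delta> > 0" "\<delta> \<le> \<delta>0" "\<delta> \<le> 1" using \<delta>0 by (auto simp: \<delta>_def)
  \<comment> \<open>Almost every path is generic for the starting position \<open>y\<close> in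
    \<open>M\<close>. On an event of probability at least one half the orbit of \<open>x\<close>
    synchronizes with that of \<open>y\<close>, and \<open>basin_sync\<close> transfers
    genericity.\<close>
  have near: "1 / 2 \<le> h (Disc t, x)" if t: "pp t > 0" and M: "M \<in> Ms" "(Disc s, y) \<in> M" and d: "dist (Disc t, x) (Disc s, y) < \<delta>" for t x s y M
  proof -
    have ts: "s = t" and dxy: "dist x y < \<delta>0" using dist_disc_times_less[OF d \<delta>(3)] \<delta>(2) by auto
    from \<delta>0(2)[rule_format, OF t dxy] obtain A where A: "A \<in> sets path_algebra" "1 / 2 \<le> measure (PP t) A"
      "\<forall>\<omega>\<in>A. (\<lambda>j. dist (fiber_iter f j \<omega> x) (fiber_iter f j \<omega> y)) \<longlonglongrightarrow> 0" by (elim bexE conjE)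
    interpret PP: prob_space "PP t" by (rule PP_prob)
    have "measure (PP t) A \<le> measure (PP t) {\<omega>. (\<omega>, x) \<in> Bas}"
    proof (rule PP.finite_measure_mono_AE)
      show "{\<omega>. (\<omega>, x) \<in> Bas} \<in> sets (PP t)" using Bx by (simp add: PP_sets)
      have "AE \<omega> in PP t. (\<omega>, y) \<in> basin f (\<mu> M)" using gen[OF M(1), of t y] M(2) ts by simp
      then show "AE \<omega> in PP t. \<omega> \<in> A \<longrightarrow> \<omega> \<in> {\<omega>. (\<omega>, x) \<in> Bas}"
      proof eventually_elim
        case (elim \<omega>)
        show ?case
        proof
          assume "\<omega> \<in> A"
          then have "(\<omega>, x) \<in> basin f (\<mu> M)" by (intro T.basin_sync[OF \<mu>[OF M(1)] bspec[OF A(3)] elim])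
          then show "\<omega> \<in> {\<omega>. (\<omega>, x) \<in> Bas}" using M(1) by (auto simp: Bas_def)
        qed
      qed
    qed
    then show ?thesis using A(2) by (simp add: h)
  qed
  \<comment> \<open>A continuous substitute for the indicator of a neighbourhood of the minimal
    sets: \<open>reach\<close> requires continuity, and \<open>near\<close> gives
    \<open>v \<le> 2 * \<delta> * h\<close> on \<open>support\<close>.\<close>
  define v where "v z = max 0 (\<delta> - infdist z (\<Union>Ms))" for z
  have vc: "continuous_on UNIV v" unfolding v_def by (intro continuous_intros)
  have v0: "0 \<le> v z" for z by (simp add: v_def)
  have meets: "\<exists>z\<in>D. v z > 0" if D: "absorbing D" "D \<noteq> {}" "D \<subseteq> support" for D
  proof -
    obtain M where M: "minimal M" "M \<subseteq> D" using minimal_exists[OF D(1,2)] .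
    then have "M \<in> Ms" "M \<noteq> {}" using D by (auto simp: Ms_def minimal_def)
    then obtain z where "z \<in> M" by blast
    then have "infdist z (\<Union>Ms) = 0" "z \<in> D" using \<open>M \<in> Ms\<close> M(2) by (auto intro!: infdist_zero)
    then show ?thesis using \<delta>(1) by (intro bexI[of _ z]) (simp_all add: v_def)
  qed
  have "\<exists>n c. c > 0 \<and> (\<forall>z\<in>support. c \<le> (\<Sum>j<n. (\<K> ^^ j) v z))"
  proof (rule reach[OF absorbing_support vc v0 meets])
    fix n and c :: real
    assume "c > 0" "\<And>z. z \<in> support \<Longrightarrow> c \<le> (\<Sum>j<n. (\<K> ^^ j) v z)"
    then show ?thesis by (intro exI[of _ n] exI[of _ c] conjI ballI)
  qed
  then obtain n c where c: "c > 0" "\<forall>z\<in>support. c \<le> (\<Sum>j<n. (\<K> ^^ j) v z)" by (elim exE conjE)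
  have vh: "v z \<le> (2 * \<delta>) * h z" if z: "z \<in> support" for z
  proof (cases "infdist z (\<Union>Ms) < \<delta>")
    case True
    have ne: "\<Union>Ms \<noteq> {}" using meets[OF absorbing_support support_nonempty] minimal_exists[OF absorbing_support support_nonempty]
      by (metis Ms_def Sup_upper empty_subsetI mem_Collect_eq minimal_def subset_antisym)
    have "\<exists>y\<in>\<Union>Ms. dist z y < \<delta>"
    proof (rule ccontr)
      assume "\<not> (\<exists>y\<in>\<Union>Ms. dist z y < \<delta>)"
      then have "\<delta> \<le> (INF y\<in>\<Union>Ms. dist z y)" using ne by (intro cINF_greatest) (auto simp: not_less)
      then show False using True ne by (simp add: infdist_notempty)
    qed
    then obtain y M where y: "M \<in> Ms" "y \<in> M" "dist z y < \<delta>" by blast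
    obtain t x where zt: "z = (Disc t, x)" by (cases z rule: sym_of.cases)
    obtain s y' where ys: "y = (Disc s, y')" by (cases y rule: sym_of.cases)
    have "1 / 2 \<le> h z" using near[of t M s y' x] z y by (simp add: zt ys)
    moreover have "v z \<le> \<delta>" using infdist_nonneg[of z "\<Union>Ms"] \<delta>(1) by (simp add: v_def)
    moreover have "2 * \<delta> * (1 / 2) \<le> 2 * \<delta> * h z" using calculation(1) \<delta>(1) by (intro mult_left_mono) auto
    ultimately show ?thesis by simp
  next
    case False
    then have "v z = 0" by (simp add: v_def)
    then show ?thesis using h0[of z] \<delta>(1) by simp
  qed
  have low: "c \<le> real n * (2 * \<delta>) * h z" if z: "z \<in> support" for z
  proof -
    have "c \<le> (\<Sum>j<n. (\<K> ^^ j) v z)" by (rule bspec[OF c(2) z])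
    also have "\<dots> \<le> (\<Sum>j<n. (\<K> ^^ j) (\<lambda>y. (2 * \<delta>) * h y) z)"
      by (intro sum_mono op_power_mono_on[OF absorbing_support z] vh)
    also have "\<dots> = real n * (2 * \<delta>) * h z" by (simp add: op_power_cmult hinv[OF z])
    finally show ?thesis .
  qed
  \<comment> \<open>Since \<open>h\<close> is harmonic, summing
    \<open>v \<le> 2 * \<delta> * h\<close> over \<open>n\<close> iterates bounds \<open>h\<close>
    below by this constant on all of \<open>support\<close>.\<close>
  define \<kappa> where "\<kappa> = c / (real n * (2 * \<delta>))"
  have n: "real n * (2 * \<delta>) > 0"
  proof -
    obtain z where "z \<in> support" using support_nonempty by blast
    from low[OF this] c(1) have "n \<noteq> 0" by (intro notI) simp
    then show ?thesis using \<delta>(1) by simp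
  qed
  have \<kappa>: "\<kappa> > 0" "z \<in> support \<Longrightarrow> \<kappa> \<le> h z" for z
    using c(1) n low[of z] by (simp_all add: \<kappa>_def divide_le_eq mult.commute)
  have "\<kappa> \<le> 1"
  proof -
    obtain z where z: "z \<in> support" using support_nonempty by blast
    obtain t x where "z = (Disc t, x)" by (cases z rule: sym_of.cases)
    then show ?thesis using \<kappa>(2)[OF z] prob_space.prob_le_1[OF PP_prob, of t "{\<omega>. (\<omega>, x) \<in> Bas}"] by (simp add: h)
  qed
  then have "AE \<omega> in PP t. (\<omega>, x) \<in> Bas" if "pp t > 0" for t x
    using full_if_bounded_below[where G = "\<lambda>\<omega> x. (\<omega>, x) \<in> Bas", OF Bx inv \<kappa>(1) _ _ that] \<kappa>(2) by (simp add: h[symmetric])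
  then have full: "AE \<omega> in P. (\<omega>, x) \<in> Bas" for x by (intro AE_P_iff)
  show ?thesis
  proof (intro exI[of _ "\<mu> ` Ms"] conjI ballI allI)
    show "finite (\<mu> ` Ms)" using fin by simp
    show "AE \<omega> in P. \<exists>\<mu>\<in>\<mu> ` Ms. (\<omega>, x) \<in> basin f \<mu>" for x
      using full[of x] by eventually_elim (auto simp: Bas_def)
    fix m assume "m \<in> \<mu> ` Ms"
    then obtain M where M: "M \<in> Ms" "m = \<mu> M" by blast
    show "AE y in m. y \<in> basin f m" using ae[OF M(1)] by (simp only: M(2))
    show "markovian P f m" unfolding M(2) \<mu>_def by (rule markovian_lift[OF \<eta>(1)[OF M(1)]])
  qed
qed

end

end

section \<open>The truncated Lyapunov exponent\<close>

lemma usc_measurable: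
  assumes "usc b"
  shows "b \<in> borel_measurable borel"
proof -
  have "open {z. b z < c}" for c
  proof (subst open_subopen, intro ballI)
    fix z assume "z \<in> {z. b z < c}"
    then have "\<forall>\<^sub>F y in nhds z. b y < c" using assms unfolding usc_def by simp
    then obtain S where "open S" "z \<in> S" "\<forall>y\<in>S. b y < c" unfolding eventually_nhds by (elim exE conjE)
    then show "\<exists>S. open S \<and> z \<in> S \<and> S \<subseteq> {z. b z < c}" by (intro exI[of _ S]) auto
  qed
  then show ?thesis unfolding borel_measurable_iff_less by (auto intro: borel_open)
qed

text \<open>Since \<open>exp (- M) \<le> 1\<close>, truncation changes only negative logarithms, so
  the positive part is the same for every \<open>M\<close>.\<close>

lemma ennreal_ln_max:
  assumes "0 \<le> l" "0 \<le> M"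
  shows "ennreal (ln (max l (exp (- M)))) = e2ennreal (log_ext (ereal l))"
proof (cases "l = 0")
  case True
  have "max l (exp (- M)) = exp (- M)" using True by (simp add: max_def)
  then show ?thesis using True assms(2) by (simp add: log_ext_def e2ennreal_neg ennreal_neg)
next
  case False
  then have l: "l > 0" using assms by simp
  show ?thesis
  proof (cases "exp (- M) \<le> l")
    case True
    then show ?thesis using l by (simp add: log_ext_def max_absorb1 e2ennreal_ereal)
  next
    case False
    then have "max l (exp (- M)) = exp (- M)" by simp
    moreover have "ln l \<le> 0"
    proof -
      have "l \<le> exp (- M)" "exp (- M) \<le> 1" using False assms(2) by simp_all
      then have "l \<le> 1" by (rule order_trans)
      then show ?thesis using l by simp
    qed
    ultimately show ?thesis using l assms(2) by (simp add: log_ext_def e2ennreal_ereal ennreal_neg)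
  qed
qed

text \<open>Lowering the floor lets the negative parts increase to that of the full logarithm; for
  \<open>l = 0\<close> they grow without bound.\<close>

lemma SUP_neg_ln_max:
  assumes "0 \<le> l" "n \<ge> (1 :: nat)"
  shows "(SUP i. ennreal (- ln (max l (exp (- (real i * real n)))))) = e2ennreal (- log_ext (ereal l))"
proof (cases "l = 0")
  case True
  have "(SUP i. ennreal (real i * real n)) = \<top>"
  proof -
    have "(SUP i. of_nat i :: ennreal) \<le> (SUP i. ennreal (real i * real n))"
    proof (rule SUP_mono)
      fix i :: nat
      have "real i * 1 \<le> real i * real n" using assms(2) by (intro mult_left_mono) auto
      then have "(of_nat i :: ennreal) \<le> ennreal (real i * real n)"
        by (simp add: ennreal_of_nat_eq_real_of_nat ennreal_leI)
      then show "\<exists>m\<in>UNIV. (of_nat i :: ennreal) \<le> ennreal (real m * real n)" by blast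
    qed
    then show ?thesis by (simp add: ennreal_SUP_of_nat_eq_top top_unique)
  qed
  moreover have "max l (exp (- (real i * real n))) = exp (- (real i * real n))" for i using True by (simp add: max_def)
  ultimately show ?thesis using True by (simp add: log_ext_def)
next
  case False
  then have l: "l > 0" using assms by simp
  have e: "e2ennreal (- log_ext (ereal l)) = ennreal (- ln l)" using l by (simp add: log_ext_def e2ennreal_ereal)
  have le: "- ln (max l (exp (- (real i * real n)))) \<le> - ln l" for i using l by simp
  obtain i where "- ln l \<le> real i" using real_arch_simple by blast
  moreover have "real i * 1 \<le> real i * real n" using assms(2) by (intro mult_left_mono) auto
  ultimately have "- (real i * real n) \<le> ln l" by linarith
  then have "exp (- (real i * real n)) \<le> l" using l by (subst ln_ge_iff[symmetric]) auto
  then have "max l (exp (- (real i * real n))) = l" by simp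
  then have "ennreal (- ln l) \<le> (SUP i. ennreal (- ln (max l (exp (- (real i * real n))))))"
    by (intro SUP_upper2[of i]) auto
  then show ?thesis unfolding e by (intro antisym SUP_least ennreal_leI le)
qed

context unique_walk
begin

text \<open>The positive part is independent of the truncation and integrable, while the negative
  parts increase with the level; by monotone convergence a finite level already gives a negative
  integral.\<close>

lemma mean_log_lip_negative_of_exponent:
  assumes \<eta>: "stationary \<eta>" and n: "n \<ge> 1"
    and neg: "integral_ext (lift \<eta>) (\<lambda>(\<omega>, x). log_ext (local_lip (fiber_iter f n \<omega>) x)) < 0"
  shows "\<exists>M\<ge>0. (\<integral>z. mean_log_lip n M z \<partial>\<eta>) < 0"
proof -
  have \<eta>': "prob_space \<eta>" "sets \<eta> = sets borel" using \<eta> by (auto simp: stationary_def)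
  interpret l: prob_space "lift \<eta>" by (rule lift_prob[OF \<eta>'])
  define h where "h y = log_ext (local_lip (fiber_iter f n (fst y)) (snd y))" for y :: "(nat \<Rightarrow> 't) \<times> 'x"
  define G where "G M y = log_lip M (map (fst y) [0..<n]) (snd y)" for M :: real and y :: "(nat \<Rightarrow> 't) \<times> 'x"
  define k where "k y = loc_lip (word_map f (map (fst y) [0..<n])) (snd y)" for y :: "(nat \<Rightarrow> 't) \<times> 'x"
  have Gk: "G M y = ln (max (k y) (exp (- (M * real n))))" for M y by (simp add: G_def log_lip_def k_def)
  have hk: "h y = log_ext (ereal (k y))" for y
  proof -
    have "fiber_iter f n (fst y) = word_map f (map (fst y) [0..<n])" by (rule ext) (rule fiber_iter_word)
    then show ?thesis unfolding h_def k_def ereal_loc_lip[OF word_map_lip, symmetric] by simp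
  qed
  have k0: "0 \<le> k y" for y by (simp add: k_def loc_lip_nonneg)
  have Gm: "G M \<in> borel_measurable skew_algebra" for M
  proof -
    have "(\<lambda>y. log_lip M w (snd y)) \<in> borel_measurable (path_algebra \<Otimes>\<^sub>M borel)" for w
      unfolding log_lip_def
      by (intro measurable_compose[OF measurable_snd] usc_measurable usc_ln_max usc_loc_lip[OF word_map_lip]) simp
    moreover have "(\<lambda>y :: (nat \<Rightarrow> 't) \<times> 'x. map (fst y) [0..<n]) \<in> measurable (path_algebra \<Otimes>\<^sub>M borel) (count_space UNIV)"
      by (rule measurable_compose[OF measurable_fst prefix_measurable])
    ultimately show ?thesis
      unfolding G_def[abs_def] skew_algebra_def
      by (rule measurable_compose_countable[where f = "\<lambda>w y. log_lip M w (snd y)"])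
  qed
  have Gl: "G M \<in> borel_measurable (lift \<eta>)" for M
    using Gm unfolding measurable_cong_sets[OF lift_sets[OF \<eta>'] refl] .
  have Gb: "\<bar>G M y\<bar> \<le> n * (M + ln L)" if "M \<ge> 0" for M y
    using log_lip_bound[OF that, of "map (fst y) [0..<n]" "snd y"] by (simp add: G_def)
  have Gi: "integrable (lift \<eta>) (G M)" if "M \<ge> 0" for M
    using Gl Gb[OF that] by (intro l.integrable_const_bound[of _ "n * (M + ln L)"] AE_I2) (simp_all only: real_norm_def)
  have mean: "(\<integral>y. G M y \<partial>lift \<eta>) = (\<integral>z. mean_log_lip n M z \<partial>\<eta>)" if M: "M \<ge> 0" for M
  proof -
    have "(\<integral>y. G M y \<partial>lift \<eta>) = (\<integral>z. fiber_mean (\<lambda>\<omega> x. G M (\<omega>, x)) z \<partial>\<eta>)"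
      by (rule integral_lift[OF \<eta>' Gm Gb[OF M]])
    also have "\<dots> = (\<integral>z. mean_log_lip n M z \<partial>\<eta>)"
    proof (rule integral_cong_AE)
      show "fiber_mean (\<lambda>\<omega> x. G M (\<omega>, x)) \<in> borel_measurable \<eta>"
        using fiber_mean_measurable[OF Gm] unfolding measurable_cong_sets[OF \<eta>'(2) refl] .
      show "mean_log_lip n M \<in> borel_measurable \<eta>"
        using usc_measurable[OF mean_log_lip_usc] unfolding measurable_cong_sets[OF \<eta>'(2) refl] .
      show "AE z in \<eta>. fiber_mean (\<lambda>\<omega> x. G M (\<omega>, x)) z = mean_log_lip n M z"
        using stationary_support[OF \<eta>]
      proof eventually_elim
        case (elim z)
        obtain t x where z: "z = (Disc t, x)" by (cases z rule: sym_of.cases)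
        then have t: "pp t > 0" using elim by simp
        \<comment> \<open>Cut off outside words of length \<open>n\<close>, because
          \<open>integral_PP_shift_power\<close> asks for a bound over all words.\<close>
        define H where "H w \<omega> = (if length w = n then log_lip M w x else 0)" for w and \<omega> :: "nat \<Rightarrow> 't"
        have Hb: "\<bar>H w \<omega>\<bar> \<le> n * (M + ln L)" for w \<omega>
          using log_lip_bound[OF M, of w x] L M by (auto simp: H_def)
        have "(\<integral>\<omega>. H (map \<omega> [0..<n]) ((shift ^^ n) \<omega>) \<partial>PP t) = path_exp q n t (\<lambda>w u. \<integral>\<omega>. H w \<omega> \<partial>PP u)"
          by (rule integral_PP_shift_power[OF t _ Hb]) (simp add: H_def)
        also have "\<dots> = path_exp q n t (\<lambda>w u. log_lip M w x)"
          using prob_space.prob_space[OF PP_prob] by (intro path_exp_cong) (simp add: H_def)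
        finally show ?case by (simp add: z mean_log_lip_def H_def G_def)
      qed
    qed
    finally show ?thesis .
  qed
  define A where "A = (\<integral>\<^sup>+ y. e2ennreal (h y) \<partial>lift \<eta>)"
  define B where "B i = (\<integral>\<^sup>+ y. ennreal (- G (real i) y) \<partial>lift \<eta>)" for i
  have A: "A = (\<integral>\<^sup>+ y. ennreal (G (real i) y) \<partial>lift \<eta>)" for i
    unfolding A_def hk Gk using k0 by (intro nn_integral_cong) (simp add: ennreal_ln_max)
  have Afin: "A < \<top>"
    using Gi[of 0] A[of 0] unfolding real_integrable_def by (simp add: less_top)
  have Bfin: "B i < \<top>" for i
    using Gi[of "real i"] unfolding real_integrable_def B_def by (simp add: less_top)
  have "(\<integral>\<^sup>+ y. e2ennreal (- h y) \<partial>lift \<eta>) = (\<integral>\<^sup>+ y. (SUP i. ennreal (- G (real i) y)) \<partial>lift \<eta>)"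
    unfolding hk Gk using k0 n by (intro nn_integral_cong) (simp only: SUP_neg_ln_max)
  also have "\<dots> = (SUP i. B i)"
    unfolding B_def
  proof (rule nn_integral_monotone_convergence_SUP)
    show "incseq (\<lambda>i y. ennreal (- G (real i) y))"
    proof (intro incseq_SucI le_funI ennreal_leI)
      show "- G (real i) y \<le> - G (real (Suc i)) y" for i y
        using log_lip_antimono[of "real i" "real (Suc i)"] by (simp add: G_def)
    qed
    show "(\<lambda>y. ennreal (- G (real i) y)) \<in> borel_measurable (lift \<eta>)" for i
      using Gl[of "real i"] by measurable
  qed
  finally have neg': "enn2ereal A - enn2ereal (SUP i. B i) < 0"
    using neg unfolding integral_ext_def A_def h_def case_prod_unfold by simp
  have "A < (SUP i. B i)"
  proof (rule ccontr)
    assume "\<not> A < (SUP i. B i)"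
    then have le: "(SUP i. B i) \<le> A" by simp
    then have "(SUP i. B i) < \<top>" using Afin by (rule le_less_trans)
    then have "enn2ereal (SUP i. B i) \<noteq> \<infinity>" by (metis enn2ereal_eq_top_iff less_irrefl)
    moreover have "enn2ereal (SUP i. B i) \<le> enn2ereal A" using le by (simp add: less_eq_ennreal.rep_eq)
    ultimately have "0 \<le> enn2ereal A - enn2ereal (SUP i. B i)"
      using enn2ereal_nonneg[of "SUP i. B i"] by (subst ereal_diff_positive) auto
    then show False using neg' by simp
  qed
  then obtain i where i: "A < B i" unfolding less_SUP_iff by blast
  have "(\<integral>y. G (real i) y \<partial>lift \<eta>) = enn2real A - enn2real (B i)"
    unfolding real_lebesgue_integral_def[OF Gi[OF of_nat_0_le_iff]] A[of i] B_def ..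
  also have "\<dots> < 0" using i Bfin[of i] by (simp add: enn2real_less_iff)
  finally show ?thesis using mean[of "real i"] by (intro exI[of _ "real i"]) simp
qed

lemma contracts_of_negative_exponents:
  assumes neg: "\<And>\<eta>. stationary \<eta> \<Longrightarrow> lyapunov_exponent f (lift \<eta>) < 0"
  shows "\<exists>N \<beta>. N \<ge> 1 \<and> 0 < \<beta> \<and> \<beta> \<le> 1 \<and> (\<forall>\<alpha>. 0 < \<alpha> \<longrightarrow> \<alpha> \<le> \<beta> \<longrightarrow>
    (\<exists>\<theta> r. 0 < \<theta> \<and> \<theta> < 1 \<and> 0 < r \<and> contracts N \<alpha> \<theta> r))"
proof -
  have "\<exists>n\<ge>1. \<exists>M\<ge>0. (\<integral>z. mean_log_lip n M z \<partial>\<eta>) < 0" if \<eta>: "stationary \<eta>" for \<eta>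
  proof -
    from neg[OF \<eta>] obtain n where n: "n \<ge> 1" and
      lt: "integral_ext (lift \<eta>) (\<lambda>(\<omega>, x). log_ext (local_lip (fiber_iter f n \<omega>) x)) / ereal (real n) < 0"
      unfolding lyapunov_exponent_def INF_less_iff by auto
    have "integral_ext (lift \<eta>) (\<lambda>(\<omega>, x). log_ext (local_lip (fiber_iter f n \<omega>) x)) < 0"
    proof (rule ccontr)
      assume "\<not> ?thesis"
      then show False using lt n by (simp add: not_less zero_le_divide_ereal not_le[symmetric])
    qed
    from mean_log_lip_negative_of_exponent[OF \<eta> n this] show ?thesis using n by blast
  qed
  from mean_log_lip_negative[OF this] obtain N M where N: "N \<ge> 1" "M \<ge> 0" "\<And>z. mean_log_lip N M z < 0" by blast
  have "\<exists>\<beta>. 0 < \<beta> \<and> \<beta> \<le> 1 \<and> (\<forall>\<alpha>. 0 < \<alpha> \<longrightarrow> \<alpha> \<le> \<beta> \<longrightarrow> (\<exists>\<theta> r. 0 < \<theta> \<and> \<theta> < 1 \<and> 0 < r \<and> contracts N \<alpha> \<theta> r))"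
  proof (rule mean_contraction[OF N])
    fix \<beta> :: real
    assume *: "0 < \<beta>" "\<beta> \<le> 1" "\<And>\<alpha>. 0 < \<alpha> \<Longrightarrow> \<alpha> \<le> \<beta> \<Longrightarrow> \<exists>\<theta> r. 0 < \<theta> \<and> \<theta> < 1 \<and> 0 < r \<and> contracts N \<alpha> \<theta> r"
    show ?thesis by (rule exI[of _ \<beta>]) (intro conjI allI impI *)
  qed
  then show ?thesis using N(1) by (intro exI[of _ N]) simp
qed

end

section \<open>Changing the maps of uncharged symbols\<close>

lemma fiber_iter_cong: "(\<And>j. f (\<omega> j) = g (\<omega> j)) \<Longrightarrow> fiber_iter f n \<omega> = fiber_iter g n \<omega>"
  by (induction n) simp_all

lemma basin_cong:
  assumes "\<And>j. f (\<omega> j) = g (\<omega> j)"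
  shows "(\<omega>, x) \<in> basin f \<mu> \<longleftrightarrow> (\<omega>, x) \<in> basin g \<mu>"
proof -
  have "(skew_product f ^^ j) (\<omega>, x) = (skew_product g ^^ j) (\<omega>, x)" for j
    unfolding skew_product_funpow fiber_iter_cong[where f = f and g = g, OF assms] ..
  then show ?thesis by (simp add: basin_def empirical_measure_def)
qed

context unique_walk
begin

lemma AE_charged: "AE \<omega> in P. \<forall>j. pp (\<omega> j) > 0"
proof (rule AE_P_iff)
  fix t assume t: "pp t > 0"
  have "(Disc t, undefined) \<in> support" using t by simp
  from orbit_stays[OF absorbing_support this t] show "AE \<omega> in PP t. \<forall>j. pp (\<omega> j) > 0" by simp
qed

text \<open>In the final theorem the locale is instantiated with the modified maps, and
  \<open>g\<close> is the given random map, which may fail to be continuous at uncharged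
  symbols.\<close>

context
  fixes g :: "'t \<Rightarrow> 'x \<Rightarrow> 'x"
  assumes g_eq: "\<And>u. pp u > 0 \<Longrightarrow> g u = f u" and g_meas: "\<And>u. g u \<in> borel_measurable borel"
begin

lemma AE_P_agree: "AE \<omega> in P. \<forall>j. g (\<omega> j) = f (\<omega> j)"
  using AE_charged by eventually_elim (simp add: g_eq)

lemma AE_agree:
  assumes "markovian P f \<mu>"
  shows "AE y in \<mu>. \<forall>j. g (fst y j) = f (fst y j)"
proof -
  have d: "distr \<mu> path_algebra fst = P" and s: "sets \<mu> = sets skew_algebra"
    using assms by (auto simp: markovian_def invariant_prob_def space_prob_algebra)
  have m: "fst \<in> measurable \<mu> path_algebra"
    unfolding measurable_cong_sets[OF s refl] skew_algebra_def by simp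
  have "AE \<omega> in distr \<mu> path_algebra fst. \<forall>j. g (\<omega> j) = f (\<omega> j)" unfolding d by (rule AE_P_agree)
  from AE_distrD[OF m this] show ?thesis .
qed

lemma skew_g_measurable: "skew_product g \<in> measurable skew_algebra skew_algebra"
  by (rule skew_product_measurable[OF g_meas])

lemma markovian_agree:
  assumes \<mu>: "markovian P f \<mu>"
  shows "markovian P g \<mu>"
proof -
  have s: "sets \<mu> = sets skew_algebra" and F: "skew_product f \<in> measurable skew_algebra skew_algebra"
    using \<mu> by (auto simp: markovian_def invariant_prob_def space_prob_algebra)
  have "distr \<mu> skew_algebra (skew_product g) = distr \<mu> skew_algebra (skew_product f)"
  proof (rule distr_cong_AE[OF refl refl])
    show "AE y in \<mu>. skew_product g y = skew_product f y"
      using AE_agree[OF \<mu>] by eventually_elim (simp add: skew_product_def case_prod_unfold)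
  qed (use F skew_g_measurable in \<open>simp_all add: measurable_cong_sets[OF s refl]\<close>)
  then show ?thesis using \<mu> skew_g_measurable unfolding markovian_def invariant_prob_def by simp
qed

lemma lyapunov_exponent_agree:
  assumes \<mu>: "markovian P f \<mu>"
  shows "lyapunov_exponent g \<mu> = lyapunov_exponent f \<mu>"
proof -
  have *: "AE y in \<mu>. (case y of (\<omega>, x) \<Rightarrow> log_ext (local_lip (fiber_iter g n \<omega>) x)) = (case y of (\<omega>, x) \<Rightarrow> log_ext (local_lip (fiber_iter f n \<omega>) x))" for n
    using AE_agree[OF \<mu>]
  proof eventually_elim
    case (elim y)
    then have "fiber_iter g n (fst y) = fiber_iter f n (fst y)" by (intro fiber_iter_cong) simp
    then show ?case by (simp only: case_prod_unfold)
  qed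
  have "integral_ext \<mu> (\<lambda>(\<omega>, x). log_ext (local_lip (fiber_iter g n \<omega>) x)) = integral_ext \<mu> (\<lambda>(\<omega>, x). log_ext (local_lip (fiber_iter f n \<omega>) x))" for n
  proof -
    have "(\<integral>\<^sup>+ y. e2ennreal (case y of (\<omega>, x) \<Rightarrow> log_ext (local_lip (fiber_iter g n \<omega>) x)) \<partial>\<mu>)
        = (\<integral>\<^sup>+ y. e2ennreal (case y of (\<omega>, x) \<Rightarrow> log_ext (local_lip (fiber_iter f n \<omega>) x)) \<partial>\<mu>)"
      by (rule nn_integral_cong_AE) (use *[of n] in eventually_elim, simp only:)
    moreover have "(\<integral>\<^sup>+ y. e2ennreal (- (case y of (\<omega>, x) \<Rightarrow> log_ext (local_lip (fiber_iter g n \<omega>) x))) \<partial>\<mu>)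
        = (\<integral>\<^sup>+ y. e2ennreal (- (case y of (\<omega>, x) \<Rightarrow> log_ext (local_lip (fiber_iter f n \<omega>) x))) \<partial>\<mu>)"
      by (rule nn_integral_cong_AE) (use *[of n] in eventually_elim, simp only:)
    ultimately show ?thesis unfolding integral_ext_def by (simp only:)
  qed
  then show ?thesis unfolding lyapunov_exponent_def by (simp only:)
qed

lemma fpm_of_contracts:
  assumes con: "contracts N \<alpha> \<theta> r" "N \<ge> 1" "0 < \<theta>" "\<theta> < 1" "0 < r" "0 < \<alpha>" "\<alpha> \<le> 1"
    and m: "prob_space m" "sets m = sets borel"
  shows "fpm P g m"
proof -
  interpret m: prob_space m by (rule m(1))
  interpret P: prob_space P by (rule P_prob)
  interpret Pm: pair_prob_space P m ..
  from test_family_exists[OF K] obtain I :: "nat \<Rightarrow> 'x set" and \<xi> where "test_family I \<xi>" by (elim exE)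
  then interpret T: test_family I \<xi> "TYPE('t)" .
  from physical_measures[OF con] obtain S where S: "finite S"
    "\<forall>\<mu>\<in>S. markovian P f \<mu> \<and> (AE y in \<mu>. y \<in> basin f \<mu>)" "\<forall>x. AE \<omega> in P. \<exists>\<mu>\<in>S. (\<omega>, x) \<in> basin f \<mu>" by (elim exE conjE)
  have sets: "sets (P \<Otimes>\<^sub>M m) = sets skew_algebra"
    unfolding skew_algebra_def by (rule sets_pair_measure_cong[OF P_sets m(2)])
  have mark: "markovian P g \<mu>" if "\<mu> \<in> S" for \<mu> using S(2) that by (intro markovian_agree) simp
  have \<mu>: "prob_space \<mu>" "sets \<mu> = sets skew_algebra" if "\<mu> \<in> S" for \<mu>
    using mark[OF that] by (auto simp: markovian_def invariant_prob_def space_prob_algebra)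
  have bs: "basin g \<mu> \<in> sets (P \<Otimes>\<^sub>M m)" if "\<mu> \<in> S" for \<mu>
    unfolding sets by (rule T.basin_sets[OF \<mu>[OF that] skew_g_measurable])
  have erg: "ergodic_prob skew_algebra (skew_product g) \<mu>" if "\<mu> \<in> S" for \<mu>
  proof (rule ergodic_if_basin_full[OF K])
    show "invariant_prob skew_algebra (skew_product g) \<mu>" using mark[OF that] by (simp add: markovian_def)
    have "AE y in \<mu>. y \<in> basin f \<mu>" "AE y in \<mu>. \<forall>j. g (fst y j) = f (fst y j)"
      using S(2) that AE_agree by simp_all
    then show "AE y in \<mu>. y \<in> basin g \<mu>"
    proof eventually_elim
      case (elim y)
      then show ?case using basin_cong[where f = g and g = f and \<omega> = "fst y" and x = "snd y"] by simp
    qed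
  qed
  define U where "U = (\<Union>\<mu>\<in>S. basin g \<mu>)"
  have Us: "U \<in> sets (P \<Otimes>\<^sub>M m)" unfolding U_def using S(1) bs by (intro sets.finite_UN) auto
  have "AE \<omega> in P. (\<omega>, x) \<in> U" for x
    using S(3)[rule_format, of x] AE_P_agree
  proof eventually_elim
    case (elim \<omega>)
    then show ?case using basin_cong[where f = g and g = f and \<omega> = \<omega> and x = x] by (auto simp: U_def)
  qed
  \<comment> \<open>The statement holds for every \<open>x\<close>, hence for almost every
    \<open>x\<close> under any \<open>m\<close>; measurability of \<open>U\<close> allows the two
    quantifiers to be exchanged.\<close>
  then have "AE x in m. AE \<omega> in P. (\<omega>, x) \<in> U" by simp
  moreover have Uc: "{z \<in> space (P \<Otimes>\<^sub>M m). (fst z, snd z) \<in> U} \<in> sets (P \<Otimes>\<^sub>M m)" using Us by simp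
  ultimately have "AE \<omega> in P. AE x in m. (\<omega>, x) \<in> U"
    using Pm.AE_commute[of "\<lambda>\<omega> x. (\<omega>, x) \<in> U"] by simp
  then have full: "AE z in P \<Otimes>\<^sub>M m. z \<in> U" using Us by (intro Pm.AE_pair_measure) simp_all
  \<comment> \<open>A basin may be null for this particular \<open>m\<close>; such measures are
    discarded, at the cost of a null part of the union.\<close>
  define S' where "S' = {\<mu>\<in>S. emeasure (P \<Otimes>\<^sub>M m) (basin g \<mu>) > 0}"
  have null: "AE z in P \<Otimes>\<^sub>M m. \<forall>\<mu>\<in>S - S'. z \<notin> basin g \<mu>"
  proof (rule AE_finite_allI)
    fix \<mu> assume "\<mu> \<in> S - S'"
    then have "basin g \<mu> \<in> null_sets (P \<Otimes>\<^sub>M m)" using bs[of \<mu>] by (auto simp: S'_def null_sets_def)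
    then show "AE z in P \<Otimes>\<^sub>M m. z \<notin> basin g \<mu>" by (rule AE_not_in)
  qed (use S(1) in simp)
  have "AE z in P \<Otimes>\<^sub>M m. z \<in> (\<Union>\<mu>\<in>S'. basin g \<mu>)"
    using full null
  proof eventually_elim
    case (elim z)
    then show ?case by (auto simp: U_def)
  qed
  moreover have "(\<Union>\<mu>\<in>S'. basin g \<mu>) \<in> sets (P \<Otimes>\<^sub>M m)"
    using S(1) bs by (intro sets.finite_UN) (auto simp: S'_def)
  ultimately have "emeasure (P \<Otimes>\<^sub>M m) (\<Union>\<mu>\<in>S'. basin g \<mu>) = 1"
    by (simp add: Pm.emeasure_eq_1_AE)
  then show ?thesis
    unfolding fpm_def using S(1) erg mark by (intro exI[of _ S']) (auto simp: S'_def)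
qed

end

end

section \<open>The transition operator\<close>

context markov_path
begin

lemma unique_vector:
  assumes uniq: "\<And>\<rho>. stationary_prob Q \<rho> \<Longrightarrow> \<rho> = p"
    and v: "\<And>t. 0 \<le> v t" "(\<Sum>t\<in>UNIV. v t) = 1" "\<And>u. (\<Sum>t\<in>UNIV. v t * q t u) = v u"
  shows "v = pp"
proof -
  define \<rho> where "\<rho> = point_measure UNIV (\<lambda>t. ennreal (v t))"
  have em: "emeasure \<rho> A = ennreal (\<Sum>t\<in>A. v t)" for A
    unfolding \<rho>_def using v(1) by (subst emeasure_point_measure_finite) (auto simp: sum_ennreal)
  have s: "sets \<rho> = UNIV" "space \<rho> = UNIV" by (simp_all add: \<rho>_def sets_point_measure space_point_measure)
  have QA: "emeasure (Q t) A = ennreal (\<Sum>u\<in>A. q t u)" for t A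
    using q_nonneg by (subst emeasure_eq_sum_singleton) (auto simp: Q_sets emeasure_Q sum_ennreal)
  have "stationary_prob Q \<rho>"
    unfolding stationary_prob_def
  proof (intro conjI allI)
    have "prob_space \<rho>" by (rule prob_spaceI) (simp add: em s v(2))
    then show "\<rho> \<in> space (prob_algebra (count_space UNIV))" by (simp add: space_prob_algebra s)
    fix A
    have "(\<integral>\<^sup>+ t. emeasure (Q t) A \<partial>\<rho>) = (\<Sum>t\<in>UNIV. ennreal (\<Sum>u\<in>A. q t u) * ennreal (v t))"
      unfolding nn_integral_finite_type[OF s(1)] by (simp add: QA em)
    also have "\<dots> = (\<Sum>t\<in>UNIV. ennreal ((\<Sum>u\<in>A. q t u) * v t))"
      using v(1) q_nonneg by (simp add: ennreal_mult sum_nonneg)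
    also have "\<dots> = ennreal (\<Sum>t\<in>UNIV. (\<Sum>u\<in>A. q t u) * v t)"
      using v(1) q_nonneg by (intro sum_ennreal) (simp add: sum_nonneg)
    also have "(\<Sum>t\<in>UNIV. (\<Sum>u\<in>A. q t u) * v t) = (\<Sum>u\<in>A. \<Sum>t\<in>UNIV. v t * q t u)"
      unfolding sum_distrib_right by (subst sum.swap) (intro sum.cong refl mult.commute)
    finally show "emeasure \<rho> A = (\<integral>\<^sup>+ t. emeasure (Q t) A \<partial>\<rho>)" by (simp add: v(3) em)
  qed
  from uniq[OF this] have "\<rho> = p" .
  then show ?thesis using em v(1) by (auto simp: fun_eq_iff pp_def measure_def)
qed

lemma integral_Q: "(\<integral>u. g u \<partial>Q t) = (\<Sum>u\<in>UNIV. q t u * (g u :: real))"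
proof -
  interpret prob_space "Q t" by (rule Q_prob)
  have i: "integrable (Q t) (\<lambda>u. indicator {v} u * g v)" for v
    by (intro integrable_mult_left integrable_real_indicator) (simp_all add: Q_sets emeasure_eq_measure)
  have "g u = (\<Sum>v\<in>UNIV. indicator {v} u * g v)" for u
    by (simp add: indicator_def if_distrib[of "\<lambda>x. x * _"] cong: if_cong)
  then have "(\<integral>u. g u \<partial>Q t) = (\<integral>u. (\<Sum>v\<in>UNIV. indicator {v} u * g v) \<partial>Q t)" by simp
  also have "\<dots> = (\<Sum>v\<in>UNIV. \<integral>u. indicator {v} u * g v \<partial>Q t)" using i by (rule Bochner_Integration.integral_sum)
  finally show ?thesis using sets_eq_imp_space_eq[of "Q t" "count_space UNIV"] by (simp add: q_def Q_sets)
qed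

text \<open>Hoelder functions are continuous on each sheet and therefore measurable, so the integral
  over the finite alphabet is a sum, to which only symbols of positive transition probability
  contribute.\<close>

lemma hat_op_eq_step_op:
  fixes f g :: "'t \<Rightarrow> 'x::metric_space \<Rightarrow> 'x"
  assumes \<phi>: "\<phi> \<in> holder_space prod_dist1 \<alpha>" and \<alpha>: "\<alpha> > 0" and eq: "\<And>t u. q t u \<noteq> 0 \<Longrightarrow> f u = g u"
  shows "hat_op Q f \<phi> = step_op q g \<phi>"
proof
  fix z :: "'t \<times> 'x"
  obtain t x where z: "z = (t, x)" by fastforce
  obtain C where C: "holder_const prod_dist1 \<alpha> \<phi> C" using \<phi> by (auto simp: holder_space_def)
  have cont: "continuous_on UNIV (\<lambda>y. \<phi> (u, y))" for u
    unfolding continuous_on_def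
  proof (intro ballI)
    fix y
    have "((\<lambda>y'. \<phi> (u, y') - \<phi> (u, y)) \<longlongrightarrow> 0) (at y)"
    proof (rule Lim_null_comparison)
      have "norm (\<phi> (u, y') - \<phi> (u, y)) \<le> C * dist y' y powr \<alpha>" for y'
      proof -
        have "\<bar>\<phi> (u, y') - \<phi> (u, y)\<bar> \<le> C * prod_dist1 (u, y') (u, y) powr \<alpha>"
          using C by (simp only: holder_const_def)
        then show ?thesis by (simp add: prod_dist1_def)
      qed
      then show "\<forall>\<^sub>F y' in at y. norm (\<phi> (u, y') - \<phi> (u, y)) \<le> C * dist y' y powr \<alpha>" by (intro always_eventually allI)
      have "((\<lambda>y'. dist y' y) \<longlongrightarrow> 0) (at y)" using tendsto_dist[OF tendsto_ident_at[of y UNIV] tendsto_const[of y]] by simp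
      then have "((\<lambda>y'. dist y' y powr \<alpha>) \<longlongrightarrow> 0) (at y)"
        by (rule tendsto_zero_powrI[OF _ tendsto_const[of \<alpha>]]) (use \<alpha> in simp_all)
      from tendsto_mult[OF tendsto_const this] show "((\<lambda>y'. C * dist y' y powr \<alpha>) \<longlongrightarrow> 0) (at y)" by simp
    qed
    then show "((\<lambda>y'. \<phi> (u, y')) \<longlongrightarrow> \<phi> (u, y)) (at y within UNIV)" by (rule LIM_zero_cancel)
  qed
  have meas: "\<phi> \<in> borel_measurable (count_space UNIV \<Otimes>\<^sub>M borel)"
  proof -
    have "(\<lambda>z. \<phi> (u, snd z)) \<in> borel_measurable (count_space (UNIV :: 't set) \<Otimes>\<^sub>M (borel :: 'x measure))" for u
      by (rule measurable_compose[OF measurable_snd borel_measurable_continuous_onI[OF cont]])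
    then have "(\<lambda>z. \<phi> (fst z, snd z)) \<in> borel_measurable (count_space (UNIV :: 't set) \<Otimes>\<^sub>M (borel :: 'x measure))"
      by (rule measurable_compose_countable[where f = "\<lambda>u z. \<phi> (u, snd z)" and g = fst]) (rule measurable_fst)
    then show ?thesis by simp
  qed
  have "(\<lambda>u. (u, f u x)) \<in> measurable (Q t) (count_space UNIV \<Otimes>\<^sub>M borel)"
    by (rule measurableI) (simp_all add: Q_sets space_pair_measure)
  then have "hat_op Q f \<phi> z = (\<integral>u. \<phi> (u, f u x) \<partial>Q t)"
    using meas by (simp add: hat_op_def hat_kernel_def z integral_distr)
  also have "\<dots> = (\<Sum>u\<in>UNIV. q t u * \<phi> (u, f u x))" by (rule integral_Q)
  also have "\<dots> = step_op q g \<phi> z"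
    unfolding z step_op.simps
  proof (rule sum.cong[OF refl])
    show "q t u * \<phi> (u, f u x) = q t u * \<phi> (u, g u x)" for u
      using eq[of t u] by (cases "q t u = 0") simp_all
  qed
  finally show "hat_op Q f \<phi> z = step_op q g \<phi> z" .
qed

end

lemma holder_space_add:
  assumes "\<phi> \<in> holder_space D \<alpha>" "\<psi> \<in> holder_space D \<alpha>"
  shows "(\<lambda>u. \<phi> u + \<psi> u) \<in> holder_space D \<alpha>"
proof -
  obtain A B where AB: "holder_const D \<alpha> \<phi> A" "holder_const D \<alpha> \<psi> B" using assms by (auto simp: holder_space_def)
  have "\<bar>\<phi> u + \<psi> u - (\<phi> v + \<psi> v)\<bar> \<le> (A + B) * D u v powr \<alpha>" for u v
  proof -
    have "\<bar>\<phi> u - \<phi> v\<bar> \<le> A * D u v powr \<alpha>" "\<bar>\<psi> u - \<psi> v\<bar> \<le> B * D u v powr \<alpha>"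
      using AB by (simp_all add: holder_const_def)
    then show ?thesis unfolding distrib_right by linarith
  qed
  then have "holder_const D \<alpha> (\<lambda>u. \<phi> u + \<psi> u) (A + B)" using AB by (simp add: holder_const_def)
  then show ?thesis by (auto simp: holder_space_def)
qed

lemma holder_space_cmult:
  assumes "\<phi> \<in> holder_space D \<alpha>"
  shows "(\<lambda>u. c * \<phi> u) \<in> holder_space D \<alpha>"
proof -
  obtain A where A: "holder_const D \<alpha> \<phi> A" using assms by (auto simp: holder_space_def)
  have "\<bar>c * \<phi> u - c * \<phi> v\<bar> \<le> (\<bar>c\<bar> * A) * D u v powr \<alpha>" for u v
    using mult_left_mono[of "\<bar>\<phi> u - \<phi> v\<bar>" "A * D u v powr \<alpha>" "\<bar>c\<bar>"] A
    by (simp add: holder_const_def right_diff_distrib[symmetric] abs_mult mult.assoc)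
  then have "holder_const D \<alpha> (\<lambda>u. c * \<phi> u) (\<bar>c\<bar> * A)" using A by (simp add: holder_const_def)
  then show ?thesis by (auto simp: holder_space_def)
qed

lemma lip_const_finiteE:
  assumes "lip_const UNIV g < \<infinity>"
  shows "\<exists>C. C-lipschitz_on UNIV g"
  using assms unfolding lip_const_def INF_less_iff by blast

theorem theorem5:
  fixes Q :: "'t::finite \<Rightarrow> 't measure"
    and p :: "'t measure"
    and P :: "(nat \<Rightarrow> 't) measure"
    and f :: "'t \<Rightarrow> 'x::metric_space \<Rightarrow> 'x"
    and m :: "'x measure"
  assumes "compact (UNIV :: 'x set)"
    and "transition_prob Q"
    and "stationary_prob Q p"
    and "\<And>q. stationary_prob Q q \<Longrightarrow> q = p"
    and "markov_measure Q p P"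
    and "ergodic_prob path_algebra shift P"
    and "random_map f"
    and "mostly_contracting P f"
    and "m \<in> space (prob_algebra borel)"
  shows "fpm P f m \<and>
    ((\<forall>t u. emeasure p {u} = 0 \<and> emeasure (Q t) {u} \<noteq> 0 \<longrightarrow> lip_const UNIV (f u) < \<infinity>) \<longrightarrow>
     (\<exists>\<alpha>0. 0 < \<alpha>0 \<and> \<alpha>0 \<le> 1 \<and>
        (\<forall>\<alpha>. 0 < \<alpha> \<and> \<alpha> \<le> \<alpha>0 \<longrightarrow>
           quasi_compact (holder_space prod_dist1 \<alpha>) (holder_norm prod_dist1 \<alpha>) (hat_op Q f))))"
proof -
  interpret MP: markov_path Q p P using assms(2,3,5) by unfold_locales
  \<comment> \<open>By \<open>charged\<close> below, only maps of symbols of mass zero are replaced,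
    so almost no path of \<open>P\<close> ever meets a replaced map.\<close>
  define g where "g u = (if lip_const UNIV (f u) < \<infinity> then f u else id)" for u
  have "\<forall>u. \<exists>C. C-lipschitz_on UNIV (g u)"
  proof
    show "\<exists>C. C-lipschitz_on UNIV (g u)" for u
    proof (cases "lip_const UNIV (f u) < \<infinity>")
      case False
      then show ?thesis by (intro exI[of _ 1]) (simp add: g_def lipschitz_on_def)
    qed (simp add: g_def lip_const_finiteE)
  qed
  from choice[OF this] obtain C where C: "\<forall>u. (C u)-lipschitz_on UNIV (g u)" by (elim exE)
  have C0: "0 \<le> C u" for u by (rule lipschitz_on_nonneg[OF C[rule_format]])
  \<comment> \<open>A common Lipschitz constant; the summand 1 provides \<open>L \<ge> 1\<close>
    even if all maps are constant.\<close>
  define L where "L = 1 + (\<Sum>u\<in>UNIV. C u)"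
  have "L-lipschitz_on UNIV (g u)" for u
  proof (rule lipschitz_on_le[OF C[rule_format, of u]])
    show "C u \<le> L" using member_le_sum[of u UNIV C] C0 by (simp add: L_def)
  qed
  then interpret W: unique_walk Q p P g L
    using assms(1) C0 MP.unique_vector[OF assms(4)] by unfold_locales (auto simp: L_def sum_nonneg)
  have meas: "f u \<in> borel_measurable borel" for u
  proof -
    have "(\<lambda>x. (u, x)) \<in> measurable borel (count_space UNIV \<Otimes>\<^sub>M (borel :: 'x measure))" by simp
    from measurable_compose[OF this assms(7)[unfolded random_map_def]] show ?thesis by simp
  qed
  \<comment> \<open>An infinite Lipschitz constant at a symbol of positive mass would make the
    integral in \<open>log_lip_integrable\<close> infinite.\<close>
  have charged: "lip_const UNIV (f u) < \<infinity>" if u: "MP.pp u > 0" for u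
  proof (rule ccontr)
    assume "\<not> ?thesis"
    then have inf: "lip_const UNIV (f u) = \<infinity>" by simp
    have "\<infinity> * emeasure P {\<omega>. \<omega> 0 = u} = (\<integral>\<^sup>+ \<omega>. \<infinity> * indicator {\<omega>. \<omega> 0 = u} \<omega> \<partial>P)"
      using MP.start_sets by (simp add: nn_integral_cmult_indicator)
    also have "\<dots> \<le> (\<integral>\<^sup>+ \<omega>. e2ennreal (max 0 (log_ext (lip_const UNIV (f (\<omega> 0))))) \<partial>P)"
      by (intro nn_integral_mono) (auto simp: inf log_ext_def split: split_indicator)
    also have "\<dots> < \<infinity>" using assms(8) by (simp add: mostly_contracting_def log_lip_integrable_def)
    finally show False using u by (simp add: MP.emeasure_P_start ennreal_top_mult)
  qed
  have fg: "f u = g u" if "MP.pp u > 0" for u using charged[OF that] by (simp add: g_def)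
  have neg: "lyapunov_exponent g (W.lift \<eta>) < 0" if \<eta>: "W.stationary \<eta>" for \<eta>
  proof -
    have mg: "markovian P g (W.lift \<eta>)" by (rule W.markovian_lift[OF \<eta>])
    have mf: "markovian P f (W.lift \<eta>)" by (rule W.markovian_agree[where g = f, OF _ meas mg]) (rule fg)
    have "lyapunov_exponent g (W.lift \<eta>) = lyapunov_exponent f (W.lift \<eta>)"
      by (rule W.lyapunov_exponent_agree[where g = f, OF _ meas mg, symmetric]) (rule fg)
    also have "\<dots> \<le> (SUP \<mu>\<in>{\<mu>. markovian P f \<mu>}. lyapunov_exponent f \<mu>)" using mf by (intro SUP_upper) simp
    also have "\<dots> < 0" using assms(8) by (simp add: mostly_contracting_def)
    finally show ?thesis .
  qed
  have "\<exists>N \<beta>. N \<ge> 1 \<and> 0 < \<beta> \<and> \<beta> \<le> 1 \<and> (\<forall>\<alpha>. 0 < \<alpha> \<longrightarrow> \<alpha> \<le> \<beta> \<longrightarrow>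
    (\<exists>\<theta> r. 0 < \<theta> \<and> \<theta> < 1 \<and> 0 < r \<and> W.contracts N \<alpha> \<theta> r))"
    by (rule W.contracts_of_negative_exponents) (rule neg)
  then obtain N \<beta> where N: "N \<ge> 1" and \<beta>: "0 < \<beta>" "\<beta> \<le> 1"
    and con: "\<forall>\<alpha>. 0 < \<alpha> \<longrightarrow> \<alpha> \<le> \<beta> \<longrightarrow> (\<exists>\<theta> r. 0 < \<theta> \<and> \<theta> < 1 \<and> 0 < r \<and> W.contracts N \<alpha> \<theta> r)" by (elim exE conjE)
  have "fpm P f m"
  proof -
    \<comment> \<open>Property (fpm) does not involve an exponent, so the largest admissible one
      serves.\<close>
    from con[rule_format, OF \<beta>(1) order_refl] obtain \<theta> r where "0 < \<theta>" "\<theta> < 1" "0 < r" "W.contracts N \<beta> \<theta> r" by (elim exE conjE)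
    note c = this
    have "prob_space m" "sets m = sets borel" using assms(9) by (auto simp: space_prob_algebra)
    from W.fpm_of_contracts[where g = f, OF _ meas c(4) N c(1,2,3) \<beta> this] show ?thesis using fg by simp
  qed
  moreover have "\<exists>\<alpha>0. 0 < \<alpha>0 \<and> \<alpha>0 \<le> 1 \<and> (\<forall>\<alpha>. 0 < \<alpha> \<and> \<alpha> \<le> \<alpha>0 \<longrightarrow>
      quasi_compact (holder_space prod_dist1 \<alpha>) (holder_norm prod_dist1 \<alpha>) (hat_op Q f))"
    if hyp: "\<forall>t u. emeasure p {u} = 0 \<and> emeasure (Q t) {u} \<noteq> 0 \<longrightarrow> lip_const UNIV (f u) < \<infinity>"
  proof (intro exI[of _ \<beta>] conjI allI impI \<beta>)
    fix \<alpha> assume \<alpha>: "0 < \<alpha> \<and> \<alpha> \<le> \<beta>"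
    from con \<alpha> obtain \<theta> r where \<theta>: "0 < \<theta>" "\<theta> < 1" "0 < r" "W.contracts N \<alpha> \<theta> r" by blast
    \<comment> \<open>The operator also sees symbols of mass zero that \<open>Q\<close> can reach;
      for these the hypothesis guarantees that the map was not replaced.\<close>
    have fg': "f u = g u" if "MP.q t u \<noteq> 0" for t u
    proof (cases "MP.pp u > 0")
      case False
      then have "emeasure p {u} = 0" "emeasure (Q t) {u} \<noteq> 0"
        using that MP.pp_nonneg[of u] MP.q_nonneg[of t u] by (simp_all add: MP.emeasure_p MP.emeasure_Q)
      then show ?thesis using hyp by (simp add: g_def)
    qed (rule fg)
    show "quasi_compact (holder_space prod_dist1 \<alpha>) (holder_norm prod_dist1 \<alpha>) (hat_op Q f)"
    proof (rule quasi_compact_cong)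
      show "hat_op Q f \<phi> = step_op MP.q g \<phi>" if "\<phi> \<in> holder_space prod_dist1 \<alpha>" for \<phi>
        using \<alpha> fg' by (intro MP.hat_op_eq_step_op[OF that]) auto
      show "quasi_compact (holder_space prod_dist1 \<alpha>) (holder_norm prod_dist1 \<alpha>) (step_op MP.q g)"
        using \<alpha> \<beta> by (intro W.step_op_quasi_compact[OF \<theta>(4) N \<theta>(1,2,3)]) auto
    qed (rule holder_space_add holder_space_cmult; assumption)+
  qed
  ultimately show ?thesis by blast
qed

end
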